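(* Let $G\ne\mathbb 1$ be a Fuchsian group acting on $\mathbb D$, let $n\ge3$ be an integer and $\bullet\in\{A,B\}$. Then the differential at the origin $D_0\beta^\bullet_n$ of the higher Bers map $\beta_n^\bullet$ is injective when restricted to the tangent space of $\mathcal T_B(G)$ at the origin.
   Context: $\mathbb D$ is the unit disc, $\mathbb D^c$ the interior of its complement in the Riemann sphere $\hat{\mathbb C}$. $L^\infty_{(-1,1)}(\mathbb D^c,G)$ is the Banach space of essentially bounded measurable $\mu$ on $\mathbb D^c$ with $\mu(z)=\mu(gz)\overline{g'(z)}/g'(z)$ a.e. for all $g\in G$; $\mathrm{Belt}(\mathbb D^c,G)$ is its open unit ball. For $\mu\in\mathrm{Belt}(\mathbb D^c,G)$, extended by $0$ to $\mathbb D$, $w^\mu$ is the quasiconformal homeomorphism of $\hat{\mathbb C}$ with $\bar\partial w=\mu\,\partial w$, $w^\mu(0)=0$, $(w^\mu)'(0)=1$, $(w^\mu)''(0)=0$. $\mathcal T_B(G)=\mathrm{Belt}(\mathbb D^c,G)/\!\sim$, where $\mu\sim\nu$ iff $w^\mu|_{\partial\mathbb D}=w^\nu|_{\partial\mathbb D}$, with quotient map $\pi_T$ and induced complex structure. Higher Schwarzians: with $S_f=(f''/f')'-\tfrac12(f''/f')^2$, $\sigma^A_3[f]=S_f$, $\sigma^A_{n+1}[f]=\sigma^A_n[f]'-(n-1)\frac{f''}{f'}\sigma^A_n[f]$, and $\sigma^B_n[f]=-2(f')^{\frac n2-1}\frac{d^{n-1}}{dz^{n-1}}\big((f')^{1-\frac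 n2}\big)$ (same branch of the square root in both places for odd $n$). The higher Bers maps are $\beta^\bullet_n:\mathcal T_B(G)\to B_{n-1}(\mathbb D)$, $\beta^\bullet_n([\mu])=\sigma^\bullet_n[w^\mu|_{\mathbb D}]$, with lifts $\tilde\beta^\bullet_n=\beta^\bullet_n\circ\pi_T$; here $B_q(\mathbb D)$ is the Banach space of holomorphic $f$ on $\mathbb D$ with $\sup_{\mathbb D}|f(z)|(1-|z|^2)^q<\infty$. The maps $\beta^A_3=\beta^B_3$ are the classical Bers embedding (a holomorphic embedding onto an open subset of the $G$-automorphic elements of $B_2(\mathbb D)$, whose lift is a holomorphic submersion); accordingly the tangent space of $\mathcal T_B(G)$ at the origin is $L^\infty_{(-1,1)}(\mathbb D^c,G)\big/\ker\big(D_0\tilde\beta^\bullet_3|_{L^\infty_{(-1,1)}(\mathbb D^c,G)}\big)$.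
   Formalization: The formal theorem excludes finite groups G of rotations about 0 of order at most n-2; for exactly these the claim fails (e.g. G = {z, -z}, n = 4, where z^2/conj(z)^2 gives a nonzero tangent vector killed by the differential). *)

theory Defs
  imports
    "HOL-Analysis.Analysis"
    "HOL-Probability.Essential_Supremum"
    "HOL-Algebra.Bij"
begin

section \<open>Fuchsian groups and Beltrami coefficients\<close>

abbreviation disc :: "complex set" where
  "disc \<equiv> ball 0 1"

text \<open>The interior of the complement of the disc in the Riemann sphere, without the point at
  infinity, which is a null set and is irrelevant for essentially bounded functions.\<close>

abbreviation ext_disc :: "complex set" where
  "ext_disc \<equiv> {z. 1 < norm z}"

text \<open>A Fuchsian group acting on the disc: a group of conformal automorphisms of the disc acting
  properly discontinuously.\<close>

definition fuchsian_group :: "(complex \<Rightarrow> complex) set \<Rightarrow> bool" where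
  "fuchsian_group G \<longleftrightarrow>
     subgroup G (BijGroup disc) \<and>
     (\<forall>g\<in>G. g holomorphic_on disc) \<and>
     (\<forall>K. compact K \<and> K \<subseteq> disc \<longrightarrow> finite {g \<in> G. g ` K \<inter> K \<noteq> {}})"

text \<open>A conformal automorphism of the disc is a Moebius transformation commuting with the
  reflection in the unit circle; its action on the exterior is therefore the following.  (At the
  one possible pole the value is 0; this is a null set.)\<close>

definition ext_action :: "(complex \<Rightarrow> complex) \<Rightarrow> complex \<Rightarrow> complex" where
  "ext_action g z = 1 / cnj (g (1 / cnj z))"

text \<open>Elements of \<open>linf_space G\<close> are functions rather than classes modulo almost
  everywhere equality, so that \<open>linf_norm\<close> is a seminorm.  Values off \<open>ext_disc\<close>
  play no role.\<close>

definition linf_space :: "(complex \<Rightarrow> complex) set \<Rightarrow> (complex \<Rightarrow> complex) set" where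
  "linf_space G =
     {\<mu>. \<mu> \<in> borel_measurable (lebesgue_on ext_disc) \<and>
         esssup (lebesgue_on ext_disc) (\<lambda>z. ereal (norm (\<mu> z))) < \<infinity> \<and>
         (\<forall>g\<in>G. AE z in lebesgue_on ext_disc.
            \<mu> z = \<mu> (ext_action g z) * cnj (deriv (ext_action g) z) / deriv (ext_action g) z)}"

definition linf_norm :: "(complex \<Rightarrow> complex) \<Rightarrow> real" where
  "linf_norm \<mu> = real_of_ereal (esssup (lebesgue_on ext_disc) (\<lambda>z. ereal (norm (\<mu> z))))"

definition belt :: "(complex \<Rightarrow> complex) set \<Rightarrow> (complex \<Rightarrow> complex) set" where
  "belt G = {\<mu> \<in> linf_space G. linf_norm \<mu> < 1}"


section \<open>Quasiconformal homeomorphisms of the Riemann sphere\<close>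

text \<open>The Riemann sphere is the one-point compactification of the plane; \<open>None\<close> is the
  point at infinity.\<close>

abbreviation riemann_sphere :: "complex option topology" where
  "riemann_sphere \<equiv> Alexandroff_compactification euclidean"

text \<open>The expression of a self-map of the sphere in the standard coordinate; the value 0 at poles
  is a dummy.\<close>

definition planar :: "(complex option \<Rightarrow> complex option) \<Rightarrow> complex \<Rightarrow> complex" where
  "planar w z = (case w (Some z) of None \<Rightarrow> 0 | Some v \<Rightarrow> v)"

definition test_function ::
    "complex set \<Rightarrow> (complex \<Rightarrow> complex) \<Rightarrow> (complex \<Rightarrow> complex) \<Rightarrow> (complex \<Rightarrow> complex) \<Rightarrow> bool" where
  "test_function U \<phi> \<phi>x \<phi>y \<longleftrightarrow>
     continuous_on UNIV \<phi>x \<and> continuous_on UNIV \<phi>y \<and>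
     (\<forall>z. (\<phi> has_derivative (\<lambda>h. of_real (Re h) * \<phi>x z + of_real (Im h) * \<phi>y z)) (at z)) \<and>
     (\<exists>K. compact K \<and> K \<subseteq> U \<and> (\<forall>z. z \<notin> K \<longrightarrow> \<phi> z = 0))"

definition locally_L2 :: "complex set \<Rightarrow> (complex \<Rightarrow> complex) \<Rightarrow> bool" where
  "locally_L2 U p \<longleftrightarrow>
     p \<in> borel_measurable (lebesgue_on U) \<and>
     (\<forall>K. compact K \<and> K \<subseteq> U \<longrightarrow> set_integrable lebesgue K (\<lambda>z. (norm (p z))\<^sup>2))"

text \<open>\<open>p\<close> and \<open>q\<close> are the distributional derivatives of \<open>f\<close>
  with respect to \<open>z\<close> and to its conjugate on the open set \<open>U\<close>.\<close>

definition weak_wirtinger ::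
    "complex set \<Rightarrow> (complex \<Rightarrow> complex) \<Rightarrow> (complex \<Rightarrow> complex) \<Rightarrow> (complex \<Rightarrow> complex) \<Rightarrow> bool" where
  "weak_wirtinger U f p q \<longleftrightarrow>
     (\<forall>\<phi> \<phi>x \<phi>y. test_function U \<phi> \<phi>x \<phi>y \<longrightarrow>
        (LINT z:U|lebesgue. f z * ((\<phi>x z - \<i> * \<phi>y z) / 2)) = - (LINT z:U|lebesgue. p z * \<phi> z) \<and>
        (LINT z:U|lebesgue. f z * ((\<phi>x z + \<i> * \<phi>y z) / 2)) = - (LINT z:U|lebesgue. q z * \<phi> z))"

text \<open>The analytic definition of quasiconformality: a homeomorphism of the sphere, locally in the
  Sobolev space of square integrable functions with square integrable first derivatives, that
  satisfies the Beltrami equation almost everywhere.  When the essential supremum of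
  \<open>\<mu>\<close> is less than 1, it preserves orientation automatically.  The equation is only
  imposed off the point at infinity and its preimage: isolated points are removable for
  quasiconformal homeomorphisms.\<close>

definition qc_solution :: "(complex \<Rightarrow> complex) \<Rightarrow> (complex option \<Rightarrow> complex option) \<Rightarrow> bool" where
  "qc_solution \<mu> w \<longleftrightarrow>
     homeomorphic_map riemann_sphere riemann_sphere w \<and>
     (let U = {z. w (Some z) \<noteq> None} in
        \<exists>p q. locally_L2 U p \<and> locally_L2 U q \<and> weak_wirtinger U (planar w) p q \<and>
              (AE z in lebesgue_on U. q z = \<mu> z * p z))"

text \<open>The defining properties of the normalised solution for a coefficient on the exterior,
  extended by 0.  It is holomorphic near 0 because the coefficient vanishes on the disc.  By the
  measurable Riemann mapping theorem it exists and is unique for every element of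
  \<open>belt G\<close>.\<close>

definition normalized_solution ::
    "(complex \<Rightarrow> complex) \<Rightarrow> (complex option \<Rightarrow> complex option) \<Rightarrow> bool" where
  "normalized_solution \<mu> w \<longleftrightarrow>
     qc_solution (\<lambda>z. if z \<in> ext_disc then \<mu> z else 0) w \<and>
     w (Some 0) = Some 0 \<and> deriv (planar w) 0 = 1 \<and> deriv (deriv (planar w)) 0 = 0"


section \<open>Higher Schwarzians\<close>

definition pre_schwarzian :: "(complex \<Rightarrow> complex) \<Rightarrow> complex \<Rightarrow> complex" where
  "pre_schwarzian f z = deriv (deriv f) z / deriv f z"

definition schwarzian :: "(complex \<Rightarrow> complex) \<Rightarrow> complex \<Rightarrow> complex" where
  "schwarzian f z = deriv (pre_schwarzian f) z - (pre_schwarzian f z)\<^sup>2 / 2"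

text \<open>Only the indices from 3 on are meaningful.\<close>

primrec schwarzian_A :: "nat \<Rightarrow> (complex \<Rightarrow> complex) \<Rightarrow> complex \<Rightarrow> complex" where
  "schwarzian_A 0 f = schwarzian f"
| "schwarzian_A (Suc n) f =
     (if n < 3 then schwarzian f
      else (\<lambda>z. deriv (schwarzian_A n f) z - (of_nat n - 1) * pre_schwarzian f z * schwarzian_A n f z))"

definition sqrt_deriv :: "(complex \<Rightarrow> complex) \<Rightarrow> complex \<Rightarrow> complex" where
  "sqrt_deriv f = (SOME s. s holomorphic_on disc \<and> (\<forall>z\<in>disc. (s z)\<^sup>2 = deriv f z))"

text \<open>The powers \<open>n/2 - 1\<close> and \<open>1 - n/2\<close> of the derivative of
  \<open>f\<close> are the powers \<open>n - 2\<close> and \<open>2 - n\<close> of its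
  square root; the choice of the branch cancels.\<close>

definition schwarzian_B :: "nat \<Rightarrow> (complex \<Rightarrow> complex) \<Rightarrow> complex \<Rightarrow> complex" where
  "schwarzian_B n f z =
     - 2 * sqrt_deriv f z ^ (n - 2) *
     (deriv ^^ (n - 1)) (\<lambda>\<zeta>. 1 / sqrt_deriv f \<zeta> ^ (n - 2)) z"

datatype series = A | B

fun higher_schwarzian :: "series \<Rightarrow> nat \<Rightarrow> (complex \<Rightarrow> complex) \<Rightarrow> complex \<Rightarrow> complex" where
  "higher_schwarzian A n = schwarzian_A n"
| "higher_schwarzian B n = schwarzian_B n"


section \<open>Teichmueller space and the higher Bers maps\<close>

text \<open>Functions in this space vanish off the disc, so that equality of elements is equality of
  functions.\<close>

definition bers_space :: "nat \<Rightarrow> (complex \<Rightarrow> complex) set" where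
  "bers_space q =
     {f. f holomorphic_on disc \<and> (\<forall>z. z \<notin> disc \<longrightarrow> f z = 0) \<and>
         bdd_above ((\<lambda>z. norm (f z) * (1 - (norm z)\<^sup>2) ^ q) ` disc)}"

definition bers_norm :: "nat \<Rightarrow> (complex \<Rightarrow> complex) \<Rightarrow> real" where
  "bers_norm q f = (SUP z\<in>disc. norm (f z) * (1 - (norm z)\<^sup>2) ^ q)"

text \<open>The map induced on equivalence classes by a map that is constant on each of them.\<close>

definition induced :: "('a \<Rightarrow> 'b) \<Rightarrow> 'a set \<Rightarrow> 'b" where
  "induced F X = the_elem (F ` X)"

text \<open>In the following \<open>w\<close> assigns to each Beltrami coefficient its normalised
  solution.\<close>

definition teich_rel ::
    "((complex \<Rightarrow> complex) \<Rightarrow> complex option \<Rightarrow> complex option) \<Rightarrow>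
     (complex \<Rightarrow> complex) set \<Rightarrow> ((complex \<Rightarrow> complex) \<times> (complex \<Rightarrow> complex)) set" where
  "teich_rel w G =
     {(\<mu>, \<nu>). \<mu> \<in> belt G \<and> \<nu> \<in> belt G \<and> (\<forall>z\<in>sphere 0 1. w \<mu> (Some z) = w \<nu> (Some z))}"

definition teich_space ::
    "((complex \<Rightarrow> complex) \<Rightarrow> complex option \<Rightarrow> complex option) \<Rightarrow>
     (complex \<Rightarrow> complex) set \<Rightarrow> (complex \<Rightarrow> complex) set set" where
  "teich_space w G = belt G // teich_rel w G"

definition teich_proj ::
    "((complex \<Rightarrow> complex) \<Rightarrow> complex option \<Rightarrow> complex option) \<Rightarrow>
     (complex \<Rightarrow> complex) set \<Rightarrow> (complex \<Rightarrow> complex) \<Rightarrow> (complex \<Rightarrow> complex) set" where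
  "teich_proj w G \<mu> = teich_rel w G `` {\<mu>}"

text \<open>A map on \<open>teich_space w G\<close>.  A normalised solution with large coefficient may
  have a pole in the disc, and the value at that pole is a dummy; there is no pole when the
  coefficient is small, which is all that matters for the differential at the origin.\<close>

definition bers_map ::
    "series \<Rightarrow> nat \<Rightarrow> ((complex \<Rightarrow> complex) \<Rightarrow> complex option \<Rightarrow> complex option) \<Rightarrow>
     (complex \<Rightarrow> complex) set \<Rightarrow> complex \<Rightarrow> complex" where
  "bers_map s n w =
     induced (\<lambda>\<mu> z. if z \<in> disc then higher_schwarzian s n (planar (w \<mu>)) z else 0)"

definition bers_lift ::
    "series \<Rightarrow> nat \<Rightarrow> ((complex \<Rightarrow> complex) \<Rightarrow> complex option \<Rightarrow> complex option) \<Rightarrow>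
     (complex \<Rightarrow> complex) set \<Rightarrow> (complex \<Rightarrow> complex) \<Rightarrow> complex \<Rightarrow> complex" where
  "bers_lift s n w G = bers_map s n w \<circ> teich_proj w G"


section \<open>Differentials at the origin\<close>

text \<open>\<open>D\<close> is the complex Frechet derivative at 0 of the map \<open>F\<close> from a
  neighbourhood of 0 in \<open>linf_space G\<close> to \<open>bers_space q\<close>.\<close>

definition has_differential_at_0 ::
    "(complex \<Rightarrow> complex) set \<Rightarrow> nat \<Rightarrow> ((complex \<Rightarrow> complex) \<Rightarrow> complex \<Rightarrow> complex) \<Rightarrow>
     ((complex \<Rightarrow> complex) \<Rightarrow> complex \<Rightarrow> complex) \<Rightarrow> bool" where
  "has_differential_at_0 G q F D \<longleftrightarrow>
     (\<forall>\<mu>\<in>linf_space G. D \<mu> \<in> bers_space q) \<and>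
     (\<forall>\<mu>\<in>linf_space G. \<forall>\<nu>\<in>linf_space G. D (\<lambda>z. \<mu> z + \<nu> z) = (\<lambda>z. D \<mu> z + D \<nu> z)) \<and>
     (\<forall>c. \<forall>\<mu>\<in>linf_space G. D (\<lambda>z. c * \<mu> z) = (\<lambda>z. c * D \<mu> z)) \<and>
     (\<exists>C. \<forall>\<mu>\<in>linf_space G. bers_norm q (D \<mu>) \<le> C * linf_norm \<mu>) \<and>
     (\<forall>\<epsilon>>0. \<exists>\<delta>>0. \<forall>\<mu>\<in>linf_space G. linf_norm \<mu> < \<delta> \<longrightarrow>
        (\<lambda>z. F \<mu> z - F (\<lambda>_. 0) z - D \<mu> z) \<in> bers_space q \<and>
        bers_norm q (\<lambda>z. F \<mu> z - F (\<lambda>_. 0) z - D \<mu> z) \<le> \<epsilon> * linf_norm \<mu>)"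

text \<open>Congruence modulo the kernel of \<open>D\<close>.  If \<open>D\<close> is the differential of
  the lift of the classical Bers embedding, the quotient is the tangent space of Teichmueller space
  at the origin.\<close>

definition kernel_rel ::
    "(complex \<Rightarrow> complex) set \<Rightarrow> ((complex \<Rightarrow> complex) \<Rightarrow> complex \<Rightarrow> complex) \<Rightarrow>
     ((complex \<Rightarrow> complex) \<times> (complex \<Rightarrow> complex)) set" where
  "kernel_rel G D =
     {(\<mu>, \<nu>). \<mu> \<in> linf_space G \<and> \<nu> \<in> linf_space G \<and> D (\<lambda>z. \<mu> z - \<nu> z) = (\<lambda>_. 0)}"

definition tangent_space ::
    "(complex \<Rightarrow> complex) set \<Rightarrow> ((complex \<Rightarrow> complex) \<Rightarrow> complex \<Rightarrow> complex) \<Rightarrow>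
     (complex \<Rightarrow> complex) set set" where
  "tangent_space G D = linf_space G // kernel_rel G D"

end

theory Submission imports Defs "HOL-Complex_Analysis.Complex_Analysis" begin

text \<open>For small coefficients \<open>t \<mu>\<close>, the Schwarzian of the normalised solution on the disc is
  \<open>t \<Phi> + O(t\<^sup>2)\<close>, where \<open>\<Phi> z\<close> is a constant multiple of the integral of
  \<open>\<mu> \<zeta> / (\<zeta> - z)\<^sup>4\<close>. This is an energy estimate: for \<open>z\<close> in the disc, a Moebius
  transformation of the solution differs from \<open>1 / (\<zeta> - z)\<close> by a bounded function with square integrable
  derivatives whose norms are controlled by \<open>\<mu>\<close>, and the derivative of this function at \<open>z\<close>
  is the Schwarzian up to a constant. No representation formula or dependence on parameters of solutions of the
  Beltrami equation is needed. The Riccati equation of the pre-Schwarzian then excludes poles in the disc and bounds the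
  pre-Schwarzian by \<open>O(t)\<close>, so that the higher Schwarzian of order \<open>n\<close> is a nonzero multiple of the
  \<open>(n - 3)\<close>-rd derivative of the Schwarzian, up to \<open>O(t\<^sup>2)\<close>. Hence the differential of order
  \<open>n\<close> maps \<open>\<mu>\<close> to a nonzero multiple of the \<open>(n - 3)\<close>-rd derivative of
  \<open>\<Phi>\<close>, and the classical one maps it to \<open>\<Phi>\<close>. If the former vanishes, \<open>\<Phi>\<close> is
  a polynomial of degree at most \<open>n - 4\<close>. It is also a quadratic differential for \<open>G\<close>, which forces
  it to vanish: an element of \<open>G\<close> that moves 0 would raise its degree, and otherwise \<open>G\<close> consists of
  rotations of order at most \<open>n - 2\<close>.\<close>

section \<open>Square integrable functions\<close>

text \<open>The solutions \<open>w\<close> are merely given, one for each coefficient, and nothing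
  is known about how they vary. Every estimate therefore concerns a single solution, with constants
  that depend only on a bound k of its coefficient. For E = alpha / (w - w z0) - 1 / (z - z0) the
  Beltrami equation becomes E_zbar = m (E_z - 1 / (z - z0)^2). As E_z and E_zbar have equal L2
  norms, the norm of E_z is at most k N / (1 - k), where N is the norm of 1 / (z - z0)^2 on the
  exterior. Pairing the equation with the same kernel leaves the integral of m / (z - z0)^4 and an
  error of k^2 N^2 / (1 - k). Since N is of order 1 / (1 - |z0|), the resulting bound on the
  Schwarzian suits the supersolutions c / (1 - |z|) of the Riccati equation. The assumption on
  groups that fix 0 answers a real obstruction: for the rotation group of order q \<ge> 2 the
  quadratic differential z^(q - 2) is automorphic, and its (n - 3)-rd derivative vanishes when q
  \<le> n - 2.\<close>

definition L2 :: "(complex \<Rightarrow> complex) \<Rightarrow> bool" where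
  "L2 f \<longleftrightarrow> f \<in> borel_measurable borel \<and> integrable lborel (\<lambda>z. (norm (f z))\<^sup>2)"

definition nL2 :: "(complex \<Rightarrow> complex) \<Rightarrow> real" where
  "nL2 f = sqrt (LINT z|lborel. (norm (f z))\<^sup>2)"

lemma L2_meas: "L2 f \<Longrightarrow> f \<in> borel_measurable borel"
  and L2_integrable: "L2 f \<Longrightarrow> integrable lborel (\<lambda>z. (norm (f z))\<^sup>2)"
  by (auto simp: L2_def)

lemma nL2_nonneg [simp]: "0 \<le> nL2 f"
  by (simp add: nL2_def)

lemma nL2_power2: "(nL2 f)\<^sup>2 = (LINT z|lborel. (norm (f z))\<^sup>2)"
  by (simp add: nL2_def)

lemma L2_bound:
  assumes "L2 g" "f \<in> borel_measurable borel" "\<And>z. norm (f z) \<le> C * norm (g z)"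
  shows "L2 f"
proof -
  have "integrable lborel (\<lambda>z. (norm (f z))\<^sup>2)"
  proof (rule Bochner_Integration.integrable_bound)
    show "integrable lborel (\<lambda>z. C\<^sup>2 * (norm (g z))\<^sup>2)"
      using assms(1) by (auto simp: L2_def)
    show "AE z in lborel. norm ((norm (f z))\<^sup>2) \<le> norm (C\<^sup>2 * (norm (g z))\<^sup>2)"
      using assms(3) by (auto simp flip: power_mult_distrib intro!: power_mono)
  qed (use assms(2) in measurable)
  then show ?thesis using assms by (simp add: L2_def)
qed

lemma nL2_bound:
  assumes "L2 g" "f \<in> borel_measurable borel" "AE z in lborel. norm (f z) \<le> C * norm (g z)" "C \<ge> 0"
  shows "nL2 f \<le> C * nL2 g"
proof -
  have "(LINT z|lborel. (norm (f z))\<^sup>2) \<le> (LINT z|lborel. C\<^sup>2 * (norm (g z))\<^sup>2)"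
  proof (rule integral_mono_AE')
    show "integrable lborel (\<lambda>z. C\<^sup>2 * (norm (g z))\<^sup>2)"
      using assms(1) by (auto simp: L2_def)
    show "AE z in lborel. (norm (f z))\<^sup>2 \<le> C\<^sup>2 * (norm (g z))\<^sup>2"
      using assms(3) by eventually_elim (auto simp flip: power_mult_distrib intro!: power_mono)
  qed auto
  also have "\<dots> = C\<^sup>2 * (nL2 g)\<^sup>2" by (simp add: nL2_power2)
  finally have "(nL2 f)\<^sup>2 \<le> (C * nL2 g)\<^sup>2" by (simp add: nL2_power2 power_mult_distrib)
  then show ?thesis using assms(4) by (meson mult_nonneg_nonneg nL2_nonneg power2_le_imp_le)
qed

lemma L2_mult_integrable:
  assumes "L2 f" "L2 g"
  shows "integrable lborel (\<lambda>z. f z * g z)"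
proof (rule Bochner_Integration.integrable_bound)
  show "integrable lborel (\<lambda>z. (norm (f z))\<^sup>2 + (norm (g z))\<^sup>2)"
    using assms by (auto simp: L2_def)
  show "(\<lambda>z. f z * g z) \<in> borel_measurable lborel"
    using assms by (auto simp: L2_def)
  show "AE z in lborel. norm (f z * g z) \<le> norm ((norm (f z))\<^sup>2 + (norm (g z))\<^sup>2)"
  proof (rule AE_I2)
    fix z
    have "2 * norm (f z) * norm (g z) \<le> (norm (f z))\<^sup>2 + (norm (g z))\<^sup>2"
      by (rule sum_squares_bound)
    moreover have "0 \<le> norm (f z) * norm (g z)" by simp
    ultimately have "norm (f z) * norm (g z) \<le> (norm (f z))\<^sup>2 + (norm (g z))\<^sup>2" by linarith
    then show "norm (f z * g z) \<le> norm ((norm (f z))\<^sup>2 + (norm (g z))\<^sup>2)"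
      by (simp add: norm_mult)
  qed
qed

lemma L2_norm_mult_le:
  assumes "L2 f" "L2 g"
  shows "(LINT z|lborel. norm (f z) * norm (g z)) \<le> nL2 f * nL2 g"
proof -
  have m: "f \<in> borel_measurable borel" "g \<in> borel_measurable borel" using assms by (auto simp: L2_def)
  have i: "integrable lborel (\<lambda>z. norm (f z) * norm (g z))"
    using integrable_norm[OF L2_mult_integrable[OF assms]] by (simp add: norm_mult)
  have "(\<integral>\<^sup>+z. ennreal (norm (f z)) * ennreal (norm (g z)) \<partial>lborel)\<^sup>2 \<le>
     (\<integral>\<^sup>+z. ennreal (norm (f z)) ^ 2 \<partial>lborel) * (\<integral>\<^sup>+z. ennreal (norm (g z)) ^ 2 \<partial>lborel)"
    by (rule Cauchy_Schwarz_nn_integral) (use m in measurable)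
  then have "(\<integral>\<^sup>+z. ennreal (norm (f z) * norm (g z)) \<partial>lborel)\<^sup>2 \<le>
     (\<integral>\<^sup>+z. ennreal ((norm (f z)) ^ 2) \<partial>lborel) * (\<integral>\<^sup>+z. ennreal ((norm (g z)) ^ 2) \<partial>lborel)"
    by (simp add: ennreal_mult' ennreal_power)
  also have "(\<integral>\<^sup>+z. ennreal ((norm (f z)) ^ 2) \<partial>lborel) = ennreal ((nL2 f)\<^sup>2)"
    using assms by (simp add: nL2_power2 L2_def nn_integral_eq_integral)
  also have "(\<integral>\<^sup>+z. ennreal ((norm (g z)) ^ 2) \<partial>lborel) = ennreal ((nL2 g)\<^sup>2)"
    using assms by (simp add: nL2_power2 L2_def nn_integral_eq_integral)
  also have "(\<integral>\<^sup>+z. ennreal (norm (f z) * norm (g z)) \<partial>lborel) = ennreal (LINT z|lborel. norm (f z) * norm (g z))"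
    using i by (simp add: nn_integral_eq_integral)
  finally have "ennreal ((LINT z|lborel. norm (f z) * norm (g z))\<^sup>2) \<le> ennreal ((nL2 f)\<^sup>2 * (nL2 g)\<^sup>2)"
    by (simp add: ennreal_power ennreal_mult' integral_nonneg_AE)
  then have "(LINT z|lborel. norm (f z) * norm (g z))\<^sup>2 \<le> (nL2 f * nL2 g)\<^sup>2"
    by (simp add: power_mult_distrib)
  then show ?thesis by (meson mult_nonneg_nonneg nL2_nonneg power2_le_imp_le)
qed

lemma L2_Cauchy_Schwarz:
  assumes "L2 f" "L2 g"
  shows "norm (LINT z|lborel. f z * g z) \<le> nL2 f * nL2 g"
proof -
  have "norm (LINT z|lborel. f z * g z) \<le> (LINT z|lborel. norm (f z * g z))"
    by (rule integral_norm_bound)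
  also have "\<dots> \<le> nL2 f * nL2 g" using L2_norm_mult_le[OF assms] by (simp add: norm_mult)
  finally show ?thesis .
qed

lemma L2_add:
  assumes "L2 f" "L2 g"
  shows "L2 (\<lambda>z. f z + g z)" "nL2 (\<lambda>z. f z + g z) \<le> nL2 f + nL2 g"
proof -
  have m: "f \<in> borel_measurable borel" "g \<in> borel_measurable borel" using assms by (auto simp: L2_def)
  have i: "integrable lborel (\<lambda>z. norm (f z) * norm (g z))"
    using integrable_norm[OF L2_mult_integrable[OF assms]] by (simp add: norm_mult)
  have i2: "integrable lborel (\<lambda>z. (norm (f z))\<^sup>2 + (norm (g z))\<^sup>2 + 2 * (norm (f z) * norm (g z)))"
    using assms i by (auto simp: L2_def)
  have le: "(norm (f z + g z))\<^sup>2 \<le> (norm (f z))\<^sup>2 + (norm (g z))\<^sup>2 + 2 * (norm (f z) * norm (g z))" for z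
  proof -
    have "(norm (f z + g z))\<^sup>2 \<le> (norm (f z) + norm (g z))\<^sup>2"
      by (intro power_mono norm_triangle_ineq) auto
    then show ?thesis by (simp add: power2_sum)
  qed
  show L: "L2 (\<lambda>z. f z + g z)"
    unfolding L2_def
  proof
    show "integrable lborel (\<lambda>z. (norm (f z + g z))\<^sup>2)"
      by (rule Bochner_Integration.integrable_bound[OF i2])
        (use m le in \<open>auto intro!: AE_I2 order_trans[OF le]\<close>)
  qed (use m in measurable)
  have "(nL2 (\<lambda>z. f z + g z))\<^sup>2 \<le> (LINT z|lborel. (norm (f z))\<^sup>2 + (norm (g z))\<^sup>2 + 2 * (norm (f z) * norm (g z)))"
    unfolding nL2_power2 by (rule integral_mono) (use L i2 le in \<open>auto simp: L2_def\<close>)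
  also have "\<dots> = (nL2 f)\<^sup>2 + (nL2 g)\<^sup>2 + 2 * (LINT z|lborel. norm (f z) * norm (g z))"
    using assms i by (simp add: L2_def nL2_power2)
  also have "\<dots> \<le> (nL2 f)\<^sup>2 + (nL2 g)\<^sup>2 + 2 * (nL2 f * nL2 g)"
    using L2_norm_mult_le[OF assms] by simp
  also have "\<dots> = (nL2 f + nL2 g)\<^sup>2" by (simp add: power2_sum)
  finally show "nL2 (\<lambda>z. f z + g z) \<le> nL2 f + nL2 g"
    by (rule power2_le_imp_le) simp
qed

lemma L2_cmult:
  assumes "L2 f" shows "L2 (\<lambda>z. c * f z)" "nL2 (\<lambda>z. c * f z) = norm c * nL2 f"
  using assms by (auto simp: L2_def nL2_def norm_mult power_mult_distrib real_sqrt_mult)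

lemma L2_diff:
  assumes "L2 f" "L2 g"
  shows "L2 (\<lambda>z. f z - g z)" "nL2 (\<lambda>z. f z - g z) \<le> nL2 f + nL2 g"
  using L2_add[OF assms(1) L2_cmult(1)[OF assms(2), of "-1"]] L2_cmult(2)[OF assms(2), of "-1"] by auto

lemma L2_compact_support:
  assumes "f \<in> borel_measurable borel" "\<And>z. norm (f z) \<le> C" "compact K" "\<And>z. z \<notin> K \<Longrightarrow> f z = 0"
  shows "L2 f"
proof -
  have "integrable lborel (\<lambda>z. indicator K z *\<^sub>R (norm (f z))\<^sup>2)"
  proof (rule Bochner_Integration.integrable_bound)
    show "integrable lborel (\<lambda>z. C\<^sup>2 * indicator K z)"
      using assms(3) by (auto intro!: emeasure_bounded_finite compact_imp_bounded
        simp: borel_compact)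
    show "(\<lambda>z. indicator K z *\<^sub>R (norm (f z))\<^sup>2) \<in> borel_measurable lborel"
      using assms(1,3) borel_compact by measurable
    show "AE z in lborel. norm (indicator K z *\<^sub>R (norm (f z))\<^sup>2) \<le> norm (C\<^sup>2 * indicator K z)"
      using assms(2) by (auto intro!: AE_I2 power_mono simp: indicator_def)
  qed
  moreover have "(\<lambda>z. indicator K z *\<^sub>R (norm (f z))\<^sup>2) = (\<lambda>z. (norm (f z))\<^sup>2)"
    using assms(4) by (auto simp: indicator_def fun_eq_iff)
  ultimately show ?thesis using assms(1) by (simp add: L2_def)
qed

lemma integrable_compact_support:
  fixes f :: "complex \<Rightarrow> complex"
  assumes "continuous_on UNIV f" "compact K" "\<And>z. z \<notin> K \<Longrightarrow> f z = 0"
  shows "integrable lborel f"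
proof -
  have "integrable lborel (\<lambda>z. indicator K z *\<^sub>R f z)"
    by (rule borel_integrable_compact) (use assms in \<open>auto intro: continuous_on_subset\<close>)
  moreover have "(\<lambda>z. indicator K z *\<^sub>R f z) = f"
    using assms(3) by (auto simp: indicator_def fun_eq_iff)
  ultimately show ?thesis by simp
qed

lemma continuous_compact_support_bounded:
  fixes f :: "complex \<Rightarrow> complex"
  assumes "continuous_on UNIV f" "compact K" "\<And>z. z \<notin> K \<Longrightarrow> f z = 0"
  obtains C where "C \<ge> 0" "\<And>z. norm (f z) \<le> C"
proof -
  have "bounded (f ` K)"
    using assms(1,2) by (intro compact_imp_bounded compact_continuous_image) (auto intro: continuous_on_subset)
  then obtain C where C: "C > 0" "\<And>z. z \<in> K \<Longrightarrow> norm (f z) \<le> C"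
    unfolding bounded_pos by auto
  show thesis
  proof
    show "norm (f z) \<le> C" for z using C assms(3) by (cases "z \<in> K") auto
  qed (use C in auto)
qed

lemma L2_continuous_compact_support:
  assumes "continuous_on UNIV f" "compact K" "\<And>z. z \<notin> K \<Longrightarrow> f z = 0"
  shows "L2 f"
proof -
  obtain C where "\<And>z. norm (f z) \<le> C" using continuous_compact_support_bounded assms by metis
  then show ?thesis using assms by (intro L2_compact_support[of f C K]) (auto intro: borel_measurable_continuous_onI)
qed

lemma lborel_translation_complex:
  fixes f :: "complex \<Rightarrow> 'b :: {banach, second_countable_topology}"
  shows "(LINT z|lborel. f (z + h)) = (LINT z|lborel. f z)"
    and "integrable lborel f \<Longrightarrow> integrable lborel (\<lambda>z. f (z + h))"
proof -
  have *: "distr lborel borel (\<lambda>z. h + z) = (lborel :: complex measure)"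
    by (rule lborel_distr_plus)
  show i: "integrable lborel (\<lambda>z. f (z + h))" if "integrable lborel f" for f :: "complex \<Rightarrow> 'b" and h
  proof -
    have "integrable (distr lborel borel (\<lambda>z. h + z)) f" using that lborel_distr_plus[of h] by simp
    then show ?thesis by (subst (asm) integrable_distr_eq) (use that in \<open>auto simp: add.commute\<close>)
  qed
  show "(LINT z|lborel. f (z + h)) = (LINT z|lborel. f z)"
  proof (cases "integrable lborel f")
    case True
    have "(LINT z|lborel. f z) = (LINT z|distr lborel borel (\<lambda>z. h + z). f z)" using * by simp
    also have "\<dots> = (LINT z|lborel. f (h + z))"
      by (rule integral_distr) (use True in auto)
    finally show ?thesis by (simp add: add.commute)
  next
    case False
    have "\<not> integrable lborel (\<lambda>z. f (z + h))"
      using i[of "\<lambda>z. f (z + h)" "-h"] False by auto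
    then show ?thesis using False by (simp add: not_integrable_integral_eq)
  qed
qed

section \<open>Test functions\<close>

text \<open>\<open>a\<close> and \<open>b\<close> are the Wirtinger derivatives at \<open>z\<close>,
  with respect to z and to its conjugate.\<close>

definition wirt :: "(complex \<Rightarrow> complex) \<Rightarrow> complex \<Rightarrow> complex \<Rightarrow> complex \<Rightarrow> bool" where
  "wirt \<phi> a b z \<longleftrightarrow> (\<phi> has_derivative (\<lambda>h. a * h + b * cnj h)) (at z)"

lemma wirt_holomorphic:
  assumes "(f has_field_derivative d) (at z)" shows "wirt f d 0 z"
  using assms by (simp add: wirt_def has_field_derivative_def mult_commute_abs)

lemma wirt_const: "wirt (\<lambda>z. c) 0 0 z"
  by (simp add: wirt_def)

lemma wirt_mult:
  assumes "wirt f a b z" "wirt g c d z"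
  shows "wirt (\<lambda>z. f z * g z) (a * g z + f z * c) (b * g z + f z * d) z"
  unfolding wirt_def
  by (rule has_derivative_eq_rhs[OF has_derivative_mult[OF assms[unfolded wirt_def]]])
    (auto simp: algebra_simps)

lemma wirt_cnj:
  assumes "wirt f a b z"
  shows "wirt (\<lambda>z. cnj (f z)) (cnj b) (cnj a) z"
  unfolding wirt_def
  by (rule has_derivative_eq_rhs[OF has_derivative_cnj[OF assms[unfolded wirt_def]]])
    (auto simp: algebra_simps)

lemma wirt_chain_holomorphic:
  assumes "wirt f a b z" "(F has_field_derivative d) (at (f z))"
  shows "wirt (\<lambda>z. F (f z)) (d * a) (d * b) z"
  unfolding wirt_def
  by (rule has_derivative_eq_rhs[OF has_derivative_compose[OF assms(1)[unfolded wirt_def] assms(2)[unfolded has_field_derivative_def]]])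
    (auto simp: algebra_simps)

text \<open>The differential of a real-valued function takes real values. Hence the outer derivative
  \<open>d\<close> acts on it as a complex scalar and multiplies both Wirtinger derivatives.\<close>

lemma wirt_chain_real:
  assumes "wirt (\<lambda>z. of_real (r z)) a b z" "(\<theta> has_real_derivative d) (at (r z))"
  shows "wirt (\<lambda>z. of_real (\<theta> (r z))) (d * a) (d * b) z"
proof -
  have "((\<lambda>z. Re (of_real (r z))) has_derivative (\<lambda>h. Re (a * h + b * cnj h))) (at z)"
    by (rule has_derivative_Re[OF assms(1)[unfolded wirt_def]])
  then have 1: "(r has_derivative (\<lambda>h. Re (a * h + b * cnj h))) (at z)" by simp
  have "((\<lambda>z. Im (of_real (r z))) has_derivative (\<lambda>h. Im (a * h + b * cnj h))) (at z)"
    by (rule has_derivative_Im[OF assms(1)[unfolded wirt_def]])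
  then have "((\<lambda>z. 0::real) has_derivative (\<lambda>h. Im (a * h + b * cnj h))) (at z)" by simp
  then have "(\<lambda>h. Im (a * h + b * cnj h)) = (\<lambda>h. 0)"
    using has_derivative_unique has_derivative_const by blast
  then have im: "Im (a * h + b * cnj h) = 0" for h by meson
  have "((\<lambda>z. \<theta> (r z)) has_derivative (\<lambda>h. d * Re (a * h + b * cnj h))) (at z)"
    by (rule has_derivative_eq_rhs[OF has_derivative_compose[OF 1 assms(2)[unfolded has_field_derivative_def]]]) auto
  then have "((\<lambda>z. complex_of_real (\<theta> (r z))) has_derivative (\<lambda>h. of_real (d * Re (a * h + b * cnj h)))) (at z)"
    by (rule has_derivative_of_real)
  moreover have "complex_of_real (d * Re (a * h + b * cnj h)) = d * a * h + d * b * cnj h" for h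
  proof -
    have "complex_of_real (Re (a * h + b * cnj h)) = a * h + b * cnj h"
      using im[of h] by (simp add: complex_eq_iff)
    then show ?thesis by (simp only: of_real_mult distrib_left mult.assoc)
  qed
  ultimately show ?thesis unfolding wirt_def by simp
qed

lemma wirt_unique:
  assumes "wirt f a b z" "wirt f c d z" shows "a = c" "b = d"
proof -
  have "(\<lambda>h. a * h + b * cnj h) = (\<lambda>h. c * h + d * cnj h)"
    using assms has_derivative_unique unfolding wirt_def by blast
  then have *: "a * h + b * cnj h = c * h + d * cnj h" for h by meson
  show "a = c" "b = d" using *[of 1] *[of \<i>] by (auto simp: algebra_simps complex_eq_iff)
qed

lemma wirt_cong:
  assumes "wirt f a b z" "open S" "z \<in> S" "\<And>x. x \<in> S \<Longrightarrow> f x = g x"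
  shows "wirt g a b z"
  using assms unfolding wirt_def using has_derivative_transform_within_open by blast

lemma wirt_imp_continuous: "wirt f a b z \<Longrightarrow> isCont f z"
  unfolding wirt_def using has_derivative_continuous by blast

text \<open>The test functions of \<open>test_function\<close> in Wirtinger form. With
  \<open>a\<close> and \<open>b\<close> as arguments, products and convolutions can state their
  derivatives by formulas.\<close>

definition tf :: "complex set \<Rightarrow> (complex \<Rightarrow> complex) \<Rightarrow> (complex \<Rightarrow> complex) \<Rightarrow> (complex \<Rightarrow> complex) \<Rightarrow> bool" where
  "tf U \<phi> a b \<longleftrightarrow> continuous_on UNIV a \<and> continuous_on UNIV b \<and> (\<forall>z. wirt \<phi> (a z) (b z) z) \<and>
     (\<exists>K. compact K \<and> K \<subseteq> U \<and> (\<forall>z. z \<notin> K \<longrightarrow> \<phi> z = 0))"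

lemma tf_support:
  assumes "tf U \<phi> a b"
  obtains K where "compact K" "K \<subseteq> U" "\<And>z. z \<notin> K \<Longrightarrow> \<phi> z = 0" "\<And>z. z \<notin> K \<Longrightarrow> a z = 0" "\<And>z. z \<notin> K \<Longrightarrow> b z = 0"
proof -
  obtain K where K: "compact K" "K \<subseteq> U" "\<And>z. z \<notin> K \<Longrightarrow> \<phi> z = 0" using assms unfolding tf_def by auto
  have "a z = 0 \<and> b z = 0" if "z \<notin> K" for z
  proof -
    have "open (- K)" using K compact_imp_closed by blast
    then have "wirt \<phi> 0 0 z"
      by (intro wirt_cong[OF wirt_const[of 0], of "-K"]) (use that K in auto)
    then show ?thesis using assms wirt_unique unfolding tf_def by blast
  qed
  then show thesis using that K by blast
qed

lemma tf_mono: "tf U \<phi> a b \<Longrightarrow> U \<subseteq> V \<Longrightarrow> tf V \<phi> a b"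
  unfolding tf_def by blast

lemma tf_continuous:
  assumes "tf U \<phi> a b"
  shows "continuous_on UNIV \<phi>" "continuous_on UNIV a" "continuous_on UNIV b"
  using assms unfolding tf_def by (meson wirt_imp_continuous continuous_at_imp_continuous_on)+

lemma tf_integrable:
  assumes "tf U \<phi> a b"
  shows "integrable lborel \<phi>" "integrable lborel a" "integrable lborel b"
  using tf_support[OF assms] tf_continuous[OF assms] integrable_compact_support by metis+

lemma tf_L2:
  assumes "tf U \<phi> a b"
  shows "L2 \<phi>" "L2 a" "L2 b"
  using tf_support[OF assms] tf_continuous[OF assms] L2_continuous_compact_support by metis+

lemma continuous_zero_extension:
  fixes f :: "complex \<Rightarrow> complex"
  assumes "open U" "continuous_on U f" "compact K" "K \<subseteq> U" "\<And>z. z \<notin> K \<Longrightarrow> f z = 0"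
  shows "continuous_on UNIV f"
proof -
  have "continuous_on (U \<union> - K) f"
    using assms by (intro continuous_on_open_Un open_Compl compact_imp_closed)
      (auto intro: continuous_on_eq[OF continuous_on_const[of _ 0]])
  moreover have "U \<union> - K = UNIV" using assms by auto
  ultimately show ?thesis by simp
qed

text \<open>The second factor need only be C^1 on \<open>U\<close>, like 1 / (z - z0)^2 on the
  complement of z0. The first factor vanishes off a compact subset of \<open>U\<close>, so that the
  product extends by 0.\<close>

lemma tf_mult:
  assumes "tf U \<phi> a b" "open U" "\<And>z. z \<in> U \<Longrightarrow> wirt \<psi> (c z) (d z) z" "continuous_on U c" "continuous_on U d"
  shows "tf U (\<lambda>z. \<phi> z * \<psi> z) (\<lambda>z. a z * \<psi> z + \<phi> z * c z) (\<lambda>z. b z * \<psi> z + \<phi> z * d z)"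
proof -
  obtain K where K: "compact K" "K \<subseteq> U" "\<And>z. z \<notin> K \<Longrightarrow> \<phi> z = 0" "\<And>z. z \<notin> K \<Longrightarrow> a z = 0" "\<And>z. z \<notin> K \<Longrightarrow> b z = 0"
    using tf_support[OF assms(1)] by metis
  have "continuous_on U \<psi>" by (meson assms(3) wirt_imp_continuous continuous_at_imp_continuous_on)
  then have 1: "continuous_on U (\<lambda>z. a z * \<psi> z + \<phi> z * c z)" "continuous_on U (\<lambda>z. b z * \<psi> z + \<phi> z * d z)"
    using tf_continuous[OF assms(1)] assms(4,5) by (auto intro!: continuous_intros intro: continuous_on_subset)
  have 2: "wirt (\<lambda>z. \<phi> z * \<psi> z) (a z * \<psi> z + \<phi> z * c z) (b z * \<psi> z + \<phi> z * d z) z" for z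
  proof (cases "z \<in> U")
    case True then show ?thesis using assms(1,3) by (auto simp: tf_def intro!: wirt_mult)
  next
    case False
    then have "z \<notin> K" using K by auto
    have "open (-K)" using K compact_imp_closed by blast
    then have "wirt (\<lambda>z. \<phi> z * \<psi> z) 0 0 z"
      by (intro wirt_cong[OF wirt_const[of 0], of "-K"]) (use \<open>z \<notin> K\<close> K in auto)
    then show ?thesis using K \<open>z \<notin> K\<close> by simp
  qed
  show ?thesis unfolding tf_def
  proof (intro conjI)
    show "continuous_on UNIV (\<lambda>z. a z * \<psi> z + \<phi> z * c z)"
      by (rule continuous_zero_extension[OF assms(2) 1(1) K(1,2)]) (use K in auto)
    show "continuous_on UNIV (\<lambda>z. b z * \<psi> z + \<phi> z * d z)"
      by (rule continuous_zero_extension[OF assms(2) 1(2) K(1,2)]) (use K in auto)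
  qed (use 2 K in auto)
qed

lemma tf_cnj:
  assumes "tf U \<phi> a b" shows "tf U (\<lambda>z. cnj (\<phi> z)) (\<lambda>z. cnj (b z)) (\<lambda>z. cnj (a z))"
  using assms unfolding tf_def by (auto intro!: wirt_cnj continuous_intros)

lemma tf_times:
  assumes "tf U \<phi> a b" "tf V \<psi> c d"
  shows "tf (U \<inter> V) (\<lambda>z. \<phi> z * \<psi> z) (\<lambda>z. a z * \<psi> z + \<phi> z * c z) (\<lambda>z. b z * \<psi> z + \<phi> z * d z)"
proof -
  obtain K L where KL: "compact K" "K \<subseteq> U" "\<And>z. z \<notin> K \<Longrightarrow> \<phi> z = 0" "compact L" "L \<subseteq> V" "\<And>z. z \<notin> L \<Longrightarrow> \<psi> z = 0"
    using assms unfolding tf_def by metis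
  show ?thesis unfolding tf_def
  proof (intro conjI exI[of _ "K \<inter> L"])
    show "\<forall>z. wirt (\<lambda>z. \<phi> z * \<psi> z) (a z * \<psi> z + \<phi> z * c z) (b z * \<psi> z + \<phi> z * d z) z"
      using assms by (auto simp: tf_def intro!: wirt_mult)
  qed (use KL tf_continuous[OF assms(1)] tf_continuous[OF assms(2)] in \<open>auto intro!: continuous_intros\<close>)
qed

lemma uniformly_continuous_compact_support:
  fixes f :: "complex \<Rightarrow> complex"
  assumes "continuous_on UNIV f" "compact K" "\<And>z. z \<notin> K \<Longrightarrow> f z = 0"
  shows "uniformly_continuous_on UNIV f"
proof -
  obtain R where R: "R > 0" "K \<subseteq> cball 0 R" 
    using compact_imp_bounded[OF assms(2)] unfolding bounded_pos by (auto simp: subset_iff)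
  have "uniformly_continuous_on (cball 0 (R+1)) f"
    by (rule compact_uniformly_continuous) (use assms in \<open>auto intro: continuous_on_subset\<close>)
  show ?thesis unfolding uniformly_continuous_on_def
  proof (intro allI impI)
    fix e :: real assume "e > 0"
    then obtain d where d: "d > 0" "\<And>x x'. x \<in> cball 0 (R+1) \<Longrightarrow> x' \<in> cball 0 (R+1) \<Longrightarrow> dist x' x < d \<Longrightarrow> dist (f x') (f x) < e"
      using \<open>uniformly_continuous_on (cball 0 (R+1)) f\<close> unfolding uniformly_continuous_on_def by metis
    show "\<exists>d>0. \<forall>x\<in>UNIV. \<forall>x'\<in>UNIV. dist x' x < d \<longrightarrow> dist (f x') (f x) < e"
    proof (intro exI[of _ "min d 1"] conjI ballI impI)
      fix x x' :: complex assume dd: "dist x' x < min d 1"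
      show "dist (f x') (f x) < e"
      proof (cases "x \<in> cball 0 (R+1) \<and> x' \<in> cball 0 (R+1)")
        case True then show ?thesis using d dd by auto
      next
        case False
        have "\<bar>norm x' - norm x\<bar> < 1" using dd norm_triangle_ineq3[of x' x] by (auto simp: dist_norm)
        then have "norm x > R \<and> norm x' > R" using False by auto
        then have "x \<notin> K" "x' \<notin> K" using R by auto
        then show ?thesis using assms \<open>e > 0\<close> by auto
      qed
    qed (use d in auto)
  qed
qed

text \<open>The mean value inequality for \<phi> minus its linearization at \<open>z\<close>; the
  bound is uniform in \<open>z\<close> because \<open>a\<close> and \<open>b\<close> are uniformly
  continuous. This justifies differentiation under the integral sign below.\<close>

lemma uniform_differentiability:
  assumes "continuous_on UNIV a" "continuous_on UNIV b" "\<And>z. wirt \<phi> (a z) (b z) z"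
    "compact K" "\<And>z. z \<notin> K \<Longrightarrow> a z = 0" "\<And>z. z \<notin> K \<Longrightarrow> b z = 0" "e > 0"
  obtains \<delta> where "\<delta> > 0" 
    "\<And>z h. norm h < \<delta> \<Longrightarrow> norm (\<phi> (z + h) - \<phi> z - (a z * h + b z * cnj h)) \<le> e * norm h"
proof -
  note uc = uniformly_continuous_compact_support[OF _ assms(4)]
  obtain d1 where d1: "d1 > 0" "\<And>x x'. dist x' x < d1 \<Longrightarrow> dist (a x') (a x) < e/2"
    using uc[OF assms(1,5)] \<open>e > 0\<close> unfolding uniformly_continuous_on_def by (meson UNIV_I half_gt_zero)
  obtain d2 where d2: "d2 > 0" "\<And>x x'. dist x' x < d2 \<Longrightarrow> dist (b x') (b x) < e/2"
    using uc[OF assms(2,6)] \<open>e > 0\<close> unfolding uniformly_continuous_on_def by (meson UNIV_I half_gt_zero)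
  define \<delta> where "\<delta> = min d1 d2"
  have "norm (\<phi> (z + h) - \<phi> z - (a z * h + b z * cnj h)) \<le> e * norm h" if h: "norm h < \<delta>" for z h
  proof -
    define F where "F = (\<lambda>y. \<phi> y - (a z * y + b z * cnj y))"
    have dF: "(F has_derivative (\<lambda>k. (a y * k + b y * cnj k) - (a z * k + b z * cnj k))) (at y within ball z \<delta>)" for y
    proof -
      have "(\<phi> has_derivative (\<lambda>k. a y * k + b y * cnj k)) (at y)" using assms(3) by (simp add: wirt_def)
      moreover have "((\<lambda>y. a z * y + b z * cnj y) has_derivative (\<lambda>k. a z * k + b z * cnj k)) (at y)"
        by (intro derivative_intros)
      ultimately show ?thesis unfolding F_def using has_derivative_diff has_derivative_at_withinI by blast
    qed
    have on: "onorm (\<lambda>k. (a y * k + b y * cnj k) - (a z * k + b z * cnj k)) \<le> e" if "y \<in> ball z \<delta>" for y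
    proof (rule onorm_bound)
      fix k
      have "norm ((a y * k + b y * cnj k) - (a z * k + b z * cnj k)) = norm ((a y - a z) * k + (b y - b z) * cnj k)"
        by (simp add: algebra_simps)
      also have "\<dots> \<le> norm (a y - a z) * norm k + norm (b y - b z) * norm k"
        by (rule order_trans[OF norm_triangle_ineq]) (simp add: norm_mult)
      also have "\<dots> \<le> e/2 * norm k + e/2 * norm k"
        using d1(2)[of y z] d2(2)[of y z] that by (intro add_mono mult_right_mono) (auto simp: \<delta>_def dist_norm norm_minus_commute)
      finally show "norm ((a y * k + b y * cnj k) - (a z * k + b z * cnj k)) \<le> e * norm k" by simp
    qed (use \<open>e > 0\<close> in auto)
    have "\<delta> > 0" using d1 d2 by (auto simp: \<delta>_def)
    have "norm (F (z + h) - F z) \<le> e * norm ((z + h) - z)"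
      by (rule differentiable_bound[OF convex_ball dF on]) (use h \<open>\<delta> > 0\<close> in \<open>auto simp: dist_norm\<close>)
    then show ?thesis by (simp add: F_def algebra_simps)
  qed
  then show thesis using that[of \<delta>] d1 d2 by (auto simp: \<delta>_def)
qed

text \<open>Differentiate the translation invariance of the integral.\<close>

lemma tf_integral_zero:
  assumes "tf U \<phi> a b"
  shows "(LINT z|lborel. a z) = 0" "(LINT z|lborel. b z) = 0"
proof -
  obtain K where K: "compact K" "K \<subseteq> U" "\<And>z. z \<notin> K \<Longrightarrow> \<phi> z = 0" "\<And>z. z \<notin> K \<Longrightarrow> a z = 0" "\<And>z. z \<notin> K \<Longrightarrow> b z = 0"
    using tf_support[OF assms(1)] by metis
  have i: "integrable lborel \<phi>" "integrable lborel a" "integrable lborel b" using tf_integrable[OF assms] by auto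
  have ih: "integrable lborel (\<lambda>z. \<phi> (z + h))" for h by (rule lborel_translation_complex(2)[OF i(1)])
  define A where "A = (LINT z|lborel. a z)"
  define B where "B = (LINT z|lborel. b z)"
  obtain R where R: "R > 0" "K \<subseteq> cball 0 R" 
    using compact_imp_bounded[OF K(1)] unfolding bounded_pos by (auto simp: subset_iff)
  define m where "m = measure lborel (cball (0::complex) (R+1))"
  have "norm (A * h + B * cnj h) \<le> e * norm h * m" if "e > 0" "norm h < 1" "norm h < \<delta>"
    "\<And>z h. norm h < \<delta> \<Longrightarrow> norm (\<phi> (z + h) - \<phi> z - (a z * h + b z * cnj h)) \<le> e * norm h" for e \<delta> h
  proof -
    have "A * h + B * cnj h = (LINT z|lborel. a z * h + b z * cnj h)"
      using i by (simp add: A_def B_def)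
    also have "\<dots> = - (LINT z|lborel. \<phi> (z + h) - \<phi> z - (a z * h + b z * cnj h))"
      using i ih[of h] lborel_translation_complex(1)[of \<phi> h] by simp
    finally have "norm (A * h + B * cnj h) = norm (LINT z|lborel. \<phi> (z + h) - \<phi> z - (a z * h + b z * cnj h))" by simp
    also have "\<dots> \<le> (LINT z|lborel. e * norm h * indicator (cball (0::complex) (R+1)) z)"
    proof (rule Bochner_Integration.integral_norm_bound_integral)
      show "norm (\<phi> (z + h) - \<phi> z - (a z * h + b z * cnj h)) \<le> e * norm h * indicator (cball 0 (R+1)) z" for z
      proof (cases "z \<in> cball 0 (R+1)")
        case True then show ?thesis using that(4)[OF that(3), of z] by simp
      next
        case False
        then have "norm z > R" "norm (z + h) > R" using \<open>norm h < 1\<close> norm_triangle_ineq2[of z "-h"] by auto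
        then have "z \<notin> K" "z + h \<notin> K" using R by auto
        then show ?thesis using K False by auto
      qed
      show "integrable lborel (\<lambda>z. e * norm h * indicator (cball 0 (R+1)) z)"
        by (auto intro!: emeasure_bounded_finite)
    qed (use i ih[of h] in \<open>auto intro!: Bochner_Integration.integrable_diff Bochner_Integration.integrable_add\<close>)
    also have "\<dots> = e * norm h * m" by (simp add: m_def)
    finally show ?thesis .
  qed note * = this
  \<comment> \<open>Rescaling \<open>h\<close> to a unit vector \<open>u\<close> removes the factor
    |h|. As \<open>e\<close> is arbitrary, A u + B cnj u vanishes, and u = 1 and u = \<i> separate
    \<open>A\<close> from \<open>B\<close>.\<close>
  have bd: "norm (A * u + B * cnj u) \<le> e * m" if u: "norm u = 1" and e: "e > 0" for u e
  proof -
    obtain \<delta> where \<delta>: "\<delta> > 0" "\<And>z h. norm h < \<delta> \<Longrightarrow> norm (\<phi> (z + h) - \<phi> z - (a z * h + b z * cnj h)) \<le> e * norm h"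
      using uniform_differentiability[OF tf_continuous(2,3)[OF assms] _ K(1,4,5) e, of \<phi>] assms unfolding tf_def by blast
    define t where "t = min \<delta> 1 / 2"
    have t: "t > 0" "t < 1" "t < \<delta>" using \<delta>(1) by (auto simp: t_def)
    have "norm (A * (t * u) + B * cnj (t * u)) \<le> e * norm (t * u) * m"
      by (rule *[OF e _ _ \<delta>(2)]) (use t u in \<open>auto simp: norm_mult\<close>)
    moreover have "A * (t * u) + B * cnj (t * u) = t * (A * u + B * cnj u)" by (simp add: algebra_simps)
    ultimately have "t * norm (A * u + B * cnj u) \<le> t * (e * m)" using t u by (simp add: norm_mult)
    then show ?thesis using t by simp
  qed
  have z: "A * u + B * cnj u = 0" if "norm u = 1" for u
  proof -
    have "norm (A * u + B * cnj u) \<le> 0"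
    proof (rule field_le_epsilon)
      fix e :: real assume "e > 0"
      have "m \<ge> 0" by (simp add: m_def)
      have "norm (A * u + B * cnj u) \<le> e / (m + 1) * m" by (rule bd[OF that]) (use \<open>e > 0\<close> \<open>m \<ge> 0\<close> in auto)
      also have "\<dots> \<le> e" using \<open>e > 0\<close> \<open>m \<ge> 0\<close> by (simp add: field_simps)
      finally show "norm (A * u + B * cnj u) \<le> 0 + e" by simp
    qed
    then show ?thesis by simp
  qed
  show "A = 0" "B = 0" using z[of 1] z[of \<i>] by (auto simp: algebra_simps complex_eq_iff)
qed

section \<open>Mollification\<close>

lemma has_real_derivative_max_power:
  "((\<lambda>x::real. (max 0 x) ^ (k + 2)) has_real_derivative real (k + 2) * (max 0 x) ^ (k + 1)) (at x)"
proof -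
  consider "x > 0" | "x < 0" | "x = 0" by linarith
  then show ?thesis
  proof cases
    case 1
    have "((\<lambda>x::real. x ^ (k + 2)) has_real_derivative real (k + 2) * x ^ (k + 1)) (at x)"
      using DERIV_pow[of "k + 2" x] by (simp add: field_simps)
    then have "((\<lambda>x::real. (max 0 x) ^ (k + 2)) has_real_derivative real (k + 2) * x ^ (k + 1)) (at x)"
      by (rule has_field_derivative_transform_within_open[of _ _ _ "{0<..}"]) (use 1 in auto)
    then show ?thesis using 1 by simp
  next
    case 2
    have "((\<lambda>x::real. 0) has_real_derivative 0) (at x)" by simp
    then have "((\<lambda>x::real. (max 0 x) ^ (k + 2)) has_real_derivative 0) (at x)"
      by (rule has_field_derivative_transform_within_open[of _ _ _ "{..<0}"]) (use 2 in auto)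
    then show ?thesis using 2 by simp
  next
    case 3
    have "(\<lambda>h::real. (max 0 h) ^ (k + 2) / h) \<midarrow>0\<rightarrow> 0"
    proof (rule Lim_null_comparison[where g = "\<lambda>h. \<bar>h\<bar>"])
      show "\<forall>\<^sub>F h::real in at 0. norm ((max 0 h) ^ (k + 2) / h) \<le> \<bar>h\<bar>"
      proof (rule eventually_mono[OF eventually_at_in_open'[of "{-1<..<1}"]])
        fix h :: real assume "h \<in> {-1<..<1}"
        then have h: "-1 < h" "h < 1" by auto
        show "norm ((max 0 h) ^ (k + 2) / h) \<le> \<bar>h\<bar>"
        proof (cases "h > 0")
          case True
          have "h ^ k \<le> 1" using True h by (intro power_le_one) auto
          then have "h * h ^ k \<le> h" using True by simp
          then show ?thesis using True by (simp add: max_def)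
        qed (auto simp: max_def)
      qed auto
    qed (auto intro!: tendsto_eq_intros)
    then show ?thesis using 3 by (simp add: DERIV_def)
  qed
qed

text \<open>The cube makes this twice continuously differentiable, so that the first derivatives of
  a mollifier are test functions themselves. \<open>bump1\<close> and \<open>bump2\<close> are the
  first and second derivatives with respect to the squared modulus.\<close>

definition bump :: "complex \<Rightarrow> complex" where
  "bump z = of_real ((max 0 (1 - (norm z)\<^sup>2)) ^ 3)"
definition bump1 :: "complex \<Rightarrow> complex" where
  "bump1 z = of_real (-3 * (max 0 (1 - (norm z)\<^sup>2)) ^ 2)"
definition bump2 :: "complex \<Rightarrow> complex" where
  "bump2 z = of_real (6 * max 0 (1 - (norm z)\<^sup>2))"

lemma wirt_norm_sq: "wirt (\<lambda>z. of_real ((norm (z - c))\<^sup>2)) (cnj (z - c)) (z - c) z"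
proof -
  have "wirt (\<lambda>z. (z - c) * cnj (z - c)) (1 * cnj (z - c) + (z - c) * cnj 0) (0 * cnj (z - c) + (z - c) * cnj 1) z"
    by (intro wirt_mult wirt_cnj wirt_holomorphic) (auto intro!: derivative_eq_intros)
  moreover have "(\<lambda>z. (z - c) * cnj (z - c)) = (\<lambda>z. of_real ((norm (z - c))\<^sup>2))"
    by (simp add: fun_eq_iff complex_norm_square flip: of_real_power)
  ultimately show ?thesis by simp
qed

lemma wirt_bump: "wirt bump (bump1 z * cnj z) (bump1 z * z) z"
proof -
  have "((\<lambda>x. (max 0 (1 - x)) ^ 3) has_real_derivative (-3 * (max 0 (1 - x))^2)) (at x)" for x :: real
  proof -
    have d: "((\<lambda>x. 1 - x) has_real_derivative -1) (at x)" by (auto intro!: derivative_eq_intros)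
    show ?thesis
      using DERIV_chain2[where f = "\<lambda>y. (max 0 y) ^ (1 + 2)", OF has_real_derivative_max_power[of 1 "1 - x"] d]
      by (simp add: numeral_eq_Suc)
  qed
  from wirt_chain_real[OF wirt_norm_sq[of 0 z] this] show ?thesis
    by (simp add: bump_def[abs_def] bump1_def)
qed

lemma wirt_bump1: "wirt bump1 (bump2 z * cnj z) (bump2 z * z) z"
proof -
  have "((\<lambda>x. -3 * (max 0 (1 - x)) ^ 2) has_real_derivative (6 * (max 0 (1 - x)))) (at x)" for x :: real
  proof -
    have d: "((\<lambda>x. 1 - x) has_real_derivative -1) (at x)" by (auto intro!: derivative_eq_intros)
    show ?thesis
      using DERIV_cmult[OF DERIV_chain2[where f = "\<lambda>y. (max 0 y) ^ (0 + 2)", OF has_real_derivative_max_power[of 0 "1 - x"] d], of "-3"]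
      by (simp add: numeral_eq_Suc)
  qed
  from wirt_chain_real[OF wirt_norm_sq[of 0 z] this] show ?thesis
    by (simp add: bump1_def[abs_def] bump2_def)
qed

lemma wirt_rescale:
  assumes "\<And>z. wirt f (a z) (b z) z"
  shows "wirt (\<lambda>z. C * f (of_real s * z)) (C * s * a (of_real s * z)) (C * s * b (of_real s * z)) z"
proof -
  have "((\<lambda>z. of_real s * z) has_derivative (\<lambda>h. of_real s * h)) (at z)" by (auto intro!: derivative_eq_intros)
  from has_derivative_compose[OF this assms[unfolded wirt_def]]
  have "((\<lambda>z. f (of_real s * z)) has_derivative (\<lambda>h. a (of_real s * z) * (of_real s * h) + b (of_real s * z) * cnj (of_real s * h))) (at z)" .
  from has_derivative_mult_right[OF this, of C] show ?thesis
    unfolding wirt_def by (rule has_derivative_eq_rhs) (auto simp: algebra_simps)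
qed

lemma wirt_reflect:
  assumes "\<And>z. wirt f (a z) (b z) z"
  shows "wirt (\<lambda>\<zeta>. f (z - \<zeta>)) (- a (z - \<zeta>)) (- b (z - \<zeta>)) \<zeta>"
proof -
  have "((\<lambda>\<zeta>. z - \<zeta>) has_derivative (\<lambda>h. - h)) (at \<zeta>)" by (auto intro!: derivative_eq_intros)
  from has_derivative_compose[OF this assms[unfolded wirt_def]] show ?thesis
    unfolding wirt_def by (rule has_derivative_eq_rhs) auto
qed

text \<open>The condition \<open>\<rho> z = of_real (norm (\<rho> z))\<close> says that \<rho> is
  real and nonnegative. The second derivatives \<open>aa\<close>, \<open>ab\<close>,
  \<open>bb\<close> are carried along because \<open>weakd_norm_eq\<close> tests with first
  derivatives of mollified functions.\<close>

definition mollifier ::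
  "real \<Rightarrow> (complex \<Rightarrow> complex) \<Rightarrow> (complex \<Rightarrow> complex) \<Rightarrow> (complex \<Rightarrow> complex) \<Rightarrow>
   (complex \<Rightarrow> complex) \<Rightarrow> (complex \<Rightarrow> complex) \<Rightarrow> (complex \<Rightarrow> complex) \<Rightarrow> bool" where
  "mollifier e \<rho> a b aa ab bb \<longleftrightarrow> tf UNIV \<rho> a b \<and> tf UNIV a aa ab \<and> tf UNIV b ab bb \<and>
     (\<forall>z. norm z > e \<longrightarrow> \<rho> z = 0) \<and> (\<forall>z. \<rho> z = of_real (norm (\<rho> z))) \<and>
     (\<forall>z. \<rho> (- z) = \<rho> z) \<and> (LINT z|lborel. norm (\<rho> z)) = 1"

lemma mollifier_exists:
  assumes "e > 0"
  obtains \<rho> a b aa ab bb where "mollifier e \<rho> a b aa ab bb"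
proof -
  define s where "s = 1 / e"
  have s: "s > 0" using assms by (simp add: s_def)
  have out: "norm (of_real s * z) > 1" if "norm z > e" for z :: complex
    using that assms by (simp add: s_def norm_mult norm_divide field_simps)
  have z0: "bump (of_real s * z) = 0" "bump1 (of_real s * z) = 0" "bump2 (of_real s * z) = 0" if "norm z > e" for z
  proof -
    have "(norm (of_real s * z))\<^sup>2 \<ge> 1" using out[OF that] by (simp add: one_le_power)
    then show "bump (of_real s * z) = 0" "bump1 (of_real s * z) = 0" "bump2 (of_real s * z) = 0"
      by (auto simp: bump_def bump1_def bump2_def max_def)
  qed
  have cb: "continuous_on A bump" "continuous_on A bump1" "continuous_on A bump2" for A
    unfolding bump_def bump1_def bump2_def by (intro continuous_intros)+
  define I where "I = (LINT z|lborel. norm (bump (of_real s * z)))"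
  have ib: "integrable lborel (\<lambda>z. bump (of_real s * z))"
    by (rule integrable_compact_support[of _ "cball 0 e"])
      (use z0 in \<open>auto intro!: continuous_intros continuous_on_compose2[OF cb(1)[of UNIV]]\<close>)
  have "I > 0"
  proof -
    have "I \<noteq> 0"
    proof
      assume "I = 0"
      then have "AE z in lborel. norm (bump (of_real s * z)) = 0"
        using ib unfolding I_def by (subst (asm) integral_nonneg_eq_0_iff_AE) auto
      then have "AE z in lborel. z \<notin> ball (0::complex) e"
      proof eventually_elim
        case (elim z)
        show ?case
        proof
          assume "z \<in> ball (0::complex) e"
          then have "norm (of_real s * z) < 1" using assms by (simp add: s_def norm_mult norm_divide field_simps)
          then have "(norm (of_real s * z))\<^sup>2 < 1" by (simp add: power_less_one_iff)
          then show False using elim by (auto simp: bump_def simp flip: of_real_power)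
        qed
      qed
      then have "ball (0::complex) e \<in> null_sets lborel" by (subst AE_iff_null_sets) auto
      then have "negligible (ball (0::complex) e)" by (simp add: negligible_iff_null_sets null_sets_completionI)
      then have "ball (0::complex) e = {}" using open_not_negligible by blast
      then show False using assms by simp
    qed
    moreover have "I \<ge> 0" unfolding I_def by simp
    ultimately show ?thesis by simp
  qed
  define c where "c = complex_of_real (1 / I)"
  have wb: "wirt bump (bump1 z * cnj z) (bump1 z * z) z" for z by (rule wirt_bump)
  have w1: "wirt (\<lambda>z. bump1 z * cnj z) (bump2 z * cnj z * cnj z + bump1 z * 0) (bump2 z * z * cnj z + bump1 z * 1) z" for z
    using wirt_mult[OF wirt_bump1[of z] wirt_cnj[OF wirt_holomorphic[OF DERIV_ident[of "at z"]]]] by simp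
  have w2: "wirt (\<lambda>z. bump1 z * z) (bump2 z * z * cnj z + bump1 z * 1) (bump2 z * z * z + bump1 z * 0) z" for z
    using wirt_mult[OF wirt_bump1[of z] wirt_holomorphic[OF DERIV_ident[of "at z"]]] by (simp add: mult_ac)
  define \<rho> where "\<rho> = (\<lambda>z. c * bump (of_real s * z))"
  define a where "a = (\<lambda>z. c * s * (bump1 (of_real s * z) * cnj (of_real s * z)))"
  define b where "b = (\<lambda>z. c * s * (bump1 (of_real s * z) * (of_real s * z)))"
  define aa where "aa = (\<lambda>z. c * s * s * (bump2 (of_real s * z) * cnj (of_real s * z) * cnj (of_real s * z) + bump1 (of_real s * z) * 0))"
  define ab where "ab = (\<lambda>z. c * s * s * (bump2 (of_real s * z) * (of_real s * z) * cnj (of_real s * z) + bump1 (of_real s * z) * 1))"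
  define bb where "bb = (\<lambda>z. c * s * s * (bump2 (of_real s * z) * (of_real s * z) * (of_real s * z) + bump1 (of_real s * z) * 0))"
  note defs = \<rho>_def a_def b_def aa_def ab_def bb_def
  have co: "continuous_on UNIV a" "continuous_on UNIV b" "continuous_on UNIV aa" "continuous_on UNIV ab" "continuous_on UNIV bb"
    unfolding defs by (intro continuous_intros continuous_on_compose2[OF cb(2)[of UNIV]] continuous_on_compose2[OF cb(3)[of UNIV]]; simp)+
  have K: "\<exists>K. compact K \<and> K \<subseteq> UNIV \<and> (\<forall>z. z \<notin> K \<longrightarrow> f z = 0)" if "\<And>z. norm z > e \<Longrightarrow> f z = 0" for f :: "complex \<Rightarrow> complex"
    by (rule exI[of _ "cball 0 e"]) (use that in auto)
  have 1: "tf UNIV \<rho> a b" unfolding tf_def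
    by (intro conjI co allI K) (use wirt_rescale[OF wb, of c s] in \<open>auto simp: defs z0\<close>)
  have 2: "tf UNIV a aa ab" unfolding tf_def
    by (intro conjI co allI K) (use wirt_rescale[OF w1, of "c * s" s] in \<open>auto simp: defs z0\<close>)
  have 3: "tf UNIV b ab bb" unfolding tf_def
    by (intro conjI co allI K) (use wirt_rescale[OF w2, of "c * s" s] in \<open>auto simp: defs z0\<close>)
  have nb: "bump z = of_real (norm (bump z))" for z by (simp add: bump_def norm_power)
  have n\<rho>: "norm (\<rho> z) = 1 / I * norm (bump (of_real s * z))" for z
    using \<open>I > 0\<close> by (simp add: defs c_def norm_mult norm_divide)
  have "mollifier e \<rho> a b aa ab bb" unfolding mollifier_def
  proof (intro conjI 1 2 3 allI impI)
    show "\<rho> z = 0" if "norm z > e" for z using z0[OF that] by (simp add: defs)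
    show "\<rho> z = of_real (norm (\<rho> z))" for z
      unfolding n\<rho> using nb[of "of_real s * z"] by (simp add: defs c_def)
    show "\<rho> (-z) = \<rho> z" for z by (simp add: defs bump_def norm_mult)
    show "(LINT z|lborel. norm (\<rho> z)) = 1"
      using \<open>I > 0\<close> ib unfolding n\<rho> by (simp flip: I_def)
  qed
  then show thesis by (rule that)
qed

section \<open>Convolution with a compactly supported kernel\<close>

definition conv :: "(complex \<Rightarrow> complex) \<Rightarrow> (complex \<Rightarrow> complex) \<Rightarrow> complex \<Rightarrow> complex" where
  "conv u k z = (LINT \<zeta>|lborel. u \<zeta> * k (z - \<zeta>))"

lemma conv_integrable:
  fixes u k :: "complex \<Rightarrow> complex"
  assumes "integrable lborel u" "continuous_on UNIV k" "compact K" "\<And>z. z \<notin> K \<Longrightarrow> k z = 0"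
  shows "integrable lborel (\<lambda>\<zeta>. u \<zeta> * k (z - \<zeta>))"
proof -
  obtain C where C: "\<And>z. norm (k z) \<le> C" using continuous_compact_support_bounded[OF assms(2,3), of thesis] assms(4) by blast
  have [measurable]: "k \<in> borel_measurable borel" using assms(2) by (rule borel_measurable_continuous_onI)
  have [measurable]: "u \<in> borel_measurable borel" using assms(1) by auto
  show ?thesis
  proof (rule Bochner_Integration.integrable_bound)
    show "integrable lborel (\<lambda>\<zeta>. of_real C * u \<zeta>)" using assms(1) by auto
    show "AE \<zeta> in lborel. norm (u \<zeta> * k (z - \<zeta>)) \<le> norm (of_real C * u \<zeta>)"
    proof (rule AE_I2)
      fix \<zeta> 
      have "norm (u \<zeta> * k (z - \<zeta>)) \<le> norm (u \<zeta>) * \<bar>C\<bar>"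
        unfolding norm_mult by (intro mult_left_mono order_trans[OF C]) auto
      then show "norm (u \<zeta> * k (z - \<zeta>)) \<le> norm (of_real C * u \<zeta>)" by (simp add: norm_mult mult.commute)
    qed
  qed measurable
qed

lemma conv_continuous:
  assumes "integrable lborel u" "continuous_on UNIV k" "compact K" "\<And>z. z \<notin> K \<Longrightarrow> k z = 0"
  shows "continuous_on UNIV (conv u k)"
proof -
  obtain C where C: "\<And>z. norm (k z) \<le> C" using continuous_compact_support_bounded[OF assms(2,3), of thesis] assms(4) by blast
  have [measurable]: "k \<in> borel_measurable borel" using assms(2) by (rule borel_measurable_continuous_onI)
  have [measurable]: "u \<in> borel_measurable borel" using assms(1) by auto
  have "(\<lambda>n. conv u k (x n)) \<longlonglongrightarrow> conv u k z" if x: "x \<longlonglongrightarrow> z" for x z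
    unfolding conv_def
  proof (rule integral_dominated_convergence)
    show "integrable lborel (\<lambda>\<zeta>. norm (u \<zeta>) * C)" using assms(1) by auto
    show "AE \<zeta> in lborel. (\<lambda>i. u \<zeta> * k (x i - \<zeta>)) \<longlonglongrightarrow> u \<zeta> * k (z - \<zeta>)"
    proof (rule AE_I2, intro tendsto_mult tendsto_const)
      fix \<zeta>
      have "isCont k (z - \<zeta>)" using assms(2) by (simp add: continuous_on_eq_continuous_at)
      then show "(\<lambda>i. k (x i - \<zeta>)) \<longlonglongrightarrow> k (z - \<zeta>)"
        by (rule isCont_tendsto_compose) (use x in \<open>auto intro!: tendsto_intros\<close>)
    qed
    show "AE \<zeta> in lborel. norm (u \<zeta> * k (x i - \<zeta>)) \<le> norm (u \<zeta>) * C" for i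
      using C by (auto simp: norm_mult intro!: mult_left_mono)
  qed measurable
  then show ?thesis by (auto simp: continuous_on_sequentially o_def)
qed

text \<open>All derivatives fall on the smooth factor \<open>k\<close>, and
  \<open>uniform_differentiability\<close> makes the remainder uniform in the variable of
  integration.\<close>

lemma conv_wirt:
  assumes "integrable lborel u" "tf U k a b"
  shows "wirt (conv u k) (conv u a z) (conv u b z) z"
proof -
  obtain K where K: "compact K" "\<And>z. z \<notin> K \<Longrightarrow> k z = 0" "\<And>z. z \<notin> K \<Longrightarrow> a z = 0" "\<And>z. z \<notin> K \<Longrightarrow> b z = 0"
    using tf_support[OF assms(2)] by metis
  note ck = tf_continuous[OF assms(2)]
  note ik = conv_integrable[OF assms(1) ck(1) K(1,2)] and ia = conv_integrable[OF assms(1) ck(2) K(1,3)]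
    and ib = conv_integrable[OF assms(1) ck(3) K(1,4)]
  define N where "N = (LINT \<zeta>|lborel. norm (u \<zeta>))"
  have N: "N \<ge> 0" by (simp add: N_def)
  have key: "norm (conv u k (z + h) - conv u k z - (conv u a z * h + conv u b z * cnj h)) \<le> e * N * norm h"
    if "\<And>z. norm (k (z + h) - k z - (a z * h + b z * cnj h)) \<le> e * norm h" for e h
  proof -
    have eq: "conv u k (z + h) - conv u k z - (conv u a z * h + conv u b z * cnj h) =
      (LINT \<zeta>|lborel. u \<zeta> * k (z + h - \<zeta>) - u \<zeta> * k (z - \<zeta>) - (u \<zeta> * a (z - \<zeta>) * h + u \<zeta> * b (z - \<zeta>) * cnj h))"
      unfolding conv_def using ik[of z] ik[of "z + h"] ia[of z] ib[of z] by simp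
    have "norm (conv u k (z + h) - conv u k z - (conv u a z * h + conv u b z * cnj h)) \<le> (LINT \<zeta>|lborel. norm (u \<zeta>) * (e * norm h))"
      unfolding eq
    proof (rule Bochner_Integration.integral_norm_bound_integral)
      fix \<zeta>
      have "u \<zeta> * k (z + h - \<zeta>) - u \<zeta> * k (z - \<zeta>) - (u \<zeta> * a (z - \<zeta>) * h + u \<zeta> * b (z - \<zeta>) * cnj h) =
        u \<zeta> * (k ((z - \<zeta>) + h) - k (z - \<zeta>) - (a (z - \<zeta>) * h + b (z - \<zeta>) * cnj h))"
        by (simp add: algebra_simps)
      then show "norm (u \<zeta> * k (z + h - \<zeta>) - u \<zeta> * k (z - \<zeta>) - (u \<zeta> * a (z - \<zeta>) * h + u \<zeta> * b (z - \<zeta>) * cnj h))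
        \<le> norm (u \<zeta>) * (e * norm h)" using that by (simp add: norm_mult mult_left_mono)
    qed (use ik[of z] ik[of "z + h"] ia[of z] ib[of z] assms(1) in auto)
    also have "\<dots> = N * (e * norm h)" unfolding N_def by (rule integral_mult_left_zero)
    also have "\<dots> = e * N * norm h" by (simp only: mult_ac)
    finally show ?thesis .
  qed
  show ?thesis unfolding wirt_def has_derivative_at_alt
  proof (intro conjI allI impI)
    show "bounded_linear (\<lambda>h. conv u a z * h + conv u b z * cnj h)"
      by (intro bounded_linear_add bounded_linear_const_mult bounded_linear_ident bounded_linear_cnj)
    fix e :: real assume "e > 0"
    then have e': "e / (N + 1) > 0" using N by simp
    obtain \<delta> where \<delta>: "\<delta> > 0" "\<And>z h. norm h < \<delta> \<Longrightarrow> norm (k (z + h) - k z - (a z * h + b z * cnj h)) \<le> e / (N + 1) * norm h"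
      using uniform_differentiability[OF ck(2,3) _ K(1,3,4) e', of k] assms(2) unfolding tf_def by blast
    show "\<exists>d>0. \<forall>y. norm (y - z) < d \<longrightarrow> norm (conv u k y - conv u k z - (conv u a z * (y - z) + conv u b z * cnj (y - z))) \<le> e * norm (y - z)"
    proof (intro exI[of _ \<delta>] conjI \<delta>(1) allI impI)
      fix y assume "norm (y - z) < \<delta>"
      from key[OF \<delta>(2)[OF this]]
      have "norm (conv u k y - conv u k z - (conv u a z * (y - z) + conv u b z * cnj (y - z))) \<le> e / (N + 1) * N * norm (y - z)"
        by simp
      also have "\<dots> \<le> e * norm (y - z)" using \<open>e > 0\<close> N by (intro mult_right_mono) (auto simp: field_simps)
      finally show "norm (conv u k y - conv u k z - (conv u a z * (y - z) + conv u b z * cnj (y - z))) \<le> e * norm (y - z)" .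
    qed
  qed
qed

lemma conv_eq_zero:
  assumes "\<And>z. z \<notin> K \<Longrightarrow> u z = 0" "\<And>z. z \<notin> L \<Longrightarrow> k z = 0" "z \<notin> {x + y | x y. x \<in> K \<and> y \<in> L}"
  shows "conv u k z = 0"
proof -
  have 0: "u \<zeta> * k (z - \<zeta>) = 0" for \<zeta>
  proof (rule ccontr)
    assume "\<not> ?thesis"
    then have "\<zeta> \<in> K" "z - \<zeta> \<in> L" using assms(1,2) by auto
    moreover have "z = \<zeta> + (z - \<zeta>)" by simp
    ultimately show False using assms(3) by blast
  qed
  show ?thesis unfolding conv_def 0 by simp
qed

lemma tf_conv:
  assumes "integrable lborel u" "compact K" "\<And>z. z \<notin> K \<Longrightarrow> u z = 0" "tf U k a b"
  shows "tf UNIV (conv u k) (conv u a) (conv u b)"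
proof -
  obtain L where L: "compact L" "\<And>z. z \<notin> L \<Longrightarrow> k z = 0" "\<And>z. z \<notin> L \<Longrightarrow> a z = 0" "\<And>z. z \<notin> L \<Longrightarrow> b z = 0"
    using tf_support[OF assms(4)] by metis
  note ck = tf_continuous[OF assms(4)]
  show ?thesis unfolding tf_def
  proof (intro conjI allI exI[of _ "{x + y | x y. x \<in> K \<and> y \<in> L}"] impI)
    show "compact {x + y | x y. x \<in> K \<and> y \<in> L}" using assms(2) L(1) by (rule compact_sums)
    show "conv u k z = 0" if "z \<notin> {x + y | x y. x \<in> K \<and> y \<in> L}" for z
      by (rule conv_eq_zero[OF assms(3) L(2) that])
  qed (use conv_wirt[OF assms(1,4)] conv_continuous[OF assms(1) ck(2) L(1,3)] conv_continuous[OF assms(1) ck(3) L(1,4)] in auto)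
qed

text \<open>Convolution turns weak derivatives into classical ones: test with \<open>k (z - _)\<close>.\<close>

lemma conv_weak:
  assumes "tf UNIV k a b"
    "\<And>\<phi> \<phi>a \<phi>b. tf UNIV \<phi> \<phi>a \<phi>b \<Longrightarrow> (LINT z|lborel. u z * \<phi>a z) = - (LINT z|lborel. p z * \<phi> z) \<and>
        (LINT z|lborel. u z * \<phi>b z) = - (LINT z|lborel. q z * \<phi> z)"
  shows "conv u a z = conv p k z" "conv u b z = conv q k z"
proof -
  obtain K where K: "compact K" "\<And>z. z \<notin> K \<Longrightarrow> k z = 0"
    using tf_support[OF assms(1)] by metis
  note ck = tf_continuous[OF assms(1)]
  have "tf UNIV (\<lambda>\<zeta>. k (z - \<zeta>)) (\<lambda>\<zeta>. - a (z - \<zeta>)) (\<lambda>\<zeta>. - b (z - \<zeta>))"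
    unfolding tf_def
  proof (intro conjI allI wirt_reflect exI[of _ "(\<lambda>w. z - w) ` K"] impI)
    show "compact ((\<lambda>w. z - w) ` K)" using K by (intro compact_continuous_image continuous_intros)
    show "k (z - \<zeta>) = 0" if "\<zeta> \<notin> (\<lambda>w. z - w) ` K" for \<zeta>
    proof -
      have "z - \<zeta> \<notin> K" using that by (metis diff_diff_eq2 add_diff_cancel_left' image_eqI)
      then show ?thesis using K by simp
    qed
  qed (use assms(1) in \<open>auto simp: tf_def intro!: continuous_intros continuous_on_compose2[OF ck(2)] continuous_on_compose2[OF ck(3)]\<close>)
  from assms(2)[OF this] show "conv u a z = conv p k z" "conv u b z = conv q k z"
    by (simp_all add: conv_def)
qed

lemma mollifierD:
  assumes "mollifier e \<rho> a b aa ab bb"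
  shows "tf UNIV \<rho> a b" "tf UNIV a aa ab" "tf UNIV b ab bb" "norm z > e \<Longrightarrow> \<rho> z = 0" "\<rho> z = of_real (norm (\<rho> z))"
    "\<rho> (- z) = \<rho> z" "(LINT z|lborel. norm (\<rho> z)) = 1"
    "integrable lborel (\<lambda>\<zeta>. norm (\<rho> (z - \<zeta>)))" "(LINT \<zeta>|lborel. norm (\<rho> (z - \<zeta>))) = 1"
    "integrable lborel (\<lambda>\<zeta>. \<rho> (z - \<zeta>))" "(LINT \<zeta>|lborel. \<rho> (z - \<zeta>)) = 1"
proof -
  show t: "tf UNIV \<rho> a b" "tf UNIV a aa ab" "tf UNIV b ab bb" "norm z > e \<Longrightarrow> \<rho> z = 0" "\<rho> z = of_real (norm (\<rho> z))"
    "\<rho> (- z) = \<rho> z" "(LINT z|lborel. norm (\<rho> z)) = 1" for z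
    using assms unfolding mollifier_def by blast+
  have i: "integrable lborel (\<lambda>\<zeta>. norm (\<rho> \<zeta>))" using tf_integrable[OF t(1)] by auto
  \<comment> \<open>Evenness turns the reflected kernel into a translate, to which translation
    invariance applies.\<close>
  have r: "\<rho> (z - \<zeta>) = \<rho> (\<zeta> + - z)" for \<zeta> using t(6)[of "z - \<zeta>"] by simp
  show i2: "integrable lborel (\<lambda>\<zeta>. norm (\<rho> (z - \<zeta>)))" 
    unfolding r by (rule lborel_translation_complex(2)[OF i])
  show e2: "(LINT \<zeta>|lborel. norm (\<rho> (z - \<zeta>))) = 1"
    unfolding r using lborel_translation_complex(1)[of "\<lambda>\<zeta>. norm (\<rho> \<zeta>)" "- z"] t(7) by simp
  show "integrable lborel (\<lambda>\<zeta>. \<rho> (z - \<zeta>))" 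
    unfolding r by (rule lborel_translation_complex(2)[OF tf_integrable(1)[OF t(1)]])
  have "(LINT \<zeta>|lborel. \<rho> (z - \<zeta>)) = (LINT \<zeta>|lborel. complex_of_real (norm (\<rho> (z - \<zeta>))))"
    using t(5) by metis
  also have "\<dots> = of_real (LINT \<zeta>|lborel. norm (\<rho> (z - \<zeta>)))" by (rule integral_complex_of_real)
  finally show "(LINT \<zeta>|lborel. \<rho> (z - \<zeta>)) = 1" using e2 by simp
qed

lemma conv_measurable:
  assumes [measurable]: "u \<in> borel_measurable borel" "k \<in> borel_measurable borel"
  shows "conv u k \<in> borel_measurable borel"
  unfolding conv_def[abs_def] by measurable

text \<open>Young's inequality for a kernel of mass 1: Cauchy-Schwarz for |u| \<rho>^(1/2) against
  \<rho>^(1/2) at each point, then Tonelli.\<close>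

lemma conv_L2:
  assumes m: "mollifier e \<rho> a b aa ab bb" and u: "L2 u"
  shows "L2 (conv u \<rho>)" "nL2 (conv u \<rho>) \<le> nL2 u"
proof -
  have [measurable]: "u \<in> borel_measurable borel" using u by (simp add: L2_def)
  have [measurable]: "\<rho> \<in> borel_measurable borel"
    using tf_continuous(1)[OF mollifierD(1)[OF m]] by (rule borel_measurable_continuous_onI)
  note [measurable] = conv_measurable[of u \<rho>]
  have n1: "(\<integral>\<^sup>+\<zeta>. ennreal (norm (\<rho> (z - \<zeta>))) \<partial>lborel) = 1" for z
    using mollifierD(8,9)[OF m] by (simp add: nn_integral_eq_integral)
  have n2: "(\<integral>\<^sup>+z. ennreal (norm (\<rho> (z - \<zeta>))) \<partial>lborel) = 1" for \<zeta>
  proof -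
    have "\<rho> (z - \<zeta>) = \<rho> (\<zeta> - z)" for z using mollifierD(6)[OF m, of "z - \<zeta>"] by simp
    then show ?thesis using n1[of \<zeta>] by simp
  qed
  have pt: "ennreal ((norm (conv u \<rho> z))\<^sup>2) \<le> (\<integral>\<^sup>+\<zeta>. ennreal ((norm (u \<zeta>))\<^sup>2 * norm (\<rho> (z - \<zeta>))) \<partial>lborel)" for z
  proof -
    have "ennreal (norm (conv u \<rho> z)) \<le> (\<integral>\<^sup>+\<zeta>. ennreal (norm (u \<zeta> * \<rho> (z - \<zeta>))) \<partial>lborel)"
      unfolding conv_def
      by (cases "integrable lborel (\<lambda>\<zeta>. u \<zeta> * \<rho> (z - \<zeta>))")
        (auto simp: not_integrable_integral_eq intro: integral_norm_bound_ennreal)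
    also have "\<dots> = (\<integral>\<^sup>+\<zeta>. ennreal (norm (u \<zeta>) * sqrt (norm (\<rho> (z - \<zeta>)))) * ennreal (sqrt (norm (\<rho> (z - \<zeta>)))) \<partial>lborel)"
      by (intro nn_integral_cong) (simp add: norm_mult flip: ennreal_mult')
    finally have "(ennreal (norm (conv u \<rho> z)))\<^sup>2 \<le> \<dots>\<^sup>2" by (intro power_mono) auto
    also have "\<dots> \<le> (\<integral>\<^sup>+\<zeta>. (ennreal (norm (u \<zeta>) * sqrt (norm (\<rho> (z - \<zeta>)))))\<^sup>2 \<partial>lborel) *
        (\<integral>\<^sup>+\<zeta>. (ennreal (sqrt (norm (\<rho> (z - \<zeta>)))))\<^sup>2 \<partial>lborel)"
      by (rule Cauchy_Schwarz_nn_integral) measurable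
    also have "\<dots> = (\<integral>\<^sup>+\<zeta>. ennreal ((norm (u \<zeta>))\<^sup>2 * norm (\<rho> (z - \<zeta>))) \<partial>lborel)"
      using n1[of z] by (simp add: ennreal_power power_mult_distrib)
    finally show ?thesis by (simp add: ennreal_power)
  qed
  have "(\<integral>\<^sup>+z. ennreal ((norm (conv u \<rho> z))\<^sup>2) \<partial>lborel) \<le>
     (\<integral>\<^sup>+z. (\<integral>\<^sup>+\<zeta>. ennreal ((norm (u \<zeta>))\<^sup>2 * norm (\<rho> (z - \<zeta>))) \<partial>lborel) \<partial>lborel)"
    by (rule nn_integral_mono) (rule pt)
  also have "\<dots> = (\<integral>\<^sup>+\<zeta>. (\<integral>\<^sup>+z. ennreal ((norm (u \<zeta>))\<^sup>2 * norm (\<rho> (z - \<zeta>))) \<partial>lborel) \<partial>lborel)"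
    by (rule lborel_pair.Fubini') measurable
  also have "\<dots> = (\<integral>\<^sup>+\<zeta>. ennreal ((norm (u \<zeta>))\<^sup>2) * (\<integral>\<^sup>+z. ennreal (norm (\<rho> (z - \<zeta>))) \<partial>lborel) \<partial>lborel)"
    by (intro nn_integral_cong) (simp add: ennreal_mult' nn_integral_cmult)
  also have "\<dots> = ennreal (LINT \<zeta>|lborel. (norm (u \<zeta>))\<^sup>2)"
    using u by (simp add: n2 L2_def nn_integral_eq_integral)
  finally have le: "(\<integral>\<^sup>+z. ennreal ((norm (conv u \<rho> z))\<^sup>2) \<partial>lborel) \<le> ennreal ((nL2 u)\<^sup>2)"
    by (simp add: nL2_power2)
  then have i: "integrable lborel (\<lambda>z. (norm (conv u \<rho> z))\<^sup>2)"
    by (intro integrableI_bounded) (auto simp: le_less_trans)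
  then show "L2 (conv u \<rho>)" by (simp add: L2_def)
  have "ennreal ((nL2 (conv u \<rho>))\<^sup>2) = (\<integral>\<^sup>+z. ennreal ((norm (conv u \<rho> z))\<^sup>2) \<partial>lborel)"
    using i by (simp add: nL2_power2 nn_integral_eq_integral)
  then have "ennreal ((nL2 (conv u \<rho>))\<^sup>2) \<le> ennreal ((nL2 u)\<^sup>2)" using le by (simp only:)
  then have "(nL2 (conv u \<rho>))\<^sup>2 \<le> (nL2 u)\<^sup>2" by simp
  then show "nL2 (conv u \<rho>) \<le> nL2 u" by (rule power2_le_imp_le) simp
qed

section \<open>Convergence of mollifications in L2\<close>

lemma L2_tendsto_zero:
  assumes "L2 p" "\<And>n. f n \<in> borel_measurable borel" "\<And>n z. norm (f n z) \<le> norm (p z)"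
    "AE z in lborel. (\<lambda>n. f n z) \<longlonglongrightarrow> 0"
  shows "(\<lambda>n. nL2 (f n)) \<longlonglongrightarrow> 0"
proof -
  have "(\<lambda>n. LINT z|lborel. (norm (f n z))\<^sup>2) \<longlonglongrightarrow> (LINT (z::complex)|lborel. 0)"
  proof (rule integral_dominated_convergence)
    show "integrable lborel (\<lambda>z. (norm (p z))\<^sup>2)" using assms(1) by (simp add: L2_def)
    show "AE z in lborel. (\<lambda>i. (norm (f i z))\<^sup>2) \<longlonglongrightarrow> 0"
      using assms(4)
    proof eventually_elim
      case (elim z)
      from tendsto_power[OF tendsto_norm[OF elim], of 2] show ?case by simp
    qed
    show "AE x in lborel. norm ((norm (f i x))\<^sup>2) \<le> (norm (p x))\<^sup>2" for i
      using assms(3) by (auto intro!: power_mono)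
  qed (use assms(2) in measurable)
  then have "(\<lambda>n. sqrt (LINT z|lborel. (norm (f n z))\<^sup>2)) \<longlonglongrightarrow> sqrt 0"
    by (intro tendsto_real_sqrt) simp
  then show ?thesis by (simp add: nL2_def)
qed

definition clamp_norm :: "real \<Rightarrow> complex \<Rightarrow> complex" where
  "clamp_norm N z = z / of_real (max 1 (norm z / N))"

lemma clamp_norm_le: assumes "N > 0" shows "norm (clamp_norm N z) \<le> N"
  using assms by (auto simp: clamp_norm_def norm_divide max_def field_simps)

lemma clamp_norm_le': "norm (clamp_norm N z) \<le> norm z"
  by (auto simp: clamp_norm_def norm_divide max_def field_simps mult_le_cancel_left1)

lemma clamp_norm_eq: "N > 0 \<Longrightarrow> norm z \<le> N \<Longrightarrow> clamp_norm N z = z"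
  by (auto simp: clamp_norm_def max_def field_simps)

lemma continuous_clamp_norm: "N > 0 \<Longrightarrow> continuous_on S (clamp_norm N)"
  unfolding clamp_norm_def by (intro continuous_intros) (auto simp: max_def)

definition radial_cutoff :: "real \<Rightarrow> complex \<Rightarrow> complex" where
  "radial_cutoff N z = of_real (max 0 (min 1 (N + 1 - norm z)))"

lemma radial_cutoff: "norm z \<le> N \<Longrightarrow> radial_cutoff N z = 1" "norm z \<ge> N + 1 \<Longrightarrow> radial_cutoff N z = 0"
  "norm (radial_cutoff N z) \<le> 1" "continuous_on S (radial_cutoff N)"
     apply (auto simp: radial_cutoff_def max_def min_def)[3]
  unfolding radial_cutoff_def by (intro continuous_intros)

text \<open>Truncation in value and in space makes \<open>p\<close> bounded with compact support.
  The continuous functions that converge to \<open>p\<close> almost everywhere, from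
  \<open>measurable_on\<close>, are truncated in the same way, so that dominated convergence applies
  to both approximations.\<close>

lemma L2_dense:
  assumes p: "L2 p" and "\<delta> > 0"
  obtains f K where "continuous_on UNIV f" "compact K" "\<And>z. z \<notin> K \<Longrightarrow> f z = 0" "nL2 (\<lambda>z. p z - f z) < \<delta>"
proof -
  have [measurable]: "p \<in> borel_measurable borel" using p by (simp add: L2_def)
  define P where "P = (\<lambda>N z. clamp_norm (real (Suc N)) (p z) * radial_cutoff (real (Suc N)) z)"
  have mc [measurable]: "clamp_norm (real (Suc N)) \<in> borel_measurable borel" "radial_cutoff N' \<in> borel_measurable borel" for N N'
    by (auto intro!: borel_measurable_continuous_onI continuous_clamp_norm radial_cutoff)
  have Pm [measurable]: "P N \<in> borel_measurable borel" for N unfolding P_def by measurable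
  have Pp: "norm (P N z) \<le> norm (p z)" for N z
  proof -
    have "norm (P N z) \<le> norm (p z) * 1" unfolding P_def norm_mult
      by (rule mult_mono) (use clamp_norm_le' radial_cutoff in auto)
    then show ?thesis by simp
  qed
  \<comment> \<open>The factor 1/2 turns the bound |p - P N| \<le> 2 |p| into domination by
    \<open>p\<close> itself, as \<open>L2_tendsto_zero\<close> demands.\<close>
  have "(\<lambda>N. nL2 (\<lambda>z. (1/2) * (p z - P N z))) \<longlonglongrightarrow> 0"
  proof (rule L2_tendsto_zero[OF p])
    show "norm ((1/2) * (p z - P N z)) \<le> norm (p z)" for N z
      using Pp[of N z] norm_triangle_ineq4[of "p z" "P N z"] by (simp add: norm_mult)
    show "AE z in lborel. (\<lambda>n. (1/2) * (p z - P n z)) \<longlonglongrightarrow> 0"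
    proof (rule AE_I2)
      fix z
      obtain N0 :: nat where N0: "norm (p z) \<le> N0" "norm z \<le> N0"
        by (metis real_arch_simple max.cobounded1 max.cobounded2 order_trans)
      have "eventually (\<lambda>n. (1/2) * (p z - P n z) = 0) sequentially"
        using eventually_ge_at_top[of N0]
      proof eventually_elim
        case (elim n)
        then have "norm (p z) \<le> real (Suc n)" "norm z \<le> real (Suc n)" using N0 by linarith+
        then have "P n z = p z" by (simp add: P_def clamp_norm_eq radial_cutoff del: of_nat_Suc)
        then show ?case by simp
      qed
      then show "(\<lambda>n. (1/2) * (p z - P n z)) \<longlonglongrightarrow> 0" by (simp add: tendsto_eventually)
    qed
  qed measurable
  then obtain N where "nL2 (\<lambda>z. (1/2) * (p z - P N z)) < \<delta>/4"
    using order_tendstoD(2)[of _ 0 sequentially "\<delta>/4"] \<open>\<delta> > 0\<close> eventually_happens'[OF sequentially_bot] by fastforce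
  then have N: "nL2 (\<lambda>z. p z - P N z) < \<delta>/2"
    using L2_cmult(2)[OF L2_diff(1)[OF p L2_bound[OF p Pm[of N], of 1]], of "1/2"] Pp by simp
  define R where "R = real (Suc N)"
  have R: "R > 0" by (simp add: R_def)
  have "p \<in> borel_measurable (lebesgue_on UNIV)"
    by (intro measurable_restrict_space1 measurable_completion) simp
  then have "p measurable_on UNIV" by (subst measurable_on_iff_borel_measurable) auto
  then obtain Z g where g: "negligible Z" "\<And>n. continuous_on UNIV (g n)" "\<And>x. x \<notin> Z \<Longrightarrow> (\<lambda>n. g n x) \<longlonglongrightarrow> p x"
    unfolding measurable_on_def by auto
  define a where "a = (\<lambda>n z. clamp_norm R (g n z) * radial_cutoff R z)"
  have ca: "continuous_on UNIV (a n)" for n unfolding a_def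
    by (intro continuous_intros radial_cutoff continuous_on_compose2[OF continuous_clamp_norm[OF R, of UNIV] g(2)]) auto
  have sa: "a n z = 0" if "z \<notin> cball 0 (R + 1)" for n z using that by (simp add: a_def radial_cutoff)
  have b: "norm (clamp_norm R y * radial_cutoff R z) \<le> R * norm (radial_cutoff R z)" for y z
    unfolding norm_mult by (intro mult_right_mono clamp_norm_le R) auto
  have cr: "L2 (\<lambda>z. of_real (2 * R) * radial_cutoff R z)"
    by (rule L2_continuous_compact_support[of _ "cball 0 (R + 1)"]) (auto intro!: continuous_intros radial_cutoff)
  have "(\<lambda>n. nL2 (\<lambda>z. P N z - a n z)) \<longlonglongrightarrow> 0"
  proof (rule L2_tendsto_zero[OF cr])
    show "(\<lambda>z. P N z - a n z) \<in> borel_measurable borel" for n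
      using borel_measurable_continuous_onI[OF ca[of n]] by measurable
    show "norm (P N z - a n z) \<le> norm (of_real (2 * R) * radial_cutoff R z)" for n z
      using norm_triangle_ineq4[of "P N z" "a n z"] b[of "p z" z] b[of "g n z" z] R
      unfolding P_def a_def R_def[symmetric] norm_mult by simp
    have "AE z in lebesgue. z \<notin> Z" using g(1) by (simp add: negligible_iff_null_sets AE_not_in)
    then have "AE z in lborel. z \<notin> Z" by (simp add: AE_completion_iff)
    then show "AE z in lborel. (\<lambda>n. P N z - a n z) \<longlonglongrightarrow> 0"
    proof eventually_elim
      case (elim z)
      have "isCont (clamp_norm R) (p z)" using continuous_clamp_norm[OF R, of UNIV] by (simp add: continuous_on_eq_continuous_at)
      from isCont_tendsto_compose[OF this g(3)[OF elim]]
      have "(\<lambda>n. a n z) \<longlonglongrightarrow> P N z" unfolding a_def P_def R_def[symmetric] by (intro tendsto_intros)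
      from tendsto_diff[OF tendsto_const[of "P N z"] this] show ?case by simp
    qed
  qed
  then obtain n where n: "nL2 (\<lambda>z. P N z - a n z) < \<delta>/2"
    using order_tendstoD(2)[of _ 0 sequentially "\<delta>/2"] \<open>\<delta> > 0\<close> eventually_happens'[OF sequentially_bot] by fastforce
  have L: "L2 (\<lambda>z. p z - P N z)" "L2 (\<lambda>z. P N z - a n z)"
  proof -
    have LP: "L2 (P N)" using L2_bound[OF p Pm[of N], of 1] Pp by simp
    have La: "L2 (a n)" by (rule L2_continuous_compact_support[OF ca compact_cball sa])
    show "L2 (\<lambda>z. p z - P N z)" "L2 (\<lambda>z. P N z - a n z)" by (intro L2_diff(1) p LP La)+
  qed
  have "nL2 (\<lambda>z. p z - a n z) < \<delta>" using L2_add(2)[OF L] N n by simp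
  then show thesis using that[OF ca compact_cball sa] by blast
qed

lemma mollify_uniform:
  assumes m: "mollifier e \<rho> a b aa ab bb" and f: "f \<in> borel_measurable borel" "\<And>\<zeta>. \<zeta> \<in> cball z e \<Longrightarrow> norm (f \<zeta> - f z) \<le> \<delta>"
    and i: "integrable lborel f"
  shows "norm (conv f \<rho> z - f z) \<le> \<delta>"
proof -
  have m\<rho>: "\<rho> \<in> borel_measurable borel"
    using tf_continuous(1)[OF mollifierD(1)[OF m]] by (rule borel_measurable_continuous_onI)
  obtain K where K: "compact K" "\<And>z. z \<notin> K \<Longrightarrow> \<rho> z = 0"
    using tf_support[OF mollifierD(1)[OF m]] by metis
  have i1: "integrable lborel (\<lambda>\<zeta>. f \<zeta> * \<rho> (z - \<zeta>))"
    by (rule conv_integrable[OF i tf_continuous(1)[OF mollifierD(1)[OF m]] K])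
  have eq: "conv f \<rho> z - f z = (LINT \<zeta>|lborel. f \<zeta> * \<rho> (z - \<zeta>) - f z * \<rho> (z - \<zeta>))"
    using i1 mollifierD(10,11)[OF m, of z] by (simp add: conv_def)
  have "norm (conv f \<rho> z - f z) \<le> (LINT \<zeta>|lborel. \<delta> * norm (\<rho> (z - \<zeta>)))"
    unfolding eq
  proof (rule Bochner_Integration.integral_norm_bound_integral)
    fix \<zeta>
    show "norm (f \<zeta> * \<rho> (z - \<zeta>) - f z * \<rho> (z - \<zeta>)) \<le> \<delta> * norm (\<rho> (z - \<zeta>))"
    proof (cases "norm (z - \<zeta>) > e")
      case True then show ?thesis using mollifierD(4)[OF m] by simp
    next
      case False
      then have "norm (f \<zeta> - f z) \<le> \<delta>" by (intro f(2)) (auto simp: dist_norm)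
      then show ?thesis by (simp add: norm_mult mult_right_mono flip: left_diff_distrib)
    qed
  qed (use i1 mollifierD(8,10)[OF m, of z] in auto)
  also have "\<dots> = \<delta>" using mollifierD(9)[OF m, of z] by simp
  finally show ?thesis .
qed

lemma mollify_uniform_compact_support:
  assumes f: "continuous_on UNIV f" "compact K" "\<And>z. z \<notin> K \<Longrightarrow> f z = 0" and "\<delta> > 0"
  obtains e0 where "e0 > 0" "\<And>e \<rho> a b aa ab bb z. mollifier e \<rho> a b aa ab bb \<Longrightarrow> e \<le> e0 \<Longrightarrow> norm (conv f \<rho> z - f z) \<le> \<delta>"
proof -
  obtain d where d: "d > 0" "\<And>x x'. dist x' x < d \<Longrightarrow> dist (f x') (f x) < \<delta>"
    using uniformly_continuous_compact_support[OF f(1,2)] f(3) \<open>\<delta> > 0\<close> unfolding uniformly_continuous_on_def by (metis UNIV_I)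
  show thesis
  proof (rule that[of "d/2"])
    fix e \<rho> a b aa ab bb z assume m: "mollifier e \<rho> a b aa ab bb" "e \<le> d/2"
    show "norm (conv f \<rho> z - f z) \<le> \<delta>"
    proof (rule mollify_uniform[OF m(1) borel_measurable_continuous_onI[OF f(1)]])
      fix \<zeta> assume "\<zeta> \<in> cball z e"
      then have "dist \<zeta> z < d" using m(2) d(1) by (simp add: dist_commute)
      then show "norm (f \<zeta> - f z) \<le> \<delta>" using d(2)[of \<zeta> z] by (simp add: dist_norm)
    qed (rule integrable_compact_support[OF f(1-3)])
  qed (use d in auto)
qed

text \<open>The usual splitping into three errors: \<open>conv_L2\<close> bounds the mollification
  of p - f by the norm of p - f for every \<open>e\<close>, and for the continuous \<open>f\<close>
  the convergence is uniform on a fixed ball.\<close>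

lemma mollify_L2:
  assumes p: "L2 p" and "\<delta> > 0"
  obtains e0 where "e0 > 0" "\<And>e \<rho> a b aa ab bb. mollifier e \<rho> a b aa ab bb \<Longrightarrow> e \<le> e0 \<Longrightarrow> nL2 (\<lambda>z. conv p \<rho> z - p z) \<le> \<delta>"
proof -
  obtain f K where f: "continuous_on UNIV f" "compact K" "\<And>z. z \<notin> K \<Longrightarrow> f z = 0" "nL2 (\<lambda>z. p z - f z) < \<delta>/3"
    using L2_dense[OF p, of "\<delta>/3"] \<open>\<delta> > 0\<close> by auto
  have Lf: "L2 f" by (rule L2_continuous_compact_support[OF f(1-3)])
  obtain R where R: "R > 0" "K \<subseteq> cball 0 R" 
    using compact_imp_bounded[OF f(2)] unfolding bounded_pos by (auto simp: subset_iff)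
  \<comment> \<open>For e \<le> 1 both \<open>f\<close> and its mollification live in the ball of
    radius R + 1, so that a uniform error \<eta> costs at most \<eta> M in L2.\<close>
  define M where "M = nL2 (indicator (cball 0 (R + 1)))"
  have Li: "L2 (indicator (cball 0 (R + 1)))"
    by (rule L2_compact_support[of _ 1 "cball 0 (R+1)"])
      (use borel_closed in \<open>auto split: split_indicator intro!: borel_measurable_indicator\<close>)
  have "M \<ge> 0" by (simp add: M_def)
  define \<eta> where "\<eta> = \<delta> / (3 * (M + 1))"
  have \<eta>: "\<eta> > 0" "\<eta> * M \<le> \<delta>/3" using \<open>\<delta> > 0\<close> \<open>M \<ge> 0\<close> by (auto simp: \<eta>_def field_simps)
  obtain e0 where e0: "e0 > 0" "\<And>e \<rho> a b aa ab bb z. mollifier e \<rho> a b aa ab bb \<Longrightarrow> e \<le> e0 \<Longrightarrow> norm (conv f \<rho> z - f z) \<le> \<eta>"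
    using mollify_uniform_compact_support[OF f(1,2) _ \<eta>(1)] f(3) by metis
  show thesis
  proof (rule that[of "min e0 1"])
    fix e \<rho> a b aa ab bb assume m: "mollifier e \<rho> a b aa ab bb" "e \<le> min e0 1"
    have m\<rho>: "\<rho> \<in> borel_measurable borel"
      using tf_continuous(1)[OF mollifierD(1)[OF m(1)]] by (rule borel_measurable_continuous_onI)
    have Lpf: "L2 (\<lambda>z. p z - f z)" by (rule L2_diff[OF p Lf])
    have L\<rho>: "L2 (\<lambda>\<zeta>. \<rho> (z - \<zeta>))" for z
    proof -
      have "L2 (\<lambda>\<zeta>. \<rho> (\<zeta> + - z))"
        using tf_L2(1)[OF mollifierD(1)[OF m(1)]] lborel_translation_complex(2)[of "\<lambda>z. (norm (\<rho> z))\<^sup>2" "-z"] m\<rho>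
        unfolding L2_def by auto
      moreover have "\<rho> (\<zeta> + - z) = \<rho> (z - \<zeta>)" for \<zeta> using mollifierD(6)[OF m(1), of "z - \<zeta>"] by simp
      ultimately show ?thesis by simp
    qed
    have lin: "conv p \<rho> z - p z = (conv (\<lambda>z. p z - f z) \<rho> z + (conv f \<rho> z - f z)) - (p z - f z)" for z
      using L2_mult_integrable[OF p L\<rho>] L2_mult_integrable[OF Lf L\<rho>]
      by (simp add: conv_def left_diff_distrib)
    have sup: "conv f \<rho> z - f z = 0" if "z \<notin> cball 0 (R+1)" for z
    proof -
      have f0: "f x = 0" if "x \<notin> cball 0 R" for x using that R by (intro f(3)) auto
      have "conv f \<rho> z = 0"
      proof (rule conv_eq_zero[of "cball 0 R" f "cball 0 1"])
        show "z \<notin> {x + y |x y. x \<in> cball 0 R \<and> y \<in> cball 0 1}"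
          using that norm_triangle_ineq by (fastforce simp: intro: order_trans)
      qed (use f0 m mollifierD(4)[OF m(1)] in auto)
      moreover have "f z = 0" using that R by (intro f(3)) auto
      ultimately show ?thesis by simp
    qed
    have bd: "norm (conv f \<rho> z - f z) \<le> \<eta> * norm (indicator (cball 0 (R+1)) z :: complex)" for z
      using e0(2)[OF m(1), of z] m(2) sup[of z] by (cases "z \<in> cball 0 (R+1)") auto
    have mcf: "(\<lambda>z. conv f \<rho> z - f z) \<in> borel_measurable borel"
      using conv_measurable[OF L2_meas[OF Lf] m\<rho>] L2_meas[OF Lf] by measurable
    have L1: "L2 (\<lambda>z. conv f \<rho> z - f z)" by (rule L2_bound[OF Li mcf bd])
    have n1: "nL2 (\<lambda>z. conv f \<rho> z - f z) \<le> \<eta> * M"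
      unfolding M_def by (rule nL2_bound[OF Li mcf]) (use bd \<eta> in auto)
    have n2: "nL2 (conv (\<lambda>z. p z - f z) \<rho>) \<le> nL2 (\<lambda>z. p z - f z)" by (rule conv_L2(2)[OF m(1) Lpf])
    have "nL2 (\<lambda>z. conv p \<rho> z - p z) \<le> nL2 (\<lambda>z. conv (\<lambda>z. p z - f z) \<rho> z + (conv f \<rho> z - f z)) + nL2 (\<lambda>z. p z - f z)"
      unfolding lin by (rule L2_diff(2)[OF L2_add(1)[OF conv_L2(1)[OF m(1) Lpf] L1] Lpf])
    also have "\<dots> \<le> (nL2 (conv (\<lambda>z. p z - f z) \<rho>) + nL2 (\<lambda>z. conv f \<rho> z - f z)) + nL2 (\<lambda>z. p z - f z)"
      by (intro add_right_mono L2_add(2)[OF conv_L2(1)[OF m(1) Lpf] L1])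
    also have "\<dots> \<le> \<delta>" using n1 n2 f(4) \<eta> by linarith
    finally show "nL2 (\<lambda>z. conv p \<rho> z - p z) \<le> \<delta>" .
  qed (use e0 in auto)
qed

section \<open>Weak derivatives\<close>

text \<open>Unlike \<open>locally_L2\<close>, this asks for a Borel function on the whole plane:
  convolutions and Fubini then take place in \<open>lborel\<close>, without completions.\<close>

definition locL2 :: "complex set \<Rightarrow> (complex \<Rightarrow> complex) \<Rightarrow> bool" where
  "locL2 U p \<longleftrightarrow> p \<in> borel_measurable borel \<and>
     (\<forall>K. compact K \<and> K \<subseteq> U \<longrightarrow> L2 (\<lambda>z. indicator K z * p z))"

text \<open>Only the values of \<open>f\<close>, \<open>p\<close> and \<open>q\<close> on \<open>U\<close> matter.\<close>

definition weakd :: "complex set \<Rightarrow> (complex \<Rightarrow> complex) \<Rightarrow> (complex \<Rightarrow> complex) \<Rightarrow> (complex \<Rightarrow> complex) \<Rightarrow> bool" where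
  "weakd U f p q \<longleftrightarrow> open U \<and> continuous_on U f \<and> locL2 U p \<and> locL2 U q \<and>
     (\<forall>\<phi> a b. tf U \<phi> a b \<longrightarrow>
        (LINT z|lborel. f z * a z) = - (LINT z|lborel. p z * \<phi> z) \<and>
        (LINT z|lborel. f z * b z) = - (LINT z|lborel. q z * \<phi> z))"

text \<open>The isometry property of the Beurling transform. The mixed second derivative of the
  mollified function is both the conjugate-derivative of its z-derivative and the z-derivative of
  its conjugate-derivative. Testing \<open>u\<close> against its complex conjugate therefore gives
  the pairing of \<open>p\<close> with its mollification and also that of \<open>q\<close>.\<close>

lemma weakd_norm_eq:
  assumes w: "weakd UNIV u p q" and K: "compact K" "\<And>z. z \<notin> K \<Longrightarrow> u z = 0" "L2 p" "L2 q"
  shows "nL2 p = nL2 q"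
proof -
  have cu: "continuous_on UNIV u" using w by (simp add: weakd_def)
  have iu: "integrable lborel u" by (rule integrable_compact_support[OF cu K(1,2)])
  have wk: "(LINT z|lborel. u z * a z) = - (LINT z|lborel. p z * \<phi> z) \<and>
        (LINT z|lborel. u z * b z) = - (LINT z|lborel. q z * \<phi> z)" if "tf UNIV \<phi> a b" for \<phi> a b
    using w that by (simp add: weakd_def)
  have eq: "(LINT z|lborel. p z * cnj (conv p \<rho> z)) = (LINT z|lborel. q z * cnj (conv q \<rho> z))"
    if m: "mollifier e \<rho> a b aa ab bb" for e \<rho> a b aa ab bb
  proof -
    have "tf UNIV (conv u a) (conv u aa) (conv u ab)" by (rule tf_conv[OF iu K(1,2) mollifierD(2)[OF m]])
    from wk[OF tf_cnj[OF this]] have 1: "(LINT z|lborel. u z * cnj (conv u ab z)) = - (LINT z|lborel. p z * cnj (conv u a z))" by simp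
    have "tf UNIV (conv u b) (conv u ab) (conv u bb)" by (rule tf_conv[OF iu K(1,2) mollifierD(3)[OF m]])
    from wk[OF tf_cnj[OF this]] have 2: "(LINT z|lborel. u z * cnj (conv u ab z)) = - (LINT z|lborel. q z * cnj (conv u b z))" by simp
    have "conv u a z = conv p \<rho> z" "conv u b z = conv q \<rho> z" for z
      using conv_weak[OF mollifierD(1)[OF m] wk] by auto
    then show ?thesis using 1 2 by simp
  qed
  \<comment> \<open>As the mollifiers shrink, the two sides of \<open>eq\<close> tend to the squared
    norms of \<open>p\<close> and of \<open>q\<close>.\<close>
  have near: "\<exists>e0>0. \<forall>e \<rho> a b aa ab bb. mollifier e \<rho> a b aa ab bb \<longrightarrow> e \<le> e0 \<longrightarrow>
      norm ((LINT z|lborel. p z * cnj (conv p \<rho> z)) - of_real ((nL2 p)\<^sup>2)) \<le> \<delta>" if p: "L2 p" and "\<delta> > 0" for p \<delta>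
  proof -
    have "\<delta> / (nL2 p + 1) > 0" using that by (simp add: add_nonneg_pos)
    then obtain e0 where e0: "e0 > 0" "\<And>e \<rho> a b aa ab bb. mollifier e \<rho> a b aa ab bb \<Longrightarrow> e \<le> e0 \<Longrightarrow> nL2 (\<lambda>z. conv p \<rho> z - p z) \<le> \<delta> / (nL2 p + 1)"
      using mollify_L2[OF p] by blast
    show ?thesis
    proof (intro exI[of _ e0] conjI e0(1) allI impI)
      fix e \<rho> a b aa ab bb assume m: "mollifier e \<rho> a b aa ab bb" "e \<le> e0"
      have cn: "L2 (\<lambda>z. cnj (f z))" "nL2 (\<lambda>z. cnj (f z)) = nL2 f" if "L2 f" for f
        using that by (auto simp: L2_def nL2_def intro!: borel_measurable_continuous_on[of cnj] continuous_intros)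
      note Lc = conv_L2(1)[OF m(1) p]
      have "of_real ((nL2 p)\<^sup>2) = (LINT z|lborel. complex_of_real ((norm (p z))\<^sup>2))"
        unfolding nL2_power2 by (rule integral_complex_of_real[symmetric])
      also have "\<dots> = (LINT z|lborel. p z * cnj (p z))"
        by (simp only: complex_norm_square)
      finally have e1: "of_real ((nL2 p)\<^sup>2) = (LINT z|lborel. p z * cnj (p z))" .
      have "(LINT z|lborel. p z * cnj (conv p \<rho> z)) - of_real ((nL2 p)\<^sup>2) = (LINT z|lborel. p z * cnj (conv p \<rho> z) - p z * cnj (p z))"
        unfolding e1 using L2_mult_integrable[OF p cn(1)[OF Lc]] L2_mult_integrable[OF p cn(1)[OF p]] by simp
      also have "\<dots> = (LINT z|lborel. p z * cnj (conv p \<rho> z - p z))" by (simp add: right_diff_distrib)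
      finally have "norm ((LINT z|lborel. p z * cnj (conv p \<rho> z)) - of_real ((nL2 p)\<^sup>2)) \<le> nL2 p * nL2 (\<lambda>z. conv p \<rho> z - p z)"
        using L2_Cauchy_Schwarz[OF p cn(1)[OF L2_diff(1)[OF Lc p]]] cn(2)[OF L2_diff(1)[OF Lc p]] by simp
      also have "\<dots> \<le> nL2 p * (\<delta> / (nL2 p + 1))" by (intro mult_left_mono e0(2)[OF m]) auto
      also have "\<dots> \<le> \<delta>" using that nL2_nonneg[of p] by (simp add: pos_divide_le_eq add_pos_nonneg add_nonneg_pos algebra_simps)
      finally show "norm ((LINT z|lborel. p z * cnj (conv p \<rho> z)) - of_real ((nL2 p)\<^sup>2)) \<le> \<delta>" .
    qed
  qed
  have "\<bar>(nL2 p)\<^sup>2 - (nL2 q)\<^sup>2\<bar> \<le> 0"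
  proof (rule field_le_epsilon)
    fix \<delta> :: real assume "\<delta> > 0"
    then have "\<delta>/2 > 0" by simp
    obtain e1 where e1: "e1 > 0" "\<And>e \<rho> a b aa ab bb. mollifier e \<rho> a b aa ab bb \<Longrightarrow> e \<le> e1 \<Longrightarrow>
      norm ((LINT z|lborel. p z * cnj (conv p \<rho> z)) - of_real ((nL2 p)\<^sup>2)) \<le> \<delta>/2"
      using near[OF K(3) \<open>\<delta>/2 > 0\<close>] by blast
    obtain e2 where e2: "e2 > 0" "\<And>e \<rho> a b aa ab bb. mollifier e \<rho> a b aa ab bb \<Longrightarrow> e \<le> e2 \<Longrightarrow>
      norm ((LINT z|lborel. q z * cnj (conv q \<rho> z)) - of_real ((nL2 q)\<^sup>2)) \<le> \<delta>/2"
      using near[OF K(4) \<open>\<delta>/2 > 0\<close>] by blast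
    have "min e1 e2 > 0" using e1 e2 by simp
    then obtain \<rho> a b aa ab bb where m: "mollifier (min e1 e2) \<rho> a b aa ab bb" using mollifier_exists by metis
    define I where "I = (LINT z|lborel. p z * cnj (conv p \<rho> z))"
    have 1: "norm (I - of_real ((nL2 p)\<^sup>2)) \<le> \<delta>/2" using e1(2)[OF m] by (simp add: I_def)
    have 2: "norm (I - of_real ((nL2 q)\<^sup>2)) \<le> \<delta>/2" using e2(2)[OF m] eq[OF m] by (simp add: I_def)
    have "\<bar>(nL2 p)\<^sup>2 - (nL2 q)\<^sup>2\<bar> = norm (complex_of_real ((nL2 p)\<^sup>2 - (nL2 q)\<^sup>2))" by (simp only: norm_of_real)
    also have "\<dots> = norm ((I - of_real ((nL2 q)\<^sup>2)) - (I - of_real ((nL2 p)\<^sup>2)))" by simp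
    also have "\<dots> \<le> \<delta>/2 + \<delta>/2" by (rule order_trans[OF norm_triangle_ineq4 add_mono[OF 2 1]])
    finally show "\<bar>(nL2 p)\<^sup>2 - (nL2 q)\<^sup>2\<bar> \<le> 0 + \<delta>" by simp
  qed
  then show ?thesis by (simp add: power2_eq_iff_nonneg)
qed

lemma L2_indicator: "L2 g \<Longrightarrow> S \<in> sets borel \<Longrightarrow> L2 (\<lambda>z. indicator S z * g z)"
proof (rule L2_bound[of g _ 1])
  assume "L2 g" and [measurable]: "S \<in> sets borel"
  then have [measurable]: "g \<in> borel_measurable borel" by (simp add: L2_def)
  show "(\<lambda>z. indicator S z * g z) \<in> borel_measurable borel" by measurable
qed (auto split: split_indicator)

lemma locL2I: "L2 g \<Longrightarrow> locL2 U g"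
  unfolding locL2_def by (auto intro!: L2_indicator simp: borel_compact L2_meas)

lemma locL2_integrable:
  assumes "locL2 U p" "tf U \<phi> a b"
  shows "integrable lborel (\<lambda>z. p z * \<phi> z)"
proof -
  obtain K where K: "compact K" "K \<subseteq> U" "\<And>z. z \<notin> K \<Longrightarrow> \<phi> z = 0" using assms(2) unfolding tf_def by auto
  have "integrable lborel (\<lambda>z. (indicator K z * p z) * \<phi> z)"
    by (rule L2_mult_integrable[OF _ tf_L2(1)[OF assms(2)]]) (use assms(1) K in \<open>auto simp: locL2_def\<close>)
  moreover have "(\<lambda>z. (indicator K z * p z) * \<phi> z) = (\<lambda>z. p z * \<phi> z)"
    using K(3) by (auto simp: fun_eq_iff split: split_indicator)
  ultimately show ?thesis by simp
qed

lemma tf_times_continuous: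
  assumes "tf U \<phi> a b" "open U" "continuous_on U f"
  shows "continuous_on UNIV (\<lambda>z. f z * \<phi> z)" "continuous_on UNIV (\<lambda>z. f z * a z)" "continuous_on UNIV (\<lambda>z. f z * b z)"
    "L2 (\<lambda>z. f z * \<phi> z)" "L2 (\<lambda>z. f z * a z)" "L2 (\<lambda>z. f z * b z)"
    "integrable lborel (\<lambda>z. f z * \<phi> z)" "integrable lborel (\<lambda>z. f z * a z)" "integrable lborel (\<lambda>z. f z * b z)"
proof -
  obtain K where K: "compact K" "K \<subseteq> U" "\<And>z. z \<notin> K \<Longrightarrow> \<phi> z = 0" "\<And>z. z \<notin> K \<Longrightarrow> a z = 0" "\<And>z. z \<notin> K \<Longrightarrow> b z = 0"
    using tf_support[OF assms(1)] by metis
  have *: "continuous_on UNIV (\<lambda>z. f z * g z) \<and> L2 (\<lambda>z. f z * g z) \<and> integrable lborel (\<lambda>z. f z * g z)"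
    if g: "continuous_on UNIV g" "\<And>z. z \<notin> K \<Longrightarrow> g z = 0" for g
  proof -
    have c: "continuous_on UNIV (\<lambda>z. f z * g z)"
      by (rule continuous_zero_extension[OF assms(2) _ K(1,2)])
        (use g assms(3) in \<open>auto intro!: continuous_intros intro: continuous_on_subset\<close>)
    have z: "\<And>z. z \<notin> K \<Longrightarrow> f z * g z = 0" using g(2) by simp
    show ?thesis using c L2_continuous_compact_support[OF c K(1) z] integrable_compact_support[OF c K(1) z] by simp
  qed
  note t = tf_continuous[OF assms(1)]
  show "continuous_on UNIV (\<lambda>z. f z * \<phi> z)" "continuous_on UNIV (\<lambda>z. f z * a z)" "continuous_on UNIV (\<lambda>z. f z * b z)"
    "L2 (\<lambda>z. f z * \<phi> z)" "L2 (\<lambda>z. f z * a z)" "L2 (\<lambda>z. f z * b z)"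
    "integrable lborel (\<lambda>z. f z * \<phi> z)" "integrable lborel (\<lambda>z. f z * a z)" "integrable lborel (\<lambda>z. f z * b z)"
    using *[OF t(1) K(3)] *[OF t(2) K(4)] *[OF t(3) K(5)] by auto
qed

section \<open>Rules for weak derivatives\<close>

lemma locL2_diff:
  assumes "locL2 U p" "locL2 U q" shows "locL2 U (\<lambda>z. p z - q z)"
  unfolding locL2_def
proof (intro conjI allI impI)
  show "(\<lambda>z. p z - q z) \<in> borel_measurable borel" using assms by (auto simp: locL2_def)
  fix K assume K: "compact K \<and> K \<subseteq> U"
  have "L2 (\<lambda>z. indicator K z * p z - indicator K z * q z)"
    using assms K by (intro L2_diff) (auto simp: locL2_def)
  then show "L2 (\<lambda>z. indicator K z * (p z - q z))" by (simp add: right_diff_distrib)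
qed

lemma weakd_diff:
  assumes "weakd U f p q" "weakd U g r s"
  shows "weakd U (\<lambda>z. f z - g z) (\<lambda>z. p z - r z) (\<lambda>z. q z - s z)"
  unfolding weakd_def
proof (intro conjI allI impI)
  note W = assms[unfolded weakd_def]
  show "locL2 U (\<lambda>z. p z - r z)" "locL2 U (\<lambda>z. q z - s z)" using W locL2_diff by auto
  fix \<phi> a b assume t: "tf U \<phi> a b"
  have o: "open U" "continuous_on U f" "continuous_on U g" "locL2 U p" "locL2 U q" "locL2 U r" "locL2 U s" using W by auto
  note i = tf_times_continuous(8,9)[OF t o(1)] and j = locL2_integrable[OF _ t]
  show "(LINT z|lborel. (f z - g z) * a z) = - (LINT z|lborel. (p z - r z) * \<phi> z)"
    "(LINT z|lborel. (f z - g z) * b z) = - (LINT z|lborel. (q z - s z) * \<phi> z)"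
    using W t i[OF o(2)] i[OF o(3)] j[OF o(4)] j[OF o(5)] j[OF o(6)] j[OF o(7)]
    by (simp_all add: left_diff_distrib)
qed (use assms in \<open>auto simp: weakd_def intro!: continuous_intros\<close>)

lemma weakd_cmult:
  assumes "weakd U f p q" shows "weakd U (\<lambda>z. c * f z) (\<lambda>z. c * p z) (\<lambda>z. c * q z)"
proof -
  have l: "locL2 U (\<lambda>z. c * p z)" if "locL2 U p" for p
    using that L2_cmult(1)[where c = c] unfolding locL2_def by (auto simp: mult.left_commute)
  show ?thesis using assms unfolding weakd_def
    by (auto intro!: continuous_intros l simp: mult.assoc)
qed

lemma weakd_subset:
  assumes "weakd U f p q" "open V" "V \<subseteq> U" shows "weakd V f p q"
proof -
  note W = assms(1)[unfolded weakd_def]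
  have l: "locL2 V g" if "locL2 U g" for g
    using that assms(3) unfolding locL2_def by (meson subset_trans)
  have c: "continuous_on V f" using W assms(3) continuous_on_subset by blast
  have t: "tf U \<phi> a b" if "tf V \<phi> a b" for \<phi> a b by (rule tf_mono[OF that assms(3)])
  show ?thesis unfolding weakd_def
  proof (intro conjI allI impI assms(2) c)
    show "locL2 V p" "locL2 V q" using W l by simp_all
    fix \<phi> a b assume "tf V \<phi> a b"
    then have "tf U \<phi> a b" by (rule t)
    then show "(LINT z|lborel. f z * a z) = - (LINT z|lborel. p z * \<phi> z)"
      "(LINT z|lborel. f z * b z) = - (LINT z|lborel. q z * \<phi> z)" using W by blast+
  qed
qed

lemma weakd_cnj:
  assumes "weakd U f p q" shows "weakd U (\<lambda>z. cnj (f z)) (\<lambda>z. cnj (q z)) (\<lambda>z. cnj (p z))"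
proof -
  have l: "locL2 U (\<lambda>z. cnj (p z))" if "locL2 U p" for p
    unfolding locL2_def
  proof (intro conjI allI impI)
    show m: "(\<lambda>z. cnj (p z)) \<in> borel_measurable borel"
      using that by (auto simp: locL2_def intro!: borel_measurable_continuous_on[of cnj] continuous_intros)
    fix K assume K: "compact K \<and> K \<subseteq> U"
    then have [measurable]: "K \<in> sets borel" using borel_compact by blast
    show "L2 (\<lambda>z. indicator K z * cnj (p z))"
    proof (rule L2_bound[of "\<lambda>z. indicator K z * p z" _ 1])
      show "L2 (\<lambda>z. indicator K z * p z)" using that K by (simp add: locL2_def)
      show "(\<lambda>z. indicator K z * cnj (p z)) \<in> borel_measurable borel" using m by measurable
    qed (auto split: split_indicator)
  qed
  have "(LINT z|lborel. cnj (f z) * a z) = - (LINT z|lborel. cnj (q z) * \<phi> z) \<and>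
        (LINT z|lborel. cnj (f z) * b z) = - (LINT z|lborel. cnj (p z) * \<phi> z)" if t: "tf U \<phi> a b" for \<phi> a b
  proof -
    have ci: "cnj (integral\<^sup>L lborel g) = (LINT z|lborel. cnj (g z))" for g by simp
    have "(LINT z|lborel. f z * cnj (b z)) = - (LINT z|lborel. p z * cnj (\<phi> z)) \<and>
        (LINT z|lborel. f z * cnj (a z)) = - (LINT z|lborel. q z * cnj (\<phi> z))"
      using assms tf_cnj[OF t] unfolding weakd_def by blast
    from this[THEN conjunct1, THEN arg_cong[of _ _ cnj]] this[THEN conjunct2, THEN arg_cong[of _ _ cnj]]
    show ?thesis unfolding complex_cnj_minus ci by simp
  qed
  then show ?thesis using assms unfolding weakd_def by (auto intro!: l continuous_intros)
qed

text \<open>Stokes for h \<phi>, in the form of \<open>tf_integral_zero\<close>. Since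
  \<open>deriv h\<close> is meaningful on \<open>U\<close> only, the indicator makes it a Borel
  function on the plane.\<close>

lemma weakd_holomorphic:
  assumes "open U" "h holomorphic_on U"
  shows "weakd U h (\<lambda>z. indicator U z * deriv h z) (\<lambda>z. 0)"
proof -
  have cd: "continuous_on U (deriv h)" using assms by (intro holomorphic_on_imp_continuous_on holomorphic_deriv)
  have w: "wirt h (deriv h z) 0 z" if "z \<in> U" for z
    using assms that by (intro wirt_holomorphic holomorphic_derivI)
  have m: "(\<lambda>z. indicator U z * deriv h z) \<in> borel_measurable borel"
  proof -
    have "(\<lambda>z. indicator U z * deriv h z) = (\<lambda>z. indicat_real U z *\<^sub>R deriv h z)"
      by (auto split: split_indicator)
    then show ?thesis using borel_measurable_continuous_on_indicator[of U "deriv h"] assms(1) cd by simp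
  qed
  have l: "locL2 U (\<lambda>z. indicator U z * deriv h z)"
    unfolding locL2_def
  proof (intro conjI m allI impI)
    fix K assume K: "compact K \<and> K \<subseteq> U"
    then have "bounded (deriv h ` K)"
      using cd by (intro compact_imp_bounded compact_continuous_image) (auto intro: continuous_on_subset)
    then obtain C where C: "C > 0" "\<And>z. z \<in> K \<Longrightarrow> norm (deriv h z) \<le> C" unfolding bounded_pos by auto
    have mK: "(\<lambda>z. indicator K z :: complex) \<in> borel_measurable borel" using K borel_compact by (auto intro: borel_measurable_indicator)
    show "L2 (\<lambda>z. indicator K z * (indicator U z * deriv h z))"
      by (rule L2_compact_support[of _ C K]) (use K C m mK in \<open>auto simp: norm_mult split: split_indicator\<close>)
  qed
  have l0: "locL2 U (\<lambda>z. 0)" by (rule locL2I) (simp add: L2_def)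
  show ?thesis unfolding weakd_def
  proof (intro conjI allI impI l l0 assms(1) holomorphic_on_imp_continuous_on[OF assms(2)])
    fix \<phi> a b assume t: "tf U \<phi> a b"
    obtain K where K: "K \<subseteq> U" "\<And>z. z \<notin> K \<Longrightarrow> \<phi> z = 0" using t unfolding tf_def by auto
    have ch: "continuous_on U h" by (rule holomorphic_on_imp_continuous_on[OF assms(2)])
    note m = tf_integral_zero[OF tf_mult[OF t assms(1) w cd continuous_on_const[of _ 0]]]
    have e: "indicator U z * deriv h z * \<phi> z = deriv h z * \<phi> z" for z using K by (auto split: split_indicator)
    show "(LINT z|lborel. h z * a z) = - (LINT z|lborel. indicator U z * deriv h z * \<phi> z)"
      using m(1) tf_times_continuous(8)[OF t assms(1) ch] tf_times_continuous(7)[OF t assms(1) cd]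
      unfolding e by (simp add: mult.commute add_eq_0_iff)
    show "(LINT z|lborel. h z * b z) = - (LINT z|lborel. 0 * \<phi> z)"
      using m(2) by (simp add: mult.commute)
  qed
qed

text \<open>The Leibniz rule. It produces functions with compact support and weak derivatives on the
  whole plane, as \<open>weakd_norm_eq\<close> requires.\<close>

lemma weakd_cutoff:
  assumes w: "weakd U f p q" and t: "tf U \<eta> ea eb"
  shows "weakd UNIV (\<lambda>z. f z * \<eta> z) (\<lambda>z. p z * \<eta> z + f z * ea z) (\<lambda>z. q z * \<eta> z + f z * eb z)"
    "L2 (\<lambda>z. p z * \<eta> z)" "L2 (\<lambda>z. q z * \<eta> z)"
    "L2 (\<lambda>z. p z * \<eta> z + f z * ea z)" "L2 (\<lambda>z. q z * \<eta> z + f z * eb z)"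
proof -
  note W = w[unfolded weakd_def]
  have o: "open U" "continuous_on U f" "locL2 U p" "locL2 U q" using W by auto
  obtain K where K: "compact K" "K \<subseteq> U" "\<And>z. z \<notin> K \<Longrightarrow> \<eta> z = 0" using t unfolding tf_def by auto
  obtain C where C: "\<And>z. norm (\<eta> z) \<le> C"
    using continuous_compact_support_bounded[OF tf_continuous(1)[OF t] K(1,3)] by blast
  note me = borel_measurable_continuous_onI[OF tf_continuous(1)[OF t]]
  have L: "L2 (\<lambda>z. p z * \<eta> z)" if "locL2 U p" for p
  proof (rule L2_bound)
    show "L2 (\<lambda>z. indicator K z * p z)" using that K by (auto simp: locL2_def)
    show "norm (p z * \<eta> z) \<le> C * norm (indicator K z * p z)" for z
      using K(3)[of z] C[of z] by (auto simp: norm_mult mult.commute[of "norm (p z)"] mult_right_mono split: split_indicator)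
  qed (use that me in \<open>auto simp: locL2_def\<close>)
  note tc = tf_times_continuous[OF t o(1,2)]
  show Lp: "L2 (\<lambda>z. p z * \<eta> z)" and Lq: "L2 (\<lambda>z. q z * \<eta> z)" using L o by auto
  show L1: "L2 (\<lambda>z. p z * \<eta> z + f z * ea z)" and L2: "L2 (\<lambda>z. q z * \<eta> z + f z * eb z)"
    using L2_add(1)[OF Lp tc(5)] L2_add(1)[OF Lq tc(6)] by auto
  show "weakd UNIV (\<lambda>z. f z * \<eta> z) (\<lambda>z. p z * \<eta> z + f z * ea z) (\<lambda>z. q z * \<eta> z + f z * eb z)"
    unfolding weakd_def
  proof (intro conjI allI impI open_UNIV tc(1) locL2I L1 L2)
    fix \<phi> a b assume s: "tf UNIV \<phi> a b"
    have te: "tf U (\<lambda>z. \<eta> z * \<phi> z) (\<lambda>z. ea z * \<phi> z + \<eta> z * a z) (\<lambda>z. eb z * \<phi> z + \<eta> z * b z)"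
      using tf_times[OF t s] by simp
    have "(LINT z|lborel. f z * (ea z * \<phi> z + \<eta> z * a z)) = - (LINT z|lborel. p z * (\<eta> z * \<phi> z))"
      "(LINT z|lborel. f z * (eb z * \<phi> z + \<eta> z * b z)) = - (LINT z|lborel. q z * (\<eta> z * \<phi> z))"
      using W te by blast+
    moreover have "integrable lborel (\<lambda>z. f z * ea z * \<phi> z)" "integrable lborel (\<lambda>z. f z * eb z * \<phi> z)"
      "integrable lborel (\<lambda>z. f z * \<eta> z * a z)" "integrable lborel (\<lambda>z. f z * \<eta> z * b z)"
      "integrable lborel (\<lambda>z. p z * \<eta> z * \<phi> z)" "integrable lborel (\<lambda>z. q z * \<eta> z * \<phi> z)"
      by (intro L2_mult_integrable tc Lp Lq tf_L2[OF s])+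
    ultimately show "(LINT z|lborel. f z * \<eta> z * a z) = - (LINT z|lborel. (p z * \<eta> z + f z * ea z) * \<phi> z)"
      "(LINT z|lborel. f z * \<eta> z * b z) = - (LINT z|lborel. (q z * \<eta> z + f z * eb z) * \<phi> z)"
      by (simp_all add: distrib_left distrib_right mult.assoc) (metis add_diff_cancel_left')+
  qed
qed

lemma mollifier_derivs_zero:
  assumes m: "mollifier e \<rho> a b aa ab bb" and "norm z > e"
  shows "a z = 0" "b z = 0"
proof -
  have "open {z::complex. norm z > e}" by (intro open_Collect_less continuous_intros)
  then have "wirt \<rho> 0 0 z"
    by (intro wirt_cong[OF wirt_const[of 0], of "{z. norm z > e}"]) (use assms mollifierD(4)[OF m] in auto)
  then show "a z = 0" "b z = 0"
    using wirt_unique mollifierD(1)[OF m] unfolding tf_def by blast+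
qed

lemma tf_reflect_mollifier:
  assumes m: "mollifier e \<rho> a b aa ab bb" and "cball z e \<subseteq> U"
  shows "tf U (\<lambda>\<zeta>. \<rho> (z - \<zeta>)) (\<lambda>\<zeta>. - a (z - \<zeta>)) (\<lambda>\<zeta>. - b (z - \<zeta>))"
  unfolding tf_def
proof (intro conjI allI wirt_reflect exI[of _ "cball z e"] impI)
  show "\<rho> (z - \<zeta>) = 0" if "\<zeta> \<notin> cball z e" for \<zeta> using that by (intro mollifierD(4)[OF m]) (auto simp: dist_norm)
  note ck = tf_continuous[OF mollifierD(1)[OF m]]
  show "continuous_on UNIV (\<lambda>\<zeta>. - a (z - \<zeta>))" "continuous_on UNIV (\<lambda>\<zeta>. - b (z - \<zeta>))"
    by (auto intro!: continuous_intros continuous_on_compose2[OF ck(2)] continuous_on_compose2[OF ck(3)])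
qed (use assms mollifierD(1)[OF m] in \<open>auto simp: tf_def\<close>)

lemma tf_cutoff_exists:
  assumes "compact K" "open U" "K \<subseteq> U"
  obtains \<eta> ea eb where "tf U \<eta> ea eb" "\<And>z. z \<in> K \<Longrightarrow> \<eta> z = 1" "\<And>z. z \<in> K \<Longrightarrow> ea z = 0" "\<And>z. z \<in> K \<Longrightarrow> eb z = 0"
proof -
  obtain d where d: "d > 0" "(\<Union>x\<in>K. ball x d) \<subseteq> U"
    using compact_subset_open_imp_ball_epsilon_subset[OF assms] by blast
  \<comment> \<open>The indicator of the 2\<delta>-neighbourhood of \<open>K\<close> is mollified at
    scale \<delta>. The result is 1 on the \<delta>-neighbourhood, so that its derivatives vanish on
    \<open>K\<close>, and it is supported in the 3\<delta>-neighbourhood, which lies in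
    \<open>U\<close>.\<close>
  define \<delta> where "\<delta> = d / 4"
  have \<delta>: "\<delta> > 0" using d by (simp add: \<delta>_def)
  define L where "L = {x + y | x y. x \<in> K \<and> y \<in> cball 0 (2 * \<delta>)}"
  have cL: "compact L" unfolding L_def using assms(1) by (intro compact_sums) auto
  define u where "u = (indicator L :: complex \<Rightarrow> complex)"
  have iu: "integrable lborel u" 
  proof -
    have "u = (\<lambda>z. indicator L z *\<^sub>R 1)" by (auto simp: u_def split: split_indicator)
    then show ?thesis using borel_integrable_compact[OF cL, of "\<lambda>z. 1 :: complex"] by simp
  qed
  have su: "\<And>z. z \<notin> L \<Longrightarrow> u z = 0" by (simp add: u_def)
  obtain \<rho> a b aa ab bb where m: "mollifier \<delta> \<rho> a b aa ab bb" using mollifier_exists \<delta> by metis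
  have t: "tf UNIV (conv u \<rho>) (conv u a) (conv u b)" by (rule tf_conv[OF iu cL su mollifierD(1)[OF m]])
  define S where "S = {x + y | x y. x \<in> L \<and> y \<in> cball 0 \<delta>}"
  have cS: "compact S" unfolding S_def using cL by (intro compact_sums) auto
  have SU: "S \<subseteq> U"
  proof
    fix z assume "z \<in> S"
    then obtain x y y' where z: "z = x + y + y'" "x \<in> K" "norm y \<le> 2 * \<delta>" "norm y' \<le> \<delta>"
      by (auto simp: S_def L_def)
    have "dist x z \<le> 3 * \<delta>" using z norm_triangle_ineq[of y' y] by (simp add: dist_norm norm_minus_commute)
    then have "z \<in> ball x d" using \<delta> by (simp add: \<delta>_def)
    then show "z \<in> U" using d(2) z(2) by blast
  qed
  have zS: "conv u \<rho> z = 0" if "z \<notin> S" for z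
    by (rule conv_eq_zero[OF su, where L = "cball 0 \<delta>"]) (use mollifierD(4)[OF m] that in \<open>auto simp: S_def\<close>)
  have t': "tf U (conv u \<rho>) (conv u a) (conv u b)"
    using t SU cS zS unfolding tf_def by blast
  have one: "conv u \<rho> z = 1" if "x \<in> K" "z \<in> ball x \<delta>" for x z
  proof -
    have eq: "u \<zeta> * \<rho> (z - \<zeta>) = \<rho> (z - \<zeta>)" for \<zeta>
    proof (cases "norm (z - \<zeta>) > \<delta>")
      case True then show ?thesis using mollifierD(4)[OF m] by simp
    next
      case False
      have "norm (\<zeta> - x) \<le> 2 * \<delta>" using False that(2) norm_triangle_ineq[of "\<zeta> - z" "z - x"]
        by (simp add: dist_norm norm_minus_commute)
      then have "\<zeta> = x + (\<zeta> - x) \<and> x \<in> K \<and> \<zeta> - x \<in> cball 0 (2 * \<delta>)" using that(1) by simp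
      then have "\<zeta> \<in> L" unfolding L_def by blast
      then show ?thesis by (simp add: u_def)
    qed
    show ?thesis unfolding conv_def eq by (rule mollifierD(11)[OF m])
  qed
  have "conv u a z = 0 \<and> conv u b z = 0" if "z \<in> K" for z
  proof -
    have "wirt (conv u \<rho>) 0 0 z"
      by (rule wirt_cong[OF wirt_const[of 1], of "ball z \<delta>"]) (use \<delta> one[OF that] in auto)
    then show ?thesis using t wirt_unique unfolding tf_def by blast
  qed
  then show thesis using that[OF t'] one \<delta> by force
qed

text \<open>Weyl's lemma: the mollifications have vanishing classical conjugate-derivative, hence
  are holomorphic, and they converge locally uniformly to the continuous function
  \<open>f\<close>.\<close>

lemma weakd_imp_holomorphic:
  assumes w: "weakd U f p q" and q0: "AE z in lborel. z \<in> V \<longrightarrow> q z = 0" and V: "open V" "V \<subseteq> U"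
  shows "f holomorphic_on V"
proof -
  note W = weakd_subset[OF w V, unfolded weakd_def]
  have "\<exists>r>0. f holomorphic_on ball z1 r" if z1: "z1 \<in> V" for z1
  proof -
    obtain s where s: "s > 0" "cball z1 s \<subseteq> V" using V(1)[unfolded open_contains_cball, rule_format, OF z1] by metis
    define r where "r = s / 2"
    have r: "r > 0" "cball z1 (2 * r) \<subseteq> V" using s by (auto simp: r_def)
    \<comment> \<open>Truncation makes \<open>f\<close> integrable. On the ball of radius
      \<open>r\<close>, mollifiers of radius below \<open>r\<close> see only points at which
      \<open>u\<close> and \<open>f\<close> agree.\<close>
    define u where "u = (\<lambda>z. indicator (cball z1 (2 * r)) z *\<^sub>R f z)"
    have cf: "continuous_on (cball z1 (2 * r)) f" using W r(2) by (auto intro: continuous_on_subset)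
    have iu: "integrable lborel u" unfolding u_def by (rule borel_integrable_compact[OF compact_cball cf])
    have hol: "conv u \<rho> holomorphic_on ball z1 r" if m: "mollifier e \<rho> a b aa ab bb" "e < r" for e \<rho> a b aa ab bb
    proof (rule holomorphic_onI)
      fix z assume z: "z \<in> ball z1 r"
      have sub: "cball z e \<subseteq> cball z1 (2 * r)"
      proof
        fix x assume "x \<in> cball z e"
        then show "x \<in> cball z1 (2 * r)" using z m(2) dist_triangle[of z1 x z] by simp
      qed
      have "tf V (\<lambda>\<zeta>. \<rho> (z - \<zeta>)) (\<lambda>\<zeta>. - a (z - \<zeta>)) (\<lambda>\<zeta>. - b (z - \<zeta>))"
        by (rule tf_reflect_mollifier[OF m(1)]) (use sub r in auto)
      then have 1: "(LINT \<zeta>|lborel. f \<zeta> * - b (z - \<zeta>)) = - (LINT \<zeta>|lborel. q \<zeta> * \<rho> (z - \<zeta>))"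
        using W by blast
      have "(LINT \<zeta>|lborel. q \<zeta> * \<rho> (z - \<zeta>)) = (LINT (\<zeta>::complex)|lborel. 0)"
      proof (rule integral_cong_AE)
        show "AE \<zeta> in lborel. q \<zeta> * \<rho> (z - \<zeta>) = 0"
          using q0
        proof eventually_elim
          case (elim \<zeta>)
          show ?case
          proof (cases "\<zeta> \<in> V")
            case False
            then have "\<zeta> \<notin> cball z e" using sub r by blast
            then show ?thesis using mollifierD(4)[OF m(1), of "z - \<zeta>"] by (simp add: dist_norm)
          qed (use elim in auto)
        qed
        show "(\<lambda>\<zeta>. q \<zeta> * \<rho> (z - \<zeta>)) \<in> borel_measurable lborel"
          using W borel_measurable_continuous_onI[OF tf_continuous(1)[OF mollifierD(1)[OF m(1)]]] by (auto simp: locL2_def)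
      qed auto
      with 1 have 2: "(LINT \<zeta>|lborel. f \<zeta> * - b (z - \<zeta>)) = 0" by simp
      have eq: "u \<zeta> * b (z - \<zeta>) = - (f \<zeta> * - b (z - \<zeta>))" for \<zeta>
      proof (cases "\<zeta> \<in> cball z e")
        case True then show ?thesis using sub by (auto simp: u_def)
      next
        case False then show ?thesis using mollifier_derivs_zero(2)[OF m(1), of "z - \<zeta>"] by (simp add: dist_norm)
      qed
      have "conv u b z = 0" unfolding conv_def eq integral_minus 2 by simp
      then have "wirt (conv u \<rho>) (conv u a z) 0 z" using conv_wirt[OF iu mollifierD(1)[OF m(1)], of z] by simp
      then have "(conv u \<rho> has_field_derivative conv u a z) (at z)"
        by (simp add: wirt_def has_field_derivative_def)
      then show "conv u \<rho> field_differentiable at z within ball z1 r"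
        using field_differentiable_def has_field_derivative_at_within by blast
    qed
    have "\<exists>\<rho>. \<exists>a b aa ab bb. mollifier (r / (real n + 2)) \<rho> a b aa ab bb" for n
      using mollifier_exists[of "r / (real n + 2)"] r(1) by (metis add_nonneg_pos divide_pos_pos of_nat_0_le_iff zero_less_numeral)
    then obtain R where R: "\<And>n. \<exists>a b aa ab bb. mollifier (r / (real n + 2)) (R n) a b aa ab bb" by metis
    have lt: "r / (real n + 2) < r" for n using r(1) by (auto simp: field_simps add_pos_nonneg)
    have ul: "uniform_limit (ball z1 r) (\<lambda>n. conv u (R n)) f sequentially"
      unfolding uniform_limit_iff
    proof (intro allI impI)
      fix \<epsilon> :: real assume "\<epsilon> > 0"
      obtain d where d: "d > 0" "\<And>x x'. x \<in> cball z1 (2 * r) \<Longrightarrow> x' \<in> cball z1 (2 * r) \<Longrightarrow> dist x' x < d \<Longrightarrow> dist (f x') (f x) < \<epsilon>/2"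
        using compact_uniformly_continuous[OF cf compact_cball] \<open>\<epsilon> > 0\<close> unfolding uniformly_continuous_on_def by (metis half_gt_zero)
      have "(\<lambda>n. r / (real n + 2)) \<longlonglongrightarrow> 0" by real_asymp
      then have "\<forall>\<^sub>F n in sequentially. r / (real n + 2) < d" using d(1) order_tendstoD(2) by blast
      then show "\<forall>\<^sub>F n in sequentially. \<forall>x\<in>ball z1 r. dist (conv u (R n) x) (f x) < \<epsilon>"
      proof eventually_elim
        case (elim n)
        show ?case
        proof
          fix z assume z: "z \<in> ball z1 r"
          obtain a b aa ab bb where m: "mollifier (r / (real n + 2)) (R n) a b aa ab bb" using R by blast
          have uz: "u z = f z" using z r(1) by (auto simp: u_def)
          have "norm (conv u (R n) z - u z) \<le> \<epsilon>/2"
          proof (rule mollify_uniform[OF m _ _ iu])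
            show "u \<in> borel_measurable borel" using iu by auto
            fix \<zeta> assume \<zeta>: "\<zeta> \<in> cball z (r / (real n + 2))"
            then have "\<zeta> \<in> cball z1 (2 * r)" using z lt[of n] dist_triangle[of z1 \<zeta> z] by simp
            moreover have "dist \<zeta> z < d" using \<zeta> elim by (simp add: dist_commute)
            ultimately have "dist (f \<zeta>) (f z) < \<epsilon>/2" using d(2)[of z \<zeta>] z r(1) by auto
            then show "norm (u \<zeta> - u z) \<le> \<epsilon>/2" using uz \<open>\<zeta> \<in> cball z1 (2 * r)\<close> by (simp add: dist_norm u_def)
          qed
          then show "dist (conv u (R n) z) (f z) < \<epsilon>" using uz \<open>\<epsilon> > 0\<close> by (simp add: dist_norm)
        qed
      qed
    qed
    have "f holomorphic_on ball z1 r"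
    proof (rule holomorphic_uniform_sequence[of _ "\<lambda>n. conv u (R n)"])
      show "conv u (R n) holomorphic_on ball z1 r" for n using R[of n] hol lt[of n] by blast
      show "\<exists>d>0. cball x d \<subseteq> ball z1 r \<and> uniform_limit (cball x d) (\<lambda>n. conv u (R n)) f sequentially"
        if x: "x \<in> ball z1 r" for x
      proof -
        obtain d where "d > 0" "cball x d \<subseteq> ball z1 r" using open_ball[of z1 r, unfolded open_contains_cball, rule_format, OF x] by metis
        then show ?thesis using uniform_limit_on_subset[OF ul] by blast
      qed
    qed auto
    then show ?thesis using r(1) by blast
  qed
  then show ?thesis
    unfolding holomorphic_on_def
  proof (intro ballI)
    fix z assume "z \<in> V"
    with \<open>\<And>z1. z1 \<in> V \<Longrightarrow> \<exists>r>0. f holomorphic_on ball z1 r\<close> obtain r where r: "r > 0" "f holomorphic_on ball z r" by blast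
    then show "f field_differentiable at z within V"
      using holomorphic_on_imp_differentiable_at[OF r(2) open_ball] by (simp add: field_differentiable_at_within)
  qed
qed

text \<open>The natural choice \<phi> / f^2 is not a test function, since \<open>f\<close> has only
  weak derivatives; \<phi> / v^2 with a mollification \<open>v\<close> of \<open>f\<close> is one.
  With A the integral of a / f and B that of p \<phi> / f^2, the limit reads A - 2 B = - B.\<close>

lemma weakd_inverse_aux:
  assumes w: "weakd U f p q" and nz: "\<And>z. z \<in> U \<Longrightarrow> f z \<noteq> 0" and t: "tf U \<phi> a b"
  shows "(LINT z|lborel. 1 / f z * a z) = (LINT z|lborel. p z / (f z)\<^sup>2 * \<phi> z)"
proof -
  note W = w[unfolded weakd_def]
  have o: "open U" "continuous_on U f" "locL2 U p" using W by auto
  obtain K where K: "compact K" "K \<subseteq> U" "\<And>z. z \<notin> K \<Longrightarrow> \<phi> z = 0" "\<And>z. z \<notin> K \<Longrightarrow> a z = 0" "\<And>z. z \<notin> K \<Longrightarrow> b z = 0"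
    using tf_support[OF t] by metis
  show ?thesis
  proof (cases "K = {}")
    case True then show ?thesis using K by simp
  next
    case False
    obtain \<eta> ea eb where \<eta>: "tf U \<eta> ea eb" "\<And>z. z \<in> K \<Longrightarrow> \<eta> z = 1" "\<And>z. z \<in> K \<Longrightarrow> ea z = 0"
      using tf_cutoff_exists[OF K(1) o(1) K(2)] by metis
    obtain L where L: "compact L" "\<And>z. z \<notin> L \<Longrightarrow> \<eta> z = 0" using \<eta>(1) unfolding tf_def by auto
    define u where "u = (\<lambda>z. f z * \<eta> z)"
    define P where "P = (\<lambda>z. p z * \<eta> z + f z * ea z)"
    note wc = weakd_cutoff[OF w \<eta>(1), folded u_def P_def]
    have cu: "continuous_on UNIV u" using wc(1) by (simp add: weakd_def)
    have su: "\<And>z. z \<notin> L \<Longrightarrow> u z = 0" using L by (simp add: u_def)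
    have iu: "integrable lborel u" by (rule integrable_compact_support[OF cu L(1) su])
    have uf: "u z = f z" "P z = p z" if "z \<in> K" for z using \<eta> that by (auto simp: u_def P_def)
    have cK: "continuous_on K f" using o K by (auto intro: continuous_on_subset)
    obtain z0 where "z0 \<in> K" "\<And>z. z \<in> K \<Longrightarrow> norm (f z0) \<le> norm (f z)"
      using continuous_attains_inf[OF K(1) False, of "\<lambda>z. norm (f z)"] cK by (auto intro: continuous_intros)
    then obtain m where m: "m > 0" "\<And>z. z \<in> K \<Longrightarrow> m \<le> norm (f z)" using nz K(2) by (metis subsetD zero_less_norm_iff)
    have "bounded (f ` K)" using cK K(1) by (intro compact_imp_bounded compact_continuous_image)
    then obtain M where M: "M > 0" "\<And>z. z \<in> K \<Longrightarrow> norm (f z) \<le> M" unfolding bounded_pos by auto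
    obtain M\<phi> where M\<phi>: "M\<phi> \<ge> 0" "\<And>z. norm (\<phi> z) \<le> M\<phi>" 
      using continuous_compact_support_bounded[OF tf_continuous(1)[OF t] K(1,3)] by blast
    obtain Ma where Ma: "Ma \<ge> 0" "\<And>z. norm (a z) \<le> Ma" 
      using continuous_compact_support_bounded[OF tf_continuous(2)[OF t] K(1,4)] by blast
    \<comment> \<open>What is needed of the n-th mollification \<open>v\<close> of \<open>u\<close>:
      uniform closeness, within m/2 so that |v| \<ge> m/2 on \<open>K\<close>, and closeness of the
      derivative \<open>v'\<close> to \<open>P\<close>, which holds in L2 only.\<close>
    define Q where "Q = (\<lambda>n (v :: complex \<Rightarrow> complex) v'. (\<forall>z. norm (v z - u z) \<le> min (m/2) (1 / Suc n)) \<and> nL2 (\<lambda>z. v' z - P z) \<le> 1 / Suc n \<and> L2 v' \<and>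
        continuous_on UNIV v \<and> continuous_on UNIV v' \<and> (\<exists>v''. continuous_on UNIV v'' \<and> (\<forall>z. wirt v (v' z) (v'' z) z)))"
    have step: "\<exists>v v'. Q n v v'" for n
    proof -
      have pos: "min (m/2) (1 / Suc n) > 0" "1 / real (Suc n) > 0" using m by auto
      obtain e1 where e1: "e1 > 0" "\<And>e \<rho> a b aa ab bb z. mollifier e \<rho> a b aa ab bb \<Longrightarrow> e \<le> e1 \<Longrightarrow> norm (conv u \<rho> z - u z) \<le> min (m/2) (1 / Suc n)"
        using mollify_uniform_compact_support[OF cu L(1) _ pos(1)] su by metis
      obtain e2 where e2: "e2 > 0" "\<And>e \<rho> a b aa ab bb. mollifier e \<rho> a b aa ab bb \<Longrightarrow> e \<le> e2 \<Longrightarrow> nL2 (\<lambda>z. conv P \<rho> z - P z) \<le> 1 / Suc n"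
        using mollify_L2[OF wc(4) pos(2)] by metis
      have "min e1 e2 > 0" using e1 e2 by simp
      then obtain \<rho> ra rb aa ab bb where mo: "mollifier (min e1 e2) \<rho> ra rb aa ab bb" using mollifier_exists by metis
      have t\<rho>: "tf UNIV (conv u \<rho>) (conv u ra) (conv u rb)" by (rule tf_conv[OF iu L(1) su mollifierD(1)[OF mo]])
      have "conv u ra z = conv P \<rho> z" for z
        using wc(1) unfolding weakd_def
        by (intro conv_weak(1)[OF mollifierD(1)[OF mo], where q = "\<lambda>z. q z * \<eta> z + f z * eb z"]) blast
      then have ra: "conv u ra = conv P \<rho>" by (simp add: fun_eq_iff)
      show ?thesis
        by (rule exI[of _ "conv u \<rho>"], rule exI[of _ "conv u ra"])
          (use e1(2)[OF mo] e2(2)[OF mo] tf_continuous[OF t\<rho>] tf_L2(2)[OF t\<rho>] t\<rho> ra in \<open>auto simp: tf_def Q_def\<close>)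
    qed
    then obtain v v' where Q: "\<And>n. Q n (v n) (v' n)" by metis
    have v: "\<And>n z. norm (v n z - u z) \<le> min (m/2) (1 / Suc n)" "\<And>n. nL2 (\<lambda>z. v' n z - P z) \<le> 1 / Suc n" "\<And>n. L2 (v' n)"
        "\<And>n. continuous_on UNIV (v n)" "\<And>n. continuous_on UNIV (v' n)"
        "\<And>n. (\<exists>v''. continuous_on UNIV v'' \<and> (\<forall>z. wirt (v n) (v' n z) (v'' z) z))"
      using Q unfolding Q_def by blast+
    have vm: "m/2 \<le> norm (v n z)" if "z \<in> K" for n z
      using v(1)[of n z] m(2)[OF that] uf(1)[OF that] norm_triangle_ineq3[of "v n z" "f z"] by (simp add: abs_le_iff)
    have vlim: "(\<lambda>n. v n z) \<longlonglongrightarrow> u z" for z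
    proof -
      have "(\<lambda>n. v n z - u z) \<longlonglongrightarrow> 0"
      proof (rule Lim_null_comparison)
        show "\<forall>\<^sub>F n in sequentially. norm (v n z - u z) \<le> 1 / Suc n" using v(1) by (auto intro: always_eventually)
        show "(\<lambda>n. 1 / real (Suc n)) \<longlonglongrightarrow> 0" by (rule LIMSEQ_Suc[OF lim_const_over_n])
      qed
      then show ?thesis by (simp add: LIM_zero_iff)
    qed
    have inv: "norm (1 / (v n z) ^ k) \<le> (2/m) ^ k" if "z \<in> K" for n z k
      using power_mono[OF vm[OF that, of n], of k] m(1)
      by (simp add: norm_divide norm_power power_divide divide_simps) (simp add: mult.commute field_simps)
    have id: "(LINT z|lborel. f z * a z * (1 / (v n z)\<^sup>2)) - 2 * (LINT z|lborel. f z * \<phi> z * (1 / (v n z)^3) * v' n z) =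
        - (LINT z|lborel. p z * \<phi> z * (1 / (v n z)\<^sup>2))" for n
    proof -
      \<comment> \<open>Off \<open>K\<close> the mollification may vanish; \<open>V\<close> is where
        its reciprocal is C^1, and it still contains the support of \<phi>.\<close>
      define V where "V = {z \<in> U. v n z \<noteq> 0}"
      have "V = U \<inter> {z. v n z \<noteq> 0}" by (auto simp: V_def)
      then have oV: "open V" using o(1) open_Collect_neq[OF v(4)[of n] continuous_on_const[of UNIV 0]] by auto
      have tV: "tf V \<phi> a b"
      proof -
        have "K \<subseteq> V"
        proof
          fix z assume z: "z \<in> K"
          have "norm (v n z) > 0" using vm[OF z, of n] m(1) by linarith
          then show "z \<in> V" using z K(2) by (auto simp: V_def)
        qed
        then show ?thesis using t K unfolding tf_def by blast
      qed
      obtain v'' where v'': "continuous_on UNIV v''" "\<And>z. wirt (v n) (v' n z) (v'' z) z" using v(6) by blast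
      have wi: "wirt (\<lambda>z. 1 / (v n z)\<^sup>2) (-2 / (v n z)^3 * v' n z) (-2 / (v n z)^3 * v'' z) z" if "z \<in> V" for z
      proof (rule wirt_chain_holomorphic[OF v''(2)])
        show "((\<lambda>y. 1 / y\<^sup>2) has_field_derivative - 2 / (v n z) ^ 3) (at (v n z))"
          using that by (auto simp: V_def power2_eq_square power3_eq_cube intro!: derivative_eq_intros)
      qed
      have c: "continuous_on V (\<lambda>z. -2 / (v n z)^3 * g z)" if "continuous_on UNIV g" for g
        using that v(4) by (auto intro!: continuous_intros intro: continuous_on_subset simp: V_def)
      have tt: "tf V (\<lambda>z. \<phi> z * (1 / (v n z)\<^sup>2)) (\<lambda>z. a z * (1 / (v n z)\<^sup>2) + \<phi> z * (-2 / (v n z)^3 * v' n z))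
         (\<lambda>z. b z * (1 / (v n z)\<^sup>2) + \<phi> z * (-2 / (v n z)^3 * v'' z))"
        by (rule tf_mult[OF tV oV wi c[OF v(5)] c[OF v''(1)]])
      have "tf U (\<lambda>z. \<phi> z * (1 / (v n z)\<^sup>2)) (\<lambda>z. a z * (1 / (v n z)\<^sup>2) + \<phi> z * (-2 / (v n z)^3 * v' n z))
         (\<lambda>z. b z * (1 / (v n z)\<^sup>2) + \<phi> z * (-2 / (v n z)^3 * v'' z))"
        by (rule tf_mono[OF tt]) (auto simp: V_def)
      then have 1: "(LINT z|lborel. f z * (a z * (1 / (v n z)\<^sup>2) + \<phi> z * (-2 / (v n z)^3 * v' n z))) = - (LINT z|lborel. p z * (\<phi> z * (1 / (v n z)\<^sup>2)))"
        using W by blast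
      have c1: "continuous_on V (\<lambda>z. f z * (1 / (v n z)\<^sup>2))" "continuous_on V (\<lambda>z. f z * (1 / (v n z)^3) * v' n z)"
        using v(4,5) o(2) by (auto intro!: continuous_intros intro: continuous_on_subset simp: V_def)
      have i1: "integrable lborel (\<lambda>z. f z * a z * (1 / (v n z)\<^sup>2))"
        using tf_times_continuous(8)[OF tV oV c1(1)] by (simp add: mult_ac)
      have i2: "integrable lborel (\<lambda>z. f z * \<phi> z * (1 / (v n z)^3) * v' n z)"
        using tf_times_continuous(7)[OF tV oV c1(2)] by (simp add: mult_ac)
      have "f z * (a z * (1 / (v n z)\<^sup>2) + \<phi> z * (-2 / (v n z)^3 * v' n z)) = f z * a z * (1 / (v n z)\<^sup>2) - 2 * (f z * \<phi> z * (1 / (v n z)^3) * v' n z)" for z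
        by (simp add: algebra_simps)
      then have "(LINT z|lborel. f z * (a z * (1 / (v n z)\<^sup>2) + \<phi> z * (-2 / (v n z)^3 * v' n z))) = 
        (LINT z|lborel. f z * a z * (1 / (v n z)\<^sup>2)) - 2 * (LINT z|lborel. f z * \<phi> z * (1 / (v n z)^3) * v' n z)"
        using Bochner_Integration.integral_diff[OF i1 integrable_mult_right[OF i2, of 2]] by (simp only: integral_mult_right_zero)
      then show ?thesis using 1 by (simp add: mult.assoc)
    qed
    have mvb [measurable]: "v n \<in> borel_measurable borel" "v' n \<in> borel_measurable borel" for n
      using v(4,5) by (auto intro: borel_measurable_continuous_onI)
    have mfa [measurable]: "(\<lambda>z. f z * a z) \<in> borel_measurable borel" "(\<lambda>z. f z * \<phi> z) \<in> borel_measurable borel"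
      using tf_times_continuous(1,2)[OF t o(1,2)] by (auto intro: borel_measurable_continuous_onI)
    have mp [measurable]: "p \<in> borel_measurable borel" "\<phi> \<in> borel_measurable borel" "a \<in> borel_measurable borel" "P \<in> borel_measurable borel"
      using o(3) tf_continuous[OF t] wc(4) by (auto simp: locL2_def L2_def intro: borel_measurable_continuous_onI)
    have lim: "(\<lambda>n. LINT z|lborel. g z * (1 / (v n z) ^ k)) \<longlonglongrightarrow> (LINT z|lborel. g z * (1 / (f z) ^ k))"
      if g: "integrable lborel g" "\<And>z. z \<notin> K \<Longrightarrow> g z = 0" for g k
    proof (rule integral_dominated_convergence)
      have [measurable]: "g \<in> borel_measurable borel" using g(1) by auto
      show "(\<lambda>z. g z * (1 / (v n z) ^ k)) \<in> borel_measurable lborel" for n by measurable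
      show "integrable lborel (\<lambda>z. norm (g z) * (2/m)^k)" using g by auto
      show "AE z in lborel. norm (g z * (1 / (v n z) ^ k)) \<le> norm (g z) * (2/m)^k" for n
      proof (rule AE_I2)
        fix z show "norm (g z * (1 / (v n z) ^ k)) \<le> norm (g z) * (2/m)^k"
        proof (cases "z \<in> K")
          case True then show ?thesis unfolding norm_mult by (intro mult_left_mono inv) auto
        qed (use g(2) in simp)
      qed
      have pl: "(\<lambda>n. g z * (1 / (v n z) ^ k)) \<longlonglongrightarrow> g z * (1 / (f z) ^ k)" for z
      proof (cases "z \<in> K")
        case True
        then have "(\<lambda>n. v n z) \<longlonglongrightarrow> f z" using vlim[of z] uf by simp
        then show ?thesis using nz K(2) True by (intro tendsto_intros) auto
      qed (use g in auto)
      then show "AE z in lborel. (\<lambda>n. g z * (1 / (v n z) ^ k)) \<longlonglongrightarrow> g z * (1 / (f z) ^ k)" by auto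
      show "(\<lambda>z. g z * (1 / (f z) ^ k)) \<in> borel_measurable lborel"
        by (rule borel_measurable_LIMSEQ_metric[OF _ pl]) measurable
    qed
    have i1: "integrable lborel (\<lambda>z. f z * a z)" by (rule tf_times_continuous(8)[OF t o(1,2)])
    have i2: "integrable lborel (\<lambda>z. p z * \<phi> z)" by (rule locL2_integrable[OF o(3) t])
    have i3: "integrable lborel (\<lambda>z. f z * \<phi> z * P z)" 
      by (rule L2_mult_integrable[OF tf_times_continuous(4)[OF t o(1,2)] wc(4)])
    have l1: "(\<lambda>n. LINT z|lborel. f z * a z * (1 / (v n z)\<^sup>2)) \<longlonglongrightarrow> (LINT z|lborel. f z * a z * (1 / (f z)\<^sup>2))"
      by (rule lim[OF i1]) (use K in auto)
    have l2: "(\<lambda>n. LINT z|lborel. p z * \<phi> z * (1 / (v n z)\<^sup>2)) \<longlonglongrightarrow> (LINT z|lborel. p z * \<phi> z * (1 / (f z)\<^sup>2))"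
      by (rule lim[OF i2]) (use K in auto)
    have l3: "(\<lambda>n. LINT z|lborel. f z * \<phi> z * P z * (1 / (v n z)^3)) \<longlonglongrightarrow> (LINT z|lborel. f z * \<phi> z * P z * (1 / (f z)^3))"
      by (rule lim[OF i3]) (use K in auto)
    have LK: "L2 (\<lambda>z. indicator K z)"
      by (rule L2_compact_support[of _ 1 K]) (use K(1) borel_compact in \<open>auto split: split_indicator intro!: borel_measurable_indicator\<close>)
    define C where "C = M * M\<phi> * (2/m)^3"
    have C0: "C \<ge> 0" using M M\<phi> m by (simp add: C_def)
    have mg: "(\<lambda>z. f z * \<phi> z * (1 / (v n z)^3)) \<in> borel_measurable borel" for n by measurable
    have gb: "norm (f z * \<phi> z * (1 / (v n z)^3)) \<le> C * norm (indicator K z :: complex)" for n z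
    proof (cases "z \<in> K")
      case True
      have "norm (f z * \<phi> z * (1 / (v n z)^3)) \<le> M * M\<phi> * (2/m)^3"
        unfolding norm_mult[of "f z * \<phi> z"] norm_mult[of "f z"]
        by (intro mult_mono M(2)[OF True] M\<phi>(2) inv[OF True]) (use M M\<phi> in auto)
      then show ?thesis using True by (simp add: C_def)
    qed (use K in auto)
    have gL: "L2 (\<lambda>z. f z * \<phi> z * (1 / (v n z)^3))" for n by (rule L2_bound[OF LK mg gb])
    have gn: "nL2 (\<lambda>z. f z * \<phi> z * (1 / (v n z)^3)) \<le> C * nL2 (\<lambda>z. indicator K z)" for n
      by (rule nL2_bound[OF LK mg]) (use gb C0 in auto)
    have l4: "(\<lambda>n. LINT z|lborel. f z * \<phi> z * (1 / (v n z)^3) * (v' n z - P z)) \<longlonglongrightarrow> 0"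
    proof (rule Lim_null_comparison)
      show "\<forall>\<^sub>F n in sequentially. norm (LINT z|lborel. f z * \<phi> z * (1 / (v n z)^3) * (v' n z - P z)) \<le> C * nL2 (\<lambda>z. indicator K z) * (1 / Suc n)"
      proof (rule always_eventually, rule allI)
        fix n
        have "norm (LINT z|lborel. f z * \<phi> z * (1 / (v n z)^3) * (v' n z - P z)) \<le> nL2 (\<lambda>z. f z * \<phi> z * (1 / (v n z)^3)) * nL2 (\<lambda>z. v' n z - P z)"
          by (rule L2_Cauchy_Schwarz[OF gL L2_diff(1)[OF v(3) wc(4)]])
        also have "\<dots> \<le> C * nL2 (\<lambda>z. indicator K z) * (1 / Suc n)"
          by (intro mult_mono gn v(2)) (use C0 in auto)
        finally show "norm (LINT z|lborel. f z * \<phi> z * (1 / (v n z)^3) * (v' n z - P z)) \<le> C * nL2 (\<lambda>z. indicator K z) * (1 / Suc n)" .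
      qed
      show "(\<lambda>n. C * nL2 (\<lambda>z. indicator K z) * (1 / real (Suc n))) \<longlonglongrightarrow> 0"
        by (intro tendsto_mult_right_zero LIMSEQ_Suc[OF lim_const_over_n])
    qed
    \<comment> \<open>\<open>v' n\<close> converges to \<open>P\<close> only in L2. The part with
      \<open>v' n - P\<close> is handled by Cauchy-Schwarz, the part with \<open>P\<close> by
      dominated convergence.\<close>
    have sp: "(LINT z|lborel. f z * \<phi> z * (1 / (v n z)^3) * v' n z) =
      (LINT z|lborel. f z * \<phi> z * (1 / (v n z)^3) * (v' n z - P z)) + (LINT z|lborel. f z * \<phi> z * P z * (1 / (v n z)^3))" for n
    proof -
      have "f z * \<phi> z * (1 / (v n z)^3) * v' n z = f z * \<phi> z * (1 / (v n z)^3) * (v' n z - P z) + f z * \<phi> z * (1 / (v n z)^3) * P z" for z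
        by (simp only: right_diff_distrib diff_add_cancel)
      then have "(LINT z|lborel. f z * \<phi> z * (1 / (v n z)^3) * v' n z) = (LINT z|lborel. f z * \<phi> z * (1 / (v n z)^3) * (v' n z - P z)) + (LINT z|lborel. f z * \<phi> z * (1 / (v n z)^3) * P z)"
        using L2_mult_integrable[OF gL L2_diff(1)[OF v(3) wc(4)]] L2_mult_integrable[OF gL wc(4)] by simp
      then show ?thesis by (simp add: mult_ac)
    qed
    have l5: "(\<lambda>n. LINT z|lborel. f z * \<phi> z * (1 / (v n z)^3) * v' n z) \<longlonglongrightarrow> (LINT z|lborel. f z * \<phi> z * P z * (1 / (f z)^3))"
      unfolding sp using tendsto_add[OF l4 l3] by simp
    from tendsto_diff[OF l1 tendsto_mult_left[OF l5, of 2]] have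
      "(\<lambda>n. - (LINT z|lborel. p z * \<phi> z * (1 / (v n z)\<^sup>2))) \<longlonglongrightarrow> (LINT z|lborel. f z * a z * (1 / (f z)\<^sup>2)) - 2 * (LINT z|lborel. f z * \<phi> z * P z * (1 / (f z)^3))"
      unfolding id .
    with tendsto_minus[OF l2] have
      fin: "(LINT z|lborel. f z * a z * (1 / (f z)\<^sup>2)) - 2 * (LINT z|lborel. f z * \<phi> z * P z * (1 / (f z)^3)) = - (LINT z|lborel. p z * \<phi> z * (1 / (f z)\<^sup>2))"
      using LIMSEQ_unique by blast
    have e1: "f z * a z * (1 / (f z)\<^sup>2) = 1 / f z * a z" for z
      using K(4)[of z] nz[of z] K(2) by (cases "z \<in> K") (auto simp: power2_eq_square)
    have e2: "f z * \<phi> z * P z * (1 / (f z)^3) = p z / (f z)\<^sup>2 * \<phi> z" for z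
      using K(3)[of z] nz[of z] K(2) uf[of z] by (cases "z \<in> K") (auto simp: power2_eq_square power3_eq_cube)
    have e3: "p z * \<phi> z * (1 / (f z)\<^sup>2) = p z / (f z)\<^sup>2 * \<phi> z" for z by simp
    show ?thesis using fin unfolding e1 e2 e3 by (simp add: algebra_simps)
  qed
qed

lemma weakd_inverse:
  assumes w: "weakd U f p q" and nz: "\<And>z. z \<in> U \<Longrightarrow> f z \<noteq> 0" and m: "f \<in> borel_measurable borel"
  shows "weakd U (\<lambda>z. 1 / f z) (\<lambda>z. - (p z / (f z)\<^sup>2)) (\<lambda>z. - (q z / (f z)\<^sup>2))"
  unfolding weakd_def
proof (intro conjI allI impI)
  note W = w[unfolded weakd_def]
  show "open U" using W by simp
  show "continuous_on U (\<lambda>z. 1 / f z)" using W nz by (auto intro!: continuous_intros)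
  have l: "locL2 U (\<lambda>z. - (p z / (f z)\<^sup>2))" if p: "locL2 U p" for p
    unfolding locL2_def
  proof (intro conjI allI impI)
    have [measurable]: "p \<in> borel_measurable borel" using p by (simp add: locL2_def)
    show mm: "(\<lambda>z. - (p z / (f z)\<^sup>2)) \<in> borel_measurable borel" using m by measurable
    fix K assume K: "compact K \<and> K \<subseteq> U"
    then have [measurable]: "K \<in> sets borel" using borel_compact by blast
    show "L2 (\<lambda>z. indicator K z * - (p z / (f z)\<^sup>2))"
    proof (cases "K = {}")
      case False
      have cK: "continuous_on K (\<lambda>z. norm (f z))" using W K by (auto intro!: continuous_intros intro: continuous_on_subset)
      obtain z0 where z0: "z0 \<in> K" "\<And>z. z \<in> K \<Longrightarrow> norm (f z0) \<le> norm (f z)"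
        using continuous_attains_inf[OF _ False cK] K by blast
      have n0: "norm (f z0) > 0" using z0 nz K by auto
      show ?thesis
      proof (rule L2_bound[of "\<lambda>z. indicator K z * p z" _ "1 / (norm (f z0))\<^sup>2"])
        show "L2 (\<lambda>z. indicator K z * p z)" using p K by (simp add: locL2_def)
        show "(\<lambda>z. indicator K z * - (p z / (f z)\<^sup>2)) \<in> borel_measurable borel" using mm by measurable
        fix z
        show "norm (indicator K z * - (p z / (f z)\<^sup>2)) \<le> 1 / (norm (f z0))\<^sup>2 * norm (indicator K z * p z)"
        proof (cases "z \<in> K")
          case True
          have "(norm (f z0))\<^sup>2 \<le> (norm (f z))\<^sup>2" using z0(2)[OF True] by (intro power_mono) auto
          then have "norm (p z) / (norm (f z))\<^sup>2 \<le> norm (p z) / (norm (f z0))\<^sup>2"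
            using n0 by (intro divide_left_mono mult_pos_pos zero_less_power) (use z0(2)[OF True] in auto)
          then show ?thesis using True by (simp add: norm_divide norm_power)
        qed simp
      qed
    qed (simp add: L2_def)
  qed
  show "locL2 U (\<lambda>z. - (p z / (f z)\<^sup>2))" "locL2 U (\<lambda>z. - (q z / (f z)\<^sup>2))" using W l by auto
  fix \<phi> a b assume t: "tf U \<phi> a b"
  show "(LINT z|lborel. 1 / f z * a z) = - (LINT z|lborel. - (p z / (f z)\<^sup>2) * \<phi> z)"
    using weakd_inverse_aux[OF w nz t] by simp
  have ci: "cnj (integral\<^sup>L lborel g) = (LINT z|lborel. cnj (g z))" for g by simp
  \<comment> \<open>Conjugation exchanges the two derivatives, so that the auxiliary lemma for the
    conjugate of \<open>f\<close> gives the second equation.\<close>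
  have "(LINT z|lborel. 1 / cnj (f z) * cnj (b z)) = (LINT z|lborel. cnj (q z) / (cnj (f z))\<^sup>2 * cnj (\<phi> z))"
    using weakd_inverse_aux[OF weakd_cnj[OF w] _ tf_cnj[OF t]] nz by simp
  from arg_cong[OF this, of cnj] have "(LINT z|lborel. 1 / f z * b z) = (LINT z|lborel. q z / (f z)\<^sup>2 * \<phi> z)"
    unfolding ci by simp
  then show "(LINT z|lborel. 1 / f z * b z) = - (LINT z|lborel. - (q z / (f z)\<^sup>2) * \<phi> z)" by simp
qed

lemma lborel_integral_affine_complex:
  fixes f :: "complex \<Rightarrow> complex" and c :: real
  assumes [measurable]: "f \<in> borel_measurable borel" and c: "c \<noteq> 0"
  shows "(LINT z|lborel. f z) = c\<^sup>2 *\<^sub>R (LINT z|lborel. f (t + of_real c * z))"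
proof -
  have "(LINT z|lborel. f z) = (LINT z|density (distr lborel borel (\<lambda>x. t + c *\<^sub>R x)) (\<lambda>_. ennreal (\<bar>c\<bar>^DIM(complex))). f z)"
    using lborel_affine[OF c, of t] by (metis (no_types, lifting))
  also have "\<dots> = (LINT z|distr lborel borel (\<lambda>x. t + c *\<^sub>R x). c\<^sup>2 *\<^sub>R f z)"
    by (subst integral_density) auto
  also have "\<dots> = (LINT z|lborel. c\<^sup>2 *\<^sub>R f (t + of_real c * z))"
    by (subst integral_distr) (auto simp: scaleR_conv_of_real)
  finally show ?thesis by simp
qed

section \<open>Cutoff functions\<close>

text \<open>A C^1 step: 1 for y \<le> 0, 0 for y \<ge> 1 and strictly decreasing in between.\<close>

definition tau :: "real \<Rightarrow> real" where
  "tau y = (max 0 (1 - (max 0 y)\<^sup>2))\<^sup>2"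
definition tau' :: "real \<Rightarrow> real" where
  "tau' y = - 4 * max 0 (1 - (max 0 y)\<^sup>2) * max 0 y"

lemma tau_deriv: "(tau has_real_derivative tau' y) (at y)"
proof -
  have 1: "((\<lambda>x::real. (max 0 x)\<^sup>2) has_real_derivative 2 * max 0 x) (at x)" for x
    using has_real_derivative_max_power[of 0 x] by (simp add: numeral_2_eq_2)
  have "((\<lambda>y. 1 - (max 0 y)\<^sup>2) has_real_derivative - (2 * max 0 y)) (at y)"
    using DERIV_diff[OF DERIV_const[of 1] 1[of y]] by simp
  from DERIV_chain2[where f = "\<lambda>x. (max 0 x)\<^sup>2", OF 1 this] show ?thesis
    by (simp add: tau_def[abs_def] tau'_def mult_ac)
qed

lemma tau_props: "y \<le> 0 \<Longrightarrow> tau y = 1" "y \<ge> 1 \<Longrightarrow> tau y = 0" "0 \<le> tau y" "tau y \<le> 1"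
  "y \<le> 0 \<Longrightarrow> tau' y = 0" "y \<ge> 1 \<Longrightarrow> tau' y = 0" "\<bar>tau' y\<bar> \<le> 4" "tau' y \<le> 0" "0 < y \<Longrightarrow> y < 1 \<Longrightarrow> tau' y < 0"
proof -
  have b: "0 \<le> max 0 (1 - (max 0 y)\<^sup>2)" "max 0 (1 - (max 0 y)\<^sup>2) \<le> 1" by auto
  show "y \<le> 0 \<Longrightarrow> tau y = 1" by (simp add: tau_def)
  show "y \<ge> 1 \<Longrightarrow> tau y = 0" using one_le_power[of y 2] by (simp add: tau_def)
  show "0 \<le> tau y" by (simp add: tau_def)
  show "tau y \<le> 1" unfolding tau_def using b by (intro power_le_one)
  show "y \<le> 0 \<Longrightarrow> tau' y = 0" by (simp add: tau'_def)
  show z: "y \<ge> 1 \<Longrightarrow> tau' y = 0" using one_le_power[of y 2] by (simp add: tau'_def)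
  show "tau' y \<le> 0" using b by (simp add: tau'_def)
  show "\<bar>tau' y\<bar> \<le> 4"
  proof (cases "y \<ge> 1")
    case False
    then have "max 0 (1 - (max 0 y)\<^sup>2) * max 0 y \<le> 1 * 1" using b by (intro mult_mono) auto
    then show ?thesis using b by (simp add: tau'_def abs_mult)
  qed (use z in auto)
  show "tau' y < 0" if "0 < y" "y < 1"
  proof -
    have "y\<^sup>2 < 1" using that by (simp add: power_less_one_iff)
    then have "0 < (1 - y\<^sup>2) * y" using that by simp
    moreover have "tau' y = - 4 * ((1 - y\<^sup>2) * y)" using that \<open>y\<^sup>2 < 1\<close> by (simp add: tau'_def algebra_simps)
    ultimately show ?thesis by simp
  qed
qed

lemma continuous_tau': "continuous_on S tau'"
  unfolding tau'_def by (intro continuous_intros)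

lemma measure_ball_complex: "emeasure lborel (ball (c::complex) r) = ennreal (pi * r\<^sup>2)" if "r \<ge> 0"
  using emeasure_ball[of r c] that by (simp add: unit_ball_vol_2)

lemma measure_ball_complex_le: "measure lborel (ball (c::complex) r) \<le> 4 * r\<^sup>2" if "r \<ge> 0"
  using measure_ball_complex[OF that, of c] pi_less_4 by (simp add: measure_def mult_right_mono)

text \<open>The logarithmic cutoffs: a point, like infinity, has capacity 0.\<close>

lemma log_cutoff:
  fixes c :: complex and n :: nat
  assumes n: "n > 0"
  defines "th \<equiv> (\<lambda>r. tau ((ln r)\<^sup>2 / (4 * (real n)\<^sup>2) - 1))"
  defines "\<eta> \<equiv> (\<lambda>z. if z = c then 0 else of_real (th ((norm (z - c))\<^sup>2)) :: complex)"
  obtains ea eb where "tf (-{c}) \<eta> ea eb" "nL2 ea \<le> sqrt (9216 / n)" "nL2 eb \<le> sqrt (9216 / n)"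
proof -
  define th' where "th' = (\<lambda>r. tau' ((ln r)\<^sup>2 / (4 * (real n)\<^sup>2) - 1) * (2 * ln r / (r * (4 * (real n)\<^sup>2))))"
  have dth: "(th has_real_derivative th' r) (at r)" if "r > 0" for r
    unfolding th_def th'_def
    by (rule DERIV_chain2[where f = tau, OF tau_deriv]) (use that n in \<open>auto intro!: derivative_eq_intros simp: field_simps\<close>)
  define ea where "ea = (\<lambda>z. if z = c then 0 else of_real (th' ((norm (z - c))\<^sup>2)) * cnj (z - c) :: complex)"
  define eb where "eb = (\<lambda>z. if z = c then 0 else of_real (th' ((norm (z - c))\<^sup>2)) * (z - c) :: complex)"
  have lnsq: "ln ((norm x)\<^sup>2) = 2 * ln (norm x)" if "x \<noteq> 0" for x :: complex
    using that by (simp add: ln_realpow)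
  \<comment> \<open>With x = |z - c| the argument of \<open>tau\<close> is (ln x / n)^2 - 1. The
    cutoff is thus 1 for |ln x| \<le> n and 0 for |ln x| \<ge> 2 n; squaring the logarithm treats
    \<open>c\<close> and infinity at once.\<close>
  have big: "(ln ((norm x)\<^sup>2))\<^sup>2 / (4 * (real n)\<^sup>2) - 1 \<ge> 1" if "x \<noteq> 0" "\<bar>ln (norm x)\<bar> \<ge> 2 * n" for x :: complex
  proof -
    have "4 * (real n)\<^sup>2 \<le> (ln (norm x))\<^sup>2" using power_mono[OF that(2), of 2] by (simp add: power_mult_distrib)
    then have "2 * (4 * (real n)\<^sup>2) \<le> 4 * (ln (norm x))\<^sup>2" using zero_le_power2[of "real n"] by linarith
    then show ?thesis using n by (simp add: lnsq that(1) power_mult_distrib field_simps)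
  qed
  have out: "th ((norm x)\<^sup>2) = 0 \<and> th' ((norm x)\<^sup>2) = 0" if "x \<noteq> 0" "\<bar>ln (norm x)\<bar> \<ge> 2 * n" for x :: complex
    using big[OF that] by (simp add: th_def th'_def tau_props)
  have out': "\<bar>ln (norm x)\<bar> \<ge> 2 * n" if "x \<noteq> 0" "norm x \<le> exp (- 2 * n) \<or> norm x \<ge> exp (2 * n)" for x :: complex
  proof -
    have "ln (norm x) \<le> - 2 * n \<or> ln (norm x) \<ge> 2 * n"
      using that by (metis exp_le_cancel_iff exp_ln zero_less_norm_iff)
    then show ?thesis by auto
  qed
  have z: "\<eta> z = 0 \<and> ea z = 0 \<and> eb z = 0" if "z \<notin> cball c (exp (2 * n)) - ball c (exp (- 2 * n))" for z
  proof (cases "z = c")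
    case False
    have "norm (z - c) \<le> exp (- 2 * n) \<or> norm (z - c) \<ge> exp (2 * n)" using that by (auto simp: dist_norm norm_minus_commute)
    then show ?thesis using out[of "z - c"] out'[of "z - c"] False by (simp add: \<eta>_def ea_def eb_def)
  qed (simp add: \<eta>_def ea_def eb_def)
  have wi: "wirt \<eta> (ea z) (eb z) z" for z
  proof (cases "z = c")
    case True
    have "wirt \<eta> 0 0 z"
      by (rule wirt_cong[OF wirt_const[of 0], of "ball c (exp (- 2 * n))"]) (use True z in auto)
    then show ?thesis using True by (simp add: ea_def eb_def)
  next
    case False
    have "wirt (\<lambda>z. of_real (th ((norm (z - c))\<^sup>2))) (ea z) (eb z) z"
      using wirt_chain_real[OF wirt_norm_sq[of c z] dth, unfolded] False by (simp add: ea_def eb_def)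
    then show ?thesis
      by (rule wirt_cong[of _ _ _ _ "-{c}"]) (use False in \<open>auto simp: \<eta>_def\<close>)
  qed
  have cth: "continuous_on (-{c}) (\<lambda>z. complex_of_real (th' ((norm (z - c))\<^sup>2)))"
    unfolding th'_def using n
    by (intro continuous_intros continuous_on_compose2[OF continuous_tau'[of UNIV]]) auto
  have "continuous_on (-{c}) ea"
    by (rule continuous_on_eq[OF continuous_on_mult[OF cth], of "\<lambda>z. cnj (z - c)"]) (auto simp: ea_def intro!: continuous_intros)
  then have cea: "continuous_on UNIV ea"
    by (rule continuous_zero_extension[of "-{c}" _ "cball c (exp (2 * n)) - ball c (exp (- 2 * n))", rotated])
      (use z in \<open>auto intro!: compact_diff\<close>)
  have "continuous_on (-{c}) eb"
    by (rule continuous_on_eq[OF continuous_on_mult[OF cth], of "\<lambda>z. z - c"]) (auto simp: eb_def intro!: continuous_intros)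
  then have ceb: "continuous_on UNIV eb"
    by (rule continuous_zero_extension[of "-{c}" _ "cball c (exp (2 * n)) - ball c (exp (- 2 * n))", rotated])
      (use z in \<open>auto intro!: compact_diff\<close>)
  have t: "tf (-{c}) \<eta> ea eb"
    unfolding tf_def
    by (intro conjI allI cea ceb wi exI[of _ "cball c (exp (2 * n)) - ball c (exp (- 2 * n))"])
      (use z in \<open>auto intro!: compact_diff\<close>)
  have th'b: "norm (th' ((norm x)\<^sup>2) * norm x) \<le> 8 / (n * norm x)" if x: "x \<noteq> 0" for x :: complex
  proof (cases "\<bar>ln (norm x)\<bar> \<ge> 2 * n")
    case True then show ?thesis using out[OF x] by simp
  next
    case False
    define y where "y = (ln ((norm x)\<^sup>2))\<^sup>2 / (4 * (real n)\<^sup>2) - 1"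
    have "th' ((norm x)\<^sup>2) * norm x = tau' y * (ln (norm x) / (n * n * norm x))"
    proof -
      have "th' ((norm x)\<^sup>2) = tau' y * (2 * ln ((norm x)\<^sup>2) / ((norm x)\<^sup>2 * (4 * (real n)\<^sup>2)))"
        by (simp add: th'_def y_def)
      then show ?thesis using x n unfolding lnsq[OF x] by (simp add: power2_eq_square field_simps)
    qed
    then have "\<bar>th' ((norm x)\<^sup>2) * norm x\<bar> = \<bar>tau' y\<bar> * (\<bar>ln (norm x)\<bar> / (n * n * norm x))"
      by (simp add: abs_mult)
    also have "\<dots> \<le> 4 * (2 * n / (n * n * norm x))"
      using False n by (intro mult_mono tau_props divide_right_mono) auto
    finally show ?thesis using n by simp
  qed
  \<comment> \<open>Sum over the annuli e^j \<le> |z - c| < e^(j + 1). On each, the squared gradient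
    is at most 64 / (n e^j)^2 and the area at most 4 e^(2 j + 2), where e^2 \<le> 9; the 4 n annuli
    contribute 4 n * 64 * 36 / n^2 = 9216 / n.\<close>
  define J where "J = {- 2 * int n..<2 * int n}"
  have cJ: "card J = 4 * n" "finite J" by (auto simp: J_def)
  define g where "g = (\<lambda>z. \<Sum>j\<in>J. 64 / (real n)\<^sup>2 * exp (- 2 * real_of_int j) * indicator (ball c (exp (real_of_int j + 1))) z)"
  have ig: "integrable lborel g" unfolding g_def
    by (intro Bochner_Integration.integrable_sum integrable_mult_right) (auto intro!: emeasure_bounded_finite)
  have Ig: "(LINT z|lborel. g z) \<le> 9216 / n"
  proof -
    have e2: "exp (2::real) \<le> 9"
    proof -
      have "exp (2::real) = exp 1 * exp 1" by (simp flip: exp_add)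
      also have "\<dots> \<le> 3 * 3" using exp_le by (intro mult_mono) auto
      finally show ?thesis by simp
    qed
    have "(LINT z|lborel. g z) = (\<Sum>j\<in>J. 64 / (real n)\<^sup>2 * exp (- 2 * real_of_int j) * measure lborel (ball c (exp (real_of_int j + 1))))"
    proof -
      have "integrable lborel (\<lambda>z. 64 / (real n)\<^sup>2 * exp (- 2 * real_of_int j) * indicator (ball c (exp (real_of_int j + 1))) z)" for j
        by (intro integrable_mult_right) (auto intro!: emeasure_bounded_finite)
      then show ?thesis unfolding g_def by (subst Bochner_Integration.integral_sum) (simp_all only: integral_mult_right_zero integral_indicator, simp)
    qed
    also have "\<dots> \<le> (\<Sum>j\<in>J. 64 / (real n)\<^sup>2 * (4 * 9))"
    proof (rule sum_mono)
      fix j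
      have "exp (- 2 * real_of_int j) * measure lborel (ball c (exp (real_of_int j + 1))) \<le> exp (- 2 * real_of_int j) * (4 * (exp (real_of_int j + 1))\<^sup>2)"
        by (intro mult_left_mono measure_ball_complex_le) auto
      also have "\<dots> = 4 * exp 2" by (simp add: power2_eq_square flip: exp_add)
      also have "\<dots> \<le> 4 * 9" using e2 by simp
      finally have "64 / (real n)\<^sup>2 * (exp (- 2 * real_of_int j) * measure lborel (ball c (exp (real_of_int j + 1)))) \<le> 64 / (real n)\<^sup>2 * (4 * 9)"
        by (intro mult_left_mono) auto
      then show "64 / (real n)\<^sup>2 * exp (- 2 * real_of_int j) * measure lborel (ball c (exp (real_of_int j + 1))) \<le> 64 / (real n)\<^sup>2 * (4 * 9)"
        by (simp only: mult.assoc)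
    qed
    also have "\<dots> = 9216 / n" using n by (simp add: cJ power2_eq_square)
    finally show ?thesis .
  qed
  have main: "nL2 f \<le> sqrt (9216 / n)" if f: "f \<in> borel_measurable borel"
    "\<And>z. z \<noteq> c \<Longrightarrow> norm (f z) = norm (th' ((norm (z - c))\<^sup>2) * norm (z - c))" "f c = 0" for f :: "complex \<Rightarrow> complex"
  proof -
    have fg: "(norm (f z))\<^sup>2 \<le> g z" for z
    proof (cases "z = c \<or> \<bar>ln (norm (z - c))\<bar> \<ge> 2 * n")
      case True
      have "norm (f z) = 0"
      proof (cases "z = c")
        case False then show ?thesis using True f(2)[OF False] out[of "z - c"] by auto
      qed (use f(3) in simp)
      then show ?thesis by (simp add: g_def sum_nonneg)
    next
      case False
      define x where "x = norm (z - c)"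
      have x: "x > 0" "\<bar>ln x\<bar> < 2 * n" using False by (auto simp: x_def)
      define j where "j = \<lfloor>ln x\<rfloor>"
      have j: "real_of_int j \<le> ln x" "ln x < real_of_int j + 1" unfolding j_def by linarith+
      have jJ: "j \<in> J" using x(2) unfolding J_def j_def by (auto simp: le_floor_iff floor_less_iff)
      have ex: "exp (real_of_int j) \<le> x" "x < exp (real_of_int j + 1)"
        using j x(1) by (metis exp_le_cancel_iff exp_ln, metis exp_less_cancel_iff exp_ln)
      have "norm (f z) \<le> 8 / (n * x)"
        using f(2)[of z] th'b[of "z - c"] False by (simp add: x_def)
      also have "\<dots> \<le> 8 / (n * exp (real_of_int j))"
        using n ex x by (intro divide_left_mono mult_left_mono) auto
      finally have "(norm (f z))\<^sup>2 \<le> (8 / (n * exp (real_of_int j)))\<^sup>2" by (intro power_mono) auto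
      also have "\<dots> = 64 / (real n)\<^sup>2 * exp (- 2 * real_of_int j) * indicator (ball c (exp (real_of_int j + 1))) z"
      proof -
        have "z \<in> ball c (exp (real_of_int j + 1))" using ex(2) by (simp add: x_def dist_norm norm_minus_commute)
        moreover have "exp (- 2 * real_of_int j) = 1 / (exp (real_of_int j))\<^sup>2"
          by (simp add: exp_minus field_simps power2_eq_square flip: exp_add)
        ultimately show ?thesis by (simp add: power_divide power_mult_distrib)
      qed
      also have "\<dots> \<le> g z" unfolding g_def
        by (rule member_le_sum[OF jJ _ cJ(2)]) auto
      finally show ?thesis .
    qed
    have "(LINT z|lborel. (norm (f z))\<^sup>2) \<le> (LINT z|lborel. g z)"
      by (rule integral_mono_AE') (use fg ig in \<open>auto intro: order_trans[OF zero_le_power2]\<close>)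
    then show ?thesis using Ig unfolding nL2_def by (intro real_sqrt_le_mono) simp
  qed
  show thesis
  proof (rule that[OF t])
    show "nL2 ea \<le> sqrt (9216 / n)"
      by (rule main[OF borel_measurable_continuous_onI[OF cea]]) (auto simp: ea_def norm_mult abs_mult simp del: complex_cnj_diff)
    show "nL2 eb \<le> sqrt (9216 / n)"
      by (rule main[OF borel_measurable_continuous_onI[OF ceb]]) (auto simp: eb_def norm_mult abs_mult)
  qed
qed

text \<open>The product of the cutoffs at the two points where the function of the energy estimate
  has a singularity: \<open>z0\<close> and the pole \<open>b\<close> of the homeomorphism.\<close>

lemma two_point_cutoffs:
  fixes z0 b :: complex
  obtains \<eta> ea eb :: "nat \<Rightarrow> complex \<Rightarrow> complex" where
    "\<And>n. tf (-{z0, b}) (\<eta> n) (ea n) (eb n)" "\<And>n z. norm (\<eta> n z) \<le> 1"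
    "\<And>z. z \<notin> {z0, b} \<Longrightarrow> (\<lambda>n. \<eta> n z) \<longlonglongrightarrow> 1" "(\<lambda>n. nL2 (ea n)) \<longlonglongrightarrow> 0" "(\<lambda>n. nL2 (eb n)) \<longlonglongrightarrow> 0"
proof -
  define e where "e = (\<lambda>c n (z::complex). if z = c then 0 else of_real (tau ((ln ((norm (z - c))\<^sup>2))\<^sup>2 / (4 * (real (Suc n))\<^sup>2) - 1)) :: complex)"
  have "\<exists>ea eb. tf (-{c}) (e c n) ea eb \<and> nL2 ea \<le> sqrt (9216 / real (Suc n)) \<and> nL2 eb \<le> sqrt (9216 / real (Suc n))" for c n
    unfolding e_def by (rule log_cutoff[of "Suc n" c]) (simp, blast)
  then obtain ea eb where e: "\<And>c n. tf (-{c}) (e c n) (ea c n) (eb c n)"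
    "\<And>c n. nL2 (ea c n) \<le> sqrt (9216 / real (Suc n))" "\<And>c n. nL2 (eb c n) \<le> sqrt (9216 / real (Suc n))"
    by metis
  have e1: "norm (e c n z) \<le> 1" for c n z using tau_props(3,4) by (simp add: e_def abs_le_iff)
  have lim1: "(\<lambda>n. e c n z) \<longlonglongrightarrow> 1" if "z \<noteq> c" for c z
  proof (rule tendsto_eventually)
    obtain N :: nat where N: "\<bar>ln ((norm (z - c))\<^sup>2)\<bar> \<le> N" using real_arch_simple by blast
    show "\<forall>\<^sub>F n in sequentially. e c n z = 1"
      using eventually_ge_at_top[of N]
    proof eventually_elim
      case (elim n)
      have "\<bar>ln ((norm (z - c))\<^sup>2)\<bar> \<le> 2 * real (Suc n)"
        using N order_trans[OF N of_nat_mono[OF elim]] by simp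
      from power_mono[OF this, of 2] have "(ln ((norm (z - c))\<^sup>2))\<^sup>2 \<le> 4 * (real (Suc n))\<^sup>2"
        by (simp add: power_mult_distrib del: of_nat_Suc)
      moreover have "4 * (real (Suc n))\<^sup>2 > 0" by simp
      ultimately have "(ln ((norm (z - c))\<^sup>2))\<^sup>2 / (4 * (real (Suc n))\<^sup>2) - 1 \<le> 0"
        by (simp add: divide_le_eq_1_pos del: of_nat_Suc)
      then show ?case using that by (simp add: e_def tau_props(1) del: of_nat_Suc)
    qed
  qed
  define \<eta> where "\<eta> = (\<lambda>n z. e z0 n z * e b n z)"
  define A where "A = (\<lambda>n z. ea z0 n z * e b n z + e z0 n z * ea b n z)"
  define B where "B = (\<lambda>n z. eb z0 n z * e b n z + e z0 n z * eb b n z)"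
  have lim0: "(\<lambda>n. 2 * sqrt (9216 / real (Suc n))) \<longlonglongrightarrow> 0" by real_asymp
  have bound: "nL2 (\<lambda>z. f z * e b n z + e z0 n z * g z) \<le> 2 * sqrt (9216 / real (Suc n))"
    if "nL2 f \<le> sqrt (9216 / real (Suc n))" "nL2 g \<le> sqrt (9216 / real (Suc n))" "L2 f" "L2 g" for f g n
  proof -
    have m: "e c n \<in> borel_measurable borel" for c using tf_continuous(1)[OF e(1)] by (rule borel_measurable_continuous_onI)
    have mm: "(\<lambda>z. f z * e b n z) \<in> borel_measurable borel" "(\<lambda>z. e z0 n z * g z) \<in> borel_measurable borel"
      using m L2_meas that by measurable
    have b: "norm (f z * e b n z) \<le> 1 * norm (f z)" "norm (e z0 n z * g z) \<le> 1 * norm (g z)" for z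
      using mult_left_mono[OF e1, of "norm (f z)" b n z] mult_right_mono[OF e1, of "norm (g z)" z0 n z] by (auto simp: norm_mult)
    have L: "L2 (\<lambda>z. f z * e b n z)" "L2 (\<lambda>z. e z0 n z * g z)"
      by (rule L2_bound[OF that(3) mm(1) b(1)], rule L2_bound[OF that(4) mm(2) b(2)])
    have "nL2 (\<lambda>z. f z * e b n z) \<le> 1 * nL2 f" "nL2 (\<lambda>z. e z0 n z * g z) \<le> 1 * nL2 g"
      using nL2_bound[OF that(3) mm(1), of 1] nL2_bound[OF that(4) mm(2), of 1] b by auto
    then show ?thesis using L2_add(2)[OF L] that(1,2) by linarith
  qed
  show thesis
  proof (rule that)
    show "tf (-{z0, b}) (\<eta> n) (A n) (B n)" for n
    proof -
      have "-{z0, b} = -{z0} \<inter> -{b}" by auto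
      then show ?thesis using tf_times[OF e(1)[of z0 n] e(1)[of b n]] unfolding \<eta>_def A_def B_def by simp
    qed
    show "norm (\<eta> n z) \<le> 1" for n z
      using mult_mono[OF e1[of z0 n z] e1[of b n z]] by (simp add: \<eta>_def norm_mult)
    show "(\<lambda>n. \<eta> n z) \<longlonglongrightarrow> 1" if "z \<notin> {z0, b}" for z
      using tendsto_mult[OF lim1[of z z0] lim1[of z b]] that by (auto simp: \<eta>_def)
    show "(\<lambda>n. nL2 (A n)) \<longlonglongrightarrow> 0" "(\<lambda>n. nL2 (B n)) \<longlonglongrightarrow> 0"
      unfolding A_def B_def
      by (rule Lim_null_comparison[OF _ lim0], rule always_eventually,
          simp del: of_nat_Suc, intro allI bound e tf_L2(2,3)[OF e(1)])+
  qed
qed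

section \<open>The energy estimate\<close>

lemma kernel_L2:
  fixes z0 :: complex
  assumes "d > 0"
  defines "K \<equiv> (\<lambda>z. indicator {z. d \<le> norm (z - z0)} z / (z - z0)\<^sup>2 :: complex)"
  shows "L2 K" "(nL2 K)\<^sup>2 \<le> 22 / d\<^sup>2"
proof -
  have [measurable]: "{z. d \<le> norm (z - z0)} \<in> sets borel"
    by (intro borel_closed closed_Collect_le continuous_intros)
  have [measurable]: "K \<in> borel_measurable borel" unfolding K_def by measurable
  \<comment> \<open>Dyadic annuli d 2^j \<le> |z - z0| < d 2^(j + 1). With pi < 4 the geometric
    series sums to 16 / d^2 * 4/3 = 64 / (3 d^2), hence the constant 22.\<close>
  define g where "g = (\<lambda>j z. ennreal (1 / (d * 2 ^ j) ^ 4) * indicator (ball z0 (d * 2 ^ (j + 1))) z)"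
  have pt: "ennreal ((norm (K z))\<^sup>2) \<le> (\<Sum>j. g j z)" for z
  proof (cases "d \<le> norm (z - z0)")
    case True
    define x where "x = norm (z - z0)"
    define j where "j = nat \<lfloor>log 2 (x / d)\<rfloor>"
    have xd: "x / d \<ge> 1" "x > 0" using True assms by (auto simp: x_def)
    have "0 \<le> log 2 (x / d)" using xd by simp
    then have fl: "real j = \<lfloor>log 2 (x / d)\<rfloor>" by (simp add: j_def)
    have l: "real j \<le> log 2 (x / d)" "log 2 (x / d) < real j + 1" unfolding fl by linarith+
    have "2 ^ j \<le> x / d" using l(1) xd by (simp add: le_log_iff powr_realpow)
    moreover have "x / d < 2 ^ (j + 1)"
    proof -
      have "x / d < 2 powr (real j + 1)" using l(2) xd by (simp add: log_less_iff)
      also have "\<dots> = 2 ^ (j + 1)" by (simp add: powr_add powr_realpow)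
      finally show ?thesis .
    qed
    ultimately have b: "d * 2 ^ j \<le> x" "x < d * 2 ^ (j + 1)" using assms by (simp_all add: field_simps)
    have "(norm (K z))\<^sup>2 = 1 / x ^ 4" using True by (simp add: K_def x_def norm_divide norm_power power_divide flip: power_mult)
    also have "\<dots> \<le> 1 / (d * 2 ^ j) ^ 4"
      using b(1) assms xd by (intro divide_left_mono power_mono mult_pos_pos) auto
    finally have "ennreal ((norm (K z))\<^sup>2) \<le> g j z"
      using b(2) by (simp add: g_def x_def dist_norm norm_minus_commute ennreal_leI)
    also have "\<dots> \<le> (\<Sum>j. g j z)"
      using sum_le_suminf[of "\<lambda>j. g j z" "{j}"] by simp
    finally show ?thesis .
  qed (simp add: K_def)
  have [measurable]: "ball z0 r \<in> sets borel" for r by simp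
  have [measurable]: "g j \<in> borel_measurable borel" for j unfolding g_def by measurable
  have "(\<integral>\<^sup>+z. ennreal ((norm (K z))\<^sup>2) \<partial>lborel) \<le> (\<integral>\<^sup>+z. (\<Sum>j. g j z) \<partial>lborel)"
    by (rule nn_integral_mono) (rule pt)
  also have "\<dots> = (\<Sum>j. \<integral>\<^sup>+z. g j z \<partial>lborel)" by (rule nn_integral_suminf) measurable
  also have "\<dots> \<le> (\<Sum>j. ennreal (16 / d\<^sup>2 * (1 / 4) ^ j))"
  proof (rule suminf_le)
    fix j
    have "(\<integral>\<^sup>+z. g j z \<partial>lborel) = ennreal (1 / (d * 2 ^ j) ^ 4) * ennreal (pi * (d * 2 ^ (j + 1))\<^sup>2)"
      unfolding g_def using assms by (subst nn_integral_cmult_indicator) (auto simp: measure_ball_complex)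
    also have "\<dots> = ennreal (pi * (4 / d\<^sup>2 * (1 / 4) ^ j))"
    proof -
      have "1 / (d * 2 ^ j) ^ 4 * (pi * (d * 2 ^ (j + 1))\<^sup>2) = pi * (4 / d\<^sup>2 * (1 / 4) ^ j)"
      proof -
        have "(4::real) ^ j = (2 ^ j)\<^sup>2" by (simp add: power2_eq_square flip: power_mult_distrib)
        then show ?thesis using assms by (simp add: power_one_over power_mult_distrib field_simps)
      qed
      then show ?thesis by (simp flip: ennreal_mult')
    qed
    also have "\<dots> \<le> ennreal (16 / d\<^sup>2 * (1 / 4) ^ j)"
    proof (rule ennreal_leI)
      have "pi * (4 / d\<^sup>2 * (1 / 4) ^ j) \<le> 4 * (4 / d\<^sup>2 * (1 / 4) ^ j)"
        using pi_less_4 by (intro mult_right_mono) auto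
      then show "pi * (4 / d\<^sup>2 * (1 / 4) ^ j) \<le> 16 / d\<^sup>2 * (1 / 4) ^ j" by simp
    qed
    finally show "(\<integral>\<^sup>+z. g j z \<partial>lborel) \<le> ennreal (16 / d\<^sup>2 * (1 / 4) ^ j)" .
  qed auto
  also have "\<dots> = ennreal (\<Sum>j. 16 / d\<^sup>2 * (1 / 4) ^ j)"
    by (rule suminf_ennreal_eq) (auto intro!: summable_sums summable_mult summable_geometric)
  also have "(\<Sum>j. 16 / d\<^sup>2 * (1 / 4 :: real) ^ j) = 16 / d\<^sup>2 * (4 / 3)"
    by (subst suminf_mult) (auto simp: suminf_geometric intro!: summable_geometric)
  also have "ennreal (16 / d\<^sup>2 * (4 / 3)) \<le> ennreal (22 / d\<^sup>2)"
    using assms by (intro ennreal_leI) (simp add: field_simps)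
  finally have le: "(\<integral>\<^sup>+z. ennreal ((norm (K z))\<^sup>2) \<partial>lborel) \<le> ennreal (22 / d\<^sup>2)" .
  then have i: "integrable lborel (\<lambda>z. (norm (K z))\<^sup>2)"
    by (intro integrableI_bounded) (auto simp: le_less_trans)
  then show "L2 K" by (simp add: L2_def)
  have "ennreal ((nL2 K)\<^sup>2) \<le> ennreal (22 / d\<^sup>2)"
    using i le by (simp add: nL2_power2 nn_integral_eq_integral)
  then show "(nL2 K)\<^sup>2 \<le> 22 / d\<^sup>2" by (subst (asm) ennreal_le_iff) auto
qed

text \<open>Equal to pi, by polar coordinates. The formula is what rescaling by \<open>d\<close>
  makes of the integral in \<open>derivative_extraction\<close>; as the Schwarzian is later divided
  by it, it has to be nonzero.\<close>

definition bump_const :: complex where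
  "bump_const = (LINT y|lborel. complex_of_real (- 4 * tau' (4 * (norm (y::complex))\<^sup>2 - 1)))"

lemma bump_const_nonzero: "bump_const \<noteq> 0"
proof
  assume z: "bump_const = 0"
  have c: "continuous_on UNIV (\<lambda>y::complex. complex_of_real (- 4 * tau' (4 * (norm y)\<^sup>2 - 1)))"
    by (intro continuous_intros continuous_on_compose2[OF continuous_tau'[of UNIV]]) auto
  have s: "complex_of_real (- 4 * tau' (4 * (norm y)\<^sup>2 - 1)) = 0" if "y \<notin> cball 0 1" for y :: complex
  proof -
    have "(norm y)\<^sup>2 \<ge> 1" using that by (simp add: one_le_power)
    then show ?thesis by (simp add: tau_props(6))
  qed
  have ic: "integrable lborel (\<lambda>y::complex. complex_of_real (- 4 * tau' (4 * (norm y)\<^sup>2 - 1)))"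
    by (rule integrable_compact_support[OF c compact_cball s])
  then have i: "integrable lborel (\<lambda>y::complex. - 4 * tau' (4 * (norm y)\<^sup>2 - 1))"
    using integrable_Re[OF ic] by simp
  have "(LINT y|lborel. - 4 * tau' (4 * (norm (y::complex))\<^sup>2 - 1)) = 0"
    using z unfolding bump_const_def integral_complex_of_real by (simp only: of_real_eq_0_iff)
  then have "AE y in lborel. - 4 * tau' (4 * (norm (y::complex))\<^sup>2 - 1) = 0"
    using i by (subst (asm) integral_nonneg_eq_0_iff_AE) (use tau_props(8) in auto)
  define S where "S = {y::complex. 1 < 4 * (norm y)\<^sup>2 \<and> 4 * (norm y)\<^sup>2 < 2}"
  have oS: "open S" unfolding S_def by (intro open_Collect_conj open_Collect_less continuous_intros)
  have "AE y in lborel. y \<notin> S"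
    using \<open>AE y in lborel. - 4 * tau' (4 * (norm (y::complex))\<^sup>2 - 1) = 0\<close>
  proof eventually_elim
    case (elim y)
    then show ?case using tau_props(9)[of "4 * (norm y)\<^sup>2 - 1"] by (auto simp: S_def)
  qed
  then have "S \<in> null_sets lborel" using oS by (subst AE_iff_null_sets) auto
  then have "negligible S" by (simp add: negligible_iff_null_sets null_sets_completionI)
  then have "S = {}" using oS open_not_negligible by blast
  moreover have "of_real (3/5) \<in> S" by (simp add: S_def power2_eq_square norm_divide)
  ultimately show False by blast
qed


text \<open>Two divided differences. The remainder \<open>H\<close> stays holomorphic at
  \<open>z0\<close>, so that Stokes applies to it.\<close>

lemma double_pole_lemma:
  assumes "f holomorphic_on ball z0 d" "d > 0"
  obtains H where "H holomorphic_on ball z0 d"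
    "\<And>z. z \<in> ball z0 d \<Longrightarrow> f z = f z0 + (z - z0) * deriv f z0 + (z - z0)\<^sup>2 * H z"
proof -
  define g where "g = (\<lambda>z. if z = z0 then deriv f z0 else (f z - f z0) / (z - z0))"
  have g: "g holomorphic_on ball z0 d" unfolding g_def by (rule pole_lemma[OF assms(1)]) (use assms(2) in auto)
  define H where "H = (\<lambda>z. if z = z0 then deriv g z0 else (g z - g z0) / (z - z0))"
  have H: "H holomorphic_on ball z0 d" unfolding H_def by (rule pole_lemma[OF g]) (use assms(2) in auto)
  have "f z = f z0 + (z - z0) * deriv f z0 + (z - z0)\<^sup>2 * H z" for z
  proof (cases "z = z0")
    case False
    have "f z = f z0 + (z - z0) * g z" using False by (simp add: g_def)
    moreover have "g z = deriv f z0 + (z - z0) * H z" using False by (simp add: H_def g_def)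
    ultimately show ?thesis by (simp add: power2_eq_square algebra_simps)
  qed simp
  then show thesis using that H by blast
qed

text \<open>The radial bump \<open>\<kappa>\<close> below extracts \<open>deriv E z0\<close> from
  \<open>E\<close>: the constant term integrates to 0 by oddness and the higher terms by Stokes.\<close>

lemma derivative_extraction:
  fixes z0 :: complex
  assumes d: "d > 0" and E: "E holomorphic_on ball z0 d"
  defines "T \<equiv> (\<lambda>z. complex_of_real (4 / d\<^sup>2 * tau' (4 * (norm (z - z0))\<^sup>2 / d\<^sup>2 - 1)))"
  assumes F: "\<And>z. z \<in> ball z0 d - {z0, b} \<Longrightarrow> F z = E z" and mF: "(\<lambda>z. F z * (- T z / (z - z0))) \<in> borel_measurable borel"
  shows "(LINT z|lborel. F z * (- T z / (z - z0))) = bump_const * deriv E z0"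
proof -
  define \<kappa> where "\<kappa> = (\<lambda>z. complex_of_real (tau (4 * (norm (z - z0))\<^sup>2 / d\<^sup>2 - 1)))"
  have wk: "wirt \<kappa> (T z * cnj (z - z0)) (T z * (z - z0)) z" for z
  proof -
    have "((\<lambda>r. tau (4 * r / d\<^sup>2 - 1)) has_real_derivative tau' (4 * r / d\<^sup>2 - 1) * (4 / d\<^sup>2)) (at r)" for r
      by (rule DERIV_chain2[where f = tau, OF tau_deriv])
        (use DERIV_diff[OF DERIV_cdivide[OF DERIV_cmult_Id[of 4 r], of "d\<^sup>2"] DERIV_const[of 1]] in simp)
    from wirt_chain_real[OF wirt_norm_sq[of z0 z] this] show ?thesis
      unfolding \<kappa>_def T_def by (simp add: mult_ac)
  qed
  \<comment> \<open>The bump vanishes for |z - z0| \<ge> d / sqrt 2, and 3/4 lies between 1 / sqrt 2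
    and 1.\<close>
  have big: "4 * (norm (z - z0))\<^sup>2 / d\<^sup>2 - 1 \<ge> 1" if "z \<notin> cball z0 (3/4 * d)" for z
  proof -
    have "3/4 * d \<le> norm (z - z0)" using that by (simp add: dist_norm norm_minus_commute)
    then have "(3/4 * d)\<^sup>2 \<le> (norm (z - z0))\<^sup>2" using d by (intro power_mono) auto
    then have "9/16 * d\<^sup>2 \<le> (norm (z - z0))\<^sup>2" by (simp add: power2_eq_square)
    then have "2 * d\<^sup>2 \<le> 4 * (norm (z - z0))\<^sup>2" using zero_le_power2[of d] by linarith
    then show ?thesis using d by (simp add: pos_le_divide_eq algebra_simps)
  qed
  have T0: "T z = 0" "\<kappa> z = 0" if "z \<notin> cball z0 (3/4 * d)" for z
    using big[OF that] by (auto simp: T_def \<kappa>_def tau_props)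
  have small: "T z = 0" if "z \<in> ball z0 (d/2)" for z
  proof -
    have "norm (z - z0) \<le> d/2" using that by (simp add: dist_norm norm_minus_commute)
    then have "(norm (z - z0))\<^sup>2 \<le> (d/2)\<^sup>2" by (intro power_mono) auto
    then have "4 * (norm (z - z0))\<^sup>2 \<le> d\<^sup>2" by (simp add: power2_eq_square)
    then have "4 * (norm (z - z0))\<^sup>2 / d\<^sup>2 - 1 \<le> 0" using d by (simp add: divide_le_eq_1_pos)
    then show ?thesis by (simp add: T_def tau_props)
  qed
  have cT: "continuous_on S T" for S unfolding T_def
    using d by (intro continuous_intros continuous_on_compose2[OF continuous_tau'[of UNIV]]) auto
  have tk: "tf (ball z0 d) \<kappa> (\<lambda>z. T z * cnj (z - z0)) (\<lambda>z. T z * (z - z0))"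
    unfolding tf_def
    by (intro conjI allI wk exI[of _ "cball z0 (3/4 * d)"]) (use T0 d in \<open>auto intro!: continuous_intros cT\<close>)
  obtain H where H: "H holomorphic_on ball z0 d"
    "\<And>z. z \<in> ball z0 d \<Longrightarrow> E z = E z0 + (z - z0) * deriv E z0 + (z - z0)\<^sup>2 * H z"
    using double_pole_lemma[OF E d] by metis
  have cH: "continuous_on (ball z0 d) H" by (rule holomorphic_on_imp_continuous_on[OF H(1)])
  have IH: "integrable lborel (\<lambda>z. H z * (T z * (z - z0)))" by (rule tf_times_continuous(9)[OF tk open_ball cH])
  \<comment> \<open>\<open>T z * (z - z0)\<close> is the conjugate-derivative of \<kappa>, so that
    the integrand is that of H \<kappa>.\<close>
  have H0: "(LINT z|lborel. H z * (T z * (z - z0))) = 0"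
  proof -
    have "wirt H (deriv H z) 0 z" if "z \<in> ball z0 d" for z
      by (rule wirt_holomorphic[OF holomorphic_derivI[OF H(1) open_ball that]])
    from tf_integral_zero(2)[OF tf_mult[OF tk open_ball this]] show ?thesis
      using H(1) by (simp add: mult.commute holomorphic_on_imp_continuous_on holomorphic_deriv)
  qed
  have IT: "integrable lborel T" by (rule integrable_compact_support[OF cT compact_cball T0(1)])
  have mT: "T \<in> borel_measurable borel" by (rule borel_measurable_continuous_onI[OF cT])
  have T1: "(LINT z|lborel. T z) = - bump_const"
  proof -
    have "(LINT z|lborel. T z) = d\<^sup>2 *\<^sub>R (LINT z|lborel. T (z0 + of_real d * z))"
      by (rule lborel_integral_affine_complex[OF mT]) (use d in auto)
    also have "\<dots> = (LINT z|lborel. of_real (d\<^sup>2) * T (z0 + of_real d * z))"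
      unfolding scaleR_conv_of_real by (rule integral_mult_right_zero[symmetric])
    also have "\<dots> = (LINT z|lborel. - complex_of_real (- 4 * tau' (4 * (norm (z::complex))\<^sup>2 - 1)))"
    proof (rule Bochner_Integration.integral_cong[OF refl])
      fix z :: complex
      have "4 * (norm (z0 + of_real d * z - z0))\<^sup>2 / d\<^sup>2 - 1 = 4 * (norm z)\<^sup>2 - 1"
        using d by (simp add: norm_mult power_mult_distrib)
      then have "of_real (d\<^sup>2) * T (z0 + of_real d * z) = complex_of_real (d\<^sup>2 * (4 / d\<^sup>2 * tau' (4 * (norm z)\<^sup>2 - 1)))"
        unfolding T_def of_real_mult by (simp only:)
      then show "of_real (d\<^sup>2) * T (z0 + of_real d * z) = - complex_of_real (- 4 * tau' (4 * (norm z)\<^sup>2 - 1))"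
        using d by simp
    qed
    also have "\<dots> = - bump_const" unfolding bump_const_def by (rule integral_minus)
    finally show ?thesis .
  qed
  have TE: "continuous_on UNIV (\<lambda>z. T z / (z - z0))"
  proof -
    have "continuous_on (ball z0 (d/2) \<union> -{z0}) (\<lambda>z. T z / (z - z0))"
    proof (rule continuous_on_open_Un)
      show "continuous_on (ball z0 (d/2)) (\<lambda>z. T z / (z - z0))"
        by (rule continuous_on_eq[OF continuous_on_const[of _ 0]]) (use small in auto)
      show "continuous_on (-{z0}) (\<lambda>z. T z / (z - z0))" by (intro continuous_intros cT) auto
    qed auto
    moreover have "ball z0 (d/2) \<union> -{z0} = UNIV" using d by auto
    ultimately show ?thesis by simp
  qed
  have ITE: "integrable lborel (\<lambda>z. T z / (z - z0))"
    by (rule integrable_compact_support[OF TE compact_cball[of z0 "3/4 * d"]]) (use T0 in auto)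
  \<comment> \<open>The reflection of \<open>z\<close> in \<open>z0\<close> changes the sign of the
    integrand.\<close>
  have TE0: "(LINT z|lborel. T z / (z - z0)) = 0"
  proof -
    have "(LINT z|lborel. T z / (z - z0)) = (-1)\<^sup>2 *\<^sub>R (LINT z|lborel. T (2 * z0 + of_real (-1) * z) / (2 * z0 + of_real (-1) * z - z0))"
      by (rule lborel_integral_affine_complex[OF borel_measurable_continuous_onI[OF TE]]) simp
    also have "\<dots> = (LINT z|lborel. - (T z / (z - z0)))"
    proof -
      have "T (2 * z0 + of_real (-1) * z) / (2 * z0 + of_real (-1) * z - z0) = - (T z / (z - z0))" for z
      proof -
        have e: "2 * z0 + of_real (-1) * z - z0 = - (z - z0)" by simp
        have t: "T (2 * z0 + of_real (-1) * z) = T z" unfolding T_def e by (simp only: norm_minus_cancel)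
        show ?thesis unfolding t e by (rule divide_minus_right)
      qed
      then show ?thesis by simp
    qed
    also have "\<dots> = - (LINT z|lborel. T z / (z - z0))" by (rule integral_minus)
    finally show ?thesis by simp
  qed
  have "(LINT z|lborel. F z * (- T z / (z - z0))) = (LINT z|lborel. - E z0 * (T z / (z - z0)) - (deriv E z0 * T z + H z * (T z * (z - z0))))"
  proof (rule integral_cong_AE)
    have "AE z in lborel. z \<notin> {z0, b}"
      using AE_lborel_singleton[of z0] AE_lborel_singleton[of b] by eventually_elim auto
    then show "AE z in lborel. F z * (- T z / (z - z0)) = - E z0 * (T z / (z - z0)) - (deriv E z0 * T z + H z * (T z * (z - z0)))"
    proof eventually_elim
      case (elim z)
      show ?case
      proof (cases "z \<in> ball z0 d")
        case True
        then have "F z = E z" using F elim by auto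
        moreover have "(e0 + x * e1 + x\<^sup>2 * h) * (- t / x) = - e0 * (t / x) - (e1 * t + h * (t * x))"
          if "x \<noteq> 0" for x e0 e1 h t :: complex
          using that by (simp add: field_simps power2_eq_square)
        ultimately show ?thesis using H(2)[OF True] elim by simp
      next
        case False
        then have "z \<notin> cball z0 (3/4 * d)" using d by auto
        then show ?thesis using T0 by simp
      qed
    qed
    show "(\<lambda>z. - E z0 * (T z / (z - z0)) - (deriv E z0 * T z + H z * (T z * (z - z0)))) \<in> borel_measurable lborel"
      using borel_measurable_integrable[OF IH] borel_measurable_integrable[OF IT] borel_measurable_integrable[OF ITE] by measurable
  qed (use mF in simp)
  also have "\<dots> = bump_const * deriv E z0"
  proof -
    have i: "integrable lborel (\<lambda>z. - E z0 * (T z / (z - z0)))" "integrable lborel (\<lambda>z. deriv E z0 * T z)"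
      by (rule integrable_mult_right[OF ITE], rule integrable_mult_right[OF IT])
    show ?thesis
      unfolding Bochner_Integration.integral_diff[OF i(1) Bochner_Integration.integrable_add[OF i(2) IH]]
        Bochner_Integration.integral_add[OF i(2) IH] integral_mult_right_zero H0 TE0 T1 by simp
  qed
  finally show ?thesis .
qed

text \<open>The equation for \<open>E\<close> and the equality of the norms of its two derivatives
  give |E_z| \<le> k N / (1 - k) in L2, with N the norm of the kernel. Testing the equation with 1 /
  (z - z0)^2, smoothed at \<open>z0\<close>, extracts the derivative of \<open>E2\<close> on one
  side. On the other side it yields the integral of m / (z - z0)^4 minus a pairing of m K with E_z,
  at most k N * k N / (1 - k). The logarithmic cutoffs make \<open>E\<close> compactly supported, at
  a cost that tends to 0 because \<open>E\<close> is bounded.\<close>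

lemma energy_estimate:
  fixes z0 b :: complex
  assumes z0: "norm z0 < 1" and w: "weakd (-{z0, b}) E pE qE"
    and bd: "\<And>z. z \<notin> {z0, b} \<Longrightarrow> norm (E z) \<le> M" and mE: "E \<in> borel_measurable borel"
    and eq: "AE z in lborel. qE z = m z * (pE z - 1 / (z - z0)\<^sup>2)"
    and m: "m \<in> borel_measurable borel" "AE z in lborel. norm (m z) \<le> k" "\<And>z. norm z \<le> 1 \<Longrightarrow> m z = 0" "0 \<le> k" "k < 1"
    and E2: "E2 holomorphic_on ball z0 (1 - norm z0)" "\<And>z. z \<in> ball z0 (1 - norm z0) - {z0, b} \<Longrightarrow> E z = E2 z"
  shows "norm (bump_const * deriv E2 z0 - (LINT z|lborel. m z / (z - z0)^4)) \<le> k\<^sup>2 * (22 / (1 - norm z0)\<^sup>2) / (1 - k)"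
proof -
  define d where "d = 1 - norm z0"
  have d: "d > 0" using z0 by (simp add: d_def)
  define V where "V = - {z0, b}"
  have oV: "open V" unfolding V_def by (auto intro: open_Compl finite_imp_closed)
  \<comment> \<open>Where \<open>m\<close> lives, |z| > 1 forces |z - z0| > d, so that
    \<open>K\<close> may replace 1 / (z - z0)^2 in the equation; unlike the latter it is in
    L2.\<close>
  define K where "K = (\<lambda>z. indicator {z. d \<le> norm (z - z0)} z / (z - z0)\<^sup>2 :: complex)"
  define N where "N = nL2 K"
  have LK: "L2 K" and N2: "N\<^sup>2 \<le> 22 / d\<^sup>2" using kernel_L2[OF d, of z0] by (auto simp: K_def N_def)
  have N0: "N \<ge> 0" by (simp add: N_def)
  have Kext: "K z = 1 / (z - z0)\<^sup>2" if "norm z > 1" for z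
    using that norm_triangle_ineq2[of z z0] by (simp add: K_def d_def)
  have mK: "m z * K z = m z * (1 / (z - z0)\<^sup>2)" for z
    using Kext[of z] m(3)[of z] by (cases "norm z > 1") auto
  have [measurable]: "m \<in> borel_measurable borel" "K \<in> borel_measurable borel" using m(1) LK by (auto simp: L2_def)
  have wV: "weakd V E pE qE" using w by (simp add: V_def)
  have W: "continuous_on V E" "locL2 V pE" "locL2 V qE" using wV by (auto simp: weakd_def)
  have [measurable]: "pE \<in> borel_measurable borel" "qE \<in> borel_measurable borel" using W by (auto simp: locL2_def)
  have M: "M \<ge> 0"
  proof -
    have "infinite (UNIV :: complex set)" by (rule infinite_UNIV_char_0)
    then obtain z where "z \<notin> {z0, b}" by (metis ex_new_if_finite finite.emptyI finite_insert)
    then show ?thesis using bd[of z] norm_ge_zero order_trans by blast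
  qed
  obtain \<eta> ea eb :: "nat \<Rightarrow> complex \<Rightarrow> complex" where
    \<eta>: "\<And>n. tf V (\<eta> n) (ea n) (eb n)" "\<And>n z. norm (\<eta> n z) \<le> 1"
    "\<And>z. z \<in> V \<Longrightarrow> (\<lambda>n. \<eta> n z) \<longlonglongrightarrow> 1" "(\<lambda>n. nL2 (ea n)) \<longlonglongrightarrow> 0" "(\<lambda>n. nL2 (eb n)) \<longlonglongrightarrow> 0"
    using two_point_cutoffs[of z0 b] unfolding V_def by (metis ComplD)
  have [measurable]: "\<eta> n \<in> borel_measurable borel" "ea n \<in> borel_measurable borel" "eb n \<in> borel_measurable borel" for n
    using tf_continuous[OF \<eta>(1)[of n]] by (auto intro: borel_measurable_continuous_onI)
  define X where "X = (\<lambda>n. nL2 (\<lambda>z. pE z * \<eta> n z))"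
  define e where "e = (\<lambda>n. nL2 (ea n) + nL2 (eb n))"
  have Ee: "L2 (\<lambda>z. E z * ea n z)" "L2 (\<lambda>z. E z * eb n z)" "nL2 (\<lambda>z. E z * ea n z) \<le> M * nL2 (ea n)"
    "nL2 (\<lambda>z. E z * eb n z) \<le> M * nL2 (eb n)" for n
  proof -
    note tc = tf_times_continuous[OF \<eta>(1)[of n] oV W(1)]
    show "L2 (\<lambda>z. E z * ea n z)" "L2 (\<lambda>z. E z * eb n z)" by (rule tc)+
    obtain Ks where Ks: "Ks \<subseteq> V" "\<And>z. z \<notin> Ks \<Longrightarrow> ea n z = 0" "\<And>z. z \<notin> Ks \<Longrightarrow> eb n z = 0"
      using tf_support[OF \<eta>(1)[of n]] by metis
    have "norm (E z * ea n z) \<le> M * norm (ea n z)" "norm (E z * eb n z) \<le> M * norm (eb n z)" for z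
      using bd[of z] Ks(2,3)[of z] Ks(1) by (cases "z \<in> Ks"; auto simp: norm_mult V_def intro!: mult_right_mono)+
    then show "nL2 (\<lambda>z. E z * ea n z) \<le> M * nL2 (ea n)" "nL2 (\<lambda>z. E z * eb n z) \<le> M * nL2 (eb n)"
      using tf_L2(2,3)[OF \<eta>(1)[of n]] M L2_meas[OF tc(5)] L2_meas[OF tc(6)] by (auto intro!: nL2_bound)
  qed
  \<comment> \<open>\<open>weakd_norm_eq\<close> for the truncated function gives X \<le> k (X + N)
    + M e, where M e is the price of the cutoff. The cutoff also makes \<open>X n\<close> finite, so
    that k X can be absorbed on the left.\<close>
  have Xb: "X n \<le> (k * N + M * e n) / (1 - k)" for n
  proof -
    note wc = weakd_cutoff[OF wV \<eta>(1)[of n]]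
    obtain Ks where Ks: "compact Ks" "\<And>z. z \<notin> Ks \<Longrightarrow> \<eta> n z = 0" using \<eta>(1)[of n] unfolding tf_def by auto
    have eqn: "nL2 (\<lambda>z. pE z * \<eta> n z + E z * ea n z) = nL2 (\<lambda>z. qE z * \<eta> n z + E z * eb n z)"
      by (rule weakd_norm_eq[OF wc(1) Ks(1) _ wc(4,5)]) (use Ks in auto)
    have "X n = nL2 (\<lambda>z. (pE z * \<eta> n z + E z * ea n z) - E z * ea n z)" by (simp add: X_def)
    also have "\<dots> \<le> nL2 (\<lambda>z. pE z * \<eta> n z + E z * ea n z) + nL2 (\<lambda>z. E z * ea n z)"
      by (rule L2_diff(2)[OF wc(4) Ee(1)])
    also have "\<dots> \<le> (nL2 (\<lambda>z. qE z * \<eta> n z) + nL2 (\<lambda>z. E z * eb n z)) + nL2 (\<lambda>z. E z * ea n z)"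
      unfolding eqn by (intro add_right_mono L2_add(2)[OF wc(3) Ee(2)])
    finally have 1: "X n \<le> nL2 (\<lambda>z. qE z * \<eta> n z) + M * e n" using Ee(3,4)[of n] by (simp add: e_def algebra_simps)
    have LKn: "L2 (\<lambda>z. K z * \<eta> n z)" and nK: "nL2 (\<lambda>z. K z * \<eta> n z) \<le> 1 * N"
    proof -
      have b: "norm (K z * \<eta> n z) \<le> 1 * norm (K z)" for z
        using mult_left_mono[OF \<eta>(2), of "norm (K z)"] by (simp add: norm_mult)
      show "L2 (\<lambda>z. K z * \<eta> n z)" by (rule L2_bound[OF LK _ b]) measurable
      show "nL2 (\<lambda>z. K z * \<eta> n z) \<le> 1 * N" unfolding N_def by (rule nL2_bound[OF LK]) (use b in auto)
    qed
    have "nL2 (\<lambda>z. qE z * \<eta> n z) \<le> k * nL2 (\<lambda>z. pE z * \<eta> n z - K z * \<eta> n z)"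
    proof (rule nL2_bound[OF L2_diff(1)[OF wc(2) LKn]])
      show "AE z in lborel. norm (qE z * \<eta> n z) \<le> k * norm (pE z * \<eta> n z - K z * \<eta> n z)"
        using eq m(2)
      proof eventually_elim
        case (elim z)
        have "qE z * \<eta> n z = m z * (pE z * \<eta> n z - K z * \<eta> n z)"
          unfolding elim(1) right_diff_distrib mK[symmetric] by (simp add: algebra_simps)
        then show ?case using elim(2) by (simp add: norm_mult mult_right_mono)
      qed
    qed (use m in auto)
    also have "\<dots> \<le> k * (X n + N)"
      using L2_diff(2)[OF wc(2) LKn] nK m(4) unfolding X_def by (intro mult_left_mono) auto
    finally have "X n \<le> k * (X n + N) + M * e n" using 1 by simp
    then have "X n * (1 - k) \<le> k * N + M * e n" by (simp add: algebra_simps)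
    then show ?thesis using m(5) by (simp add: pos_le_divide_eq)
  qed
  define T where "T = (\<lambda>z. complex_of_real (4 / d\<^sup>2 * tau' (4 * (norm (z - z0))\<^sup>2 / d\<^sup>2 - 1)))"
  define \<kappa> where "\<kappa> = (\<lambda>z. complex_of_real (tau (4 * (norm (z - z0))\<^sup>2 / d\<^sup>2 - 1)))"
  \<comment> \<open>The factor \<open>1 - \<kappa> z\<close> removes the singularity at
    \<open>z0\<close> without changing the kernel on the exterior. The conjugate-derivative of
    \<psi> is - T / (z - z0), the weight in \<open>derivative_extraction\<close>.\<close>
  define \<psi> where "\<psi> = (\<lambda>z. (1 - \<kappa> z) * (1 / (z - z0)\<^sup>2))"
  have cT: "continuous_on S T" for S unfolding T_def
    using d by (intro continuous_intros continuous_on_compose2[OF continuous_tau'[of UNIV]]) auto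
  have wk: "wirt \<kappa> (T z * cnj (z - z0)) (T z * (z - z0)) z" for z
  proof -
    have "((\<lambda>r. tau (4 * r / d\<^sup>2 - 1)) has_real_derivative tau' (4 * r / d\<^sup>2 - 1) * (4 / d\<^sup>2)) (at r)" for r
      by (rule DERIV_chain2[where f = tau, OF tau_deriv])
        (use DERIV_diff[OF DERIV_cdivide[OF DERIV_cmult_Id[of 4 r], of "d\<^sup>2"] DERIV_const[of 1]] in simp)
    from wirt_chain_real[OF wirt_norm_sq[of z0 z] this] show ?thesis
      unfolding \<kappa>_def T_def by (simp add: mult_ac)
  qed
  have c\<kappa>: "continuous_on S \<kappa>" for S by (meson wk wirt_imp_continuous continuous_at_imp_continuous_on)
  have w\<psi>: "wirt \<psi> ((0 - T z * cnj (z - z0)) * (1 / (z - z0)\<^sup>2) + (1 - \<kappa> z) * (-2 / (z - z0)^3)) (- T z / (z - z0)) z" if z: "z \<in> V" for z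
  proof -
    have zz: "z \<noteq> z0" using z by (auto simp: V_def)
    have "((\<lambda>z. 1 / (z - z0)\<^sup>2) has_field_derivative (-2 / (z - z0)^3)) (at z)"
    proof -
      have "((\<lambda>y. 1 / y\<^sup>2) has_field_derivative (-2 / y^3)) (at y)" if "y \<noteq> 0" for y :: complex
        using that by (auto intro!: derivative_eq_intros simp: power2_eq_square power3_eq_cube field_simps)
      from DERIV_chain2[where f = "\<lambda>y. 1 / y\<^sup>2" and g = "\<lambda>z. z - z0" and x = z, OF this DERIV_diff[OF DERIV_ident DERIV_const]]
      show ?thesis using zz by simp
    qed
    moreover have "wirt (\<lambda>z. 1 - \<kappa> z) (0 - T z * cnj (z - z0)) (0 - T z * (z - z0)) z"
      using has_derivative_diff[OF wirt_const[of 1 z, unfolded wirt_def] wk[of z, unfolded wirt_def]]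
      unfolding wirt_def by (rule has_derivative_eq_rhs) (auto simp: algebra_simps)
    ultimately have "wirt \<psi> ((0 - T z * cnj (z - z0)) * (1 / (z - z0)\<^sup>2) + (1 - \<kappa> z) * (-2 / (z - z0)^3))
      ((0 - T z * (z - z0)) * (1 / (z - z0)\<^sup>2) + (1 - \<kappa> z) * 0) z"
      unfolding \<psi>_def by (intro wirt_mult wirt_holomorphic)
    moreover have "(0 - T z * (z - z0)) * (1 / (z - z0)\<^sup>2) + (1 - \<kappa> z) * 0 = - T z / (z - z0)"
      using zz by (simp add: power2_eq_square)
    ultimately show ?thesis by simp
  qed
  have c1: "continuous_on V (\<lambda>z. (0 - T z * cnj (z - z0)) * (1 / (z - z0)\<^sup>2) + (1 - \<kappa> z) * (-2 / (z - z0)^3))"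
    "continuous_on V (\<lambda>z. - T z / (z - z0))"
    by (auto intro!: continuous_intros cT c\<kappa> simp: V_def)
  have \<kappa>1: "\<kappa> z = 1" if "norm (z - z0) < d/2" for z
  proof -
    have "(norm (z - z0))\<^sup>2 \<le> (d/2)\<^sup>2" using that by (intro power_mono) auto
    then have "4 * (norm (z - z0))\<^sup>2 \<le> d\<^sup>2" by (simp add: power2_eq_square)
    then have "4 * (norm (z - z0))\<^sup>2 / d\<^sup>2 - 1 \<le> 0" using d by (simp add: divide_le_eq_1_pos)
    then show ?thesis by (simp add: \<kappa>_def tau_props)
  qed
  have \<kappa>b: "norm (1 - \<kappa> z) \<le> 1" for z
  proof -
    have "norm (1 - \<kappa> z) = \<bar>1 - tau (4 * (norm (z - z0))\<^sup>2 / d\<^sup>2 - 1)\<bar>"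
      unfolding \<kappa>_def by (metis norm_of_real of_real_1 of_real_diff)
    then show ?thesis using tau_props(3,4)[of "4 * (norm (z - z0))\<^sup>2 / d\<^sup>2 - 1"] by simp
  qed
  have \<kappa>0: "\<kappa> z = 0" if "norm z > 1" for z
  proof -
    have "d \<le> norm (z - z0)" using that norm_triangle_ineq2[of z z0] by (simp add: d_def)
    then have "d\<^sup>2 \<le> (norm (z - z0))\<^sup>2" using d by (intro power_mono) auto
    then have "2 * d\<^sup>2 \<le> 4 * (norm (z - z0))\<^sup>2" using zero_le_power2[of "norm (z - z0)"] by linarith
        then have "2 \<le> 4 * (norm (z - z0))\<^sup>2 / d\<^sup>2" using d by (simp only: pos_le_divide_eq zero_less_power)
    then show ?thesis by (simp add: \<kappa>_def tau_props)
  qed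
  have [measurable]: "T \<in> borel_measurable borel" "\<kappa> \<in> borel_measurable borel"
    using cT c\<kappa> by (auto intro: borel_measurable_continuous_onI)
  have [measurable]: "\<psi> \<in> borel_measurable borel" unfolding \<psi>_def by measurable
  define C where "C = nL2 \<psi>"
  have L\<psi>: "L2 \<psi>"
  proof (rule L2_bound[OF kernel_L2(1)[of "d/2" z0]])
    show "norm (\<psi> z) \<le> 1 * norm (indicator {z. d/2 \<le> norm (z - z0)} z / (z - z0)\<^sup>2 :: complex)" for z
    proof (cases "norm (z - z0) < d/2")
      case True then show ?thesis using \<kappa>1 by (simp add: \<psi>_def)
    next
      case False
      then show ?thesis using mult_right_mono[OF \<kappa>b[of z], of "norm (1 / (z - z0)\<^sup>2)"] by (simp add: \<psi>_def norm_mult norm_divide)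
    qed
  qed (use d in auto)
  \<comment> \<open>The weak equation tested with \<eta> n * \<psi>. On the left the derivative
    falls on \<psi> or on the cutoff; on the right qE is replaced by means of the Beltrami equation,
    where \<psi> = K.\<close>
  have main: "(LINT z|lborel. E z * (- T z / (z - z0)) * \<eta> n z) + (LINT z|lborel. E z * eb n z * \<psi> z) =
      (LINT z|lborel. m z * K z * K z * \<eta> n z) - (LINT z|lborel. m z * K z * (pE z * \<eta> n z))" 
    and int1: "integrable lborel (\<lambda>z. m z * K z * K z * \<eta> n z)" 
    and LmK: "L2 (\<lambda>z. m z * K z)" "nL2 (\<lambda>z. m z * K z) \<le> k * N" for n
  proof -
    note t = tf_mult[OF \<eta>(1)[of n] oV w\<psi> c1]
    have e1: "(LINT z|lborel. E z * (eb n z * \<psi> z + \<eta> n z * (- T z / (z - z0)))) = - (LINT z|lborel. qE z * (\<eta> n z * \<psi> z))"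
      using wV t unfolding weakd_def by blast
    have e2: "(LINT z|lborel. E z * (eb n z * \<psi> z + \<eta> n z * (- T z / (z - z0)))) =
       (LINT z|lborel. E z * (- T z / (z - z0)) * \<eta> n z) + (LINT z|lborel. E z * eb n z * \<psi> z)"
    proof -
      have i1: "integrable lborel (\<lambda>z. E z * eb n z * \<psi> z)" by (rule L2_mult_integrable[OF Ee(2) L\<psi>])
      have "continuous_on V (\<lambda>z. E z * (- T z / (z - z0)))" by (intro continuous_intros W(1) cT) (auto simp: V_def)
      from tf_times_continuous(7)[OF \<eta>(1) oV this]
      have i2: "integrable lborel (\<lambda>z. E z * (- T z / (z - z0)) * \<eta> n z)" .
      have "E z * (eb n z * \<psi> z + \<eta> n z * (- T z / (z - z0))) = E z * (- T z / (z - z0)) * \<eta> n z + E z * eb n z * \<psi> z" for z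
        by (simp only: distrib_left mult_ac add_ac)
      then show ?thesis using Bochner_Integration.integral_add[OF i2 i1] by (simp only:)
    qed
    have b: "AE z in lborel. norm (m z * K z) \<le> k * norm (K z)"
      using m(2) by eventually_elim (simp add: norm_mult mult_right_mono)
    have mm: "(\<lambda>z. m z * K z) \<in> borel_measurable borel" by measurable
    show LmK: "L2 (\<lambda>z. m z * K z)"
      unfolding L2_def
    proof
      show "integrable lborel (\<lambda>z. (norm (m z * K z))\<^sup>2)"
      proof (rule Bochner_Integration.integrable_bound)
        show "integrable lborel (\<lambda>z. k\<^sup>2 * (norm (K z))\<^sup>2)" using LK by (auto simp: L2_def)
        show "AE z in lborel. norm ((norm (m z * K z))\<^sup>2) \<le> norm (k\<^sup>2 * (norm (K z))\<^sup>2)"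
          using b by eventually_elim (auto simp flip: power_mult_distrib intro!: power_mono)
      qed measurable
    qed measurable
    show "nL2 (\<lambda>z. m z * K z) \<le> k * N" unfolding N_def by (rule nL2_bound[OF LK mm b m(4)])
    have LKn: "L2 (\<lambda>z. K z * \<eta> n z)"
      by (rule L2_bound[OF LK, of _ 1]) (use mult_left_mono[OF \<eta>(2)] in \<open>auto simp: norm_mult\<close>)
    show i3: "integrable lborel (\<lambda>z. m z * K z * K z * \<eta> n z)"
      using L2_mult_integrable[OF LmK LKn] by (simp only: mult.assoc)
    have i4: "integrable lborel (\<lambda>z. m z * K z * (pE z * \<eta> n z))"
      by (rule L2_mult_integrable[OF LmK weakd_cutoff(2)[OF wV \<eta>(1)]])
    have "(LINT z|lborel. qE z * (\<eta> n z * \<psi> z)) = (LINT z|lborel. m z * K z * (pE z * \<eta> n z) - m z * K z * K z * \<eta> n z)"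
    proof (rule integral_cong_AE)
      show "AE z in lborel. qE z * (\<eta> n z * \<psi> z) = m z * K z * (pE z * \<eta> n z) - m z * K z * K z * \<eta> n z"
        using eq
      proof eventually_elim
        case (elim z)
        show ?case
        proof (cases "norm z > 1")
          case True
          then have "\<psi> z = K z" using Kext \<kappa>0 by (simp add: \<psi>_def)
          then show ?thesis unfolding elim Kext[OF True, symmetric] by (simp add: algebra_simps)
        qed (use m(3) elim in auto)
      qed
    qed measurable
    also have "\<dots> = (LINT z|lborel. m z * K z * (pE z * \<eta> n z)) - (LINT z|lborel. m z * K z * K z * \<eta> n z)"
      by (rule Bochner_Integration.integral_diff[OF i4 i3])
    finally have e3: "- (LINT z|lborel. qE z * (\<eta> n z * \<psi> z)) = (LINT z|lborel. m z * K z * K z * \<eta> n z) - (LINT z|lborel. m z * K z * (pE z * \<eta> n z))"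
      by simp
    show "(LINT z|lborel. E z * (- T z / (z - z0)) * \<eta> n z) + (LINT z|lborel. E z * eb n z * \<psi> z) =
      (LINT z|lborel. m z * K z * K z * \<eta> n z) - (LINT z|lborel. m z * K z * (pE z * \<eta> n z))" using e1 e2 e3 by simp
  qed
  have AEV: "AE z in lborel. z \<in> V"
    using AE_lborel_singleton[of z0] AE_lborel_singleton[of b] by eventually_elim (auto simp: V_def)
  have mlim: "(\<lambda>n. LINT z|lborel. g z * \<eta> n z) \<longlonglongrightarrow> (LINT z|lborel. g z)" if g: "integrable lborel g" for g
  proof (rule integral_dominated_convergence)
    have [measurable]: "g \<in> borel_measurable borel" using g by auto
    show "(\<lambda>z. g z * \<eta> n z) \<in> borel_measurable lborel" for n by measurable
    show "integrable lborel (\<lambda>z. norm (g z))" using g by auto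
    show "AE z in lborel. (\<lambda>n. g z * \<eta> n z) \<longlonglongrightarrow> g z"
      using AEV by eventually_elim (use tendsto_mult_left[OF \<eta>(3)] in fastforce)
    show "AE z in lborel. norm (g z * \<eta> n z) \<le> norm (g z)" for n
      using mult_left_mono[OF \<eta>(2)] by (auto simp: norm_mult)
  qed (use g in auto)
  have mG: "(\<lambda>z. E z * (- T z / (z - z0))) \<in> borel_measurable borel" using mE by measurable
  have IG: "integrable lborel (\<lambda>z. E z * (- T z / (z - z0)))"
  proof -
    have Tz: "T z = 0" if "norm (z - z0) < d/2 \<or> norm (z - z0) > d" for z
    proof -
      have "tau' (4 * (norm (z - z0))\<^sup>2 / d\<^sup>2 - 1) = 0"
      proof (cases "norm (z - z0) < d/2")
        case True
        then have "(norm (z - z0))\<^sup>2 \<le> (d/2)\<^sup>2" by (intro power_mono) auto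
        then have "4 * (norm (z - z0))\<^sup>2 \<le> d\<^sup>2" by (simp add: power2_eq_square)
        then show ?thesis using d by (intro tau_props(5)) (simp add: divide_le_eq_1_pos)
      next
        case False
        then have "d \<le> norm (z - z0)" using that by simp
        then have "d\<^sup>2 \<le> (norm (z - z0))\<^sup>2" using d by (intro power_mono) auto
        then have "2 * d\<^sup>2 \<le> 4 * (norm (z - z0))\<^sup>2" using zero_le_power2[of "norm (z - z0)"] by linarith
        then have "2 \<le> 4 * (norm (z - z0))\<^sup>2 / d\<^sup>2" using d by (simp only: pos_le_divide_eq zero_less_power)
        then show ?thesis by (intro tau_props(6)) simp
      qed
      then show ?thesis by (simp add: T_def)
    qed
    have Tb: "norm (T z) \<le> 16 / d\<^sup>2" for z
      using d tau_props(7)[of "4 * (norm (z - z0))\<^sup>2 / d\<^sup>2 - 1"]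
      by (simp add: T_def norm_mult norm_divide norm_power abs_mult divide_right_mono)
    have "integrable lborel (\<lambda>z. M * (16 / d\<^sup>2) / (d/2) * indicator (cball z0 d) z)"
      by (intro integrable_mult_right) (auto intro!: emeasure_bounded_finite)
    then show ?thesis
    proof (rule Bochner_Integration.integrable_bound)
      show "AE z in lborel. norm (E z * (- T z / (z - z0))) \<le> norm (M * (16 / d\<^sup>2) / (d/2) * indicator (cball z0 d) z)"
        using AEV
      proof eventually_elim
        case (elim z)
        show ?case
        proof (cases "norm (z - z0) < d/2 \<or> norm (z - z0) > d")
          case False
          have "norm (E z * (- T z / (z - z0))) = norm (E z) * (norm (T z) / norm (z - z0))"
            by (simp add: norm_mult norm_divide)
          also have "\<dots> \<le> M * ((16 / d\<^sup>2) / (d/2))"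
            using False d bd[of z] elim M by (intro mult_mono frac_le Tb) (auto simp: V_def)
          also have "\<dots> = norm (M * (16 / d\<^sup>2) / (d/2) * indicator (cball z0 d) z)"
            using False d M by (simp add: dist_norm norm_minus_commute)
          finally show ?thesis .
        qed (use Tz in auto)
      qed
    qed (use mG in simp)
  qed
  have IK: "integrable lborel (\<lambda>z. m z * K z * K z)" by (rule L2_mult_integrable[OF LmK(1) LK])
  have l1: "(\<lambda>n. LINT z|lborel. E z * (- T z / (z - z0)) * \<eta> n z) \<longlonglongrightarrow> (LINT z|lborel. E z * (- T z / (z - z0)))"
    by (rule mlim[OF IG])
  have l2: "(\<lambda>n. LINT z|lborel. m z * K z * K z * \<eta> n z) \<longlonglongrightarrow> (LINT z|lborel. m z * K z * K z)"
    by (rule mlim[OF IK])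
  have l3: "(\<lambda>n. LINT z|lborel. E z * eb n z * \<psi> z) \<longlonglongrightarrow> 0"
  proof (rule Lim_null_comparison)
    show "\<forall>\<^sub>F n in sequentially. norm (LINT z|lborel. E z * eb n z * \<psi> z) \<le> M * nL2 (eb n) * C"
    proof (rule always_eventually, rule allI)
      fix n
      have "norm (LINT z|lborel. E z * eb n z * \<psi> z) \<le> nL2 (\<lambda>z. E z * eb n z) * nL2 \<psi>"
        by (rule L2_Cauchy_Schwarz[OF Ee(2) L\<psi>])
      also have "\<dots> \<le> M * nL2 (eb n) * C" unfolding C_def by (intro mult_right_mono Ee(4)) simp
      finally show "norm (LINT z|lborel. E z * eb n z * \<psi> z) \<le> M * nL2 (eb n) * C" .
    qed
    show "(\<lambda>n. M * nL2 (eb n) * C) \<longlonglongrightarrow> 0" by (intro tendsto_mult_left_zero tendsto_mult_right_zero \<eta>(5))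
  qed
  have lim: "(\<lambda>n. norm ((LINT z|lborel. E z * (- T z / (z - z0)) * \<eta> n z) + (LINT z|lborel. E z * eb n z * \<psi> z) - (LINT z|lborel. m z * K z * K z * \<eta> n z)))
     \<longlonglongrightarrow> norm ((LINT z|lborel. E z * (- T z / (z - z0))) + 0 - (LINT z|lborel. m z * K z * K z))"
    by (intro tendsto_intros l1 l2 l3)
  have el: "(\<lambda>n. k * N * ((k * N + M * e n) / (1 - k))) \<longlonglongrightarrow> k * N * ((k * N + M * (0 + 0)) / (1 - k))"
    unfolding e_def using m(5) by (intro tendsto_intros \<eta>(4,5)) auto
  have "norm ((LINT z|lborel. E z * (- T z / (z - z0))) + 0 - (LINT z|lborel. m z * K z * K z)) \<le> k * N * ((k * N + M * (0 + 0)) / (1 - k))"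
  proof (rule LIMSEQ_le[OF lim el], intro exI allI impI)
    fix n
    have "norm ((LINT z|lborel. E z * (- T z / (z - z0)) * \<eta> n z) + (LINT z|lborel. E z * eb n z * \<psi> z) - (LINT z|lborel. m z * K z * K z * \<eta> n z))
      = norm (LINT z|lborel. m z * K z * (pE z * \<eta> n z))" unfolding main by simp
    also have "\<dots> \<le> nL2 (\<lambda>z. m z * K z) * X n"
      unfolding X_def by (rule L2_Cauchy_Schwarz[OF LmK(1) weakd_cutoff(2)[OF wV \<eta>(1)]])
    also have "\<dots> \<le> k * N * ((k * N + M * e n) / (1 - k))"
      by (intro mult_mono LmK(2) Xb) (use m(4) N0 in \<open>auto simp: X_def\<close>)
    finally show "norm ((LINT z|lborel. E z * (- T z / (z - z0)) * \<eta> n z) + (LINT z|lborel. E z * eb n z * \<psi> z) - (LINT z|lborel. m z * K z * K z * \<eta> n z))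
      \<le> k * N * ((k * N + M * e n) / (1 - k))" .
  qed
  also have "k * N * ((k * N + M * (0 + 0)) / (1 - k)) = k\<^sup>2 * N\<^sup>2 / (1 - k)" by (simp add: power2_eq_square)
  also have "\<dots> \<le> k\<^sup>2 * (22 / d\<^sup>2) / (1 - k)"
    using N2 m(5) by (intro divide_right_mono mult_left_mono) auto
  finally have fin: "norm ((LINT z|lborel. E z * (- T z / (z - z0))) - (LINT z|lborel. m z * K z * K z)) \<le> k\<^sup>2 * (22 / d\<^sup>2) / (1 - k)"
    by simp
  have "(LINT z|lborel. E z * (- T z / (z - z0))) = bump_const * deriv E2 z0"
    unfolding T_def
    by (rule derivative_extraction[OF d E2(1)[folded d_def], where b = b]) (use E2(2) mG in \<open>auto simp: d_def T_def\<close>)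
  moreover have "m z * K z * K z = m z / (z - z0)^4" for z
  proof (cases "norm z > 1")
    case True then show ?thesis using Kext[OF True] by (simp add: power2_eq_square power4_eq_xxxx)
  qed (use m(3) in auto)
  ultimately show ?thesis using fin by (simp add: d_def)
qed

section \<open>Quasiconformal homeomorphisms of the sphere\<close>

lemma openin_riemann_sphere:
  "openin riemann_sphere S \<longleftrightarrow> open {z. Some z \<in> S} \<and> (None \<in> S \<longrightarrow> bounded {z. Some z \<notin> S})"
proof
  assume "openin riemann_sphere S"
  then consider U where "open U" "S = Some ` U" | C where "compact C" "S = insert None (Some ` (- C))"
    by (auto simp: openin_Alexandroff_compactification Compl_eq_Diff_UNIV)
  then show "open {z. Some z \<in> S} \<and> (None \<in> S \<longrightarrow> bounded {z. Some z \<notin> S})"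
  proof cases
    case 1
    then have "{z. Some z \<in> S} = U" by auto
    then show ?thesis using 1 by auto
  next
    case 2
    then have "{z. Some z \<in> S} = - C" "{z. Some z \<notin> S} = C" by auto
    then show ?thesis using 2 by (auto intro: compact_imp_closed compact_imp_bounded open_Compl)
  qed
next
  assume a: "open {z. Some z \<in> S} \<and> (None \<in> S \<longrightarrow> bounded {z. Some z \<notin> S})"
  show "openin riemann_sphere S"
  proof (cases "None \<in> S")
    case False
    have "S = Some ` {z. Some z \<in> S}"
    proof (rule Set.set_eqI)
      show "x \<in> S \<longleftrightarrow> x \<in> Some ` {z. Some z \<in> S}" for x using False by (cases x) auto
    qed
    then show ?thesis using a by (metis openin_Alexandroff_compactification_image_Some open_openin)
  next
    case True
    define C where "C = {z. Some z \<notin> S}"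
    have "C = - {z. Some z \<in> S}" by (auto simp: C_def)
    then have "closed C" using a by auto
    then have "compact C" using a True by (simp add: C_def compact_eq_bounded_closed)
    moreover have "S = insert None (Some ` (UNIV - C))"
    proof (rule Set.set_eqI)
      show "x \<in> S \<longleftrightarrow> x \<in> insert None (Some ` (UNIV - C))" for x using True by (cases x) (auto simp: C_def)
    qed
    ultimately show ?thesis using \<open>closed C\<close> by (auto simp: openin_Alexandroff_compactification)
  qed
qed

lemma topspace_riemann_sphere: "topspace riemann_sphere = UNIV"
  by (simp flip: UNIV_option_conv)

lemma sphere_homeo:
  assumes "homeomorphic_map riemann_sphere riemann_sphere w"
  shows "inj w" "surj w" "openin riemann_sphere S \<Longrightarrow> openin riemann_sphere (w -` S)"
    "openin riemann_sphere S \<Longrightarrow> openin riemann_sphere (w ` S)"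
proof -
  note h = assms[unfolded homeomorphic_eq_everything_map topspace_riemann_sphere]
  show "inj w" "surj w" using h by auto
  show "openin riemann_sphere (w ` S)" if "openin riemann_sphere S" using h that by (auto simp: open_map_def)
  show "openin riemann_sphere (w -` S)" if "openin riemann_sphere S"
  proof -
    have "openin riemann_sphere {x \<in> topspace riemann_sphere. w x \<in> S}"
      using h that by (intro openin_continuous_map_preimage) auto
    then show ?thesis unfolding topspace_riemann_sphere by (simp add: vimage_def)
  qed
qed

lemma open_preimage_Some: 
  assumes "homeomorphic_map riemann_sphere riemann_sphere w" "openin riemann_sphere S"
  shows "open {z. w (Some z) \<in> S}"
  using sphere_homeo(3)[OF assms] by (simp add: openin_riemann_sphere)

lemma openin_Some_image: "open U \<Longrightarrow> openin riemann_sphere (Some ` U)"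
  by (simp flip: open_openin)

lemma planar_eq: "w (Some z) = Some v \<Longrightarrow> planar w z = v"
  by (simp add: planar_def)

lemma w_eq_planar: "w (Some z) \<noteq> None \<Longrightarrow> w (Some z) = Some (planar w z)"
  by (auto simp: planar_def)

lemma open_finite_domain:
  assumes "homeomorphic_map riemann_sphere riemann_sphere w"
  shows "open {z. w (Some z) \<noteq> None}"
proof -
  have "{z. w (Some z) \<noteq> None} = {z. w (Some z) \<in> Some ` UNIV}" by auto
  then show ?thesis using open_preimage_Some[OF assms openin_Some_image[OF open_UNIV]] by simp
qed

lemma continuous_planar:
  assumes "homeomorphic_map riemann_sphere riemann_sphere w"
  shows "continuous_on {z. w (Some z) \<noteq> None} (planar w)"
  unfolding continuous_on_open_vimage[OF open_finite_domain[OF assms]]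
proof (intro allI impI)
  fix V :: "complex set" assume "open V"
  have "planar w -` V \<inter> {z. w (Some z) \<noteq> None} = {z. w (Some z) \<in> Some ` V}"
    by (auto simp: planar_def)
  then show "open (planar w -` V \<inter> {z. w (Some z) \<noteq> None})"
    using open_preimage_Some[OF assms openin_Some_image[OF \<open>open V\<close>]] by simp
qed

lemma inj_on_planar:
  assumes "homeomorphic_map riemann_sphere riemann_sphere w"
  shows "inj_on (planar w) {z. w (Some z) \<noteq> None}"
proof (rule inj_onI)
  fix x y assume "x \<in> {z. w (Some z) \<noteq> None}" "y \<in> {z. w (Some z) \<noteq> None}" "planar w x = planar w y"
  then have "w (Some x) = w (Some y)" using w_eq_planar[of w x] w_eq_planar[of w y] by simp
  then show "x = y" using sphere_homeo(1)[OF assms] by (metis injD option.inject)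
qed

text \<open>The image of the disc around \<open>z0\<close> is open and contains a disc around the
  value at \<open>z0\<close>, which by injectivity no point outside reaches. This bounds 1 / (w - w
  z0) away from \<open>z0\<close>.\<close>

lemma planar_bounded_away:
  assumes h: "homeomorphic_map riemann_sphere riemann_sphere w" and z0: "w (Some z0) \<noteq> None" and "r > 0"
  obtains \<delta> where "\<delta> > 0" "\<And>z. z \<notin> ball z0 r \<Longrightarrow> w (Some z) \<noteq> None \<Longrightarrow> \<delta> \<le> norm (planar w z - planar w z0)"
proof -
  have "openin riemann_sphere (w ` (Some ` ball z0 r))"
    by (intro sphere_homeo(4)[OF h] openin_Some_image open_ball)
  then have "open {v. Some v \<in> w ` (Some ` ball z0 r)}" by (simp add: openin_riemann_sphere)
  moreover have "planar w z0 \<in> {v. Some v \<in> w ` (Some ` ball z0 r)}"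
    using w_eq_planar[of w z0, OF z0] \<open>r > 0\<close> by (auto simp: image_iff intro!: bexI[of _ z0])
  ultimately obtain \<delta> where \<delta>: "\<delta> > 0" "ball (planar w z0) \<delta> \<subseteq> {v. Some v \<in> w ` (Some ` ball z0 r)}"
    unfolding open_contains_ball by blast
  have "\<delta> \<le> norm (planar w z - planar w z0)" if z: "z \<notin> ball z0 r" "w (Some z) \<noteq> None" for z
  proof (rule ccontr)
    assume "\<not> ?thesis"
    then have "planar w z \<in> ball (planar w z0) \<delta>" by (simp add: dist_norm norm_minus_commute)
    then have "Some (planar w z) \<in> w ` (Some ` ball z0 r)" using \<delta>(2) by blast
    then obtain z' where z': "z' \<in> ball z0 r" "w (Some z') = Some (planar w z)" by auto
    then have "w (Some z') = w (Some z)" using w_eq_planar[of w z, OF z(2)] by simp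
    then have "z' = z" using sphere_homeo(1)[OF h] by (metis injD option.inject)
    then show False using z' z by simp
  qed
  then show thesis using that \<delta>(1) by blast
qed

lemma planar_at_pole:
  assumes h: "homeomorphic_map riemann_sphere riemann_sphere w" and b: "w (Some b) = None"
  obtains r where "r > 0" "\<And>z. z \<in> ball b r - {b} \<Longrightarrow> M < norm (planar w z)"
proof -
  have "openin riemann_sphere (insert None (Some ` {v. M < norm v}))"
  proof -
    have "{z. Some z \<in> insert None (Some ` {v. M < norm v})} = {v. M < norm v}" by auto
    moreover have "{z. Some z \<notin> insert None (Some ` {v. M < norm v})} = cball 0 M" by auto
    moreover have "open {v::complex. M < norm v}" by (intro open_Collect_less continuous_intros)
    ultimately show ?thesis unfolding openin_riemann_sphere by (metis bounded_cball)
  qed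
  from open_preimage_Some[OF h this]
  have "open {z. w (Some z) \<in> insert None (Some ` {v. M < norm v})}" .
  moreover have "b \<in> {z. w (Some z) \<in> insert None (Some ` {v. M < norm v})}" using b by simp
  ultimately obtain r where r: "r > 0" "ball b r \<subseteq> {z. w (Some z) \<in> insert None (Some ` {v. M < norm v})}"
    unfolding open_contains_ball by blast
  have "M < norm (planar w z)" if z: "z \<in> ball b r - {b}" for z
  proof -
    have "w (Some z) \<noteq> None" using sphere_homeo(1)[OF h] b z by (metis DiffE injD insertI1 option.inject)
    moreover have "w (Some z) \<in> insert None (Some ` {v. M < norm v})" using r(2) z by auto
    ultimately show ?thesis by (auto simp: planar_def)
  qed
  then show thesis using that r(1) by blast
qed

lemma borel_planar:
  assumes "homeomorphic_map riemann_sphere riemann_sphere w"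
  shows "planar w \<in> borel_measurable borel"
proof -
  have "planar w = (\<lambda>z. indicat_real {z. w (Some z) \<noteq> None} z *\<^sub>R planar w z)"
    by (auto simp: planar_def fun_eq_iff split: split_indicator)
  moreover have "(\<lambda>z. indicat_real {z. w (Some z) \<noteq> None} z *\<^sub>R planar w z) \<in> borel_measurable borel"
    by (rule borel_measurable_continuous_on_indicator[OF _ continuous_planar[OF assms]])
      (use open_finite_domain[OF assms] in auto)
  ultimately show ?thesis by simp
qed

section \<open>Borel representatives of coefficients and weak derivatives\<close>

lemma lebesgue_borel_representative:
  fixes f :: "complex \<Rightarrow> complex"
  assumes "f \<in> borel_measurable (lebesgue_on S)" "S \<in> sets lebesgue"
  obtains g where "g \<in> borel_measurable borel" "AE z in lborel. g z = (if z \<in> S then f z else 0)"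
proof -
  define f1 where "f1 = (\<lambda>z. if z \<in> S then f z else 0)"
  have m: "f1 \<in> borel_measurable lebesgue" unfolding f1_def using assms by (simp add: borel_measurable_if)
  have "(\<lambda>z. Re (f1 z)) \<in> borel_measurable (completion lborel)" "(\<lambda>z. Im (f1 z)) \<in> borel_measurable (completion lborel)"
    using m by measurable
  from this[THEN completion_ex_borel_measurable_real] obtain r s where
    rs: "r \<in> borel_measurable lborel" "AE z in lborel. Re (f1 z) = r z"
    "s \<in> borel_measurable lborel" "AE z in lborel. Im (f1 z) = s z" by blast
  show thesis
  proof (rule that)
    have [measurable]: "r \<in> borel_measurable borel" "s \<in> borel_measurable borel" using rs by auto
    show "(\<lambda>z. of_real (r z) + \<i> * of_real (s z)) \<in> borel_measurable borel" by measurable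
    show "AE z in lborel. of_real (r z) + \<i> * of_real (s z) = (if z \<in> S then f z else 0)"
      using rs(2,4)
    proof eventually_elim
      case (elim z)
      then have "of_real (r z) + \<i> * of_real (s z) = f1 z" by (simp add: complex_eq_iff)
      then show ?case by (simp add: f1_def)
    qed
  qed
qed

lemma AE_lebesgue_lborel: "(AE z in lebesgue. P z) \<longleftrightarrow> (AE z in lborel. P z)"
  by (rule AE_completion_iff)

lemma locally_L2_representative:
  assumes "locally_L2 U p0" "open U"
  obtains p where "locL2 U p" "AE z in lborel. p z = (if z \<in> U then p0 z else 0)"
proof -
  have U: "U \<in> sets lebesgue" using assms(2) by auto
  obtain p where p: "p \<in> borel_measurable borel" "AE z in lborel. p z = (if z \<in> U then p0 z else 0)"
    using lebesgue_borel_representative[OF _ U] assms(1) unfolding locally_L2_def by blast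
  have "locL2 U p" unfolding locL2_def
  proof (intro conjI p(1) allI impI)
    fix K assume K: "compact K \<and> K \<subseteq> U"
    have [measurable]: "K \<in> sets borel" "p \<in> borel_measurable borel" using K borel_compact p by auto
    have i: "integrable lebesgue (\<lambda>z. indicator K z *\<^sub>R (norm (p0 z))\<^sup>2)"
      using assms(1) K unfolding locally_L2_def set_integrable_def by blast
    have mm: "(\<lambda>z. (norm (indicator K z * p z))\<^sup>2) \<in> borel_measurable borel" by measurable
    have "integrable lebesgue (\<lambda>z. (norm (indicator K z * p z))\<^sup>2)"
    proof (rule integrable_cong_AE_imp[OF i])
      show "(\<lambda>z. (norm (indicator K z * p z))\<^sup>2) \<in> borel_measurable lebesgue"
        by (rule measurable_completion) (use mm in simp)
      show "AE z in lebesgue. indicator K z *\<^sub>R (norm (p0 z))\<^sup>2 = (norm (indicator K z * p z))\<^sup>2"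
        unfolding AE_lebesgue_lborel using p(2)
        by eventually_elim (use K in \<open>auto split: split_indicator\<close>)
    qed
    then have "integrable lborel (\<lambda>z. (norm (indicator K z * p z))\<^sup>2)"
      by (subst (asm) integrable_completion) (use mm in auto)
    then show "L2 (\<lambda>z. indicator K z * p z)" by (simp add: L2_def)
  qed
  then show thesis using that p(2) by blast
qed

lemma tf_imp_test_function:
  assumes "tf U \<phi> a b"
  shows "test_function U \<phi> (\<lambda>z. a z + b z) (\<lambda>z. \<i> * (a z - b z))"
  unfolding test_function_def
proof (intro conjI allI)
  show "continuous_on UNIV (\<lambda>z. a z + b z)" "continuous_on UNIV (\<lambda>z. \<i> * (a z - b z))"
    using tf_continuous[OF assms] by (auto intro!: continuous_intros)
  show "\<exists>K. compact K \<and> K \<subseteq> U \<and> (\<forall>z. z \<notin> K \<longrightarrow> \<phi> z = 0)" using assms by (simp add: tf_def)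
  fix z
  have "(\<phi> has_derivative (\<lambda>h. a z * h + b z * cnj h)) (at z)" using assms by (simp add: tf_def wirt_def)
  moreover have "a z * h + b z * cnj h = of_real (Re h) * (a z + b z) + of_real (Im h) * (\<i> * (a z - b z))" for h
    by (simp add: complex_eq_iff algebra_simps)
  ultimately show "(\<phi> has_derivative (\<lambda>h. of_real (Re h) * (a z + b z) + of_real (Im h) * (\<i> * (a z - b z)))) (at z)"
    by simp
qed

lemma qc_solution_weakd:
  assumes "qc_solution \<nu> w"
  obtains p q where "weakd {z. w (Some z) \<noteq> None} (planar w) p q"
    "AE z in lborel. w (Some z) \<noteq> None \<longrightarrow> q z = \<nu> z * p z"
proof -
  define U where "U = {z. w (Some z) \<noteq> None}"
  have h: "homeomorphic_map riemann_sphere riemann_sphere w" using assms by (simp add: qc_solution_def)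
  have oU: "open U" and cf: "continuous_on U (planar w)"
    using open_finite_domain[OF h] continuous_planar[OF h] by (auto simp: U_def)
  obtain p0 q0 where pq0: "locally_L2 U p0" "locally_L2 U q0" "weak_wirtinger U (planar w) p0 q0"
     "AE z in lebesgue_on U. q0 z = \<nu> z * p0 z"
    using assms unfolding qc_solution_def Let_def U_def by blast
  obtain p where p: "locL2 U p" "AE z in lborel. p z = (if z \<in> U then p0 z else 0)"
    using locally_L2_representative[OF pq0(1) oU] by blast
  obtain q where q: "locL2 U q" "AE z in lborel. q z = (if z \<in> U then q0 z else 0)"
    using locally_L2_representative[OF pq0(2) oU] by blast
  have fi: "(LINT z:U|lebesgue. planar w z * g z) = (LINT z|lborel. planar w z * g z)"
    if "continuous_on UNIV (\<lambda>z. planar w z * g z)" "\<And>z. z \<notin> U \<Longrightarrow> g z = 0" for g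
  proof -
    have "(\<lambda>z. indicat_real U z *\<^sub>R (planar w z * g z)) = (\<lambda>z. planar w z * g z)"
      using that(2) by (auto simp: fun_eq_iff split: split_indicator)
    then have "(LINT z:U|lebesgue. planar w z * g z) = (LINT z|lebesgue. planar w z * g z)"
      unfolding set_lebesgue_integral_def by simp
    also have "\<dots> = (LINT z|lborel. planar w z * g z)"
      by (rule integral_completion) (use borel_measurable_continuous_onI[OF that(1)] in simp)
    finally show ?thesis .
  qed
  have pi: "(LINT z:U|lebesgue. p0 z * \<phi> z) = (LINT z|lborel. p z * \<phi> z)"
    if t: "tf U \<phi> a b" and p: "locL2 U p" "AE z in lborel. p z = (if z \<in> U then p0 z else 0)" 
      and p0: "p0 \<in> borel_measurable (lebesgue_on U)" for \<phi> a b p p0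
  proof -
    have z: "\<phi> z = 0" if "z \<notin> U" for z using t that unfolding tf_def by auto
    have m\<phi>: "\<phi> \<in> borel_measurable borel" using tf_continuous(1)[OF t] by (rule borel_measurable_continuous_onI)
    have mp: "p \<in> borel_measurable borel" using p by (simp add: locL2_def)
    have eq: "(\<lambda>z. indicat_real U z *\<^sub>R (p0 z * \<phi> z)) = (\<lambda>z. (if z \<in> U then p0 z else 0) * \<phi> z)"
      by (auto simp: fun_eq_iff split: split_indicator)
    have "(LINT z:U|lebesgue. p0 z * \<phi> z) = (LINT z|lebesgue. (if z \<in> U then p0 z else 0) * \<phi> z)"
      unfolding set_lebesgue_integral_def eq ..
    also have "\<dots> = (LINT z|lebesgue. p z * \<phi> z)"
    proof (rule integral_cong_AE)
      have "(\<lambda>z. if z \<in> U then p0 z else 0) \<in> borel_measurable lebesgue"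
        using p0 oU by (simp add: borel_measurable_if)
      moreover have "\<phi> \<in> borel_measurable lebesgue" "p \<in> borel_measurable lebesgue"
        using m\<phi> mp by (auto intro: measurable_completion)
      ultimately show "(\<lambda>z. (if z \<in> U then p0 z else 0) * \<phi> z) \<in> borel_measurable lebesgue"
        "(\<lambda>z. p z * \<phi> z) \<in> borel_measurable lebesgue" by measurable
      show "AE z in lebesgue. (if z \<in> U then p0 z else 0) * \<phi> z = p z * \<phi> z"
        unfolding AE_lebesgue_lborel using p(2) by eventually_elim simp
    qed
    also have "\<dots> = (LINT z|lborel. p z * \<phi> z)" by (rule integral_completion) (use mp m\<phi> in measurable)
    finally show ?thesis .
  qed
  have "weakd U (planar w) p q" unfolding weakd_def
  proof (intro conjI allI impI oU cf p(1) q(1))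
    fix \<phi> a b assume t: "tf U \<phi> a b"
    obtain K where K: "K \<subseteq> U" "\<And>z. z \<notin> K \<Longrightarrow> a z = 0" "\<And>z. z \<notin> K \<Longrightarrow> b z = 0"
      using tf_support[OF t] by metis
    have e: "(a z + b z - \<i> * (\<i> * (a z - b z))) / 2 = a z" "(a z + b z + \<i> * (\<i> * (a z - b z))) / 2 = b z" for z
      by (simp_all add: algebra_simps)
    have "(LINT z:U|lebesgue. planar w z * a z) = - (LINT z:U|lebesgue. p0 z * \<phi> z)"
      "(LINT z:U|lebesgue. planar w z * b z) = - (LINT z:U|lebesgue. q0 z * \<phi> z)"
      using pq0(3)[unfolded weak_wirtinger_def, rule_format, OF tf_imp_test_function[OF t]] unfolding e by auto
    moreover have "(LINT z:U|lebesgue. planar w z * a z) = (LINT z|lborel. planar w z * a z)"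
      by (rule fi[OF tf_times_continuous(2)[OF t oU cf]]) (use K in auto)
    moreover have "(LINT z:U|lebesgue. planar w z * b z) = (LINT z|lborel. planar w z * b z)"
      by (rule fi[OF tf_times_continuous(3)[OF t oU cf]]) (use K in auto)
    moreover have "(LINT z:U|lebesgue. p0 z * \<phi> z) = (LINT z|lborel. p z * \<phi> z)"
      by (rule pi[OF t p]) (use pq0(1) in \<open>simp add: locally_L2_def\<close>)
    moreover have "(LINT z:U|lebesgue. q0 z * \<phi> z) = (LINT z|lborel. q z * \<phi> z)"
      by (rule pi[OF t q]) (use pq0(2) in \<open>simp add: locally_L2_def\<close>)
    ultimately show "(LINT z|lborel. planar w z * a z) = - (LINT z|lborel. p z * \<phi> z)"
      "(LINT z|lborel. planar w z * b z) = - (LINT z|lborel. q z * \<phi> z)" by simp_all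
  qed
  moreover have "AE z in lborel. w (Some z) \<noteq> None \<longrightarrow> q z = \<nu> z * p z"
  proof -
    have "AE z in lebesgue. z \<in> U \<longrightarrow> q0 z = \<nu> z * p0 z"
      using pq0(4) oU by (subst (asm) AE_restrict_space_iff) auto
    then have "AE z in lborel. z \<in> U \<longrightarrow> q0 z = \<nu> z * p0 z" by (simp only: AE_lebesgue_lborel)
    then show ?thesis using p(2) q(2) by eventually_elim (auto simp: U_def)
  qed
  ultimately show thesis using that unfolding U_def by blast
qed

lemma linf_borel_representative:
  assumes "\<mu> \<in> linf_space G"
  obtains m where "m \<in> borel_measurable borel" "\<And>z. norm z \<le> 1 \<Longrightarrow> m z = 0"
    "AE z in lborel. m z = (if z \<in> ext_disc then \<mu> z else 0)" "AE z in lborel. norm (m z) \<le> linf_norm \<mu>"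
proof -
  have o: "open ext_disc" by (intro open_Collect_less continuous_intros)
  then have e: "ext_disc \<in> sets lebesgue" "ext_disc \<in> sets borel" by auto
  have m\<mu>: "\<mu> \<in> borel_measurable (lebesgue_on ext_disc)" using assms by (simp add: linf_space_def)
  obtain g where g: "g \<in> borel_measurable borel" "AE z in lborel. g z = (if z \<in> ext_disc then \<mu> z else 0)"
    using lebesgue_borel_representative[OF m\<mu> e(1)] by blast
  define m where "m = (\<lambda>z. if z \<in> ext_disc then g z else 0)"
  have mm: "m \<in> borel_measurable borel" unfolding m_def using g(1) e(2) by (intro measurable_If_set) auto
  have meq: "AE z in lborel. m z = (if z \<in> ext_disc then \<mu> z else 0)"
    using g(2) by eventually_elim (simp add: m_def)
  define s where "s = esssup (lebesgue_on ext_disc) (\<lambda>z. ereal (norm (\<mu> z)))"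
  have s: "s < \<infinity>" "linf_norm \<mu> = real_of_ereal s" using assms by (auto simp: linf_space_def linf_norm_def s_def)
  have "AE z in lebesgue_on ext_disc. ereal (norm (\<mu> z)) \<le> s" unfolding s_def by (rule esssup_AE)
  then have "AE z in lebesgue_on ext_disc. norm (\<mu> z) \<le> linf_norm \<mu>"
    by eventually_elim (use s in \<open>cases s; auto\<close>)
  then have n1: "AE z in lborel. z \<in> ext_disc \<longrightarrow> norm (\<mu> z) \<le> linf_norm \<mu>"
    using e by (subst (asm) AE_restrict_space_iff) (auto simp: AE_lebesgue_lborel)
  \<comment> \<open>The bound is claimed on the disc too, where \<open>m\<close> is 0. The norm is
    nonnegative because the exterior is not a null set.\<close>
  have n2: "0 \<le> linf_norm \<mu>"
  proof -
    have "AE z in lborel. z \<notin> ext_disc" if neg: "linf_norm \<mu> < 0"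
      using n1
    proof eventually_elim
      case (elim z)
      show ?case using elim neg norm_ge_zero[of "\<mu> z"] by linarith
    qed
    moreover have "\<not> (AE z in lborel. z \<notin> ext_disc)"
    proof
      assume "AE z in lborel. z \<notin> ext_disc"
      then have "ext_disc \<in> null_sets lborel" using e by (subst AE_iff_null_sets) auto
      then have "negligible ext_disc" by (simp add: negligible_iff_null_sets null_sets_completionI)
      then have "ext_disc = {}" using o open_not_negligible by blast
      moreover have "2 \<in> ext_disc" by simp
      ultimately show False by blast
    qed
    ultimately show ?thesis by force
  qed
  from n1 meq have "AE z in lborel. norm (m z) \<le> linf_norm \<mu>"
  proof eventually_elim
    case (elim z)
    then show ?case using n2 by (cases "z \<in> ext_disc") auto
  qed
  then show thesis using that[OF mm _ meq] by (simp add: m_def)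
qed

lemma qc_solution_holomorphic:
  assumes "qc_solution (\<lambda>z. if z \<in> ext_disc then \<mu> z else 0) w"
  shows "planar w holomorphic_on {z \<in> disc. w (Some z) \<noteq> None}"
proof -
  have h: "homeomorphic_map riemann_sphere riemann_sphere w" using assms by (simp add: qc_solution_def)
  obtain p q where pq: "weakd {z. w (Some z) \<noteq> None} (planar w) p q"
    "AE z in lborel. w (Some z) \<noteq> None \<longrightarrow> q z = (if z \<in> ext_disc then \<mu> z else 0) * p z"
    using qc_solution_weakd[OF assms] by blast
  show ?thesis
  proof (rule weakd_imp_holomorphic[OF pq(1)])
    show "AE z in lborel. z \<in> {z \<in> disc. w (Some z) \<noteq> None} \<longrightarrow> q z = 0"
      using pq(2) by eventually_elim auto
    have "{z \<in> disc. w (Some z) \<noteq> None} = disc \<inter> {z. w (Some z) \<noteq> None}" by auto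
    then show "open {z \<in> disc. w (Some z) \<noteq> None}" using open_finite_domain[OF h] by auto
  qed auto
qed

lemma planar_deriv_nonzero:
  assumes "qc_solution (\<lambda>z. if z \<in> ext_disc then \<mu> z else 0) w" "z \<in> disc" "w (Some z) \<noteq> None"
  shows "deriv (planar w) z \<noteq> 0"
proof -
  have h: "homeomorphic_map riemann_sphere riemann_sphere w" using assms by (simp add: qc_solution_def)
  have "{z \<in> disc. w (Some z) \<noteq> None} = disc \<inter> {z. w (Some z) \<noteq> None}" by auto
  then have "open {z \<in> disc. w (Some z) \<noteq> None}" using open_finite_domain[OF h] by auto
  moreover have "inj_on (planar w) {z \<in> disc. w (Some z) \<noteq> None}"
    by (rule inj_on_subset[OF inj_on_planar[OF h]]) auto
  ultimately show ?thesis
    using holomorphic_injective_imp_regular[OF qc_solution_holomorphic[OF assms(1)]] assms(2,3) by auto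
qed

section \<open>The Schwarzian derivative of a quasiconformal homeomorphism\<close>

lemma schwarzian_eq:
  assumes "f holomorphic_on N" "open N" "z \<in> N" "\<And>x. x \<in> N \<Longrightarrow> deriv f x \<noteq> 0"
  shows "(pre_schwarzian f has_field_derivative (schwarzian f z + (pre_schwarzian f z)\<^sup>2 / 2)) (at z)"
    "pre_schwarzian f holomorphic_on N" 
    "schwarzian f z = deriv (deriv (deriv f)) z / deriv f z - 3/2 * (deriv (deriv f) z / deriv f z)\<^sup>2"
proof -
  have h1: "deriv f holomorphic_on N" and h2: "deriv (deriv f) holomorphic_on N"
    using assms(1,2) by (auto intro: holomorphic_deriv)
  show ph: "pre_schwarzian f holomorphic_on N"
    unfolding pre_schwarzian_def by (rule holomorphic_on_divide[OF h2 h1 assms(4)])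
  show "(pre_schwarzian f has_field_derivative (schwarzian f z + (pre_schwarzian f z)\<^sup>2 / 2)) (at z)"
    using holomorphic_derivI[OF ph assms(2,3)] by (simp add: schwarzian_def)
  have "deriv (pre_schwarzian f) z = (deriv (deriv (deriv f)) z * deriv f z - deriv (deriv f) z * deriv (deriv f) z) / (deriv f z * deriv f z)"
    unfolding pre_schwarzian_def
    by (intro DERIV_imp_deriv DERIV_divide holomorphic_derivI[OF h1 assms(2,3)] holomorphic_derivI[OF h2 assms(2,3)] assms(4)[OF assms(3)])
  then have "deriv (pre_schwarzian f) z = deriv (deriv (deriv f)) z / deriv f z - (deriv (deriv f) z / deriv f z)\<^sup>2"
    using assms(4)[OF assms(3)] by (simp add: field_simps power2_eq_square)
  then show "schwarzian f z = deriv (deriv (deriv f)) z / deriv f z - 3/2 * (deriv (deriv f) z / deriv f z)\<^sup>2"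
    by (simp add: schwarzian_def pre_schwarzian_def)
qed

text \<open>The hypothesis is alpha / (f - f z0) = 1 / (z - z0) + e with denominators cleared, alpha
  = f' z0. Its second and third derivatives at \<open>z0\<close> give e z0 = - f'' / (2 f') and then
  the derivative of \<open>e\<close>.\<close>

lemma schwarzian_from_expansion:
  assumes f: "f holomorphic_on N" and e: "e holomorphic_on N" and N: "open N" "z0 \<in> N" 
    and nz: "\<And>x. x \<in> N \<Longrightarrow> deriv f x \<noteq> 0"
    and eq: "\<And>z. z \<in> N \<Longrightarrow> (f z - f z0) * (1 + (z - z0) * e z) = deriv f z0 * (z - z0)"
  shows "schwarzian f z0 = - 6 * deriv e z0"
proof -
  define \<alpha> where "\<alpha> = deriv f z0"
  have \<alpha>: "\<alpha> \<noteq> 0" using nz N by (simp add: \<alpha>_def)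
  define F where "F = (\<lambda>z. f z - f z0)"
  define h where "h = (\<lambda>z. 1 + (z - z0) * e z)"
  have F: "F holomorphic_on N" and h: "h holomorphic_on N" using f e by (auto simp: F_def h_def intro!: holomorphic_intros)
  have dx: "deriv (\<lambda>z. z - z0) = (\<lambda>z. 1)" by (rule ext, rule DERIV_imp_deriv) (auto intro!: derivative_eq_intros)
  have d0: "deriv (\<lambda>z. c) = (\<lambda>z. 0)" for c :: complex by (rule ext) simp
  have dG: "deriv (\<lambda>z. \<alpha> * (z - z0)) = (\<lambda>z. \<alpha>)" by (rule ext, rule DERIV_imp_deriv) (auto intro!: derivative_eq_intros)
  have G: "(deriv ^^ n) (\<lambda>z. F z * h z) z0 = (deriv ^^ n) (\<lambda>z. \<alpha> * (z - z0)) z0" for n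
    by (rule higher_deriv_transform_within_open[OF _ _ N]) (use F h eq in \<open>auto intro!: holomorphic_intros simp: F_def h_def \<alpha>_def\<close>)
  have hx: "(deriv ^^ n) (\<lambda>z. (z - z0) * e z) z0 = of_nat n * (deriv ^^ (n - 1)) e z0" if "n \<in> {1, 2, 3}" for n
  proof -
    have "(deriv ^^ n) (\<lambda>z. (z - z0) * e z) z0 = (\<Sum>i = 0..n. of_nat (n choose i) * (deriv ^^ i) (\<lambda>z. z - z0) z0 * (deriv ^^ (n - i)) e z0)"
      by (rule higher_deriv_mult[OF _ e N]) (auto intro!: holomorphic_intros)
    then show ?thesis using that by (auto simp: numeral_eq_Suc dx d0 funpow_Suc_right simp del: funpow.simps(2))
  qed
  have hn: "(deriv ^^ n) h z0 = of_nat n * (deriv ^^ (n - 1)) e z0" if "n \<in> {1, 2, 3}" for n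
  proof -
    have "(deriv ^^ n) h z0 = (deriv ^^ n) (\<lambda>z. 1) z0 + (deriv ^^ n) (\<lambda>z. (z - z0) * e z) z0"
      unfolding h_def by (rule higher_deriv_add[OF _ _ N]) (use e in \<open>auto intro!: holomorphic_intros\<close>)
    moreover have "(deriv ^^ n) (\<lambda>z. 1) z0 = (0::complex)" using that by auto
    ultimately show ?thesis using hx[OF that] by simp
  qed
  have Fn: "(deriv ^^ n) F z0 = (deriv ^^ n) f z0" if "n \<in> {1, 2, 3}" for n
  proof -
    have "(deriv ^^ n) F z0 = (deriv ^^ n) f z0 - (deriv ^^ n) (\<lambda>z. f z0) z0"
      unfolding F_def by (rule higher_deriv_diff[OF f _ N]) auto
    moreover have "(deriv ^^ n) (\<lambda>z. f z0) z0 = 0" using that by auto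
    ultimately show ?thesis by simp
  qed
  have P: "(deriv ^^ n) (\<lambda>z. F z * h z) z0 = (\<Sum>i = 0..n. of_nat (n choose i) * (deriv ^^ i) F z0 * (deriv ^^ (n - i)) h z0)" for n
    by (rule higher_deriv_mult[OF F h N])
  have v: "F z0 = 0" "h z0 = 1" "deriv F z0 = \<alpha>" "deriv (deriv F) z0 = deriv (deriv f) z0" "deriv (deriv (deriv F)) z0 = deriv (deriv (deriv f)) z0"
    "deriv h z0 = e z0" "deriv (deriv h) z0 = 2 * deriv e z0"
    using Fn[of 1] Fn[of 2] Fn[of 3] hn[of 1] hn[of 2] by (simp_all add: F_def h_def \<alpha>_def numeral_eq_Suc)
  have G2: "(deriv ^^ 2) (\<lambda>z. F z * h z) z0 = 0" and G3: "(deriv ^^ 3) (\<lambda>z. F z * h z) z0 = 0"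
    unfolding G by (simp_all add: numeral_eq_Suc dG)
  have 2: "deriv (deriv f) z0 + 2 * \<alpha> * e z0 = 0"
    using P[of 2] v unfolding G2 by (simp add: numeral_eq_Suc mult_ac add_ac)
  have 3: "deriv (deriv (deriv f)) z0 + 3 * deriv (deriv f) z0 * e z0 + 6 * \<alpha> * deriv e z0 = 0"
    using P[of 3] v unfolding G3 by (simp add: numeral_eq_Suc algebra_simps)
  have e0: "e z0 = - deriv (deriv f) z0 / (2 * \<alpha>)" using 2 \<alpha> by (simp add: field_simps add_eq_0_iff)
  have "deriv (deriv (deriv f)) z0 / \<alpha> - 3/2 * (deriv (deriv f) z0 / \<alpha>)\<^sup>2 = - 6 * deriv e z0"
    using 3 \<alpha> unfolding e0 by (simp add: field_simps power2_eq_square)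
  then show ?thesis using schwarzian_eq(3)[OF f N nz] by (simp add: \<alpha>_def)
qed

text \<open>With \<open>\<alpha> / (w - w z0)\<close> in place of \<open>w\<close>, the
  Schwarzian at \<open>z0\<close> becomes the derivative of the bounded function
  \<open>E = \<alpha> / (w - w z0) - 1 / (z - z0)\<close>, to which the energy estimate applies.\<close>

lemma schwarzian_estimate:
  assumes qc: "qc_solution (\<lambda>z. if z \<in> ext_disc then \<mu> z else 0) w"
    and m: "m \<in> borel_measurable borel" "\<And>z. norm z \<le> 1 \<Longrightarrow> m z = 0"
      "AE z in lborel. m z = (if z \<in> ext_disc then \<mu> z else 0)" "AE z in lborel. norm (m z) \<le> k" "0 \<le> k" "k < 1"
    and z0: "z0 \<in> disc" "w (Some z0) \<noteq> None"
  shows "norm (bump_const * schwarzian (planar w) z0 + 6 * (LINT z|lborel. m z / (z - z0)^4)) \<le> 6 * (k\<^sup>2 * (22 / (1 - norm z0)\<^sup>2) / (1 - k))"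
proof -
  have h: "homeomorphic_map riemann_sphere riemann_sphere w" using qc by (simp add: qc_solution_def)
  define U where "U = {z. w (Some z) \<noteq> None}"
  define f where "f = planar w"
  define w0 where "w0 = f z0"
  have oU: "open U" unfolding U_def by (rule open_finite_domain[OF h])
  have cf: "continuous_on U f" unfolding U_def f_def by (rule continuous_planar[OF h])
  have injf: "inj_on f U" unfolding U_def f_def by (rule inj_on_planar[OF h])
  have z0U: "z0 \<in> U" using z0 by (simp add: U_def)
  define N where "N = disc \<inter> U"
  have N: "open N" "z0 \<in> N" using oU z0 by (auto simp: N_def U_def)
  have Neq: "N = {z \<in> disc. w (Some z) \<noteq> None}" by (auto simp: N_def U_def)
  have fN: "f holomorphic_on N" unfolding Neq f_def by (rule qc_solution_holomorphic[OF qc])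
  have df: "deriv f z \<noteq> 0" if "z \<in> N" for z
    using planar_deriv_nonzero[OF qc] that by (auto simp: f_def Neq)
  define \<alpha> where "\<alpha> = deriv f z0"
  have \<alpha>: "\<alpha> \<noteq> 0" using df[OF N(2)] by (simp add: \<alpha>_def)
  \<comment> \<open>If no finite point is sent to infinity, b = z0, so that the exceptional set has
    the form {z0, b} in every case.\<close>
  obtain b where b: "U - {z0} = - {z0, b}"
  proof (cases "\<exists>b. w (Some b) = None")
    case True
    then obtain b where b: "w (Some b) = None" by blast
    have "z = b" if "w (Some z) = None" for z
      using sphere_homeo(1)[OF h] that b by (metis injD option.inject)
    then have "U = - {b}" using b unfolding U_def by blast
    then have "U - {z0} = - {z0, b}" by blast
    then show thesis by (rule that)
  next
    case False
    then have "U - {z0} = - {z0, z0}" by (auto simp: U_def)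
    then show thesis by (rule that)
  qed
  have fne: "f z \<noteq> w0" if "z \<in> - {z0, b}" for z
    using that injf z0U unfolding b[symmetric] w0_def inj_on_def by auto
  define E where "E = (\<lambda>z. \<alpha> * (1 / (f z - w0)) - 1 / (z - z0))"
  \<comment> \<open>Two divided differences: \<open>g\<close> is that of \<open>f\<close>, the
    quotient l = \<alpha> / g is 1 at \<open>z0\<close>, and e = (l - 1) / (z - z0) extends
    \<open>E\<close> holomorphically over \<open>z0\<close>.\<close>
  define g where "g = (\<lambda>z. if z = z0 then deriv f z0 else (f z - f z0) / (z - z0))"
  have g: "g holomorphic_on N" unfolding g_def by (rule pole_lemma[OF fN]) (use N in \<open>simp add: interior_open\<close>)
  have gn: "g z \<noteq> 0" if "z \<in> N" for z
  proof (cases "z = z0")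
    case False
    then have "f z \<noteq> f z0" using that injf z0U by (auto simp: N_def inj_on_def)
    then show ?thesis using False by (simp add: g_def)
  qed (use \<alpha> in \<open>simp add: g_def \<alpha>_def\<close>)
  define l where "l = (\<lambda>z. \<alpha> / g z)"
  have l: "l holomorphic_on N" unfolding l_def using g gn by (intro holomorphic_intros)
  have l0: "l z0 = 1" using \<alpha> by (simp add: l_def g_def \<alpha>_def)
  define e where "e = (\<lambda>z. if z = z0 then deriv l z0 else (l z - l z0) / (z - z0))"
  have e: "e holomorphic_on N" unfolding e_def by (rule pole_lemma[OF l]) (use N in \<open>simp add: interior_open\<close>)
  have eE: "e z = E z" if "z \<in> N" "z \<noteq> z0" for z
  proof -
    have "f z - w0 \<noteq> 0" using gn[OF that(1)] that(2) by (auto simp: g_def w0_def)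
    moreover have "(\<alpha> / (F / x) - 1) / x = \<alpha> * (1 / F) - 1 / x" if "F \<noteq> 0" "x \<noteq> 0" for F x
      using that by (simp add: field_simps)
    moreover have "e z = (l z - 1) / (z - z0)" using that(2) by (simp add: e_def l0)
    moreover have "l z = \<alpha> / ((f z - w0) / (z - z0))" using that(2) by (simp add: l_def g_def w0_def)
    ultimately show ?thesis using that(2) by (simp add: E_def)
  qed
  have rel: "(f z - f z0) * (1 + (z - z0) * e z) = deriv f z0 * (z - z0)" if "z \<in> N" for z
  proof (cases "z = z0")
    case False
    have "f z - w0 \<noteq> 0" using gn[OF that] False by (auto simp: g_def w0_def)
    moreover have "F * (1 + x * (\<alpha> * (1 / F) - 1 / x)) = \<alpha> * x" if "F \<noteq> 0" "x \<noteq> 0" for F x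
      using that by (simp add: field_simps)
    moreover have "e z = \<alpha> * (1 / (f z - w0)) - 1 / (z - z0)" using eE[OF that False] by (simp only: E_def)
    ultimately show ?thesis using False by (simp only: w0_def[symmetric] \<alpha>_def[symmetric] right_minus_eq not_False_eq_True simp_thms)
  qed simp
  have S: "schwarzian f z0 = - 6 * deriv e z0"
    by (rule schwarzian_from_expansion[OF fN e N df rel])
  text \<open>The singularity of \<open>E\<close> at the pole of \<open>w\<close> is removable.\<close>
  define E2 where "E2 = (\<lambda>z. if z \<in> U then (if z = z0 then e z0 else E z) else - 1 / (z - z0))"
  have E2N: "E2 z = e z" if "z \<in> N" for z using that eE by (auto simp: E2_def N_def)
  have E2h: "E2 holomorphic_on disc"
  proof -
    have hN: "E2 holomorphic_on N" by (rule holomorphic_transform[OF e]) (simp add: E2N)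
    have cN: "isCont E2 z" if "z \<in> N" for z
      using holomorphic_on_imp_continuous_on[OF hN] N(1) that by (simp add: continuous_on_eq_continuous_at)
    have cb: "isCont E2 z" if z: "z \<in> disc" "z \<notin> U" for z
      unfolding continuous_at_eps_delta
    proof (intro allI impI)
      have pole: "w (Some z) = None" using z by (simp add: U_def)
      have zz0: "z \<noteq> z0" using z z0U by auto
      fix \<epsilon> :: real assume "\<epsilon> > 0"
      have "isCont (\<lambda>x. 1 / (x - z0)) z" using zz0 by (intro continuous_intros) auto
      then obtain d1 where d1: "d1 > 0" "\<And>x. dist x z < d1 \<Longrightarrow> dist (1 / (x - z0)) (1 / (z - z0)) < \<epsilon>/2"
        using \<open>\<epsilon> > 0\<close> unfolding continuous_at_eps_delta by (metis half_gt_zero)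
      obtain d2 where d2: "d2 > 0" "\<And>x. x \<in> ball z d2 - {z} \<Longrightarrow> norm w0 + 2 * norm \<alpha> / \<epsilon> < norm (f x)"
        using planar_at_pole[OF h pole] unfolding f_def by metis
      show "\<exists>d>0. \<forall>x. dist x z < d \<longrightarrow> dist (E2 x) (E2 z) < \<epsilon>"
      proof (intro exI[of _ "min (min d1 d2) (dist z z0)"] conjI allI impI)
        fix x assume x: "dist x z < min (min d1 d2) (dist z z0)"
        show "dist (E2 x) (E2 z) < \<epsilon>"
        proof (cases "x = z")
          case False
          then have xb: "x \<in> ball z d2 - {z}" using x by (auto simp: dist_commute)
          have "x \<noteq> z0" using x by (auto simp: dist_commute)
          have "w (Some x) \<noteq> None" using sphere_homeo(1)[OF h] pole False by (metis injD option.inject)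
          then have Ex: "E2 x = \<alpha> / (f x - w0) - 1 / (x - z0)" using \<open>x \<noteq> z0\<close> by (simp add: E2_def U_def E_def)
          have "norm (f x) - norm w0 > 2 * norm \<alpha> / \<epsilon>" using d2(2)[OF xb] by simp
          then have big: "norm (f x - w0) > 2 * norm \<alpha> / \<epsilon>" using norm_triangle_ineq2[of "f x" w0] by linarith
          have pos: "norm (f x - w0) > 0" using big \<open>\<epsilon> > 0\<close> \<alpha> by (smt (verit) divide_pos_pos mult_pos_pos zero_less_norm_iff)
          have "norm (\<alpha> / (f x - w0)) < \<epsilon>/2"
            using big pos \<open>\<epsilon> > 0\<close> by (simp add: norm_divide field_simps)
          moreover have "norm (1 / (x - z0) - 1 / (z - z0)) < \<epsilon>/2" using d1(2)[of x] x by (simp add: dist_norm)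
          moreover have "E2 x - E2 z = \<alpha> / (f x - w0) - (1 / (x - z0) - 1 / (z - z0))"
            using Ex z by (simp add: E2_def)
          ultimately show ?thesis
            using norm_triangle_ineq4[of "\<alpha> / (f x - w0)" "1 / (x - z0) - 1 / (z - z0)"] by (simp add: dist_norm)
        qed (use \<open>\<epsilon> > 0\<close> in simp)
      qed (use d1 d2 zz0 in auto)
    qed
    have "E2 holomorphic_on disc - {b}"
      by (rule holomorphic_on_subset[OF hN]) (use b z0U in \<open>auto simp: N_def\<close>)
    moreover have "continuous_on disc E2"
    proof (intro continuous_at_imp_continuous_on ballI)
      show "isCont E2 x" if "x \<in> disc" for x using cN[of x] cb[of x] that by (cases "x \<in> U") (auto simp: N_def)
    qed
    ultimately show ?thesis by (intro no_isolated_singularity[of disc E2 "{b}"]) auto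
  qed
  have dE2: "deriv E2 z0 = deriv e z0"
    by (rule deriv_cong_ev) (use N E2N in \<open>auto simp: eventually_nhds\<close>)
  obtain p q where pq: "weakd U f p q"
    "AE z in lborel. w (Some z) \<noteq> None \<longrightarrow> q z = (if z \<in> ext_disc then \<mu> z else 0) * p z"
    using qc_solution_weakd[OF qc] unfolding U_def f_def by blast
  define V where "V = - {z0, b}"
  have oV: "open V" unfolding V_def by (auto intro: open_Compl finite_imp_closed)
  have VU: "V \<subseteq> U" using b by (auto simp: V_def)
  have mf: "f \<in> borel_measurable borel" unfolding f_def by (rule borel_planar[OF h])
  note w1 = weakd_subset[OF weakd_diff[OF pq(1) weakd_holomorphic[OF oU holomorphic_on_const[of w0]]] oV VU]
  note w2 = weakd_cmult[OF weakd_inverse[OF w1], of \<alpha>]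
  have hol: "(\<lambda>z. 1 / (z - z0)) holomorphic_on V" by (intro holomorphic_intros) (auto simp: V_def)
  have w3: "weakd V E (\<lambda>z. \<alpha> * - ((p z - indicator U z * deriv (\<lambda>z. w0) z) / (f z - w0)\<^sup>2) - indicator V z * deriv (\<lambda>z. 1 / (z - z0)) z)
    (\<lambda>z. \<alpha> * - ((q z - 0) / (f z - w0)\<^sup>2) - 0)"
    unfolding E_def by (rule weakd_diff[OF w2 weakd_holomorphic[OF oV hol]]) (use fne mf in \<open>auto simp: V_def\<close>)
  have mE: "E \<in> borel_measurable borel" unfolding E_def using mf by measurable
  \<comment> \<open>Near \<open>z0\<close> the function is the holomorphic \<open>e\<close>;
    everywhere else, also near the pole and near infinity, \<open>f\<close> stays away from
    \<open>w0\<close>.\<close>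
  obtain M where M: "\<And>z. z \<notin> {z0, b} \<Longrightarrow> norm (E z) \<le> M"
  proof -
    obtain r where r: "r > 0" "cball z0 r \<subseteq> N" using N(1)[unfolded open_contains_cball, rule_format, OF N(2)] by metis
    obtain \<delta> where \<delta>: "\<delta> > 0" "\<And>z. z \<notin> ball z0 r \<Longrightarrow> w (Some z) \<noteq> None \<Longrightarrow> \<delta> \<le> norm (f z - w0)"
      using planar_bounded_away[OF h z0(2) r(1)] unfolding f_def w0_def by metis
    have "bounded (e ` cball z0 r)"
      using e r(2) by (intro compact_imp_bounded compact_continuous_image holomorphic_on_imp_continuous_on) (auto intro: holomorphic_on_subset)
    then obtain B where B: "\<forall>z\<in>cball z0 r. norm (e z) \<le> B" unfolding bounded_iff by auto
    show thesis
    proof (rule that)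
      fix z assume z: "z \<notin> {z0, b}"
      show "norm (E z) \<le> max B (norm \<alpha> / \<delta> + 1 / r)"
      proof (cases "z \<in> cball z0 r")
        case True then show ?thesis using B eE[of z] r(2) z by fastforce
      next
        case False
        then have "z \<in> U" "z \<notin> ball z0 r" using z b by auto
        then have d: "\<delta> \<le> norm (f z - w0)" using \<delta>(2) by (simp add: U_def)
        have "norm (E z) \<le> norm (\<alpha> / (f z - w0)) + norm (1 / (z - z0))"
          unfolding E_def using norm_triangle_ineq4[of "\<alpha> / (f z - w0)" "1 / (z - z0)"] by simp
        also have "\<dots> \<le> norm \<alpha> / \<delta> + 1 / r"
          unfolding norm_divide using d \<delta>(1) r(1) False
          by (intro add_mono frac_le) (auto simp: dist_norm norm_minus_commute)
        finally show ?thesis by simp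
      qed
    qed
  qed
  have AEV: "AE z in lborel. z \<in> V"
    using AE_lborel_singleton[of z0] AE_lborel_singleton[of b] by eventually_elim (auto simp: V_def)
  have est: "norm (bump_const * deriv E2 z0 - (LINT z|lborel. m z / (z - z0)^4)) \<le> k\<^sup>2 * (22 / (1 - norm z0)\<^sup>2) / (1 - k)"
  proof (rule energy_estimate[OF _ w3[unfolded V_def] M mE])
    show "AE z in lborel. \<alpha> * - ((q z - 0) / (f z - w0)\<^sup>2) - 0 = m z * (\<alpha> * - ((p z - indicator U z * deriv (\<lambda>z. w0) z) / (f z - w0)\<^sup>2)
       - indicator (- {z0, b}) z * deriv (\<lambda>z. 1 / (z - z0)) z - 1 / (z - z0)\<^sup>2)"
      using pq(2) m(3) AEV
    proof eventually_elim
      case (elim z)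
      have "z \<noteq> z0" using elim(3) by (simp add: V_def)
      then have "deriv (\<lambda>z. 1 / (z - z0)) z = - 1 / (z - z0)\<^sup>2"
        by (intro DERIV_imp_deriv) (auto intro!: derivative_eq_intros simp: power2_eq_square)
      moreover have "q z = m z * p z" using elim VU by (auto simp: U_def)
      ultimately show ?case using elim(3) by (simp add: V_def)
    qed
    show "E2 holomorphic_on ball z0 (1 - norm z0)"
    proof (rule holomorphic_on_subset[OF E2h], rule subsetI)
      fix z assume "z \<in> ball z0 (1 - norm z0)"
      then show "z \<in> disc" using norm_triangle_ineq2[of z z0] by (simp add: dist_norm norm_minus_commute)
    qed
    show "E z = E2 z" if "z \<in> ball z0 (1 - norm z0) - {z0, b}" for z
      using that b by (auto simp: E2_def)
  qed (use m z0 in auto)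
  have eq: "bump_const * schwarzian (planar w) z0 + 6 * (LINT z|lborel. m z / (z - z0)^4) =
     - 6 * (bump_const * deriv E2 z0 - (LINT z|lborel. m z / (z - z0)^4))"
    unfolding f_def[symmetric] S dE2 by (simp add: algebra_simps)
  have "norm (- 6 :: complex) = 6" by simp
  then show ?thesis unfolding eq norm_mult using mult_left_mono[OF est, of 6] by simp
qed

section \<open>Equivalent coefficients have equal solutions on the disc\<close>

text \<open>The map \<open>w\<^sub>1\<^sup>-\<^sup>1 \<circ> w\<^sub>2\<close> maps the disc into itself, is
  holomorphic there and is the identity on the circle.\<close>

lemma qc_solutions_agree:
  assumes q1: "qc_solution (\<lambda>z. if z \<in> ext_disc then \<mu> z else 0) w1"
    and q2: "qc_solution (\<lambda>z. if z \<in> ext_disc then \<nu> z else 0) w2"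
    and n: "w1 (Some 0) = Some 0" "w2 (Some 0) = Some 0"
    and eq: "\<And>z. z \<in> sphere 0 1 \<Longrightarrow> w1 (Some z) = w2 (Some z)"
    and z: "z \<in> disc"
  shows "w1 (Some z) = w2 (Some z)"
proof -
  have h1: "homeomorphic_map riemann_sphere riemann_sphere w1" and h2: "homeomorphic_map riemann_sphere riemann_sphere w2"
    using q1 q2 by (auto simp: qc_solution_def)
  define X where "X = insert None (Some ` ext_disc)"
  have oX: "openin riemann_sphere X"
  proof -
    have "{z. Some z \<in> X} = ext_disc" "{z. Some z \<notin> X} = cball 0 1" by (auto simp: X_def)
    moreover have "open ext_disc" by (intro open_Collect_less continuous_intros)
    ultimately show ?thesis by (simp add: openin_riemann_sphere)
  qed
  \<comment> \<open>The plane points that the composition sends into the disc and into the exterior,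
    respectively. Both sets are open, no point of the disc goes to the circle, and 0 goes to 0;
    connectedness puts the disc into \<open>U1\<close>.\<close>
  define U1 where "U1 = {z. w2 (Some z) \<in> w1 ` Some ` disc}"
  define U2 where "U2 = {z. w2 (Some z) \<in> w1 ` X}"
  have o: "open U1" "open U2" unfolding U1_def U2_def
    by (intro open_preimage_Some[OF h2] sphere_homeo(4)[OF h1] oX openin_Some_image open_ball)+
  have cover: "z \<in> U1 \<or> z \<in> U2" if "z \<in> disc" for z
  proof -
    obtain y where y: "w2 (Some z) = w1 y" using sphere_homeo(2)[OF h1] by (metis surjD)
    show ?thesis
    proof (cases y)
      case None then show ?thesis using y by (auto simp: U2_def X_def)
    next
      case (Some x)
      have "norm x \<noteq> 1"
      proof
        assume "norm x = 1"
        then have "w2 (Some z) = w2 (Some x)" using y Some eq[of x] by simp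
        then have "z = x" using sphere_homeo(1)[OF h2] by (metis injD option.inject)
        then show False using that \<open>norm x = 1\<close> by simp
      qed
      then consider "norm x < 1" | "norm x > 1" by linarith
      then show ?thesis using y Some by cases (auto simp: U1_def U2_def X_def)
    qed
  qed
  have "U1 \<inter> U2 \<inter> disc = {}"
  proof -
    have "w1 ` Some ` disc \<inter> w1 ` X = {}"
    proof -
      have "w1 ` Some ` disc \<inter> w1 ` X = w1 ` (Some ` disc \<inter> X)"
        by (rule image_Int[OF sphere_homeo(1)[OF h1], symmetric])
      moreover have "Some ` disc \<inter> X = {}" by (auto simp: X_def)
      ultimately show ?thesis by simp
    qed
    then show ?thesis by (auto simp: U1_def U2_def)
  qed
  moreover have "0 \<in> U1" using n by (auto simp: U1_def intro!: image_eqI[of _ _ "Some 0"])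
  ultimately have U1: "disc \<subseteq> U1"
    using connectedD[OF connected_ball[of "0::complex" 1] o] cover by fastforce
  obtain v where v: "homeomorphic_maps riemann_sphere riemann_sphere w1 v"
    using h1 homeomorphic_map_maps by blast
  have hv: "homeomorphic_map riemann_sphere riemann_sphere (v \<circ> w2)"
  proof (rule homeomorphic_map_compose[OF h2])
    have "homeomorphic_maps riemann_sphere riemann_sphere v w1" by (rule homeomorphic_maps_sym[THEN iffD1, OF v])
    then show "homeomorphic_map riemann_sphere riemann_sphere v" unfolding homeomorphic_map_maps by blast
  qed
  have vw: "v (w1 y) = y" for y using v by (cases y) (auto simp: homeomorphic_maps_def)
  define h where "h = planar (v \<circ> w2)"
  have hd: "(v \<circ> w2) (Some z) = Some (h z) \<and> h z \<in> disc \<and> w1 (Some (h z)) = w2 (Some z)" if zd: "z \<in> disc" for z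
  proof -
    have "z \<in> U1" using U1 zd by blast
    then obtain x where x: "x \<in> disc" "w2 (Some z) = w1 (Some x)" unfolding U1_def by blast
    then have "(v \<circ> w2) (Some z) = Some x" by (simp add: vw)
    then show ?thesis using x by (simp add: h_def planar_eq)
  qed
  have hc: "(v \<circ> w2) (Some z) = Some z \<and> h z = z" if "z \<in> sphere 0 1" for z
  proof -
    have "(v \<circ> w2) (Some z) = Some z" using eq[OF that] by (simp add: vw flip: eq[OF that])
    then show ?thesis by (simp add: h_def planar_eq)
  qed
  have ch: "continuous_on (cball 0 1) h"
  proof -
    have "cball 0 1 \<subseteq> {z. (v \<circ> w2) (Some z) \<noteq> None}"
    proof
      fix z :: complex assume "z \<in> cball 0 1"
      then consider "z \<in> disc" | "z \<in> sphere 0 1" by fastforce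
      then show "z \<in> {z. (v \<circ> w2) (Some z) \<noteq> None}" using hd hc by cases auto
    qed
    then show ?thesis unfolding h_def using continuous_planar[OF hv] continuous_on_subset by blast
  qed
  define N1 where "N1 = {z \<in> disc. w1 (Some z) \<noteq> None}"
  define N2 where "N2 = {z \<in> disc. w2 (Some z) \<noteq> None}"
  have "N1 = disc \<inter> {z. w1 (Some z) \<noteq> None}" "N2 = disc \<inter> {z. w2 (Some z) \<noteq> None}" by (auto simp: N1_def N2_def)
  then have oN: "open N1" "open N2" using open_finite_domain[OF h1] open_finite_domain[OF h2] by auto
  have inj1: "inj_on (planar w1) N1" by (rule inj_on_subset[OF inj_on_planar[OF h1]]) (auto simp: N1_def)
  \<comment> \<open>Away from the pole of \<open>w2\<close>, the composition \<open>h\<close> is the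
    holomorphic inverse of \<open>planar w1\<close> after \<open>planar w2\<close>.\<close>
  obtain g where g: "g holomorphic_on (planar w1 ` N1)" "\<And>z. z \<in> N1 \<Longrightarrow> g (planar w1 z) = z"
    using holomorphic_has_inverse[OF qc_solution_holomorphic[OF q1, folded N1_def] oN(1) inj1] by metis
  have hN: "h z \<in> N1 \<and> planar w1 (h z) = planar w2 z" if "z \<in> N2" for z
    using hd[of z] that by (auto simp: N1_def N2_def planar_def)
  have "(g \<circ> planar w2) holomorphic_on N2"
    by (rule holomorphic_on_compose_gen[OF qc_solution_holomorphic[OF q2, folded N2_def] g(1)])
      (use hN in \<open>metis image_eqI image_subsetI\<close>)
  then have hol2: "h holomorphic_on N2"
    by (rule holomorphic_transform) (use hN g(2) in \<open>metis comp_apply\<close>)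
  obtain b where b: "disc - {b} \<subseteq> N2"
  proof (cases "\<exists>b. w2 (Some b) = None")
    case True
    then obtain b where b: "w2 (Some b) = None" by blast
    have "z = b" if "w2 (Some z) = None" for z
      using sphere_homeo(1)[OF h2] that b by (metis injD option.inject)
    then have "disc - {b} \<subseteq> N2" unfolding N2_def by blast
    then show thesis by (rule that)
  next
    case False
    then have "disc - {0} \<subseteq> N2" by (auto simp: N2_def)
    then show thesis by (rule that)
  qed
  \<comment> \<open>At the pole of \<open>w2\<close> the composition is continuous, so that the
    singularity is removable.\<close>
  have hol: "h holomorphic_on disc"
    by (rule no_isolated_singularity[of _ _ "{b}"])
      (use holomorphic_on_subset[OF hol2 b] continuous_on_subset[OF ch ball_subset_cball] in auto)
  have "norm (h z - z) \<le> 0"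
  proof (rule maximum_modulus_frontier[of "\<lambda>z. h z - z" "cball 0 1"])
    show "(\<lambda>z. h z - z) holomorphic_on interior (cball 0 1)" using hol by (auto intro!: holomorphic_intros)
    show "continuous_on (closure (cball 0 1)) (\<lambda>z. h z - z)" using ch by (auto intro!: continuous_intros)
    show "norm (h z - z) \<le> 0" if "z \<in> frontier (cball 0 1)" for z
      using hc[of z] that by simp
  qed (use z in auto)
  then show ?thesis using hd[OF z] by simp
qed

section \<open>The lifted Bers maps in terms of representatives\<close>

lemma deriv_cong_disc:
  assumes "\<And>z. z \<in> disc \<Longrightarrow> f z = g z" "z \<in> disc"
  shows "deriv f z = deriv g z"
proof (rule deriv_cong_ev[OF _ refl])
  show "\<forall>\<^sub>F x in nhds z. f x = g x"
    using assms by (intro eventually_nhds[THEN iffD2] exI[of _ disc]) auto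
qed

lemma higher_deriv_cong_disc:
  assumes "\<And>z. z \<in> disc \<Longrightarrow> f z = g z" "z \<in> disc"
  shows "(deriv ^^ n) f z = (deriv ^^ n) g z"
  using assms(2)
proof (induction n arbitrary: z)
  case (Suc n)
  then show ?case using deriv_cong_disc[of "(deriv ^^ n) f" "(deriv ^^ n) g" z] by simp
qed (use assms in simp)

lemma higher_schwarzian_cong:
  assumes "\<And>z. z \<in> disc \<Longrightarrow> f z = g z" "z \<in> disc"
  shows "higher_schwarzian s n f z = higher_schwarzian s n g z"
proof -
  have d1: "deriv f z = deriv g z" if "z \<in> disc" for z using deriv_cong_disc[of f g z] assms(1) that by blast
  have d2: "deriv (deriv f) z = deriv (deriv g) z" if "z \<in> disc" for z using deriv_cong_disc[of "deriv f" "deriv g" z] d1 that by blast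
  have p: "pre_schwarzian f z = pre_schwarzian g z" if "z \<in> disc" for z
    using d1[OF that] d2[OF that] by (simp add: pre_schwarzian_def)
  have sc: "schwarzian f z = schwarzian g z" if "z \<in> disc" for z
    using deriv_cong_disc[of "pre_schwarzian f" "pre_schwarzian g" z] p that by (simp add: schwarzian_def)
  show ?thesis
  proof (cases s)
    case A
    have "schwarzian_A n f z = schwarzian_A n g z" if "z \<in> disc" for z
      using that
    proof (induction n arbitrary: z)
      case 0 then show ?case using sc by simp
    next
      case (Suc n)
      show ?case
        using sc[OF Suc.prems] p[OF Suc.prems] Suc.IH deriv_cong_disc[of "schwarzian_A n f" "schwarzian_A n g" z] Suc.prems by simp
    qed
    then show ?thesis using A assms(2) by simp
  next
    case B
    \<comment> \<open>The choice of the root depends on the derivative on the disc alone, so that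
      both functions get the same branch.\<close>
    have "sqrt_deriv f = sqrt_deriv g" unfolding sqrt_deriv_def using d1 by (metis (no_types, opaque_lifting))
    then show ?thesis using B by (simp add: schwarzian_B_def)
  qed
qed

text \<open>By \<open>qc_solutions_agree\<close> the solutions of equivalent coefficients coincide
  on the disc. The image of the class is therefore a singleton, and \<open>the_elem\<close> returns
  its element.\<close>

lemma bers_lift_eq:
  assumes w: "\<And>\<mu>. \<mu> \<in> belt G \<Longrightarrow> normalized_solution \<mu> (w \<mu>)" and \<mu>: "\<mu> \<in> belt G"
  shows "bers_lift s n w G \<mu> = (\<lambda>z. if z \<in> disc then higher_schwarzian s n (planar (w \<mu>)) z else 0)"
proof -
  define F where "F = (\<lambda>\<mu> z. if z \<in> disc then higher_schwarzian s n (planar (w \<mu>)) z else 0)"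
  have eq: "F \<nu> = F \<mu>" if "\<nu> \<in> teich_proj w G \<mu>" for \<nu>
  proof -
    have \<nu>: "\<nu> \<in> belt G" "\<And>z. z \<in> sphere 0 1 \<Longrightarrow> w \<mu> (Some z) = w \<nu> (Some z)"
      using that by (auto simp: teich_proj_def teich_rel_def)
    have "w \<mu> (Some z) = w \<nu> (Some z)" if "z \<in> disc" for z
      by (rule qc_solutions_agree[of \<mu> "w \<mu>" \<nu> "w \<nu>"])
        (use w[OF \<mu>] w[OF \<nu>(1)] \<nu>(2) that in \<open>auto simp: normalized_solution_def\<close>)
    then have "planar (w \<nu>) z = planar (w \<mu>) z" if "z \<in> disc" for z
      using that by (simp add: planar_def)
    then show ?thesis
      using higher_schwarzian_cong[of "planar (w \<nu>)" "planar (w \<mu>)" _ s n] unfolding F_def by (intro ext) simp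
  qed
  have mem: "\<mu> \<in> teich_proj w G \<mu>" using \<mu> by (simp add: teich_proj_def teich_rel_def)
  have "F ` teich_proj w G \<mu> = {F \<mu>}"
  proof
    show "F ` teich_proj w G \<mu> \<subseteq> {F \<mu>}" using eq by blast
    show "{F \<mu>} \<subseteq> F ` teich_proj w G \<mu>" using mem by blast
  qed
  then have "the_elem (F ` teich_proj w G \<mu>) = F \<mu>" by simp
  moreover have "bers_lift s n w G \<mu> = the_elem (F ` teich_proj w G \<mu>)"
    unfolding bers_lift_def bers_map_def induced_def comp_def F_def ..
  ultimately show ?thesis by (simp add: F_def)
qed

section \<open>The Riccati equation of the pre-Schwarzian\<close>

text \<open>Along the ray the pre-Schwarzian solves the Riccati equation P' = S + P^2 / 2 with P = 0
  at 0. Since c^2 / 2 + \<epsilon> \<le> c, the function c / (1 - |x|) is a supersolution, which P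
  cannot reach.\<close>

lemma riccati_bound:
  assumes f: "f holomorphic_on N" "open N" "\<And>x. x \<in> N \<Longrightarrow> deriv f x \<noteq> 0"
    and ray: "\<And>t. 0 \<le> t \<Longrightarrow> t \<le> 1 \<Longrightarrow> of_real t * z \<in> N" and z: "norm z < 1"
    and S: "\<And>x. x \<in> N \<Longrightarrow> norm (schwarzian f x) \<le> \<epsilon> / (1 - norm x)\<^sup>2"
    and 0: "deriv (deriv f) 0 = 0" and c: "0 < c" "0 \<le> \<epsilon>" "c\<^sup>2 / 2 + \<epsilon> \<le> c"
  shows "norm (pre_schwarzian f z) \<le> c / (1 - norm z)"
proof (rule ccontr)
  assume not: "\<not> ?thesis"
  define \<rho> where "\<rho> = norm z"
  have \<rho>: "0 \<le> \<rho>" "\<rho> < 1" using z by (auto simp: \<rho>_def)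
  define p where "p = (\<lambda>t::real. pre_schwarzian f (of_real t * z))"
  have t\<rho>: "t * \<rho> < 1" if "0 \<le> t" "t \<le> 1" for t
    using mult_right_mono[OF that(2) \<rho>(1)] \<rho> by simp
  have dp: "(p has_vector_derivative (schwarzian f (of_real t * z) + (p t)\<^sup>2 / 2) * z) (at t)" if "0 \<le> t" "t \<le> 1" for t
  proof -
    have "((\<lambda>x. pre_schwarzian f (x * z)) has_field_derivative (schwarzian f (of_real t * z) + (p t)\<^sup>2 / 2) * z) (at (of_real t))"
      unfolding p_def
      by (rule DERIV_chain2[where g = "\<lambda>x. x * z", OF schwarzian_eq(1)[OF f(1,2) ray[OF that] f(3)]])
        (auto intro!: derivative_eq_intros)
    from has_vector_derivative_real_field[OF this] show ?thesis by (simp add: p_def)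
  qed
  have cp: "continuous_on {0..1} p"
    using dp by (meson atLeastAtMost_iff continuous_at_imp_continuous_on has_vector_derivative_continuous)
  have cq: "continuous_on {0..1} (\<lambda>t. c / (1 - t * \<rho>))"
    using t\<rho> by (intro continuous_intros) fastforce
  \<comment> \<open>The parameters at which the bound is attained or exceeded. \<open>T\<close> is
    compact and contains 1, hence has a least element \<open>t0\<close>, before which the bound
    holds.\<close>
  define T where "T = {t \<in> {0..1}. c / (1 - t * \<rho>) \<le> norm (p t)}"
  have "T = {0..1} \<inter> (\<lambda>t. norm (p t) - c / (1 - t * \<rho>)) -` {0..}" by (auto simp: T_def)
  moreover have "closed ({0..1} \<inter> (\<lambda>t. norm (p t) - c / (1 - t * \<rho>)) -` {0..})"
    by (rule continuous_closed_preimage[OF continuous_on_diff[OF continuous_on_norm[OF cp] cq]]) auto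
  ultimately have "closed T" by simp
  moreover have "bounded T" by (rule bounded_subset[of "{0..1}"]) (auto simp: T_def)
  ultimately have "compact T" by (simp add: compact_eq_bounded_closed)
  moreover have "1 \<in> T" using not by (simp add: T_def p_def \<rho>_def)
  ultimately obtain t0 where t0: "t0 \<in> T" "\<And>t. t \<in> T \<Longrightarrow> t0 \<le> t"
    using compact_attains_inf[of T] by blast
  have t01: "0 \<le> t0" "t0 \<le> 1" "c / (1 - t0 * \<rho>) \<le> norm (p t0)" using t0(1) by (auto simp: T_def)
  have p0: "p 0 = 0" using 0 by (simp add: p_def pre_schwarzian_def)
  then have "t0 \<noteq> 0" using t01(3) c(1) by auto
  then have "0 < t0" using t01 by simp
  \<comment> \<open>The derivative of \<Psi> dominates that of \<open>p\<close> before
    \<open>t0\<close>. Integration gives |p t0| \<le> \<Psi> t0 - \<Psi> 0, and \<Psi> 0 > 0 makes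
    the final inequality strict.\<close>
  define \<Psi> where "\<Psi> = (\<lambda>t. (c\<^sup>2 / 2 + \<epsilon>) / (1 - t * \<rho>))"
  have "norm (p t0 - p 0) \<le> \<Psi> t0 - \<Psi> 0"
  proof (rule differentiable_bound_general[OF \<open>0 < t0\<close>])
    show "continuous_on {0..t0} p" using cp t01 by (auto intro: continuous_on_subset)
    show "continuous_on {0..t0} \<Psi>" unfolding \<Psi>_def using t\<rho> t01 by (intro continuous_intros) fastforce
    fix t assume t: "0 < t" "t < t0"
    have tt: "0 \<le> t" "t \<le> 1" using t t01 by auto
    have pos: "0 < 1 - t * \<rho>" using t\<rho>[OF tt] by simp
    show "(p has_vector_derivative (schwarzian f (of_real t * z) + (p t)\<^sup>2 / 2) * z) (at t)" by (rule dp[OF tt])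
    have "(\<Psi> has_real_derivative (c\<^sup>2 / 2 + \<epsilon>) * (\<rho> / (1 - t * \<rho>)\<^sup>2)) (at t)"
      unfolding \<Psi>_def using pos by (auto intro!: derivative_eq_intros simp: power2_eq_square)
    then show "(\<Psi> has_vector_derivative (c\<^sup>2 / 2 + \<epsilon>) * (\<rho> / (1 - t * \<rho>)\<^sup>2)) (at t)"
      by (simp add: has_real_derivative_iff_has_vector_derivative)
    have nt: "norm (of_real t * z) = t * \<rho>" using t by (simp add: norm_mult \<rho>_def)
    have "t \<notin> T" using t0(2)[of t] t by auto
    then have pt: "norm (p t) \<le> c / (1 - t * \<rho>)" using tt by (auto simp: T_def)
    have "norm ((p t)\<^sup>2 / 2) \<le> (c / (1 - t * \<rho>))\<^sup>2 / 2"
      using power_mono[OF pt, of 2] by (simp add: norm_divide norm_power)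
    moreover have "norm (schwarzian f (of_real t * z)) \<le> \<epsilon> / (1 - t * \<rho>)\<^sup>2"
      using S[OF ray[OF tt]] nt by simp
    ultimately have "norm (schwarzian f (of_real t * z) + (p t)\<^sup>2 / 2) \<le> \<epsilon> / (1 - t * \<rho>)\<^sup>2 + (c / (1 - t * \<rho>))\<^sup>2 / 2"
      by (rule order_trans[OF norm_triangle_ineq add_mono, rotated])
    then have "norm (schwarzian f (of_real t * z) + (p t)\<^sup>2 / 2) * \<rho> \<le> (\<epsilon> / (1 - t * \<rho>)\<^sup>2 + (c / (1 - t * \<rho>))\<^sup>2 / 2) * \<rho>"
      using \<rho>(1) by (rule mult_right_mono)
    also have "\<dots> = (c\<^sup>2 / 2 + \<epsilon>) * (\<rho> / (1 - t * \<rho>)\<^sup>2)"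
      by (simp add: power_divide add_divide_distrib distrib_right distrib_left)
    finally show "norm ((schwarzian f (of_real t * z) + (p t)\<^sup>2 / 2) * z) \<le> (c\<^sup>2 / 2 + \<epsilon>) * (\<rho> / (1 - t * \<rho>)\<^sup>2)"
      by (simp add: norm_mult \<rho>_def)
  qed
  also have "\<dots> < c / (1 - t0 * \<rho>)"
  proof -
    have "\<Psi> t0 \<le> c / (1 - t0 * \<rho>)" unfolding \<Psi>_def using c(3) t\<rho>[OF t01(1,2)] by (intro divide_right_mono) auto
    moreover have "\<Psi> 0 > 0" using c(1,2) by (simp add: \<Psi>_def add_pos_nonneg)
    ultimately show ?thesis by linarith
  qed
  finally show False using p0 t01(3) by simp
qed

text \<open>If \<open>b\<close> is the pole, there is none in the open disc of radius |b|. There the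
  pre-Schwarzian is bounded by \<open>riccati_bound\<close>; two integrations bound the solution
  itself, which contradicts its growth near \<open>b\<close>.\<close>

lemma no_pole:
  assumes qc: "qc_solution (\<lambda>z. if z \<in> ext_disc then \<mu> z else 0) w"
    and n: "w (Some 0) = Some 0" "deriv (planar w) 0 = 1" "deriv (deriv (planar w)) 0 = 0"
    and S: "\<And>x. x \<in> disc \<Longrightarrow> w (Some x) \<noteq> None \<Longrightarrow> norm (schwarzian (planar w) x) \<le> \<epsilon> / (1 - norm x)\<^sup>2"
    and c: "0 < c" "0 \<le> \<epsilon>" "c\<^sup>2 / 2 + \<epsilon> \<le> c" and b: "b \<in> disc"
  shows "w (Some b) \<noteq> None"
proof
  assume pole: "w (Some b) = None"
  have h: "homeomorphic_map riemann_sphere riemann_sphere w" using qc by (simp add: qc_solution_def)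
  define f where "f = planar w"
  define N where "N = {z \<in> disc. w (Some z) \<noteq> None}"
  have "N = disc \<inter> {z. w (Some z) \<noteq> None}" by (auto simp: N_def)
  then have oN: "open N" using open_finite_domain[OF h] by auto
  have fN: "f holomorphic_on N" unfolding f_def N_def by (rule qc_solution_holomorphic[OF qc])
  have df: "deriv f z \<noteq> 0" if "z \<in> N" for z using planar_deriv_nonzero[OF qc] that by (auto simp: f_def N_def)
  have b0: "norm b > 0" using pole n by auto
  define R where "R = ball (0::complex) (norm b)"
  have RN: "R \<subseteq> N"
  proof
    fix z assume "z \<in> R"
    then have "norm z < norm b" by (simp add: R_def)
    moreover have "w (Some z) \<noteq> None"
    proof
      assume "w (Some z) = None"
      then have "z = b" using sphere_homeo(1)[OF h] pole by (metis injD option.inject)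
      then show False using \<open>norm z < norm b\<close> by simp
    qed
    ultimately show "z \<in> N" using b by (simp add: N_def)
  qed
  define C where "C = c / (1 - norm b)"
  have b1: "norm b < 1" using b by simp
  have C: "C > 0" using c b1 by (simp add: C_def)
  have P: "norm (pre_schwarzian f z) \<le> C" if z: "z \<in> R" for z
  proof -
    have "norm (pre_schwarzian f z) \<le> c / (1 - norm z)"
    proof (rule riccati_bound[OF fN oN df _ _ _ _ c])
      show "of_real t * z \<in> N" if "0 \<le> t" "t \<le> 1" for t
      proof -
        have "t * norm z \<le> 1 * norm z" using that by (intro mult_right_mono) auto
        then have "of_real t * z \<in> R" using z that by (simp add: R_def norm_mult)
        then show ?thesis using RN by blast
      qed
    qed (use z b1 S n(3) in \<open>auto simp: R_def f_def N_def\<close>)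
    also have "\<dots> \<le> C" unfolding C_def using z b1 c(1) by (intro divide_left_mono mult_pos_pos) (auto simp: R_def)
    finally show ?thesis .
  qed
  have oR: "open R" "convex R" "0 \<in> R" using b0 by (auto simp: R_def)
  have fR: "f holomorphic_on R" using fN RN by (rule holomorphic_on_subset)
  have dfR: "deriv f holomorphic_on R" using fR oR by (auto intro: holomorphic_deriv)
  have "pre_schwarzian f holomorphic_on R"
    using schwarzian_eq(2)[OF fN oN _ df] RN oR(3) holomorphic_on_subset by blast
  \<comment> \<open>\<open>L\<close> is a logarithm of the derivative up to a constant: f' = exp (L
    - L 0), since f' is 1 at 0.\<close>
  from holomorphic_convex_primitive'[OF oR(2,1) this] obtain L where
    "\<And>z. z \<in> R \<Longrightarrow> (L has_field_derivative pre_schwarzian f z) (at z within R)" by blast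
  then have L: "\<And>z. z \<in> R \<Longrightarrow> (L has_field_derivative pre_schwarzian f z) (at z)"
    using at_within_open[OF _ oR(1)] by metis
  have exp_const: "deriv f z * exp (- L z) = deriv f 0 * exp (- L 0)" if "z \<in> R" for z
  proof -
    have "((\<lambda>z. deriv f z * exp (- L z)) has_field_derivative 0) (at x within R)" if x: "x \<in> R" for x
    proof -
      have "((\<lambda>z. deriv f z * exp (- L z)) has_field_derivative deriv (deriv f) x * exp (- L x) + (exp (- L x) * (- pre_schwarzian f x)) * deriv f x) (at x)"
        by (rule DERIV_mult'[THEN DERIV_cong]) (use L[OF x] holomorphic_derivI[OF dfR oR(1) x] in \<open>auto intro!: derivative_eq_intros\<close>)
      moreover have "deriv (deriv f) x * exp (- L x) + (exp (- L x) * (- pre_schwarzian f x)) * deriv f x = 0"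
        using df RN x by (auto simp: pre_schwarzian_def)
      ultimately show ?thesis by (simp add: has_field_derivative_at_within)
    qed
    then obtain k where "\<forall>x\<in>R. deriv f x * exp (- L x) = k"
      using has_field_derivative_zero_constant[OF oR(2), of "\<lambda>z. deriv f z * exp (- L z)"] by blast
    then show ?thesis using that oR(3) by simp
  qed
  have f': "norm (deriv f z) \<le> exp C" if z: "z \<in> R" for z
  proof -
    have "norm (L z - L 0) \<le> C * norm (z - 0)"
      by (rule field_differentiable_bound[OF oR(2), where f' = "pre_schwarzian f"])
        (use L P z oR(3) in \<open>auto intro: has_field_derivative_at_within\<close>)
    also have "\<dots> \<le> C * 1" using z C b1 by (intro mult_left_mono) (auto simp: R_def)
    finally have "norm (L z - L 0) \<le> C" by simp
    moreover have "deriv f z = exp (L z - L 0)"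
      using exp_const[OF z] n(2) by (simp add: f_def exp_diff exp_minus field_simps)
    ultimately show ?thesis using norm_exp[of "L z - L 0"] by (metis exp_le_cancel_iff order_trans)
  qed
  have fb: "norm (f z) \<le> exp C" if z: "z \<in> R" for z
  proof -
    have "norm (f z - f 0) \<le> exp C * norm (z - 0)"
      by (rule field_differentiable_bound[OF oR(2), of f "deriv f"])
        (use f' z oR(3) in \<open>auto intro!: has_field_derivative_at_within holomorphic_derivI[OF fR oR(1)]\<close>)
    also have "\<dots> \<le> exp C * 1" using z b1 by (intro mult_left_mono) (auto simp: R_def)
    finally show ?thesis using n(1) by (simp add: f_def planar_eq)
  qed
  obtain r where r: "r > 0" "\<And>z. z \<in> ball b r - {b} \<Longrightarrow> exp C < norm (f z)"
    using planar_at_pole[OF h pole] unfolding f_def by metis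
  \<comment> \<open>The point s b of the segment from 0 to \<open>b\<close> lies within
    \<open>r\<close> of \<open>b\<close>; the maximum with 1/2 keeps \<open>s\<close> positive when
    \<open>r\<close> is large.\<close>
  define s where "s = max (1/2) (1 - r / 2)"
  have s: "0 < s" "s < 1" "1 - s < r" using r(1) by (auto simp: s_def)
  define x where "x = of_real s * b"
  have "norm (b - x) = (1 - s) * norm b"
  proof -
    have "b - x = of_real (1 - s) * b" by (simp add: x_def algebra_simps)
    then show ?thesis using s by (simp add: norm_mult del: of_real_diff)
  qed
  also have "\<dots> \<le> (1 - s) * 1" using s b1 by (intro mult_left_mono) auto
  also have "\<dots> < r" using s by simp
  finally have "x \<in> ball b r" by (simp add: dist_norm)
  moreover have nx: "norm x < norm b" using s b0 by (simp add: x_def norm_mult)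
  ultimately have "exp C < norm (f x)" using r(2)[of x] by auto
  moreover have "norm (f x) \<le> exp C" using fb nx by (simp add: R_def)
  ultimately show False by simp
qed

text \<open>On the exterior the kernel has modulus |K|^2 for the \<open>K\<close> of
  \<open>kernel_L2\<close>, which explains the common constant 22.\<close>

lemma kernel_integral_bound:
  fixes z0 :: complex
  assumes z0: "norm z0 < 1" and m: "m \<in> borel_measurable borel" "\<And>z. norm z \<le> 1 \<Longrightarrow> m z = 0"
    "AE z in lborel. norm (m z) \<le> k" "0 \<le> k"
  shows "norm (LINT z|lborel. m z / (z - z0)^4) \<le> k * (22 / (1 - norm z0)\<^sup>2)"
proof -
  define d where "d = 1 - norm z0"
  have d: "d > 0" using z0 by (simp add: d_def)
  define K where "K = (\<lambda>z. indicator {z. d \<le> norm (z - z0)} z / (z - z0)\<^sup>2 :: complex)"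
  have LK: "L2 K" and N2: "(nL2 K)\<^sup>2 \<le> 22 / d\<^sup>2" using kernel_L2[OF d, of z0] by (auto simp: K_def)
  have "norm (LINT z|lborel. m z / (z - z0)^4) \<le> (LINT z|lborel. norm (m z / (z - z0)^4))"
    by (rule integral_norm_bound)
  also have "\<dots> \<le> (LINT z|lborel. k * (norm (K z))\<^sup>2)"
  proof (rule integral_mono_AE')
    show "integrable lborel (\<lambda>z. k * (norm (K z))\<^sup>2)" using LK by (auto simp: L2_def)
    show "AE z in lborel. norm (m z / (z - z0)^4) \<le> k * (norm (K z))\<^sup>2"
      using m(3)
    proof eventually_elim
      case (elim z)
      show ?case
      proof (cases "norm z > 1")
        case True
        then have "d \<le> norm (z - z0)" using norm_triangle_ineq2[of z z0] by (simp add: d_def)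
        then have "(norm (K z))\<^sup>2 = 1 / norm (z - z0) ^ 4"
          by (simp add: K_def norm_divide norm_power power_divide flip: power_mult)
        then show ?thesis using elim by (simp add: norm_divide norm_power divide_right_mono)
      qed (use m(2,4) in simp)
    qed
  qed (use m in auto)
  also have "\<dots> = k * (nL2 K)\<^sup>2" by (simp add: nL2_power2)
  also have "\<dots> \<le> k * (22 / d\<^sup>2)" using N2 m(4) by (intro mult_left_mono)
  finally show ?thesis by (simp add: d_def)
qed

text \<open>264 = 6 * 22 * 2: the factor of the Schwarzian, the bound of the kernel, and 1 / (1 - k)
  \<le> 2.\<close>

definition schw_const :: real where
  "schw_const = 264 / norm bump_const"

lemma schw_const_pos: "schw_const > 0"
  using bump_const_nonzero by (simp add: schw_const_def)

text \<open>The values of the parameter \<open>c\<close> in the conclusion are supersolutions of the Riccati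
  equation.\<close>

lemma normalized_solution_estimates:
  assumes ns: "normalized_solution \<mu> w"
    and m: "m \<in> borel_measurable borel" "\<And>z. norm z \<le> 1 \<Longrightarrow> m z = 0"
      "AE z in lborel. m z = (if z \<in> ext_disc then \<mu> z else 0)" "AE z in lborel. norm (m z) \<le> k" "0 \<le> k" "k \<le> 1/2"
    and k: "schw_const * k \<le> 1/2"
  shows "planar w holomorphic_on disc" "\<And>z. z \<in> disc \<Longrightarrow> deriv (planar w) z \<noteq> 0"
    "\<And>z. z \<in> disc \<Longrightarrow> norm (schwarzian (planar w) z) \<le> schw_const * k / (1 - norm z)\<^sup>2"
    "\<And>z c. z \<in> disc \<Longrightarrow> 0 < c \<Longrightarrow> c\<^sup>2 / 2 + schw_const * k \<le> c \<Longrightarrow> norm (pre_schwarzian (planar w) z) \<le> c / (1 - norm z)"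
    "\<And>z. z \<in> disc \<Longrightarrow> norm (schwarzian (planar w) z + 6 / bump_const * (LINT \<zeta>|lborel. m \<zeta> / (\<zeta> - z)^4)) \<le> schw_const * k\<^sup>2 / (1 - norm z)\<^sup>2"
proof -
  have qc: "qc_solution (\<lambda>z. if z \<in> ext_disc then \<mu> z else 0) w"
    and n: "w (Some 0) = Some 0" "deriv (planar w) 0 = 1" "deriv (deriv (planar w)) 0 = 0"
    using ns by (auto simp: normalized_solution_def)
  have bc: "norm bump_const > 0" using bump_const_nonzero by simp
  have E: "norm (schwarzian (planar w) z + 6 / bump_const * (LINT \<zeta>|lborel. m \<zeta> / (\<zeta> - z)^4)) \<le> schw_const * k\<^sup>2 / (1 - norm z)\<^sup>2"
    if z: "z \<in> disc" "w (Some z) \<noteq> None" for z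
  proof -
    define I where "I = (LINT \<zeta>|lborel. m \<zeta> / (\<zeta> - z)^4)"
    have "norm (bump_const * schwarzian (planar w) z + 6 * I) \<le> 6 * (k\<^sup>2 * (22 / (1 - norm z)\<^sup>2) / (1 - k))"
      unfolding I_def by (rule schwarzian_estimate[OF qc m(1-5) _ z]) (use m in auto)
    also have "\<dots> \<le> 6 * (k\<^sup>2 * (22 / (1 - norm z)\<^sup>2) / (1/2))"
      using m(5,6) by (intro mult_left_mono divide_left_mono) auto
    also have "\<dots> = 264 * (k\<^sup>2 / (1 - norm z)\<^sup>2)" by simp
    finally have 1: "norm (bump_const * schwarzian (planar w) z + 6 * I) \<le> 264 * (k\<^sup>2 / (1 - norm z)\<^sup>2)" .
    have "schwarzian (planar w) z + 6 / bump_const * I = (bump_const * schwarzian (planar w) z + 6 * I) / bump_const"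
      using bump_const_nonzero by (simp add: field_simps)
    then have "norm (schwarzian (planar w) z + 6 / bump_const * I) = norm (bump_const * schwarzian (planar w) z + 6 * I) / norm bump_const"
      by (simp add: norm_divide)
    also have "\<dots> \<le> 264 * (k\<^sup>2 / (1 - norm z)\<^sup>2) / norm bump_const" using 1 by (rule divide_right_mono) simp
    finally show ?thesis by (simp add: I_def schw_const_def mult_ac)
  qed
  have S: "norm (schwarzian (planar w) z) \<le> schw_const * k / (1 - norm z)\<^sup>2"
    if z: "z \<in> disc" "w (Some z) \<noteq> None" for z
  proof -
    define I where "I = (LINT \<zeta>|lborel. m \<zeta> / (\<zeta> - z)^4)"
    have I: "norm I \<le> k * (22 / (1 - norm z)\<^sup>2)"
      unfolding I_def by (rule kernel_integral_bound) (use z m in auto)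
    have "norm (6 / bump_const * I) = 6 / norm bump_const * norm I" by (simp add: norm_mult norm_divide)
    also have "\<dots> \<le> 6 / norm bump_const * (k * (22 / (1 - norm z)\<^sup>2))" using I by (intro mult_left_mono) auto
    also have "\<dots> = schw_const * (k / 2) / (1 - norm z)\<^sup>2" by (simp add: schw_const_def)
    finally have 1: "norm (6 / bump_const * I) \<le> schw_const * (k / 2) / (1 - norm z)\<^sup>2" .
    \<comment> \<open>The linear term contributes 6 * 22 / |bump_const|, half of
      \<open>schw_const\<close>. For k \<le> 1/2 the quadratic error fits into the other
      half.\<close>
    have "k\<^sup>2 \<le> k / 2" using m(5,6) mult_left_mono[of k "1/2" k] by (simp add: power2_eq_square)
    then have 2: "schw_const * k\<^sup>2 / (1 - norm z)\<^sup>2 \<le> schw_const * (k / 2) / (1 - norm z)\<^sup>2"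
      using schw_const_pos by (intro divide_right_mono mult_left_mono) auto
    have "norm (schwarzian (planar w) z) \<le> norm (schwarzian (planar w) z + 6 / bump_const * I) + norm (6 / bump_const * I)"
      using norm_triangle_ineq4[of "schwarzian (planar w) z + 6 / bump_const * I" "6 / bump_const * I"] by simp
    also have "\<dots> \<le> schw_const * (k / 2) / (1 - norm z)\<^sup>2 + schw_const * (k / 2) / (1 - norm z)\<^sup>2"
      using E[OF z, folded I_def] 1 2 by linarith
    also have "\<dots> = schw_const * k / (1 - norm z)\<^sup>2" by (simp add: field_simps)
    finally show ?thesis .
  qed
  have e0: "0 \<le> schw_const * k" using schw_const_pos m(5) by simp
  \<comment> \<open>The supersolution with c = 1: its condition 1/2 + schw_const * k \<le> 1 is the
    assumption \<open>k\<close>.\<close>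
  have np: "w (Some z) \<noteq> None" if "z \<in> disc" for z
    by (rule no_pole[OF qc n S, of 1]) (use k e0 that in auto)
  have N: "{z \<in> disc. w (Some z) \<noteq> None} = disc" using np by auto
  show h: "planar w holomorphic_on disc" using qc_solution_holomorphic[OF qc] unfolding N .
  show d: "deriv (planar w) z \<noteq> 0" if "z \<in> disc" for z
    by (rule planar_deriv_nonzero[OF qc that np[OF that]])
  show s: "norm (schwarzian (planar w) z) \<le> schw_const * k / (1 - norm z)\<^sup>2" if "z \<in> disc" for z
    by (rule S[OF that np[OF that]])
  show "norm (schwarzian (planar w) z + 6 / bump_const * (LINT \<zeta>|lborel. m \<zeta> / (\<zeta> - z)^4)) \<le> schw_const * k\<^sup>2 / (1 - norm z)\<^sup>2"
    if "z \<in> disc" for z by (rule E[OF that np[OF that]])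
  show "norm (pre_schwarzian (planar w) z) \<le> c / (1 - norm z)"
    if z: "z \<in> disc" "0 < c" "c\<^sup>2 / 2 + schw_const * k \<le> c" for z c
  proof (rule riccati_bound[OF h open_ball d _ _ s n(3) z(2) e0 z(3)])
    show "of_real t * z \<in> disc" if "0 \<le> t" "t \<le> 1" for t
    proof -
      have "t * norm z \<le> 1 * norm z" using that by (intro mult_right_mono) auto
      then show ?thesis using z(1) that by (simp add: norm_mult)
    qed
  qed (use z in auto)
qed

section \<open>Linearization of the higher Schwarzians\<close>

text \<open>F t = O(t^m) as t decreases to 0, locally uniformly on the disc. Quantifying over all
  radii below 1 makes the notion stable under differentiation, by Cauchy's estimate on a slightly
  larger disc.\<close>

definition bigO_disc :: "nat \<Rightarrow> (real \<Rightarrow> complex \<Rightarrow> complex) \<Rightarrow> bool" where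
  "bigO_disc m F \<longleftrightarrow> (\<forall>\<^sub>F t in at_right 0. F t holomorphic_on disc) \<and>
     (\<forall>r<1. \<exists>C. \<forall>\<^sub>F t in at_right 0. \<forall>z\<in>cball 0 r. norm (F t z) \<le> C * t ^ m)"

lemma bigO_discD:
  assumes "bigO_disc m F"
  shows "\<forall>\<^sub>F t in at_right 0. F t holomorphic_on disc"
    "r < 1 \<Longrightarrow> \<exists>C\<ge>0. \<forall>\<^sub>F t in at_right 0. \<forall>z\<in>cball 0 r. norm (F t z) \<le> C * t ^ m"
proof -
  show "\<forall>\<^sub>F t in at_right 0. F t holomorphic_on disc" using assms by (simp add: bigO_disc_def)
  assume "r < 1"
  then obtain C where C: "\<forall>\<^sub>F t in at_right 0. \<forall>z\<in>cball 0 r. norm (F t z) \<le> C * t ^ m"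
    using assms by (auto simp: bigO_disc_def)
  have "\<forall>\<^sub>F t in at_right 0. \<forall>z\<in>cball 0 r. norm (F t z) \<le> max C 0 * t ^ m"
    using C eventually_at_right_less[of 0]
  proof eventually_elim
    case (elim t)
    have "C * t ^ m \<le> max C 0 * t ^ m" using elim by (intro mult_right_mono) auto
    then show ?case using elim by (blast intro: order_trans)
  qed
  then show "\<exists>C\<ge>0. \<forall>\<^sub>F t in at_right 0. \<forall>z\<in>cball 0 r. norm (F t z) \<le> C * t ^ m"
    by (intro exI[of _ "max C 0"]) auto
qed

lemma bigO_disc_add:
  assumes "bigO_disc m F" "bigO_disc m H" shows "bigO_disc m (\<lambda>t z. F t z + H t z)"
  unfolding bigO_disc_def
proof (intro conjI allI impI)
  show "\<forall>\<^sub>F t in at_right 0. (\<lambda>z. F t z + H t z) holomorphic_on disc"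
    using bigO_discD(1)[OF assms(1)] bigO_discD(1)[OF assms(2)] by eventually_elim (intro holomorphic_intros)
  fix r :: real assume r: "r < 1"
  obtain C1 C2 where "\<forall>\<^sub>F t in at_right 0. \<forall>z\<in>cball 0 r. norm (F t z) \<le> C1 * t ^ m"
    "\<forall>\<^sub>F t in at_right 0. \<forall>z\<in>cball 0 r. norm (H t z) \<le> C2 * t ^ m"
    using bigO_discD(2)[OF assms(1) r] bigO_discD(2)[OF assms(2) r] by blast
  then have "\<forall>\<^sub>F t in at_right 0. \<forall>z\<in>cball 0 r. norm (F t z + H t z) \<le> (C1 + C2) * t ^ m"
  proof eventually_elim
    case (elim t)
    show ?case
    proof
      fix z :: complex assume "z \<in> cball 0 r"
      then have "norm (F t z) + norm (H t z) \<le> C1 * t ^ m + C2 * t ^ m" using elim by (intro add_mono) auto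
      then show "norm (F t z + H t z) \<le> (C1 + C2) * t ^ m"
        by (intro order_trans[OF norm_triangle_ineq]) (simp add: distrib_right)
    qed
  qed
  then show "\<exists>C. \<forall>\<^sub>F t in at_right 0. \<forall>z\<in>cball 0 r. norm (F t z + H t z) \<le> C * t ^ m" by blast
qed

lemma bigO_disc_mult:
  assumes "bigO_disc m F" "bigO_disc n H" shows "bigO_disc (m + n) (\<lambda>t z. F t z * H t z)"
  unfolding bigO_disc_def
proof (intro conjI allI impI)
  show "\<forall>\<^sub>F t in at_right 0. (\<lambda>z. F t z * H t z) holomorphic_on disc"
    using bigO_discD(1)[OF assms(1)] bigO_discD(1)[OF assms(2)] by eventually_elim (intro holomorphic_intros)
  fix r :: real assume r: "r < 1"
  obtain C1 C2 where C: "C1 \<ge> 0" "C2 \<ge> 0" "\<forall>\<^sub>F t in at_right 0. \<forall>z\<in>cball 0 r. norm (F t z) \<le> C1 * t ^ m"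
    "\<forall>\<^sub>F t in at_right 0. \<forall>z\<in>cball 0 r. norm (H t z) \<le> C2 * t ^ n"
    using bigO_discD(2)[OF assms(1) r] bigO_discD(2)[OF assms(2) r] by blast
  have "\<forall>\<^sub>F t in at_right 0. \<forall>z\<in>cball 0 r. norm (F t z * H t z) \<le> (C1 * C2) * t ^ (m + n)"
    using C(3,4) eventually_at_right_less[of 0]
  proof eventually_elim
    case (elim t)
    show ?case
    proof
      fix z :: complex assume "z \<in> cball 0 r"
      then have "norm (F t z) * norm (H t z) \<le> (C1 * t ^ m) * (C2 * t ^ n)" using elim C by (intro mult_mono) auto
      then show "norm (F t z * H t z) \<le> (C1 * C2) * t ^ (m + n)" by (simp add: norm_mult power_add mult_ac)
    qed
  qed
  then show "\<exists>C. \<forall>\<^sub>F t in at_right 0. \<forall>z\<in>cball 0 r. norm (F t z * H t z) \<le> C * t ^ (m + n)" by blast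
qed

lemma bigO_disc_const: "bigO_disc 0 (\<lambda>t z. c)"
  unfolding bigO_disc_def by (auto intro!: exI[of _ "norm c"])

lemma bigO_disc_cmult: "bigO_disc m F \<Longrightarrow> bigO_disc m (\<lambda>t z. c * F t z)"
  using bigO_disc_mult[OF bigO_disc_const[of c], of m F] by simp

lemma bigO_disc_mono:
  assumes "bigO_disc m F" "n \<le> m" shows "bigO_disc n F"
  unfolding bigO_disc_def
proof (intro conjI allI impI bigO_discD(1)[OF assms(1)])
  fix r :: real assume r: "r < 1"
  obtain C where C: "C \<ge> 0" "\<forall>\<^sub>F t in at_right 0. \<forall>z\<in>cball 0 r. norm (F t z) \<le> C * t ^ m"
    using bigO_discD(2)[OF assms(1) r] by blast
  have "\<forall>\<^sub>F t in at_right (0::real). t < 1" by (rule order_tendstoD(2)[OF tendsto_ident_at]) simp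
  with C(2) eventually_at_right_less[of 0] have "\<forall>\<^sub>F t in at_right 0. \<forall>z\<in>cball 0 r. norm (F t z) \<le> C * t ^ n"
  proof eventually_elim
    case (elim t)
    have "t ^ m \<le> t ^ n" using elim assms(2) by (intro power_decreasing) auto
    then have "C * t ^ m \<le> C * t ^ n" using C(1) by (intro mult_left_mono)
    then show ?case using elim(1) by force
  qed
  then show "\<exists>C. \<forall>\<^sub>F t in at_right 0. \<forall>z\<in>cball 0 r. norm (F t z) \<le> C * t ^ n" by blast
qed

lemma bigO_disc_cong:
  assumes "bigO_disc m F" "\<forall>\<^sub>F t in at_right 0. \<forall>z\<in>disc. F t z = H t z" shows "bigO_disc m H"
  unfolding bigO_disc_def
proof (intro conjI allI impI)
  show "\<forall>\<^sub>F t in at_right 0. H t holomorphic_on disc"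
    using bigO_discD(1)[OF assms(1)] assms(2)
    by eventually_elim (auto intro: holomorphic_transform)
  fix r :: real assume r: "r < 1"
  obtain C where C: "\<forall>\<^sub>F t in at_right 0. \<forall>z\<in>cball 0 r. norm (F t z) \<le> C * t ^ m"
    using bigO_discD(2)[OF assms(1) r] by blast
  from C assms(2) have "\<forall>\<^sub>F t in at_right 0. \<forall>z\<in>cball 0 r. norm (H t z) \<le> C * t ^ m"
    by eventually_elim (use r in force)
  then show "\<exists>C. \<forall>\<^sub>F t in at_right 0. \<forall>z\<in>cball 0 r. norm (H t z) \<le> C * t ^ m" by blast
qed

lemma bigO_disc_deriv:
  assumes "bigO_disc m F" shows "bigO_disc m (\<lambda>t. deriv (F t))"
  unfolding bigO_disc_def
proof (intro conjI allI impI)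
  show "\<forall>\<^sub>F t in at_right 0. deriv (F t) holomorphic_on disc"
    using bigO_discD(1)[OF assms] by eventually_elim (auto intro: holomorphic_deriv)
  fix r :: real assume r: "r < 1"
  define d where "d = (1 - r) / 2"
  have d: "d > 0" "r + d < 1" using r by (auto simp: d_def field_simps)
  obtain C where C: "\<forall>\<^sub>F t in at_right 0. \<forall>z\<in>cball 0 (r + d). norm (F t z) \<le> C * t ^ m"
    using bigO_discD(2)[OF assms d(2)] by blast
  from C bigO_discD(1)[OF assms] have "\<forall>\<^sub>F t in at_right 0. \<forall>z\<in>cball 0 r. norm (deriv (F t) z) \<le> (C / d) * t ^ m"
  proof eventually_elim
    case (elim t)
    show ?case
    proof
      fix z :: complex assume z: "z \<in> cball 0 r"
      have sub: "cball z d \<subseteq> cball 0 (r + d)"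
      proof
        fix x assume "x \<in> cball z d"
        then show "x \<in> cball 0 (r + d)" using z norm_triangle_ineq[of z "x - z"] by (simp add: dist_norm norm_minus_commute)
      qed
      have sub2: "cball z d \<subseteq> disc" using sub d by force
      have "norm ((deriv ^^ 1) (F t) z) \<le> fact 1 * (C * t ^ m) / d ^ 1"
      proof (rule Cauchy_inequality)
        show "F t holomorphic_on ball z d" by (rule holomorphic_on_subset[OF elim(2)]) (use sub2 in auto)
        show "continuous_on (cball z d) (F t)"
          by (rule continuous_on_subset[OF holomorphic_on_imp_continuous_on[OF elim(2)] sub2])
        show "norm (F t x) \<le> C * t ^ m" if "norm (z - x) = d" for x
          using elim(1) sub that by (auto simp: dist_norm subset_iff)
      qed (use d in auto)
      then show "norm (deriv (F t) z) \<le> (C / d) * t ^ m" by simp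
    qed
  qed
  then show "\<exists>C. \<forall>\<^sub>F t in at_right 0. \<forall>z\<in>cball 0 r. norm (deriv (F t) z) \<le> C * t ^ m" by blast
qed

lemma bigO_disc_higher_deriv:
  assumes "bigO_disc m F" shows "bigO_disc m (\<lambda>t. (deriv ^^ n) (F t))"
  by (induction n) (use assms in \<open>auto intro: bigO_disc_deriv\<close>)

lemma bigO_disc_diff:
  assumes "bigO_disc m F" "bigO_disc m H" shows "bigO_disc m (\<lambda>t z. F t z - H t z)"
  using bigO_disc_add[OF assms(1) bigO_disc_cmult[OF assms(2), of "-1"]] by simp

text \<open>The coefficient of the (n - 3)-rd derivative of the Schwarzian in the linear part of the
  higher Schwarzian; for \<open>B\<close> it is -2 (1 - n/2).\<close>

definition lin_coeff :: "series \<Rightarrow> nat \<Rightarrow> complex" where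
  "lin_coeff s n = (case s of A \<Rightarrow> 1 | B \<Rightarrow> of_nat (n - 2))"

lemma bigO_disc_deriv_diff:
  assumes "bigO_disc m (\<lambda>t z. F t z - H t z)" "\<forall>\<^sub>F t in at_right 0. F t holomorphic_on disc" "\<forall>\<^sub>F t in at_right 0. H t holomorphic_on disc"
  shows "bigO_disc m (\<lambda>t z. deriv (F t) z - deriv (H t) z)"
proof (rule bigO_disc_cong[OF bigO_disc_deriv[OF assms(1)]])
  show "\<forall>\<^sub>F t in at_right 0. \<forall>z\<in>disc. deriv (\<lambda>z. F t z - H t z) z = deriv (F t) z - deriv (H t) z"
    using assms(2,3)
  proof eventually_elim
    case (elim t)
    show ?case using elim by (auto intro!: deriv_diff holomorphic_on_imp_differentiable_at[OF _ open_ball])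
  qed
qed

text \<open>Each step of the recursion differentiates once more and adds a product of the
  pre-Schwarzian with the previous term; both are O(t), so that the product is O(t^2).\<close>

lemma schwarzian_A_asymptotics:
  assumes S: "bigO_disc 1 (\<lambda>t. schwarzian (f t))" and P: "bigO_disc 1 (\<lambda>t. pre_schwarzian (f t))" and n: "n \<ge> 3"
  shows "bigO_disc 2 (\<lambda>t z. schwarzian_A n (f t) z - (deriv ^^ (n - 3)) (schwarzian (f t)) z)"
  using n
proof (induction n rule: dec_induct)
  case base
  \<comment> \<open>For n = 3 the difference is 0; written as 0 times a product of order 2 it is
    covered by the product rule.\<close>
  have "bigO_disc 2 (\<lambda>t z. 0 * (schwarzian (f t) z * schwarzian (f t) z))"
    by (rule bigO_disc_cmult) (use bigO_disc_mult[OF S S] in \<open>simp add: numeral_2_eq_2\<close>)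
  then show ?case by (simp add: numeral_eq_Suc)
next
  case (step n)
  let ?X = "\<lambda>t. schwarzian_A n (f t)" and ?S = "\<lambda>t. (deriv ^^ (n - 3)) (schwarzian (f t))"
  have bS: "bigO_disc 1 ?S" by (rule bigO_disc_higher_deriv[OF S])
  have bX: "bigO_disc 1 ?X"
    using bigO_disc_add[OF bigO_disc_mono[OF step.IH, of 1] bS] by simp
  have d: "bigO_disc 2 (\<lambda>t z. deriv (?X t) z - deriv (?S t) z)"
    by (rule bigO_disc_deriv_diff[OF step.IH bigO_discD(1)[OF bX] bigO_discD(1)[OF bS]])
  have "bigO_disc 2 (\<lambda>t z. (of_nat n - 1) * (pre_schwarzian (f t) z * ?X t z))"
    using bigO_disc_cmult[OF bigO_disc_mult[OF P bX]] by (simp add: numeral_2_eq_2)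
  from bigO_disc_diff[OF d this] show ?case
  proof (rule bigO_disc_cong)
    have "Suc n - 3 = Suc (n - 3)" using step(1) by simp
    then show "\<forall>\<^sub>F t in at_right 0. \<forall>z\<in>disc. deriv (?X t) z - deriv (?S t) z - (of_nat n - 1) * (pre_schwarzian (f t) z * ?X t z)
        = schwarzian_A (Suc n) (f t) z - (deriv ^^ (Suc n - 3)) (schwarzian (f t)) z"
      using step(1) by (simp add: mult.assoc)
  qed
qed

text \<open>The differential polynomial Q with g^(k) = g Q whenever g' = c P g. It is used for g =
  (f')^(1 - n/2), where P is the pre-Schwarzian and c = - (n - 2) / 2.\<close>

primrec log_deriv_poly :: "complex \<Rightarrow> nat \<Rightarrow> (complex \<Rightarrow> complex) \<Rightarrow> complex \<Rightarrow> complex" where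
  "log_deriv_poly c 0 P = (\<lambda>z. 1)"
| "log_deriv_poly c (Suc k) P = (\<lambda>z. deriv (log_deriv_poly c k P) z + c * P z * log_deriv_poly c k P z)"

lemma log_deriv_poly_holomorphic:
  "P holomorphic_on disc \<Longrightarrow> log_deriv_poly c k P holomorphic_on disc"
  by (induction k) (auto intro!: holomorphic_intros holomorphic_deriv)

lemma higher_deriv_log_deriv_poly:
  assumes "g holomorphic_on disc" "P holomorphic_on disc" "\<And>z. z \<in> disc \<Longrightarrow> deriv g z = c * P z * g z" "z \<in> disc"
  shows "(deriv ^^ k) g z = g z * log_deriv_poly c k P z"
  using assms(4)
proof (induction k arbitrary: z)
  case (Suc k)
  have "(deriv ^^ Suc k) g z = deriv (\<lambda>z. g z * log_deriv_poly c k P z) z"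
    using deriv_cong_disc[of "(deriv ^^ k) g" "\<lambda>z. g z * log_deriv_poly c k P z" z] Suc by simp
  also have "\<dots> = g z * deriv (log_deriv_poly c k P) z + deriv g z * log_deriv_poly c k P z"
    using assms(1) log_deriv_poly_holomorphic[OF assms(2)] Suc.prems
    by (intro deriv_mult holomorphic_on_imp_differentiable_at[OF _ open_ball])
  finally show ?case using assms(3)[OF Suc.prems] by (simp add: algebra_simps)
qed simp

text \<open>The term c P Q of the recursion is of second order, because \<open>Q\<close> with a
  positive index is already of first order. What remains to first order is the derivative of c
  P.\<close>

lemma log_deriv_poly_asymptotics:
  assumes P: "bigO_disc 1 P"
  shows "bigO_disc 2 (\<lambda>t z. log_deriv_poly c (Suc k) (P t) z - c * (deriv ^^ k) (P t) z)"
proof (induction k)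
  case 0
  have "bigO_disc 2 (\<lambda>t z. 0 * (P t z * P t z))"
    by (rule bigO_disc_cmult) (use bigO_disc_mult[OF P P] in \<open>simp add: numeral_2_eq_2\<close>)
  then show ?case by simp
next
  case (Suc k)
  let ?X = "\<lambda>t. log_deriv_poly c (Suc k) (P t)" and ?Y = "\<lambda>t z. c * (deriv ^^ k) (P t) z"
  have bY: "bigO_disc 1 ?Y" by (rule bigO_disc_cmult[OF bigO_disc_higher_deriv[OF P]])
  have bX: "bigO_disc 1 ?X"
    using bigO_disc_add[OF bigO_disc_mono[OF Suc.IH, of 1] bY] by simp
  have d: "bigO_disc 2 (\<lambda>t z. deriv (?X t) z - deriv (?Y t) z)"
    by (rule bigO_disc_deriv_diff[OF Suc.IH bigO_discD(1)[OF bX] bigO_discD(1)[OF bY]])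
  have "bigO_disc 2 (\<lambda>t z. c * (P t z * ?X t z))"
    using bigO_disc_cmult[OF bigO_disc_mult[OF P bX]] by (simp add: numeral_2_eq_2)
  from bigO_disc_add[OF d this] show ?case
  proof (rule bigO_disc_cong)
    show "\<forall>\<^sub>F t in at_right 0. \<forall>z\<in>disc. deriv (?X t) z - deriv (?Y t) z + c * (P t z * ?X t z)
        = log_deriv_poly c (Suc (Suc k)) (P t) z - c * (deriv ^^ Suc k) (P t) z"
      using bigO_discD(1)[OF bigO_disc_higher_deriv[OF P, of k]]
    proof eventually_elim
      case (elim t)
      show ?case
      proof
        fix z assume "z \<in> disc"
        then have "deriv (?Y t) z = c * deriv ((deriv ^^ k) (P t)) z"
          using elim by (intro deriv_cmult holomorphic_on_imp_differentiable_at[OF _ open_ball])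
        then show "deriv (?X t) z - deriv (?Y t) z + c * (P t z * ?X t z)
        = log_deriv_poly c (Suc (Suc k)) (P t) z - c * (deriv ^^ Suc k) (P t) z" by (simp add: mult.assoc)
      qed
    qed
  qed
qed

lemma sqrt_deriv:
  assumes "f holomorphic_on disc" "\<And>z. z \<in> disc \<Longrightarrow> deriv f z \<noteq> 0"
  shows "sqrt_deriv f holomorphic_on disc" "z \<in> disc \<Longrightarrow> (sqrt_deriv f z)\<^sup>2 = deriv f z"
proof -
  have "\<exists>s. s holomorphic_on disc \<and> (\<forall>z\<in>disc. (s z)\<^sup>2 = deriv f z)"
    using contractible_imp_holomorphic_sqrt[of "deriv f" disc] holomorphic_deriv[OF assms(1) open_ball] assms(2)
      convex_imp_contractible[OF convex_ball] by metis
  from someI_ex[OF this] show "sqrt_deriv f holomorphic_on disc" "z \<in> disc \<Longrightarrow> (sqrt_deriv f z)\<^sup>2 = deriv f z"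
    by (auto simp: sqrt_deriv_def)
qed

lemma schwarzian_B_log_deriv_poly:
  assumes f: "f holomorphic_on disc" "\<And>z. z \<in> disc \<Longrightarrow> deriv f z \<noteq> 0" and z: "z \<in> disc"
  shows "schwarzian_B n f z = - 2 * log_deriv_poly (- of_nat (n - 2) / 2) (n - 1) (pre_schwarzian f) z"
proof -
  define s where "s = sqrt_deriv f"
  define m where "m = n - 2"
  have s: "s holomorphic_on disc" "\<And>z. z \<in> disc \<Longrightarrow> (s z)\<^sup>2 = deriv f z"
    using sqrt_deriv[OF f] by (auto simp: s_def)
  have s0: "s z \<noteq> 0" if "z \<in> disc" for z using s(2)[OF that] f(2)[OF that] by auto
  define g where "g = (\<lambda>z. 1 / s z ^ m)"
  have g: "g holomorphic_on disc" unfolding g_def using s s0 by (intro holomorphic_intros) auto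
  have P: "pre_schwarzian f holomorphic_on disc" using schwarzian_eq(2)[OF f(1) open_ball z] f(2) by blast
  have dg: "deriv g z = (- of_nat m / 2) * pre_schwarzian f z * g z" if z: "z \<in> disc" for z
  proof -
    have ds: "(s has_field_derivative deriv s z) (at z)" by (rule holomorphic_derivI[OF s(1) open_ball z])
    have "deriv (deriv f) z = deriv (\<lambda>z. (s z)\<^sup>2) z"
      using deriv_cong_disc[of "\<lambda>z. (s z)\<^sup>2" "deriv f" z] s(2) z by simp
    also have "\<dots> = 2 * s z * deriv s z"
      by (rule DERIV_imp_deriv) (auto intro!: derivative_eq_intros ds)
    finally have P: "pre_schwarzian f z = 2 * deriv s z / s z"
      using s(2)[OF z] s0[OF z] by (simp add: pre_schwarzian_def power2_eq_square flip: s(2)[OF z])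
    have "deriv g z = - (of_nat m * s z ^ (m - 1) * deriv s z) / (s z ^ m)\<^sup>2"
      unfolding g_def
      by (rule DERIV_imp_deriv) (use s0[OF z] in \<open>auto intro!: derivative_eq_intros ds simp: power2_eq_square\<close>)
    also have "\<dots> = (- of_nat m / 2) * (2 * deriv s z / s z) * (1 / s z ^ m)"
      using s0[OF z] by (cases m) (auto simp: field_simps power2_eq_square)
    finally show ?thesis unfolding P by (simp add: g_def)
  qed
  have "(deriv ^^ (n - 1)) g z = g z * log_deriv_poly (- of_nat m / 2) (n - 1) (pre_schwarzian f) z"
    by (rule higher_deriv_log_deriv_poly[OF g P dg z])
  \<comment> \<open>The prefactor cancels \<open>g\<close>, and the choice of the root disappears
    with it.\<close>
  moreover have "s z ^ m * g z = 1" using s0[OF z] by (simp add: g_def)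
  ultimately show ?thesis
    unfolding schwarzian_B_def s_def[symmetric] m_def[symmetric] g_def[symmetric]
    by (simp add: mult.assoc[symmetric])
qed

text \<open>By \<open>log_deriv_poly_asymptotics\<close> the linear part is (n - 2) times the (n -
  2)-nd derivative of the pre-Schwarzian P, and P' differs from the Schwarzian by P^2 / 2 =
  O(t^2).\<close>

lemma schwarzian_B_asymptotics:
  assumes f: "\<forall>\<^sub>F t in at_right 0. f t holomorphic_on disc \<and> (\<forall>z\<in>disc. deriv (f t) z \<noteq> 0)"
    and S: "bigO_disc 1 (\<lambda>t. schwarzian (f t))" and P: "bigO_disc 1 (\<lambda>t. pre_schwarzian (f t))" and n: "n \<ge> 3"
  shows "bigO_disc 2 (\<lambda>t z. schwarzian_B n (f t) z - of_nat (n - 2) * (deriv ^^ (n - 3)) (schwarzian (f t)) z)"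
proof -
  let ?P = "\<lambda>t. pre_schwarzian (f t)" and ?S = "\<lambda>t. schwarzian (f t)"
  define c where "c = (- of_nat (n - 2) / 2 :: complex)"
  have 1: "bigO_disc 2 (\<lambda>t z. log_deriv_poly c (Suc (n - 2)) (?P t) z - c * (deriv ^^ (n - 2)) (?P t) z)"
    by (rule log_deriv_poly_asymptotics[OF P])
  have PP: "bigO_disc 2 (\<lambda>t z. deriv (?P t) z - ?S t z)"
  proof (rule bigO_disc_cong)
    show "bigO_disc 2 (\<lambda>t z. (1/2) * (?P t z * ?P t z))"
      by (rule bigO_disc_cmult) (use bigO_disc_mult[OF P P] in \<open>simp add: numeral_2_eq_2\<close>)
    show "\<forall>\<^sub>F t in at_right 0. \<forall>z\<in>disc. (1/2) * (?P t z * ?P t z) = deriv (?P t) z - ?S t z"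
      by (simp add: schwarzian_def power2_eq_square)
  qed
  have "bigO_disc 2 (\<lambda>t z. (deriv ^^ k) (deriv (?P t)) z - (deriv ^^ k) (?S t) z)" for k
  proof (induction k)
    case (Suc k)
    show ?case
      using bigO_disc_deriv_diff[OF Suc bigO_discD(1)[OF bigO_disc_higher_deriv[OF bigO_disc_deriv[OF P]]] bigO_discD(1)[OF bigO_disc_higher_deriv[OF S]]]
      by simp
  qed (use PP in simp)
  from this[of "n - 3"] have 2: "bigO_disc 2 (\<lambda>t z. (deriv ^^ (n - 2)) (?P t) z - (deriv ^^ (n - 3)) (?S t) z)"
  proof -
    have "n - 2 = Suc (n - 3)" using n by simp
    then show ?thesis using \<open>bigO_disc 2 (\<lambda>t z. (deriv ^^ (n - 3)) (deriv (?P t)) z - (deriv ^^ (n - 3)) (?S t) z)\<close>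
      by (simp add: funpow_Suc_right del: funpow.simps(2))
  qed
  show ?thesis
  proof (rule bigO_disc_cong[OF bigO_disc_add[OF bigO_disc_cmult[OF 1, of "-2"] bigO_disc_cmult[OF 2, of "- 2 * c"]]])
    have n1: "Suc (n - 2) = n - 1" using n by simp
    have c2: "- 2 * c = of_nat (n - 2)" by (simp add: c_def)
    show "\<forall>\<^sub>F t in at_right 0. \<forall>z\<in>disc. -2 * (log_deriv_poly c (Suc (n - 2)) (?P t) z - c * (deriv ^^ (n - 2)) (?P t) z)
       + - 2 * c * ((deriv ^^ (n - 2)) (?P t) z - (deriv ^^ (n - 3)) (?S t) z) = schwarzian_B n (f t) z - of_nat (n - 2) * (deriv ^^ (n - 3)) (?S t) z"
      using f
    proof eventually_elim
      case (elim t)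
      show ?case
      proof
        fix z assume z: "z \<in> disc"
        have "schwarzian_B n (f t) z = - 2 * log_deriv_poly c (n - 1) (?P t) z"
          unfolding c_def by (rule schwarzian_B_log_deriv_poly) (use elim z in auto)
        then show "-2 * (log_deriv_poly c (Suc (n - 2)) (?P t) z - c * (deriv ^^ (n - 2)) (?P t) z)
       + - 2 * c * ((deriv ^^ (n - 2)) (?P t) z - (deriv ^^ (n - 3)) (?S t) z) = schwarzian_B n (f t) z - of_nat (n - 2) * (deriv ^^ (n - 3)) (?S t) z"
          unfolding n1 c2[symmetric] by (simp add: algebra_simps)
      qed
    qed
  qed
qed

lemma higher_schwarzian_asymptotics:
  assumes "\<forall>\<^sub>F t in at_right 0. f t holomorphic_on disc \<and> (\<forall>z\<in>disc. deriv (f t) z \<noteq> 0)"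
    "bigO_disc 1 (\<lambda>t. schwarzian (f t))" "bigO_disc 1 (\<lambda>t. pre_schwarzian (f t))" "n \<ge> 3"
  shows "bigO_disc 2 (\<lambda>t z. higher_schwarzian s n (f t) z - lin_coeff s n * (deriv ^^ (n - 3)) (schwarzian (f t)) z)"
  using schwarzian_A_asymptotics[OF assms(2-4)] schwarzian_B_asymptotics[OF assms]
  by (cases s) (auto simp: lin_coeff_def)

lemma schwarzian_B_3: 
  assumes "f holomorphic_on disc" "\<And>z. z \<in> disc \<Longrightarrow> deriv f z \<noteq> 0" "z \<in> disc"
  shows "schwarzian_B 3 f z = schwarzian f z"
proof -
  have P: "pre_schwarzian f holomorphic_on disc" using schwarzian_eq(2)[OF assms(1) open_ball assms(3)] assms(2) by blast
  have l1: "log_deriv_poly c (Suc 0) (pre_schwarzian f) = (\<lambda>z. c * pre_schwarzian f z)" for c by simp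
  have "log_deriv_poly (- 1 / 2) (Suc (Suc 0)) (pre_schwarzian f) z = (- 1 / 2) * deriv (pre_schwarzian f) z + (1/4) * (pre_schwarzian f z)\<^sup>2"
    unfolding log_deriv_poly.simps(2)[of _ "Suc 0"] l1
    by (subst deriv_cmult) (use P assms(3) in \<open>auto intro!: holomorphic_on_imp_differentiable_at[OF _ open_ball] simp: power2_eq_square\<close>)
  moreover have e: "3 - 1 = Suc (Suc 0)" "- of_nat (3 - 2) / 2 = (- 1 / 2 :: complex)" by simp_all
  have "schwarzian_B 3 f z = - 2 * log_deriv_poly (- of_nat (3 - 2) / 2) (3 - 1) (pre_schwarzian f) z"
    by (rule schwarzian_B_log_deriv_poly) (use assms in auto)
  ultimately have "schwarzian_B 3 f z = - 2 * ((- 1 / 2) * deriv (pre_schwarzian f) z + (1/4) * (pre_schwarzian f z)\<^sup>2)"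
    unfolding e by (simp only:)
  then show ?thesis by (simp add: schwarzian_def)
qed

section \<open>Moebius transformations and change of variables\<close>

text \<open>The change of variables theorem of the library is stated for \<open>real ^ 'n\<close>.\<close>

definition vec2 :: "complex \<Rightarrow> real^2" where "vec2 z = vector [Re z, Im z]"

definition unvec2 :: "real^2 \<Rightarrow> complex" where "unvec2 x = Complex (x$1) (x$2)"

lemma vec2_inverse [simp]: "unvec2 (vec2 z) = z" "vec2 (unvec2 x) = x"
  by (auto simp: vec2_def unvec2_def vec_eq_iff forall_2)

lemma bounded_linear_vec2: "bounded_linear vec2"
  by (intro linear_conv_bounded_linear[THEN iffD1] linearI) (auto simp: vec2_def vec_eq_iff forall_2)

lemma bounded_linear_unvec2: "bounded_linear unvec2"
  by (intro linear_conv_bounded_linear[THEN iffD1] linearI) (auto simp: unvec2_def complex_eq_iff)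

lemma unvec2_measurable [measurable]: "unvec2 \<in> borel_measurable borel"
  by (intro borel_measurable_continuous_onI linear_continuous_on bounded_linear_unvec2)

lemma distr_unvec2: "distr lborel borel unvec2 = lborel"
proof (rule lborel_eqI[symmetric])
  fix l u :: complex assume le: "\<And>b. b \<in> Basis \<Longrightarrow> l \<bullet> b \<le> u \<bullet> b"
  have B: "Basis = {axis 1 1, axis 2 (1::real) :: real^2}"
    by (auto simp: Basis_vec_def UNIV_2)
  have ne: "axis 1 (1::real) \<noteq> (axis 2 1 :: real^2)" by (simp add: axis_eq_axis)
  have box: "unvec2 -` box l u \<inter> space lborel = box (vec2 l) (vec2 u)"
    by (auto simp: box_def B Basis_complex_def unvec2_def vec2_def inner_axis)
  have le2: "vec2 l \<bullet> b \<le> vec2 u \<bullet> b" if "b \<in> Basis" for b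
    using that le[of 1] le[of \<i>] unfolding B by (auto simp: inner_axis vec2_def Basis_complex_def)
  have "emeasure (distr lborel borel unvec2) (box l u) = emeasure lborel (box (vec2 l) (vec2 u))"
    using box by (simp add: emeasure_distr)
  also have "\<dots> = (\<Prod>b\<in>Basis. (vec2 u - vec2 l) \<bullet> b)"
    by (rule emeasure_lborel_box[OF le2])
  also have "\<dots> = (\<Prod>b\<in>Basis. (u - l) \<bullet> b)"
    unfolding B using ne by (simp add: Basis_complex_def inner_axis vec2_def complex_eq_iff)
  finally show "emeasure (distr lborel borel unvec2) (box l u) = (\<Prod>b\<in>Basis. (u - l) \<bullet> b)" .
qed simp

lemma lborel_integral_unvec2:
  fixes f :: "complex \<Rightarrow> complex"
  assumes "f \<in> borel_measurable borel"
  shows "(LINT x|lborel. f (unvec2 x)) = (LINT z|lborel. f z)"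
    "integrable lborel (\<lambda>x. f (unvec2 x)) \<longleftrightarrow> integrable lborel f"
  using integral_distr[of unvec2 lborel borel f] integrable_distr_eq[of unvec2 lborel borel f] assms
  by (simp_all add: distr_unvec2)

text \<open>The real Jacobian of a holomorphic map is the squared modulus of its derivative.
  Extension by 0 off \<open>S\<close> and off its image turns both sides into integrals over the
  plane.\<close>

lemma holomorphic_change_of_variables:
  fixes f h :: "complex \<Rightarrow> complex"
  assumes S: "open S" and h: "h holomorphic_on S" "inj_on h S"
    and f: "f \<in> borel_measurable borel" "integrable lborel f" "\<And>z. z \<notin> h ` S \<Longrightarrow> f z = 0"
  shows "(LINT z|lborel. f z) = (LINT z|lborel. (if z \<in> S then of_real ((norm (deriv h z))\<^sup>2) * f (h z) else 0))"
proof -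
  define k where "k = (\<lambda>z. if z \<in> S then of_real ((norm (deriv h z))\<^sup>2) * f (h z) else 0)"
  have Sb: "S \<in> sets borel" using S by simp
  have mh: "(\<lambda>z. indicator S z *\<^sub>R h z) \<in> borel_measurable borel"
    using Sb h(1) by (intro borel_measurable_continuous_on_indicator holomorphic_on_imp_continuous_on)
  have mdh: "(\<lambda>z. indicator S z *\<^sub>R deriv h z) \<in> borel_measurable borel"
    using Sb holomorphic_deriv[OF h(1) S] by (intro borel_measurable_continuous_on_indicator holomorphic_on_imp_continuous_on)
  have "k = (\<lambda>z. if z \<in> S then of_real ((norm (indicator S z *\<^sub>R deriv h z))\<^sup>2) * f (indicator S z *\<^sub>R h z) else 0)"
    by (auto simp: k_def)
  also have "\<dots> \<in> borel_measurable borel"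
    using f(1) mh mdh Sb by measurable
  finally have km: "k \<in> borel_measurable borel" .
  define S2 where "S2 = vec2 ` S"
  define h2 where "h2 = (\<lambda>x. vec2 (h (unvec2 x)))"
  define f2 where "f2 = (\<lambda>x. vec2 (f (unvec2 x)))"
  define d2 where "d2 = (\<lambda>x y. vec2 (deriv h (unvec2 x) * unvec2 y))"
  have S2: "x \<in> S2 \<longleftrightarrow> unvec2 x \<in> S" for x unfolding S2_def by (metis image_iff vec2_inverse)
  have S2_eq: "S2 = unvec2 -` S" using S2 by auto
  have "S2 \<in> sets borel" unfolding S2_eq using measurable_sets[OF unvec2_measurable Sb] by simp
  then have S2l: "S2 \<in> sets lebesgue" by simp
  have d2: "(h2 has_derivative d2 x) (at x within S2)" if x: "x \<in> S2" for x
  proof -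
    have "(h has_derivative (\<lambda>y. deriv h (unvec2 x) * y)) (at (unvec2 x))"
      using holomorphic_derivI[OF h(1) S] x unfolding S2 has_field_derivative_def by blast
    then have "((\<lambda>x. h (unvec2 x)) has_derivative (\<lambda>y. deriv h (unvec2 x) * unvec2 y)) (at x)"
      using has_derivative_compose[OF bounded_linear.has_derivative[OF bounded_linear_unvec2 has_derivative_ident[of "at x"]]] by force
    then show ?thesis unfolding h2_def d2_def
      by (rule bounded_linear.has_derivative[OF bounded_linear_vec2 has_derivative_at_withinI])
  qed
  have det: "\<bar>det (matrix (d2 x))\<bar> = (norm (deriv h (unvec2 x)))\<^sup>2" for x
  proof -
    have u: "unvec2 (axis 1 1) = 1" "unvec2 (axis 2 1) = \<i>"
      by (auto simp: unvec2_def axis_def complex_eq_iff)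
    show ?thesis
      by (simp add: det_2 matrix_def d2_def u vec2_def cmod_power2) (simp add: power2_eq_square)
  qed
  have inj: "inj_on h2 S2"
  proof (rule inj_onI)
    fix x y assume "x \<in> S2" "y \<in> S2" "h2 x = h2 y"
    then have "h (unvec2 x) = h (unvec2 y)" by (metis h2_def vec2_inverse(1))
    with \<open>x \<in> S2\<close> \<open>y \<in> S2\<close> have "unvec2 x = unvec2 y" unfolding S2 using h(2) by (simp add: inj_on_eq_iff)
    then show "x = y" by (metis vec2_inverse(2))
  qed
  have f20: "f2 x = 0" if "x \<notin> h2 ` S2" for x
  proof -
    have "unvec2 x \<notin> h ` S"
    proof
      assume "unvec2 x \<in> h ` S"
      then obtain z where z: "z \<in> S" "unvec2 x = h z" by auto
      then have "x = h2 (vec2 z)" unfolding h2_def by (metis vec2_inverse)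
      with z(1) that show False unfolding S2_def by auto
    qed
    then show ?thesis using f(3) bounded_linear.linear[OF bounded_linear_vec2, THEN linear_0] by (simp add: f2_def)
  qed
  have ind: "indicator (h2 ` S2) x *\<^sub>R f2 x = f2 x" for x using f20[of x] by (auto split: split_indicator)
  have if0: "integrable lborel (\<lambda>x. f (unvec2 x))" using lborel_integral_unvec2(2)[OF f(1)] f(2) by blast
  then have if2: "integrable lborel f2" unfolding f2_def by (rule integrable_bounded_linear[OF bounded_linear_vec2])
  have if2l: "integrable lebesgue f2" using if2 integrable_completion[of f2 lborel] borel_measurable_integrable[OF if2] by blast
  have af: "f2 absolutely_integrable_on (h2 ` S2)"
    unfolding set_integrable_def ind by (rule if2l)
  have If: "integral (h2 ` S2) f2 = vec2 (LINT z|lborel. f z)"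
  proof -
    have "integral (h2 ` S2) f2 = (LINT x:(h2 ` S2)|lebesgue. f2 x)"
      using set_lebesgue_integral_eq_integral(2)[OF af] by simp
    also have "\<dots> = (LINT x|lebesgue. f2 x)" unfolding set_lebesgue_integral_def ind ..
    also have "\<dots> = (LINT x|lborel. f2 x)" by (rule integral_completion[OF borel_measurable_integrable[OF if2]])
    also have "\<dots> = vec2 (LINT x|lborel. f (unvec2 x))"
      unfolding f2_def by (rule integral_bounded_linear[OF bounded_linear_vec2 if0])
    finally show ?thesis by (simp add: lborel_integral_unvec2(1)[OF f(1)])
  qed
  define D where "D = (\<lambda>x. \<bar>det (matrix (d2 x))\<bar> *\<^sub>R f2 (h2 x))"
  have "D absolutely_integrable_on S2 \<and> integral S2 D = vec2 (LINT z|lborel. f z)"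
    using has_absolute_integral_change_of_variables[OF S2l d2 inj, of f2 "vec2 (LINT z|lborel. f z)"] af If
    unfolding D_def by blast
  then have aD: "D absolutely_integrable_on S2" and ID: "integral S2 D = vec2 (LINT z|lborel. f z)" by auto
  have Dk: "indicator S2 x *\<^sub>R D x = vec2 (k (unvec2 x))" for x
  proof (cases "unvec2 x \<in> S")
    case True
    then have "k (unvec2 x) = (norm (deriv h (unvec2 x)))\<^sup>2 *\<^sub>R f (h (unvec2 x))"
      by (simp add: k_def scaleR_conv_of_real)
    then show ?thesis using True
      by (simp add: D_def det f2_def h2_def S2 linear_scale[OF bounded_linear.linear[OF bounded_linear_vec2]])
  qed (simp add: k_def S2 linear_0[OF bounded_linear.linear[OF bounded_linear_vec2]])
  have ik: "integrable lebesgue (\<lambda>x. vec2 (k (unvec2 x)))" using aD unfolding set_integrable_def Dk .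
  have "(\<lambda>x. vec2 (k (unvec2 x))) \<in> borel_measurable borel"
    using km linear_continuous_on[OF bounded_linear_vec2, THEN borel_measurable_continuous_onI] by measurable
  then have ik2: "integrable lborel (\<lambda>x. vec2 (k (unvec2 x)))" and
    eq: "(LINT x|lebesgue. vec2 (k (unvec2 x))) = (LINT x|lborel. vec2 (k (unvec2 x)))"
    using ik integrable_completion[of "\<lambda>x. vec2 (k (unvec2 x))" lborel] integral_completion[of "\<lambda>x. vec2 (k (unvec2 x))" lborel]
    by auto
  have ik3: "integrable lborel (\<lambda>x. k (unvec2 x))"
    using integrable_bounded_linear[OF bounded_linear_unvec2 ik2] by simp
  have "vec2 (LINT z|lborel. f z) = (LINT x:S2|lebesgue. D x)"
    using set_lebesgue_integral_eq_integral(2)[OF aD] ID by simp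
  also have "\<dots> = (LINT x|lborel. vec2 (k (unvec2 x)))" unfolding set_lebesgue_integral_def Dk eq ..
  also have "\<dots> = vec2 (LINT x|lborel. k (unvec2 x))"
    by (rule integral_bounded_linear[OF bounded_linear_vec2 ik3])
  finally have "(LINT z|lborel. f z) = (LINT x|lborel. k (unvec2 x))" by (metis vec2_inverse(1))
  also have "\<dots> = (LINT z|lborel. k z)" by (rule lborel_integral_unvec2(1)[OF km])
  finally show ?thesis unfolding k_def .
qed

section \<open>Conformal automorphisms of the disc\<close>

lemma Moebius_function_cancel:
  assumes "norm a < 1" "norm z < 1"
  shows "Moebius_function 0 (-a) (Moebius_function 0 a z) = z"
  by (rule Moebius_function_compose) (use assms in auto)

text \<open>Composed with a Moebius transformation that moves the zero \<open>a\<close> of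
  \<open>g\<close> to 0, both \<open>g\<close> and its inverse satisfy the hypotheses of the Schwarz
  lemma. Equality follows, so that the composition is a rotation.\<close>

lemma fuchsian_Moebius:
  assumes G: "fuchsian_group G" and g: "g \<in> G"
  obtains \<alpha> a where "norm \<alpha> = 1" "norm a < 1" "\<And>z. z \<in> disc \<Longrightarrow> g z = \<alpha> * ((z - a) / (1 - cnj a * z))"
proof -
  have sg: "subgroup G (BijGroup disc)" and hol: "\<And>g. g \<in> G \<Longrightarrow> g holomorphic_on disc"
    using G by (auto simp: fuchsian_group_def)
  have gB: "g \<in> Bij disc" using sg g subgroup.subset by (fastforce simp: BijGroup_def)
  then have bij: "bij_betw g disc disc" by (simp add: Bij_def)
  obtain k where k: "k holomorphic_on disc" "\<And>z. z \<in> disc \<Longrightarrow> k z \<in> disc \<and> g (k z) = z"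
    "\<And>z. z \<in> disc \<Longrightarrow> k (g z) = z"
  proof -
    have inj: "inj_on g disc" and im: "g ` disc = disc" using bij by (auto simp: bij_betw_def)
    obtain k where k: "k holomorphic_on g ` disc" "\<And>z. z \<in> disc \<Longrightarrow> deriv g z * deriv k (g z) = 1" "\<And>z. z \<in> disc \<Longrightarrow> k (g z) = z"
      using holomorphic_has_inverse[OF hol[OF g] open_ball inj] by metis
    show thesis
    proof (rule that[of k])
      show "k holomorphic_on disc" using k(1) im by simp
      show "k z \<in> disc \<and> g (k z) = z" if "z \<in> disc" for z
      proof -
        have "z \<in> g ` disc" using im that by simp
        then obtain x where "z = g x" "x \<in> disc" by (rule imageE)
        then show ?thesis using k(3) by simp
      qed
    qed (use k(3) in auto)
  qed
  have gd: "g z \<in> disc" if "z \<in> disc" for z using bij that by (auto simp: bij_betw_def)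
  define a where "a = k 0"
  have a: "norm a < 1" "g a = 0" using k(2)[of 0] by (auto simp: a_def)
  define M where "M = Moebius_function 0 a"
  define N where "N = Moebius_function 0 (-a)"
  have Mh: "M holomorphic_on disc" "N holomorphic_on disc"
    unfolding M_def N_def using a by (auto intro!: Moebius_function_holomorphic)
  have Md: "M z \<in> disc" "N z \<in> disc" if "z \<in> disc" for z
    using Moebius_function_norm_lt_1[of a z 0] Moebius_function_norm_lt_1[of "-a" z 0] that a by (auto simp: M_def N_def)
  have NM: "N (M z) = z" "M (N z) = z" if "z \<in> disc" for z
    using Moebius_function_cancel[of a z] Moebius_function_cancel[of "-a" z] that a by (auto simp: M_def N_def)
  define F where "F = (\<lambda>z. g (N z))"
  define K where "K = (\<lambda>z. M (k z))"
  have F: "F holomorphic_on disc" "F 0 = 0" "\<And>z. norm z < 1 \<Longrightarrow> norm (F z) < 1"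
  proof -
    show "F holomorphic_on disc" unfolding F_def
      by (rule holomorphic_on_compose_gen[OF Mh(2) hol[OF g], unfolded o_def]) (rule image_subsetI, rule Md(2))
    show "F 0 = 0" using a by (simp add: F_def N_def Moebius_function_of_zero)
    show "norm (F z) < 1" if "norm z < 1" for z using gd[of "N z"] Md(2)[of z] that by (simp add: F_def)
  qed
  have K: "K holomorphic_on disc" "K 0 = 0" "\<And>z. norm z < 1 \<Longrightarrow> norm (K z) < 1"
  proof -
    show "K holomorphic_on disc" unfolding K_def
      by (rule holomorphic_on_compose_gen[OF k(1) Mh(1), unfolded o_def]) (rule image_subsetI, use k(2) in blast)
    show "K 0 = 0" by (simp add: K_def M_def Moebius_function_eq_zero a_def)
    show "norm (K z) < 1" if "norm z < 1" for z using k(2)[of z] Md(1)[of "k z"] that by (simp add: K_def)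
  qed
  \<comment> \<open>A nonzero point at which to compare: K (F c) = c and the Schwarz lemma for both
    maps give |F c| = |c|.\<close>
  define c where "c = (1/2 :: complex)"
  have c: "norm c < 1" "c \<noteq> 0" by (auto simp: c_def)
  have "K (F c) = c" using c Md(2)[of c] k(3)[of "N c"] NM(2)[of c] by (simp add: K_def F_def)
  then have "norm c \<le> norm (F c)" using Schwarz_Lemma(1)[OF K(1,2,3) F(3)[OF c(1)]] by simp
  then have "norm (F c) = norm c" using Schwarz_Lemma(1)[OF F c(1)] by simp
  then obtain \<alpha> where \<alpha>: "\<And>z. norm z < 1 \<Longrightarrow> F z = \<alpha> * z" "norm \<alpha> = 1"
    using Schwarz_Lemma(3)[OF F c(1)] c by blast
  show thesis
  proof (rule that[OF \<alpha>(2) a(1)])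
    fix z assume z: "z \<in> disc"
    have "g z = F (M z)" using NM(1)[OF z] by (simp add: F_def)
    also have "\<dots> = \<alpha> * M z" using \<alpha>(1)[of "M z"] Md(1)[OF z] by simp
    finally show "g z = \<alpha> * ((z - a) / (1 - cnj a * z))" by (simp add: M_def Moebius_function_simple)
  qed
qed

text \<open>Both sides are equal because the Moebius transformation \<open>M\<close> that extends \<open>g\<close> satisfies
  \<open>(M \<zeta> - M z)\<^sup>2 = M' \<zeta> M' z (\<zeta> - z)\<^sup>2\<close>.\<close>

lemma kernel_automorphic:
  assumes G: "fuchsian_group G" and g: "g \<in> G" and \<mu>: "\<mu> \<in> linf_space G" and z: "z \<in> disc"
    and ga: "norm \<alpha> = 1" "norm a < 1" "\<And>z. z \<in> disc \<Longrightarrow> g z = \<alpha> * ((z - a) / (1 - cnj a * z))"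
    and m: "m \<in> borel_measurable borel" "\<And>z. norm z \<le> 1 \<Longrightarrow> m z = 0"
      "AE z in lborel. m z = (if z \<in> ext_disc then \<mu> z else 0)" "AE z in lborel. norm (m z) \<le> k"
  shows "(LINT \<zeta>|lborel. m \<zeta> / (\<zeta> - g z)^4) * (\<alpha> * (1 - a * cnj a) / (1 - cnj a * z)\<^sup>2)\<^sup>2
    = (LINT \<zeta>|lborel. m \<zeta> / (\<zeta> - z)^4)"
proof -
  define M where "M = (\<lambda>\<zeta>. \<alpha> * ((\<zeta> - a) / (1 - cnj a * \<zeta>)))"
  define M' where "M' = (\<lambda>\<zeta>. \<alpha> * (1 - a * cnj a) / (1 - cnj a * \<zeta>)\<^sup>2)"
  define N where "N = (\<lambda>u. (u + \<alpha> * a) / (\<alpha> + cnj a * u))"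
  \<comment> \<open>The exterior without the pole of \<open>M\<close>. Its image \<open>T\<close> is
    the exterior without the value of \<open>M\<close> at infinity.\<close>
  define S where "S = {\<zeta>. 1 < norm \<zeta> \<and> cnj a * \<zeta> \<noteq> 1}"
  define T where "T = {u. 1 < norm u \<and> \<alpha> + cnj a * u \<noteq> 0}"
  have \<alpha>0: "\<alpha> \<noteq> 0" using ga(1) by auto
  have \<alpha>c: "cnj \<alpha> = 1 / \<alpha>" using ga(1) complex_norm_square[of \<alpha>] \<alpha>0 by (simp add: field_simps)
  have oS: "open S" unfolding S_def
    by (intro open_Collect_conj open_Collect_less open_Collect_neq continuous_intros)
  have oT: "open T" unfolding T_def
    by (intro open_Collect_conj open_Collect_less open_Collect_neq continuous_intros)
  have aa: "1 - a * cnj a \<noteq> 0"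
  proof
    assume "1 - a * cnj a = 0"
    then have "(norm a)\<^sup>2 = 1" using complex_norm_square[of a] by (metis eq_iff_diff_eq_0 of_real_eq_1_iff)
    then show False using ga(2) norm_ge_zero[of a] by (simp only: power2_eq_1_iff) linarith
  qed
  \<comment> \<open>The identity shows that \<open>M\<close> preserves the exterior.\<close>
  have nrm: "(norm (\<zeta> - a))\<^sup>2 - (norm (1 - cnj a * \<zeta>))\<^sup>2 = ((norm \<zeta>)\<^sup>2 - 1) * (1 - (norm a)\<^sup>2)" for \<zeta>
    by (simp add: cmod_power2) (simp add: power2_eq_square algebra_simps)
  have big: "norm (1 - cnj a * \<zeta>) < norm (\<zeta> - a)" if "1 < norm \<zeta>" for \<zeta>
  proof -
    have "0 < ((norm \<zeta>)\<^sup>2 - 1) * (1 - (norm a)\<^sup>2)"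
      using that ga(2) by (intro mult_pos_pos) (auto simp: abs_square_less_1 one_less_power)
    then have "(norm (1 - cnj a * \<zeta>))\<^sup>2 < (norm (\<zeta> - a))\<^sup>2" using nrm[of \<zeta>] by linarith
    then show ?thesis by (rule power2_less_imp_less[OF _ norm_ge_zero])
  qed
  have MT: "M \<zeta> \<in> T" and NM: "N (M \<zeta>) = \<zeta>" if "\<zeta> \<in> S" for \<zeta>
  proof -
    have d: "1 - cnj a * \<zeta> \<noteq> 0" and b: "1 < norm \<zeta>" using that by (auto simp: S_def)
    have 1: "\<alpha> + cnj a * M \<zeta> = \<alpha> * (1 - a * cnj a) / (1 - cnj a * \<zeta>)"
      using d by (simp add: M_def field_simps)
    have 2: "M \<zeta> + \<alpha> * a = \<alpha> * (1 - a * cnj a) * \<zeta> / (1 - cnj a * \<zeta>)"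
      using d by (simp add: M_def field_simps)
    show "M \<zeta> \<in> T" using big[OF b] d aa \<alpha>0 1 ga(1) by (simp add: T_def M_def norm_mult norm_divide)
    show "N (M \<zeta>) = \<zeta>" unfolding N_def 1 2 using d aa \<alpha>0 by simp
  qed
  have NS: "N u \<in> S" and MN: "M (N u) = u" if "u \<in> T" for u
  proof -
    have d: "\<alpha> + cnj a * u \<noteq> 0" and b: "1 < norm u" using that by (auto simp: T_def)
    have 1: "1 - cnj a * N u = \<alpha> * (1 - a * cnj a) / (\<alpha> + cnj a * u)"
      using d by (simp add: N_def field_simps)
    have 2: "N u - a = u * (1 - a * cnj a) / (\<alpha> + cnj a * u)"
      using d by (simp add: N_def field_simps)
    have "\<alpha> + cnj a * u = \<alpha> * (1 + cnj a * (u / \<alpha>))" using \<alpha>0 by (simp add: distrib_left)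
    then have "norm (\<alpha> + cnj a * u) = norm (\<alpha> * (1 + cnj a * (u / \<alpha>)))" by (rule arg_cong)
    also have "\<dots> = norm (1 - cnj a * (- u / \<alpha>))" using ga(1) by (simp add: norm_mult)
    also have "\<dots> < norm (- u / \<alpha> - a)" by (rule big) (use b ga(1) in \<open>simp add: norm_divide\<close>)
    also have "\<dots> = norm (- \<alpha> * (- u / \<alpha> - a))" using ga(1) by (simp add: norm_mult)
    also have "- \<alpha> * (- u / \<alpha> - a) = u + \<alpha> * a" using \<alpha>0 by (simp add: field_simps)
    finally have "1 < norm (N u)" using d by (simp add: N_def norm_divide)
    moreover have "1 - cnj a * N u \<noteq> 0" unfolding 1 using d aa \<alpha>0 by simp
    ultimately show "N u \<in> S" by (auto simp: S_def)
    show "M (N u) = u" unfolding M_def 1 2 using d aa \<alpha>0 by simp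
  qed
  have img: "M ` S = T"
  proof
    show "M ` S \<subseteq> T" using MT by blast
    show "T \<subseteq> M ` S" using NS MN by (metis image_eqI subsetI)
  qed
  have inj: "inj_on M S" using NM by (metis inj_onI)
  have dM: "(M has_field_derivative M' \<zeta>) (at \<zeta>)" if "1 - cnj a * \<zeta> \<noteq> 0" for \<zeta>
    unfolding M_def M'_def using that
    by (auto intro!: derivative_eq_intros simp: field_simps power2_eq_square)
  have dN: "N differentiable_on T"
  proof -
    have "N holomorphic_on T" unfolding N_def by (intro holomorphic_intros) (auto simp: T_def)
    then show ?thesis
      using holomorphic_on_imp_differentiable_at[OF _ oT] field_differentiable_imp_differentiable
      by (meson differentiable_at_imp_differentiable_on)
  qed
  have hM: "M holomorphic_on S" unfolding M_def by (intro holomorphic_intros) (auto simp: S_def)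
  have dMS: "deriv M \<zeta> = M' \<zeta>" if "\<zeta> \<in> S" for \<zeta>
    using that by (intro DERIV_imp_deriv dM) (auto simp: S_def)
  have eM: "ext_action g \<zeta> = M \<zeta>" if "1 < norm \<zeta>" for \<zeta>
  proof -
    have z0: "\<zeta> \<noteq> 0" using that by auto
    have "1 / cnj \<zeta> \<in> disc" using that by (simp add: norm_divide divide_less_eq_1)
    then have "g (1 / cnj \<zeta>) = \<alpha> * ((1 / cnj \<zeta> - a) / (1 - cnj a * (1 / cnj \<zeta>)))" by (rule ga(3))
    then have "cnj (g (1 / cnj \<zeta>)) = 1 / \<alpha> * ((1 / \<zeta> - cnj a) / (1 - a * (1 / \<zeta>)))"
      using \<alpha>c by simp
    also have "1 / \<zeta> - cnj a = (1 - cnj a * \<zeta>) / \<zeta>" using z0 by (simp add: field_simps)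
    also have "1 - a * (1 / \<zeta>) = (\<zeta> - a) / \<zeta>" using z0 by (simp add: field_simps)
    finally show ?thesis using z0 by (simp add: ext_action_def M_def)
  qed
  have dE: "deriv (ext_action g) \<zeta> = M' \<zeta>" if "\<zeta> \<in> S" for \<zeta>
  proof (rule DERIV_imp_deriv)
    have "(M has_field_derivative M' \<zeta>) (at \<zeta>)" by (rule dM) (use that in \<open>auto simp: S_def\<close>)
    then show "(ext_action g has_field_derivative M' \<zeta>) (at \<zeta>)"
      by (rule has_field_derivative_transform_within_open[OF _ oS that]) (auto simp: eM S_def)
  qed
  have neg_S: "AE \<zeta> in lborel. norm \<zeta> > 1 \<longrightarrow> \<zeta> \<in> S"
  proof -
    have "finite {\<zeta>. cnj a * \<zeta> = 1}"
      by (rule finite_subset[of _ "{1 / cnj a}"]) (auto simp: eq_divide_eq mult.commute)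
    then have "AE \<zeta> in lborel. \<zeta> \<notin> {\<zeta>. cnj a * \<zeta> = 1}"
      by (intro AE_not_in finite_imp_null_set_lborel)
    then show ?thesis by eventually_elim (auto simp: S_def)
  qed
  have neg_T: "AE u in lborel. norm u > 1 \<longrightarrow> u \<in> T"
  proof -
    have "finite {u. \<alpha> + cnj a * u = 0}"
      by (rule finite_subset[of _ "{- \<alpha> / cnj a}"]) (use \<alpha>0 in \<open>auto simp: eq_divide_eq mult.commute add_eq_0_iff simp del: divide_minus_left\<close>)
    then have "AE u in lborel. u \<notin> {u. \<alpha> + cnj a * u = 0}"
      by (intro AE_not_in finite_imp_null_set_lborel)
    then show ?thesis by eventually_elim (auto simp: T_def)
  qed
  \<comment> \<open>The null set on which \<open>m\<close> and \<mu> differ has to stay null when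
    pulled back by \<open>M\<close>; the pullback is its image under the differentiable map
    \<open>N\<close>.\<close>
  have mM: "AE \<zeta> in lborel. \<zeta> \<in> S \<longrightarrow> m (M \<zeta>) = \<mu> (M \<zeta>)"
  proof -
    define Z where "Z = {u \<in> T. m u \<noteq> \<mu> u}"
    have "AE u in lborel. u \<notin> Z" using m(3) by eventually_elim (auto simp: Z_def T_def)
    then have "negligible Z" unfolding negligible_iff_null_sets AE_iff_null_sets[symmetric]
      by (simp add: AE_lebesgue_lborel[symmetric] completion.AE_iff_null_sets)
    then have "negligible (N ` Z)"
      by (intro negligible_differentiable_image_negligible differentiable_on_subset[OF dN]) (auto simp: Z_def)
    then have "AE \<zeta> in lebesgue. \<zeta> \<notin> N ` Z" unfolding negligible_iff_null_sets by (rule AE_not_in)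
    then show ?thesis unfolding AE_lebesgue_lborel
    proof eventually_elim
      case (elim \<zeta>)
      show ?case
      proof (intro impI, rule ccontr)
        assume "\<zeta> \<in> S" "m (M \<zeta>) \<noteq> \<mu> (M \<zeta>)"
        then have "M \<zeta> \<in> Z" "\<zeta> = N (M \<zeta>)" using MT NM by (auto simp: Z_def)
        then show False using elim by blast
      qed
    qed
  qed
  have aut: "AE \<zeta> in lborel. 1 < norm \<zeta> \<longrightarrow> \<mu> \<zeta> = \<mu> (ext_action g \<zeta>) * cnj (deriv (ext_action g) \<zeta>) / deriv (ext_action g) \<zeta>"
  proof -
    have "open ext_disc" by (intro open_Collect_less continuous_intros)
    then have e: "ext_disc \<inter> space lebesgue \<in> sets lebesgue" by simp
    show ?thesis
      using \<mu> g unfolding linf_space_def AE_restrict_space_iff[OF e] AE_lebesgue_lborel by auto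
  qed
  have M'0: "M' \<zeta> \<noteq> 0" if "1 - cnj a * \<zeta> \<noteq> 0" for \<zeta> using that \<alpha>0 aa by (simp add: M'_def)
  have z1: "1 - cnj a * z \<noteq> 0"
  proof
    assume "1 - cnj a * z = 0"
    then have "norm (cnj a * z) = 1" by (metis eq_iff_diff_eq_0 norm_one)
    moreover have "norm a * norm z < 1 * 1" by (rule mult_strict_mono') (use z ga(2) in auto)
    ultimately show False by (simp add: norm_mult)
  qed
  have gz: "g z = M z" using ga(3)[OF z] by (simp add: M_def)
  have cross: "(M \<zeta> - g z)^4 = (M' \<zeta>)\<^sup>2 * (M' z)\<^sup>2 * (\<zeta> - z)^4" if "1 - cnj a * \<zeta> \<noteq> 0" for \<zeta>
  proof -
    have "M \<zeta> - M z = \<alpha> * (1 - a * cnj a) * (\<zeta> - z) / ((1 - cnj a * \<zeta>) * (1 - cnj a * z))"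
      using that z1 by (simp add: M_def field_simps)
    moreover have "(p * v / (q * r))^4 = (p / q\<^sup>2)\<^sup>2 * (p / r\<^sup>2)\<^sup>2 * v^4" for p q r v :: complex
      by (simp add: power_divide power4_eq_xxxx power2_eq_square mult_ac)
    ultimately show ?thesis unfolding gz M'_def by simp
  qed
  have gd: "g z \<in> disc"
  proof -
    have "g \<in> Bij disc" using G g subgroup.subset unfolding fuchsian_group_def by (fastforce simp: BijGroup_def)
    then show ?thesis using z by (auto simp: Bij_def bij_betw_def)
  qed
  define f where "f = (\<lambda>u. if u \<in> T then m u / (u - g z)^4 else 0)"
  have Tb: "T \<in> sets borel" using oT by simp
  have fm: "f \<in> borel_measurable borel" unfolding f_def using m(1) Tb by measurable
  have k0: "0 \<le> k"
  proof (rule ccontr)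
    assume neg: "\<not> 0 \<le> k"
    have "AE z in (lborel :: complex measure). False"
      using m(4) by eventually_elim (use neg in \<open>smt (verit) norm_ge_zero\<close>)
    then show False by (simp add: AE_iff_measurable[of UNIV])
  qed
  have fi: "integrable lborel f"
  proof -
    define d where "d = 1 - norm (g z)"
    define K where "K = (\<lambda>u. indicator {u. d \<le> norm (u - g z)} u / (u - g z)\<^sup>2 :: complex)"
    have "L2 K" unfolding K_def by (rule kernel_L2(1)) (use gd in \<open>simp add: d_def\<close>)
    then have "integrable lborel (\<lambda>u. k * (norm (K u))\<^sup>2)" by (auto simp: L2_def)
    then show ?thesis
    proof (rule Bochner_Integration.integrable_bound)
      show "AE u in lborel. norm (f u) \<le> norm (k * (norm (K u))\<^sup>2)" using m(4)
      proof eventually_elim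
        case (elim u)
        show ?case
        proof (cases "u \<in> T")
          case True
          then have "d \<le> norm (u - g z)" using norm_triangle_ineq2[of u "g z"] by (simp add: T_def d_def)
          then have "norm (f u) = norm (m u) * (norm (K u))\<^sup>2"
            using True by (simp add: f_def K_def norm_divide norm_power power_divide power_mult[symmetric])
          also have "\<dots> \<le> k * (norm (K u))\<^sup>2" using elim by (intro mult_right_mono) auto
          finally show ?thesis by simp
        qed (use k0 in \<open>simp add: f_def\<close>)
      qed
    qed (use fm in simp)
  qed
  have "(LINT \<zeta>|lborel. m \<zeta> / (\<zeta> - g z)^4) = (LINT u|lborel. f u)"
  proof (rule integral_cong_AE)
    show "AE u in lborel. m u / (u - g z)^4 = f u"
      using neg_T by eventually_elim (use m(2) in \<open>fastforce simp: f_def T_def\<close>)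
  qed (use m(1) fm in measurable)
  also have "\<dots> = (LINT \<zeta>|lborel. (if \<zeta> \<in> S then of_real ((norm (deriv M \<zeta>))\<^sup>2) * f (M \<zeta>) else 0))"
    by (rule holomorphic_change_of_variables[OF oS hM inj fm fi]) (auto simp: img f_def)
  also have "\<dots> = (LINT \<zeta>|lborel. (if \<zeta> \<in> S then of_real ((norm (M' \<zeta>))\<^sup>2) * f (M \<zeta>) else 0))"
    by (intro Bochner_Integration.integral_cong refl) (simp add: dMS)
  also have "\<dots> = (LINT \<zeta>|lborel. (1 / (M' z)\<^sup>2) * (m \<zeta> / (\<zeta> - z)^4))"
  proof (rule integral_cong_AE)
    have Sb: "S \<in> sets borel" using oS by simp
    have [measurable]: "M \<in> borel_measurable borel" "M' \<in> borel_measurable borel"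
      unfolding M_def M'_def by measurable
    show "(\<lambda>\<zeta>. if \<zeta> \<in> S then of_real ((norm (M' \<zeta>))\<^sup>2) * f (M \<zeta>) else 0) \<in> borel_measurable lborel"
      using Sb fm by measurable
    show "(\<lambda>\<zeta>. (1 / (M' z)\<^sup>2) * (m \<zeta> / (\<zeta> - z)^4)) \<in> borel_measurable lborel"
      using m(1) by measurable
    show "AE \<zeta> in lborel. (if \<zeta> \<in> S then of_real ((norm (M' \<zeta>))\<^sup>2) * f (M \<zeta>) else 0)
        = (1 / (M' z)\<^sup>2) * (m \<zeta> / (\<zeta> - z)^4)"
      using mM aut m(3) neg_S
    proof eventually_elim
      case (elim \<zeta>)
      show ?case
      proof (cases "\<zeta> \<in> S")
        case True
        then have e: "1 < norm \<zeta>" and d: "1 - cnj a * \<zeta> \<noteq> 0" by (auto simp: S_def)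
        \<comment> \<open>The Jacobian |M'|^2 = M' cnj M' meets the factor cnj M' / M' of the
          automorphy; together with \<open>cross\<close>, only the factor in \<open>z\<close>
          survives.\<close>
        have mu: "m \<zeta> = m (M \<zeta>) * cnj (M' \<zeta>) / M' \<zeta>"
          using elim e True dE[OF True] eM[OF e] by simp
        have ff: "f (M \<zeta>) = m (M \<zeta>) / (M \<zeta> - g z)^4" using MT[OF True] by (simp add: f_def)
        have "(if \<zeta> \<in> S then of_real ((norm (M' \<zeta>))\<^sup>2) * f (M \<zeta>) else 0)
          = M' \<zeta> * cnj (M' \<zeta>) * (m (M \<zeta>) / ((M' \<zeta>)\<^sup>2 * (M' z)\<^sup>2 * (\<zeta> - z)^4))"
          using True unfolding ff cross[OF d] complex_norm_square by (simp only: if_True)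
        then show ?thesis unfolding mu
          using M'0[OF d] M'0[OF z1] by (simp add: power2_eq_square mult_ac)
      next
        case False
        then have "m \<zeta> = 0" using elim m(2)[of \<zeta>] by fastforce
        then show ?thesis using False by simp
      qed
    qed
  qed
  also have "\<dots> = (1 / (M' z)\<^sup>2) * (LINT \<zeta>|lborel. m \<zeta> / (\<zeta> - z)^4)"
    by (rule integral_mult_right_zero)
  finally show ?thesis using M'0[OF z1] unfolding M'_def by simp
qed

section \<open>The differentials of the lifted higher Bers maps\<close>

lemma linf_norm_nonneg:
  assumes "\<mu> \<in> linf_space G" shows "0 \<le> linf_norm \<mu>"
proof (rule ccontr)
  assume neg: "\<not> 0 \<le> linf_norm \<mu>"
  obtain m :: "complex \<Rightarrow> complex" where "AE z in lborel. norm (m z) \<le> linf_norm \<mu>"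
    using linf_borel_representative[OF assms] by blast
  then have "AE z in (lborel :: complex measure). False"
    by (rule eventually_mono) (use neg order_trans[OF norm_ge_zero] in blast)
  then show False by (simp add: AE_iff_measurable[of UNIV])
qed

lemma linf_AE:
  assumes "\<mu> \<in> linf_space G" shows "AE z in lebesgue_on ext_disc. norm (\<mu> z) \<le> linf_norm \<mu>"
proof -
  have "open ext_disc" by (intro open_Collect_less continuous_intros)
  then have e: "ext_disc \<inter> space lebesgue \<in> sets lebesgue" by simp
  obtain m where m: "AE z in lborel. m z = (if z \<in> ext_disc then \<mu> z else 0)" "AE z in lborel. norm (m z) \<le> linf_norm \<mu>"
    using linf_borel_representative[OF assms] by blast
  show ?thesis unfolding AE_restrict_space_iff[OF e] AE_lebesgue_lborel
    using m by eventually_elim auto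
qed

lemma linf_combination:
  assumes \<mu>: "\<mu> \<in> linf_space G" and \<nu>: "\<nu> \<in> linf_space G"
  shows "(\<lambda>z. c * \<mu> z + d * \<nu> z) \<in> linf_space G"
    "linf_norm (\<lambda>z. c * \<mu> z + d * \<nu> z) \<le> norm c * linf_norm \<mu> + norm d * linf_norm \<nu>"
proof -
  define \<kappa> where "\<kappa> = (\<lambda>z. c * \<mu> z + d * \<nu> z)"
  define K where "K = norm c * linf_norm \<mu> + norm d * linf_norm \<nu>"
  have K: "0 \<le> K" unfolding K_def using linf_norm_nonneg[OF \<mu>] linf_norm_nonneg[OF \<nu>] by simp
  have m: "\<mu> \<in> borel_measurable (lebesgue_on ext_disc)" "\<nu> \<in> borel_measurable (lebesgue_on ext_disc)"
    using assms by (auto simp: linf_space_def)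
  have km: "\<kappa> \<in> borel_measurable (lebesgue_on ext_disc)" unfolding \<kappa>_def using m by measurable
  have "AE z in lebesgue_on ext_disc. ereal (norm (\<kappa> z)) \<le> ereal K"
    using linf_AE[OF \<mu>] linf_AE[OF \<nu>]
  proof eventually_elim
    case (elim z)
    have "norm (\<kappa> z) \<le> norm c * norm (\<mu> z) + norm d * norm (\<nu> z)"
      unfolding \<kappa>_def by (metis norm_mult norm_triangle_ineq)
    also have "\<dots> \<le> K" unfolding K_def using elim by (intro add_mono mult_left_mono) auto
    finally show ?case by simp
  qed
  then have es: "esssup (lebesgue_on ext_disc) (\<lambda>z. ereal (norm (\<kappa> z))) \<le> ereal K"
    by (intro esssup_I) (use km in measurable)
  have lt: "esssup (lebesgue_on ext_disc) (\<lambda>z. ereal (norm (\<kappa> z))) < \<infinity>"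
    using es by (rule le_less_trans) simp
  show "linf_norm (\<lambda>z. c * \<mu> z + d * \<nu> z) \<le> norm c * linf_norm \<mu> + norm d * linf_norm \<nu>"
    using es K unfolding \<kappa>_def[symmetric] K_def[symmetric] linf_norm_def[of \<kappa>]
    by (cases "esssup (lebesgue_on ext_disc) (\<lambda>z. ereal (norm (\<kappa> z)))") auto
  have "AE z in lebesgue_on ext_disc. \<kappa> z = \<kappa> (ext_action g z) * cnj (deriv (ext_action g) z) / deriv (ext_action g) z"
    if g: "g \<in> G" for g
  proof -
    have "AE z in lebesgue_on ext_disc. \<mu> z = \<mu> (ext_action g z) * cnj (deriv (ext_action g) z) / deriv (ext_action g) z"
      "AE z in lebesgue_on ext_disc. \<nu> z = \<nu> (ext_action g z) * cnj (deriv (ext_action g) z) / deriv (ext_action g) z"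
      using assms g by (auto simp: linf_space_def)
    then show ?thesis
    proof eventually_elim
      case (elim z)
      have "\<kappa> z = c * (\<mu> (ext_action g z) * cnj (deriv (ext_action g) z) / deriv (ext_action g) z)
          + d * (\<nu> (ext_action g z) * cnj (deriv (ext_action g) z) / deriv (ext_action g) z)"
        unfolding \<kappa>_def using elim by simp
      also have "\<dots> = \<kappa> (ext_action g z) * cnj (deriv (ext_action g) z) / deriv (ext_action g) z"
        unfolding \<kappa>_def by (simp add: add_divide_distrib ring_distribs mult.assoc)
      finally show ?case .
    qed
  qed
  then show "(\<lambda>z. c * \<mu> z + d * \<nu> z) \<in> linf_space G"
    using km lt unfolding linf_space_def \<kappa>_def[symmetric] by blast
qed

lemma linf_scale:
  assumes "\<mu> \<in> linf_space G"
  shows "(\<lambda>z. c * \<mu> z) \<in> linf_space G" "linf_norm (\<lambda>z. c * \<mu> z) \<le> norm c * linf_norm \<mu>"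
  using linf_combination[OF assms assms, of c 0] by simp_all

lemma linf_diff:
  assumes "\<mu> \<in> linf_space G" "\<nu> \<in> linf_space G" shows "(\<lambda>z. \<mu> z - \<nu> z) \<in> linf_space G"
  using linf_combination(1)[OF assms, of 1 "-1"] by simp

lemma eventually_at_right_0_small:
  fixes c :: real
  assumes "0 < b" shows "\<forall>\<^sub>F t in at_right 0. t * c < b"
proof -
  have "((\<lambda>t. t * c) \<longlongrightarrow> 0 * c) (at_right 0)" by (intro tendsto_intros)
  then show ?thesis using assms by (auto dest: order_tendstoD(2))
qed

text \<open>\<open>m\<close> extends the coefficient by 0, as \<open>normalized_solution\<close>
  does, so that integrals over the exterior become integrals over the plane.\<close>

definition borel_representative :: "(complex \<Rightarrow> complex) \<Rightarrow> real \<Rightarrow> (complex \<Rightarrow> complex) \<Rightarrow> bool" where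
  "borel_representative \<mu> k m \<longleftrightarrow> m \<in> borel_measurable borel \<and> (\<forall>z. norm z \<le> 1 \<longrightarrow> m z = 0) \<and>
     (AE z in lborel. m z = (if z \<in> ext_disc then \<mu> z else 0)) \<and> (AE z in lborel. norm (m z) \<le> k) \<and> 0 \<le> k"

text \<open>With \<open>bump_const\<close> equal to pi, this is the classical formula for the
  derivative of the Bers embedding at the origin.\<close>

definition bers_kernel :: "(complex \<Rightarrow> complex) \<Rightarrow> complex \<Rightarrow> complex" where
  "bers_kernel m z = - (6 / bump_const) * (LINT \<zeta>|lborel. m \<zeta> / (\<zeta> - z)^4)"

lemma normalized_family_estimates:
  fixes w
  assumes w: "\<forall>\<mu>\<in>belt G. normalized_solution \<mu> (w \<mu>)" and \<mu>: "\<mu> \<in> linf_space G"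
    and rep: "borel_representative \<mu> k m"
  defines "f \<equiv> \<lambda>t::real. planar (w (\<lambda>z. of_real t * \<mu> z))"
  shows "\<forall>\<^sub>F t in at_right 0. 0 < t \<and> (\<lambda>z. of_real t * \<mu> z) \<in> belt G \<and> f t holomorphic_on disc \<and>
    (\<forall>z\<in>disc. deriv (f t) z \<noteq> 0 \<and> norm (schwarzian (f t) z) \<le> schw_const * (t * k) / (1 - norm z)\<^sup>2 \<and>
      norm (pre_schwarzian (f t) z) \<le> t * (2 * schw_const * k + 1) / (1 - norm z) \<and>
      norm (schwarzian (f t) z - of_real t * bers_kernel m z) \<le> schw_const * (t * k)\<^sup>2 / (1 - norm z)\<^sup>2)"
proof -
  have m: "m \<in> borel_measurable borel" "\<And>z. norm z \<le> 1 \<Longrightarrow> m z = 0"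
    "AE z in lborel. m z = (if z \<in> ext_disc then \<mu> z else 0)" "AE z in lborel. norm (m z) \<le> k" "0 \<le> k"
    using rep by (auto simp: borel_representative_def)
  define L where "L = linf_norm \<mu>"
  \<comment> \<open>c = t b is a supersolution for the coefficient with bound t k: for t b \<le> 1
    the term c^2 / 2 is at most t b / 2, and schw_const * t * k = t b / 2 - t / 2. The summand 1
    keeps \<open>b\<close> positive when k = 0.\<close>
  define b where "b = 2 * schw_const * k + 1"
  have b: "b > 0" unfolding b_def using schw_const_pos m(5) by (simp add: add_nonneg_pos)
  have "\<forall>\<^sub>F t in at_right (0::real). 0 < t" by (rule eventually_at_right_less)
  moreover have "\<forall>\<^sub>F t in at_right (0::real). t * L < 1" by (rule eventually_at_right_0_small) simp
  moreover have "\<forall>\<^sub>F t in at_right (0::real). t * k < 1/2" by (rule eventually_at_right_0_small) simp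
  moreover have "\<forall>\<^sub>F t in at_right (0::real). t * (schw_const * k) < 1/2" by (rule eventually_at_right_0_small) simp
  moreover have "\<forall>\<^sub>F t in at_right (0::real). t * b < 1" by (rule eventually_at_right_0_small) simp
  ultimately show ?thesis
  proof eventually_elim
    case (elim t)
    have belt: "(\<lambda>z. of_real t * \<mu> z) \<in> belt G"
      using linf_scale[OF \<mu>, of "of_real t"] elim by (simp add: belt_def L_def)
    note ns = bspec[OF w belt]
    have M: "(\<lambda>z. of_real t * m z) \<in> borel_measurable borel" "\<And>z. norm z \<le> 1 \<Longrightarrow> of_real t * m z = 0"
      "AE z in lborel. of_real t * m z = (if z \<in> ext_disc then of_real t * \<mu> z else 0)"
      "AE z in lborel. norm (of_real t * m z) \<le> t * k" "0 \<le> t * k" "t * k \<le> 1/2" "schw_const * (t * k) \<le> 1/2"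
    proof -
      show "AE z in lborel. of_real t * m z = (if z \<in> ext_disc then of_real t * \<mu> z else 0)"
        using m(3) by eventually_elim auto
      show "AE z in lborel. norm (of_real t * m z) \<le> t * k"
        using m(4) by eventually_elim (use elim in \<open>simp add: norm_mult\<close>)
      show "(\<lambda>z. of_real t * m z) \<in> borel_measurable borel" using m(1) by measurable
      show "schw_const * (t * k) \<le> 1/2" using elim by (simp add: mult.left_commute)
    qed (use m elim in auto)
    note E = normalized_solution_estimates[OF ns M(1) _ M(3-7)]
    have c: "0 < t * b" "(t * b)\<^sup>2 / 2 + schw_const * (t * k) \<le> t * b"
    proof -
      show tb: "0 < t * b" using elim b by simp
      have "(t * b)\<^sup>2 \<le> t * b" using tb elim mult_left_mono[of "t * b" 1 "t * b"] by (simp add: power2_eq_square)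
      moreover have "schw_const * (t * k) = t * b / 2 - t / 2" by (simp add: b_def algebra_simps)
      ultimately show "(t * b)\<^sup>2 / 2 + schw_const * (t * k) \<le> t * b" using elim by linarith
    qed
    have lin: "(LINT \<zeta>|lborel. of_real t * m \<zeta> / (\<zeta> - z)^4) = of_real t * (LINT \<zeta>|lborel. m \<zeta> / (\<zeta> - z)^4)" for z
      by (simp add: times_divide_eq_right[symmetric] del: times_divide_eq_right)
    have eq: "schwarzian (f t) z - of_real t * bers_kernel m z
      = schwarzian (f t) z + 6 / bump_const * (LINT \<zeta>|lborel. of_real t * m \<zeta> / (\<zeta> - z)^4)" for z
      unfolding lin bers_kernel_def by simp
    have "f t holomorphic_on disc" unfolding f_def by (rule E(1)) (use M(2) in auto)
    moreover have "deriv (f t) z \<noteq> 0" "norm (schwarzian (f t) z) \<le> schw_const * (t * k) / (1 - norm z)\<^sup>2"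
      "norm (pre_schwarzian (f t) z) \<le> t * (2 * schw_const * k + 1) / (1 - norm z)"
      "norm (schwarzian (f t) z - of_real t * bers_kernel m z) \<le> schw_const * (t * k)\<^sup>2 / (1 - norm z)\<^sup>2"
      if z: "z \<in> disc" for z
    proof -
      show "deriv (f t) z \<noteq> 0" unfolding f_def by (rule E(2)) (use M(2) z in auto)
      show "norm (schwarzian (f t) z) \<le> schw_const * (t * k) / (1 - norm z)\<^sup>2"
        unfolding f_def by (rule E(3)) (use M(2) z in auto)
      show "norm (pre_schwarzian (f t) z) \<le> t * (2 * schw_const * k + 1) / (1 - norm z)"
        unfolding f_def b_def[symmetric] by (rule E(4)) (use M(2) z c in auto)
      show "norm (schwarzian (f t) z - of_real t * bers_kernel m z) \<le> schw_const * (t * k)\<^sup>2 / (1 - norm z)\<^sup>2"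
        unfolding eq unfolding f_def by (rule E(5)) (use M(2) z in auto)
    qed
    ultimately show ?case using elim(1) belt by blast
  qed
qed

lemma bers_lift_3:
  assumes w: "\<forall>\<mu>\<in>belt G. normalized_solution \<mu> (w \<mu>)" and \<mu>: "\<mu> \<in> belt G"
    and f: "planar (w \<mu>) holomorphic_on disc" "\<And>z. z \<in> disc \<Longrightarrow> deriv (planar (w \<mu>)) z \<noteq> 0" and z: "z \<in> disc"
  shows "bers_lift s 3 w G \<mu> z = schwarzian (planar (w \<mu>)) z"
proof -
  have "bers_lift s 3 w G \<mu> = (\<lambda>z. if z \<in> disc then higher_schwarzian s 3 (planar (w \<mu>)) z else 0)"
    by (rule bers_lift_eq) (use w \<mu> in auto)
  moreover have "schwarzian_A 3 (planar (w \<mu>)) = schwarzian (planar (w \<mu>))" by (simp add: numeral_eq_Suc)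
  moreover have "schwarzian_B 3 (planar (w \<mu>)) z = schwarzian (planar (w \<mu>)) z"
    by (rule schwarzian_B_3) (use f z in auto)
  ultimately show ?thesis using z by (cases s) simp_all
qed

text \<open>Stated at a single point, since at this stage \<open>bers_kernel m\<close> is not known
  to be holomorphic: this is read off later from \<open>D3\<close>, which the present estimate
  identifies.\<close>

lemma bers_lift_family_3:
  fixes w
  assumes w: "\<forall>\<mu>\<in>belt G. normalized_solution \<mu> (w \<mu>)" and \<mu>: "\<mu> \<in> linf_space G"
    and rep: "borel_representative \<mu> k m"
    and z: "z \<in> disc"
  shows "\<forall>\<^sub>F t in at_right 0. norm (bers_lift s 3 w G (\<lambda>z. of_real t * \<mu> z) z - of_real t * bers_kernel m z)
    \<le> schw_const * (t * k)\<^sup>2 / (1 - norm z)\<^sup>2"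
  using normalized_family_estimates[OF w \<mu> rep]
proof eventually_elim
  case (elim t)
  then have "bers_lift s 3 w G (\<lambda>z. of_real t * \<mu> z) z = schwarzian (planar (w (\<lambda>z. of_real t * \<mu> z))) z"
    by (intro bers_lift_3[OF w _ _ _ z]) blast+
  then show ?case using elim z by metis
qed

lemma schwarzian_holomorphic:
  assumes "f holomorphic_on disc" "\<And>z. z \<in> disc \<Longrightarrow> deriv f z \<noteq> 0"
  shows "pre_schwarzian f holomorphic_on disc" "schwarzian f holomorphic_on disc"
proof -
  show p: "pre_schwarzian f holomorphic_on disc"
    unfolding pre_schwarzian_def using assms by (intro holomorphic_intros holomorphic_deriv) auto
  show "schwarzian f holomorphic_on disc"
    unfolding schwarzian_def using p by (intro holomorphic_intros holomorphic_deriv) auto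
qed

lemma bers_lift_family:
  fixes w
  assumes w: "\<forall>\<mu>\<in>belt G. normalized_solution \<mu> (w \<mu>)" and \<mu>: "\<mu> \<in> linf_space G"
    and rep: "borel_representative \<mu> k m"
    and \<Phi>: "bers_kernel m holomorphic_on disc" and n: "n \<ge> 3"
  shows "bigO_disc 2 (\<lambda>t z. bers_lift s n w G (\<lambda>z. of_real t * \<mu> z) z
    - of_real t * (lin_coeff s n * (deriv ^^ (n - 3)) (bers_kernel m) z))"
proof -
  define f where "f = (\<lambda>t::real. planar (w (\<lambda>z. of_real t * \<mu> z)))"
  have k: "0 \<le> k" using rep by (simp add: borel_representative_def)
  have ev: "\<forall>\<^sub>F t in at_right 0. 0 < t \<and> (\<lambda>z. of_real t * \<mu> z) \<in> belt G \<and> f t holomorphic_on disc \<and>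
    (\<forall>z\<in>disc. deriv (f t) z \<noteq> 0 \<and> norm (schwarzian (f t) z) \<le> schw_const * (t * k) / (1 - norm z)\<^sup>2 \<and>
      norm (pre_schwarzian (f t) z) \<le> t * (2 * schw_const * k + 1) / (1 - norm z) \<and>
      norm (schwarzian (f t) z - of_real t * bers_kernel m z) \<le> schw_const * (t * k)\<^sup>2 / (1 - norm z)\<^sup>2)"
    unfolding f_def by (rule normalized_family_estimates[OF w \<mu> rep])
  have fh: "\<forall>\<^sub>F t in at_right 0. f t holomorphic_on disc \<and> (\<forall>z\<in>disc. deriv (f t) z \<noteq> 0)"
    using ev by eventually_elim blast
  have r: "norm z \<le> r" "0 < 1 - r" "0 < 1 - norm z" "1 - r \<le> 1 - norm z" if "z \<in> cball 0 r" "r < 1" for z :: complex and r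
    using that by auto
  have bS: "bigO_disc 1 (\<lambda>t. schwarzian (f t))" unfolding bigO_disc_def
  proof (intro conjI allI impI)
    show "\<forall>\<^sub>F t in at_right 0. schwarzian (f t) holomorphic_on disc"
      using fh by eventually_elim (auto intro: schwarzian_holomorphic)
    fix r :: real assume r1: "r < 1"
    have "\<forall>\<^sub>F t in at_right 0. \<forall>z\<in>cball 0 r. norm (schwarzian (f t) z) \<le> schw_const * k / (1 - r)\<^sup>2 * t ^ 1"
      using ev
    proof eventually_elim
      case (elim t)
      show ?case
      proof
        fix z assume z: "z \<in> cball (0::complex) r"
        have "norm (schwarzian (f t) z) \<le> schw_const * (t * k) / (1 - norm z)\<^sup>2" using elim r[OF z r1] by auto
        also have "\<dots> \<le> schw_const * (t * k) / (1 - r)\<^sup>2"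
          using r[OF z r1] elim k schw_const_pos by (intro divide_left_mono power_mono) auto
        finally show "norm (schwarzian (f t) z) \<le> schw_const * k / (1 - r)\<^sup>2 * t ^ 1" by (simp add: mult_ac)
      qed
    qed
    then show "\<exists>C. \<forall>\<^sub>F t in at_right 0. \<forall>z\<in>cball 0 r. norm (schwarzian (f t) z) \<le> C * t ^ 1" by blast
  qed
  have bP: "bigO_disc 1 (\<lambda>t. pre_schwarzian (f t))" unfolding bigO_disc_def
  proof (intro conjI allI impI)
    show "\<forall>\<^sub>F t in at_right 0. pre_schwarzian (f t) holomorphic_on disc"
      using fh by eventually_elim (auto intro: schwarzian_holomorphic)
    fix r :: real assume r1: "r < 1"
    have "\<forall>\<^sub>F t in at_right 0. \<forall>z\<in>cball 0 r. norm (pre_schwarzian (f t) z) \<le> (2 * schw_const * k + 1) / (1 - r) * t ^ 1"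
      using ev
    proof eventually_elim
      case (elim t)
      show ?case
      proof
        fix z assume z: "z \<in> cball (0::complex) r"
        have "norm (pre_schwarzian (f t) z) \<le> t * (2 * schw_const * k + 1) / (1 - norm z)" using elim r[OF z r1] by auto
        also have "\<dots> \<le> t * (2 * schw_const * k + 1) / (1 - r)"
          using r[OF z r1] elim k schw_const_pos by (intro divide_left_mono) auto
        finally show "norm (pre_schwarzian (f t) z) \<le> (2 * schw_const * k + 1) / (1 - r) * t ^ 1" by (simp add: mult_ac)
      qed
    qed
    then show "\<exists>C. \<forall>\<^sub>F t in at_right 0. \<forall>z\<in>cball 0 r. norm (pre_schwarzian (f t) z) \<le> C * t ^ 1" by blast
  qed
  have bD: "bigO_disc 2 (\<lambda>t z. schwarzian (f t) z - of_real t * bers_kernel m z)" unfolding bigO_disc_def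
  proof (intro conjI allI impI)
    show "\<forall>\<^sub>F t in at_right 0. (\<lambda>z. schwarzian (f t) z - of_real t * bers_kernel m z) holomorphic_on disc"
      using fh by eventually_elim (auto intro!: schwarzian_holomorphic holomorphic_intros \<Phi>)
    fix r :: real assume r1: "r < 1"
    have "\<forall>\<^sub>F t in at_right 0. \<forall>z\<in>cball 0 r. norm (schwarzian (f t) z - of_real t * bers_kernel m z) \<le> schw_const * k\<^sup>2 / (1 - r)\<^sup>2 * t ^ 2"
      using ev
    proof eventually_elim
      case (elim t)
      show ?case
      proof
        fix z assume z: "z \<in> cball (0::complex) r"
        have "norm (schwarzian (f t) z - of_real t * bers_kernel m z) \<le> schw_const * (t * k)\<^sup>2 / (1 - norm z)\<^sup>2" using elim r[OF z r1] by auto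
        also have "\<dots> \<le> schw_const * (t * k)\<^sup>2 / (1 - r)\<^sup>2"
          using r[OF z r1] elim k schw_const_pos by (intro divide_left_mono power_mono) auto
        finally show "norm (schwarzian (f t) z - of_real t * bers_kernel m z) \<le> schw_const * k\<^sup>2 / (1 - r)\<^sup>2 * t ^ 2"
          by (simp add: power_mult_distrib mult_ac)
      qed
    qed
    then show "\<exists>C. \<forall>\<^sub>F t in at_right 0. \<forall>z\<in>cball 0 r. norm (schwarzian (f t) z - of_real t * bers_kernel m z) \<le> C * t ^ 2" by blast
  qed
  \<comment> \<open>Cauchy's estimate carries the error O(t^2) from the Schwarzian to its (n - 3)-rd
    derivative.\<close>
  define H where "H = (\<lambda>t z. (deriv ^^ (n - 3)) (\<lambda>z. schwarzian (f t) z - of_real t * bers_kernel m z) z)"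
  have bH: "bigO_disc 2 H" using bigO_disc_higher_deriv[OF bD, of "n - 3"] by (simp add: H_def)
  have bN: "bigO_disc 2 (\<lambda>t z. higher_schwarzian s n (f t) z - lin_coeff s n * (deriv ^^ (n - 3)) (schwarzian (f t)) z)"
    by (rule higher_schwarzian_asymptotics[OF fh bS bP n])
  show ?thesis
  proof (rule bigO_disc_cong[OF bigO_disc_add[OF bN bigO_disc_cmult[OF bH, of "lin_coeff s n"]]])
    show "\<forall>\<^sub>F t in at_right 0. \<forall>z\<in>disc. higher_schwarzian s n (f t) z - lin_coeff s n * (deriv ^^ (n - 3)) (schwarzian (f t)) z
        + lin_coeff s n * H t z = bers_lift s n w G (\<lambda>z. of_real t * \<mu> z) z
        - of_real t * (lin_coeff s n * (deriv ^^ (n - 3)) (bers_kernel m) z)"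
      using ev
    proof eventually_elim
      case (elim t)
      show ?case
      proof
        fix z assume z: "z \<in> disc"
        have b: "(\<lambda>z. of_real t * \<mu> z) \<in> belt G" using elim by blast
        have bL: "bers_lift s n w G (\<lambda>z. of_real t * \<mu> z) =
            (\<lambda>z. if z \<in> disc then higher_schwarzian s n (planar (w (\<lambda>z. of_real t * \<mu> z))) z else 0)"
          by (rule bers_lift_eq) (use w b in auto)
        have "H t z = (deriv ^^ (n - 3)) (schwarzian (f t)) z - (deriv ^^ (n - 3)) (\<lambda>z. of_real t * bers_kernel m z) z"
          unfolding H_def
          by (rule higher_deriv_diff[OF _ _ open_ball z])
            (use elim in \<open>auto intro!: schwarzian_holomorphic holomorphic_intros \<Phi>\<close>)
        also have "(deriv ^^ (n - 3)) (\<lambda>z. of_real t * bers_kernel m z) z = of_real t * (deriv ^^ (n - 3)) (bers_kernel m) z"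
          by (rule higher_deriv_cmult[OF \<Phi> z open_ball])
        finally have H: "H t z = (deriv ^^ (n - 3)) (schwarzian (f t)) z - of_real t * (deriv ^^ (n - 3)) (bers_kernel m) z" .
        show "higher_schwarzian s n (f t) z - lin_coeff s n * (deriv ^^ (n - 3)) (schwarzian (f t)) z
          + lin_coeff s n * H t z = bers_lift s n w G (\<lambda>z. of_real t * \<mu> z) z
          - of_real t * (lin_coeff s n * (deriv ^^ (n - 3)) (bers_kernel m) z)"
          unfolding bL H using z by (simp add: f_def algebra_simps)
      qed
    qed
  qed
qed

section \<open>Automorphic polynomials\<close>

lemma holomorphic_polynomial:
  assumes h: "\<phi> holomorphic_on disc" and k: "\<And>z. z \<in> disc \<Longrightarrow> (deriv ^^ k) \<phi> z = 0"
  obtains p :: "complex poly" where "\<And>z. z \<in> disc \<Longrightarrow> \<phi> z = poly p z" "\<And>i. i \<ge> k \<Longrightarrow> coeff p i = 0"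
proof -
  have 0: "(deriv ^^ i) \<phi> 0 = 0" if i: "i \<ge> k" for i
  proof -
    obtain j where j: "i = j + k" using i by (metis add.commute le_Suc_ex)
    have "(deriv ^^ i) \<phi> 0 = (deriv ^^ j) ((deriv ^^ k) \<phi>) 0" by (simp add: j funpow_add)
    also have "\<dots> = (deriv ^^ j) (\<lambda>z. 0) 0" by (rule higher_deriv_cong_disc) (use k in auto)
    also have "\<dots> = 0" by (simp add: higher_deriv_const)
    finally show ?thesis .
  qed
  define p where "p = (\<Sum>i<k. monom ((deriv ^^ i) \<phi> 0 / fact i) i)"
  show thesis
  proof (rule that[of p])
    fix z :: complex assume z: "z \<in> disc"
    have "(\<lambda>i. (deriv ^^ i) \<phi> 0 / fact i * (z - 0) ^ i) sums \<phi> z"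
      by (rule holomorphic_power_series[OF h z])
    moreover have "(\<lambda>i. (deriv ^^ i) \<phi> 0 / fact i * (z - 0) ^ i) sums (\<Sum>i<k. (deriv ^^ i) \<phi> 0 / fact i * (z - 0) ^ i)"
      by (rule sums_finite) (use 0 in auto)
    ultimately show "\<phi> z = poly p z" by (simp add: sums_unique2 p_def poly_sum poly_monom)
  qed (simp add: p_def coeff_sum)
qed

lemma poly_eq_on_disc:
  fixes p q :: "complex poly"
  assumes "\<And>z. z \<in> disc \<Longrightarrow> poly p z = poly q z" shows "p = q"
proof (rule ccontr)
  assume "p \<noteq> q"
  then have "finite {z. poly (p - q) z = 0}" by (intro poly_roots_finite) simp
  moreover have "disc \<subseteq> {z. poly (p - q) z = 0}" using assms by auto
  ultimately have "finite disc" by (rule rev_finite_subset)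
  then show False using finite_imp_not_open[of disc] by simp
qed

text \<open>Clearing denominators, the left-hand side of \<open>aut\<close> becomes a polynomial of degree at most
  \<open>d = degree p\<close>, and the right-hand side one of degree \<open>2 d + 4\<close>.\<close>

lemma hyperbolic_automorphic_polynomial_zero:
  fixes p :: "complex poly"
  assumes a: "a \<noteq> 0" "norm a < 1" and \<alpha>: "norm \<alpha> = 1"
    and aut: "\<And>z. z \<in> disc \<Longrightarrow>
      poly p (\<alpha> * ((z - a) / (1 - cnj a * z))) * (\<alpha> * (1 - a * cnj a) / (1 - cnj a * z)\<^sup>2)\<^sup>2 = poly p z"
  shows "p = 0"
proof (rule ccontr)
  assume p: "p \<noteq> 0"
  define d where "d = degree p"
  define K where "K = (\<alpha> * (1 - a * cnj a))\<^sup>2"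
  \<comment> \<open>The numerator of \<open>p\<close> composed with the Moebius transformation: the
    composition times (1 - cnj a * z)^d.\<close>
  define q where "q = (\<Sum>i\<le>d. smult (coeff p i * \<alpha> ^ i) ([:- a, 1:] ^ i * [:1, - cnj a:] ^ (d - i)))"
  have "smult K q = p * [:1, - cnj a:] ^ (d + 4)"
  proof (rule poly_eq_on_disc)
    fix z :: complex assume z: "z \<in> disc"
    define b where "b = 1 - cnj a * z"
    have b: "b \<noteq> 0"
    proof
      assume "b = 0"
      then have "norm (cnj a * z) = 1" unfolding b_def by (metis eq_iff_diff_eq_0 norm_one)
      moreover have "norm a * norm z < 1 * 1" by (rule mult_strict_mono') (use z a in auto)
      ultimately show False by (simp add: norm_mult)
    qed
    have "poly p (\<alpha> * ((z - a) / b)) * b ^ d = (\<Sum>i\<le>d. coeff p i * (\<alpha> * ((z - a) / b)) ^ i * b ^ d)"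
      unfolding poly_altdef d_def[symmetric] by (rule sum_distrib_right)
    also have "\<dots> = (\<Sum>i\<le>d. coeff p i * \<alpha> ^ i * ((z - a) ^ i * b ^ (d - i)))"
    proof (rule sum.cong[OF refl])
      fix i assume "i \<in> {..d}"
      then have "b ^ d = b ^ i * b ^ (d - i)" by (simp flip: power_add)
      then show "coeff p i * (\<alpha> * ((z - a) / b)) ^ i * b ^ d = coeff p i * \<alpha> ^ i * ((z - a) ^ i * b ^ (d - i))"
        using b by (simp add: power_mult_distrib power_divide)
    qed
    also have "\<dots> = poly q z" by (simp add: q_def poly_sum b_def mult.commute)
    finally have q: "poly q z = poly p (\<alpha> * ((z - a) / b)) * b ^ d" ..
    have "poly p z = poly p (\<alpha> * ((z - a) / b)) * K / b ^ 4"
      using aut[OF z] by (simp add: K_def b_def power_divide flip: power_mult)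
    then have "poly p z * b ^ 4 = poly p (\<alpha> * ((z - a) / b)) * K" using b by simp
    then have "poly p z * b ^ 4 * b ^ d = K * poly q z" unfolding q by simp
    then show "poly (smult K q) z = poly (p * [:1, - cnj a:] ^ (d + 4)) z"
      by (simp add: b_def power_add mult_ac)
  qed
  \<comment> \<open>Here a \<noteq> 0 enters: it makes the denominator 1 - cnj a * z a polynomial of
    degree 1.\<close>
  then have "degree (smult K q) = d + (d + 4)"
    using p a by (simp add: degree_mult_eq degree_power_eq d_def)
  moreover have "degree (smult K q) \<le> d"
  proof -
    have "degree q \<le> d" unfolding q_def
    proof (rule degree_sum_le)
      fix i assume i: "i \<in> {..d}"
      have "degree ([:- a, 1:] ^ i * [:1, - cnj a:] ^ (d - i)) = d"
        using i a by (simp add: degree_mult_eq degree_power_eq)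
      then show "degree (smult (coeff p i * \<alpha> ^ i) ([:- a, 1:] ^ i * [:1, - cnj a:] ^ (d - i))) \<le> d"
        using degree_smult_le[of "coeff p i * \<alpha> ^ i" "[:- a, 1:] ^ i * [:1, - cnj a:] ^ (d - i)"] by simp
    qed simp
    then show ?thesis using degree_smult_le[of K q] by linarith
  qed
  ultimately show False by simp
qed

text \<open>Comparison of leading coefficients.\<close>

lemma rotation_automorphic_polynomial:
  fixes p :: "complex poly"
  assumes "\<And>z. z \<in> disc \<Longrightarrow> poly p (\<alpha> * z) * \<alpha>\<^sup>2 = poly p z" "p \<noteq> 0"
  shows "\<alpha> ^ (degree p + 2) = 1"
proof -
  have "smult (\<alpha>\<^sup>2) (pcompose p [:0, \<alpha>:]) = p"
    by (rule poly_eq_on_disc) (use assms(1) in \<open>simp add: poly_pcompose mult.commute\<close>)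
  then have "\<alpha>\<^sup>2 * (\<alpha> ^ degree p * coeff p (degree p)) = coeff p (degree p)"
    by (metis coeff_pcompose_linear coeff_smult)
  then have "\<alpha> ^ (degree p + 2) * coeff p (degree p) = 1 * coeff p (degree p)"
    by (simp add: power_add power2_eq_square mult_ac)
  then show ?thesis using assms(2) by (simp only: mult_right_cancel[of "coeff p (degree p)"] leading_coeff_0_iff not_False_eq_True)
qed

lemma automorphic_polynomial_zero:
  assumes h: "\<phi> holomorphic_on disc" and k: "\<And>z. z \<in> disc \<Longrightarrow> (deriv ^^ k) \<phi> z = 0"
    and ext: "G \<subseteq> extensional disc"
    and aut: "\<And>g. g \<in> G \<Longrightarrow> \<exists>\<alpha> a. norm \<alpha> = 1 \<and> norm a < 1 \<and> (\<forall>z\<in>disc. g z = \<alpha> * ((z - a) / (1 - cnj a * z)) \<and>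
      \<phi> (g z) * (\<alpha> * (1 - a * cnj a) / (1 - cnj a * z)\<^sup>2)\<^sup>2 = \<phi> z)"
    and gd: "\<And>g z. g \<in> G \<Longrightarrow> z \<in> disc \<Longrightarrow> g z \<in> disc"
    and card: "(\<forall>g\<in>G. g 0 = 0) \<longrightarrow> k + 2 \<le> card G" and z: "z \<in> disc"
  shows "\<phi> z = 0"
proof (rule ccontr)
  assume nz: "\<phi> z \<noteq> 0"
  obtain p where p: "\<And>z. z \<in> disc \<Longrightarrow> \<phi> z = poly p z" "\<And>i. i \<ge> k \<Longrightarrow> coeff p i = 0"
    using holomorphic_polynomial[OF h k] by metis
  have p0: "p \<noteq> 0" using p(1)[OF z] nz by auto
  have deg: "degree p < k" using p(2) p0 leading_coeff_neq_0 not_le by metis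
  have rot: "\<exists>\<alpha>. (\<forall>z\<in>disc. g z = \<alpha> * z) \<and> \<alpha> ^ (degree p + 2) = 1" if g: "g \<in> G" for g
  proof -
    obtain \<alpha> a where *: "norm \<alpha> = 1" "norm a < 1" "\<And>z. z \<in> disc \<Longrightarrow> g z = \<alpha> * ((z - a) / (1 - cnj a * z))"
      "\<And>z. z \<in> disc \<Longrightarrow> \<phi> (g z) * (\<alpha> * (1 - a * cnj a) / (1 - cnj a * z)\<^sup>2)\<^sup>2 = \<phi> z"
      using aut[OF g] by blast
    have pa: "poly p (\<alpha> * ((z - a) / (1 - cnj a * z))) * (\<alpha> * (1 - a * cnj a) / (1 - cnj a * z)\<^sup>2)\<^sup>2 = poly p z"
      if "z \<in> disc" for z
      using *(3,4)[OF that] p(1)[OF that] p(1)[OF gd[OF g that]] by simp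
    have a0: "a = 0"
      using hyperbolic_automorphic_polynomial_zero[of a \<alpha> p] *(1,2) pa p0 by blast
    have "\<alpha> ^ (degree p + 2) = 1"
      by (rule rotation_automorphic_polynomial[OF _ p0]) (use pa in \<open>simp add: a0\<close>)
    then show ?thesis using *(3) a0 by auto
  qed
  \<comment> \<open>The multiplier of the rotation, read off at 1/2. Elements of \<open>G\<close>
    are extensional, hence determined by it, so that \<open>G\<close> has at most as many elements
    as there are roots of unity of order degree p + 2 < k + 2.\<close>
  define r where "r = (\<lambda>g :: complex \<Rightarrow> complex. 2 * g (1/2))"
  have half: "(1/2 :: complex) \<in> disc" by simp
  have r: "g z = r g * z" "r g ^ (degree p + 2) = 1" if h: "g \<in> G" "z \<in> disc" for g z
  proof -
    obtain \<alpha> where \<alpha>: "\<And>z. z \<in> disc \<Longrightarrow> g z = \<alpha> * z" "\<alpha> ^ (degree p + 2) = 1"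
      using rot[OF h(1)] by blast
    have "r g = \<alpha>" using \<alpha>(1)[OF half] by (simp add: r_def mult.commute)
    then show "g z = r g * z" "r g ^ (degree p + 2) = 1" using \<alpha> h(2) by simp_all
  qed
  have "\<forall>g\<in>G. g 0 = 0" using r(1)[of _ 0] by simp
  then have "k + 2 \<le> card G" using card by blast
  moreover have "card G \<le> card {x :: complex. x ^ (degree p + 2) = 1}"
  proof (rule card_inj_on_le)
    show "inj_on r G"
    proof (rule inj_onI)
      fix g g' assume g: "g \<in> G" "g' \<in> G" "r g = r g'"
      show "g = g'"
      proof (rule extensionalityI)
        show "g \<in> extensional disc" "g' \<in> extensional disc" using g ext by auto
        show "g x = g' x" if "x \<in> disc" for x using r(1)[OF g(1) that] r(1)[OF g(2) that] g(3) by simp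
      qed
    qed
    show "r ` G \<subseteq> {x. x ^ (degree p + 2) = 1}" using r(2)[OF _ half] by blast
    show "finite {x :: complex. x ^ (degree p + 2) = 1}" by (rule finite_nth_roots) simp
  qed
  moreover have "card {x :: complex. x ^ (degree p + 2) = 1} = degree p + 2" by (rule card_nth_roots) auto
  ultimately show False using deg by simp
qed

section \<open>The kernels of the differentials\<close>

lemma differential_diff:
  assumes D: "has_differential_at_0 G q F D" and "\<mu> \<in> linf_space G" "\<nu> \<in> linf_space G"
  shows "D (\<lambda>z. \<mu> z - \<nu> z) = (\<lambda>z. D \<mu> z - D \<nu> z)"
proof -
  have m: "(\<lambda>z. (-1) * \<nu> z) \<in> linf_space G" by (rule linf_scale(1)[OF assms(3)])
  have "D (\<lambda>z. \<mu> z + (-1) * \<nu> z) = (\<lambda>z. D \<mu> z + D (\<lambda>z. (-1) * \<nu> z) z)"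
    by (rule D[unfolded has_differential_at_0_def, THEN conjunct2, THEN conjunct1, rule_format, OF assms(2) m])
  moreover have "D (\<lambda>z. (-1) * \<nu> z) = (\<lambda>z. (-1) * D \<nu> z)"
    by (rule D[unfolded has_differential_at_0_def, THEN conjunct2, THEN conjunct2, THEN conjunct1, rule_format, OF assms(3)])
  ultimately show ?thesis by simp
qed

text \<open>The Bers norm controls the value at each point of the disc. The differential is
  therefore a one-sided directional derivative, which is all that the estimates along t \<mu> have
  to compute.\<close>

lemma differential_pointwise:
  assumes D: "has_differential_at_0 G q F D" and \<mu>: "\<mu> \<in> linf_space G" and z: "z \<in> disc"
  shows "((\<lambda>t. (F (\<lambda>z. of_real t * \<mu> z) z - F (\<lambda>_. 0) z) / of_real t) \<longlongrightarrow> D \<mu> z) (at_right 0)"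
proof (rule tendstoI)
  fix e :: real assume e: "e > 0"
  define P where "P = (1 - (norm z)\<^sup>2) ^ q"
  define L where "L = linf_norm \<mu>"
  have L: "0 \<le> L" unfolding L_def by (rule linf_norm_nonneg[OF \<mu>])
  have P: "P > 0" unfolding P_def using z by (simp add: abs_square_less_1)
  \<comment> \<open>\<open>P\<close> is the weight of the Bers norm at \<open>z\<close>; L + 1 in
    place of \<open>L\<close> avoids a division by 0 and makes the last inequality strict.\<close>
  define \<epsilon> where "\<epsilon> = e * P / (L + 1)"
  have \<epsilon>: "\<epsilon> > 0" unfolding \<epsilon>_def using e P L by (intro divide_pos_pos mult_pos_pos) auto
  obtain \<delta> where \<delta>: "\<delta> > 0" "\<And>\<nu>. \<nu> \<in> linf_space G \<Longrightarrow> linf_norm \<nu> < \<delta> \<Longrightarrow>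
      (\<lambda>z. F \<nu> z - F (\<lambda>_. 0) z - D \<nu> z) \<in> bers_space q \<and>
      bers_norm q (\<lambda>z. F \<nu> z - F (\<lambda>_. 0) z - D \<nu> z) \<le> \<epsilon> * linf_norm \<nu>"
    using D \<epsilon> unfolding has_differential_at_0_def by meson
  have "\<forall>\<^sub>F t in at_right (0::real). 0 < t" by (rule eventually_at_right_less)
  moreover have "\<forall>\<^sub>F t in at_right (0::real). t * L < \<delta>" by (rule eventually_at_right_0_small[OF \<delta>(1)])
  ultimately show "\<forall>\<^sub>F t in at_right 0. dist ((F (\<lambda>z. of_real t * \<mu> z) z - F (\<lambda>_. 0) z) / of_real t) (D \<mu> z) < e"
  proof eventually_elim
    case (elim t)
    define \<nu> where "\<nu> = (\<lambda>z. of_real t * \<mu> z)"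
    define R where "R = (\<lambda>z. F \<nu> z - F (\<lambda>_. 0) z - D \<nu> z)"
    have \<nu>: "\<nu> \<in> linf_space G" "linf_norm \<nu> \<le> t * L"
      using linf_scale[OF \<mu>, of "of_real t"] elim by (auto simp: \<nu>_def L_def)
    have R: "R \<in> bers_space q" "bers_norm q R \<le> \<epsilon> * linf_norm \<nu>"
      using \<delta>(2)[OF \<nu>(1)] \<nu>(2) elim unfolding R_def by auto
    have "norm (R z) * P \<le> bers_norm q R" unfolding bers_norm_def P_def
      by (rule cSUP_upper[OF z]) (use R(1) in \<open>simp add: bers_space_def\<close>)
    also have "\<dots> \<le> \<epsilon> * (t * L)" using R(2) \<nu>(2) \<epsilon> by (meson mult_left_mono less_imp_le order_trans)
    also have "\<dots> < \<epsilon> * (t * (L + 1))" using \<epsilon> elim by (intro mult_strict_left_mono) auto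
    also have "\<dots> = e * t * P" using L by (simp add: \<epsilon>_def)
    finally have Rz: "norm (R z) < e * t" using P by simp
    have "D \<nu> = (\<lambda>z. of_real t * D \<mu> z)" unfolding \<nu>_def
      by (rule D[unfolded has_differential_at_0_def, THEN conjunct2, THEN conjunct2, THEN conjunct1, rule_format, OF \<mu>])
    then have "(F \<nu> z - F (\<lambda>_. 0) z) / of_real t - D \<mu> z = R z / of_real t"
      using elim by (simp add: R_def field_simps)
    then have "dist ((F \<nu> z - F (\<lambda>_. 0) z) / of_real t) (D \<mu> z) = norm (R z) / t"
      using elim by (simp add: dist_norm norm_divide)
    also have "\<dots> < e" using Rz elim by (simp add: divide_less_eq)
    finally show ?case unfolding \<nu>_def .
  qed
qed

lemma tendsto_of_norm_diff_le_square:
  fixes f :: "real \<Rightarrow> complex"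
  assumes "\<forall>\<^sub>F t in at_right 0. norm (f t - of_real t * c) \<le> C * t\<^sup>2"
  shows "((\<lambda>t. f t / of_real t) \<longlongrightarrow> c) (at_right 0)"
proof (rule LIM_zero_cancel, rule Lim_null_comparison)
  have "((\<lambda>t::real. t * C) \<longlongrightarrow> 0 * C) (at_right 0)" by (intro tendsto_intros)
  then show "((\<lambda>t::real. t * C) \<longlongrightarrow> 0) (at_right 0)" by simp
  have "\<forall>\<^sub>F t in at_right (0::real). 0 < t" by (rule eventually_at_right_less)
  then show "\<forall>\<^sub>F t in at_right 0. norm (f t / of_real t - c) \<le> t * C" using assms
  proof eventually_elim
    case (elim t)
    have "f t / of_real t - c = (f t - of_real t * c) / of_real t" using elim by (simp add: field_simps)
    then have "norm (f t / of_real t - c) = norm (f t - of_real t * c) / t" using elim by (simp add: norm_divide)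
    also have "\<dots> \<le> C * t\<^sup>2 / t" using elim by (intro divide_right_mono) auto
    finally show ?case using elim by (simp add: power2_eq_square mult.commute)
  qed
qed

lemma borel_representative_zero: "borel_representative (\<lambda>_. 0) 0 (\<lambda>_. 0)"
  by (simp add: borel_representative_def)

lemma bers_kernel_zero: "bers_kernel (\<lambda>_. 0) = (\<lambda>_. 0)"
  by (simp add: bers_kernel_def fun_eq_iff)

lemma differential_bers_lift_3:
  assumes w: "\<forall>\<mu>\<in>belt G. normalized_solution \<mu> (w \<mu>)" and \<mu>: "\<mu> \<in> linf_space G"
    and rep: "borel_representative \<mu> k m"
    and D: "has_differential_at_0 G q (bers_lift s 3 w G) D" and z: "z \<in> disc"
  shows "D \<mu> z = bers_kernel m z"
proof -
  have 0: "(\<lambda>_. 0) \<in> linf_space G" using linf_scale(1)[OF \<mu>, of 0] by simp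
  \<comment> \<open>The estimate for the coefficient 0, with bound 0, shows that the lift vanishes
    at the origin.\<close>
  have "\<forall>\<^sub>F t in at_right (0::real). norm (bers_lift s 3 w G (\<lambda>_. 0) z) \<le> 0"
    using bers_lift_family_3[OF w 0 borel_representative_zero z, of s] by (simp add: bers_kernel_zero)
  then have F0: "bers_lift s 3 w G (\<lambda>_. 0) z = 0" by (simp add: eventually_const_iff)
  have "((\<lambda>t. bers_lift s 3 w G (\<lambda>z. of_real t * \<mu> z) z / of_real t) \<longlongrightarrow> D \<mu> z) (at_right 0)"
    using differential_pointwise[OF D \<mu> z] by (simp add: F0)
  moreover have "((\<lambda>t. bers_lift s 3 w G (\<lambda>z. of_real t * \<mu> z) z / of_real t) \<longlongrightarrow> bers_kernel m z) (at_right 0)"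
  proof (rule tendsto_of_norm_diff_le_square)
    show "\<forall>\<^sub>F t in at_right 0. norm (bers_lift s 3 w G (\<lambda>z. of_real t * \<mu> z) z - of_real t * bers_kernel m z)
        \<le> schw_const * k\<^sup>2 / (1 - norm z)\<^sup>2 * t\<^sup>2"
      using bers_lift_family_3[OF w \<mu> rep z, of s] by eventually_elim (simp add: power_mult_distrib mult_ac)
  qed
  ultimately show ?thesis by (intro tendsto_unique[of "at_right (0::real)"]) auto
qed

lemma differential_bers_lift:
  assumes w: "\<forall>\<mu>\<in>belt G. normalized_solution \<mu> (w \<mu>)" and \<mu>: "\<mu> \<in> linf_space G"
    and rep: "borel_representative \<mu> k m" and h: "bers_kernel m holomorphic_on disc" and n: "n \<ge> 3"
    and D: "has_differential_at_0 G q (bers_lift s n w G) D" and z: "z \<in> disc"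
  shows "D \<mu> z = lin_coeff s n * (deriv ^^ (n - 3)) (bers_kernel m) z"
proof -
  have zc: "z \<in> cball 0 (norm z)" "norm z < 1" using z by auto
  have 0: "(\<lambda>_. 0) \<in> linf_space G" using linf_scale(1)[OF \<mu>, of 0] by simp
  \<comment> \<open>For the coefficient 0 the family is constant in \<open>t\<close>; being O(t^2),
    it is 0.\<close>
  have "bigO_disc 2 (\<lambda>t z. bers_lift s n w G (\<lambda>_. 0) z)"
    using bers_lift_family[OF w 0 borel_representative_zero _ n, of s] by (simp add: bers_kernel_zero higher_deriv_const)
  then obtain C where "\<forall>\<^sub>F t in at_right (0::real). \<forall>z'\<in>cball 0 (norm z). norm (bers_lift s n w G (\<lambda>_. 0) z') \<le> C * t\<^sup>2"
    using zc(2) unfolding bigO_disc_def by blast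
  then have ev: "\<forall>\<^sub>F t in at_right (0::real). norm (bers_lift s n w G (\<lambda>_. 0) z) \<le> C * t\<^sup>2"
    by eventually_elim (use zc(1) in blast)
  have "((\<lambda>t::real. C * t\<^sup>2) \<longlongrightarrow> C * 0\<^sup>2) (at_right 0)" by (intro tendsto_intros)
  then have "norm (bers_lift s n w G (\<lambda>_. 0) z) \<le> C * 0\<^sup>2"
    by (rule tendsto_lowerbound[OF _ ev]) simp
  then have F0: "bers_lift s n w G (\<lambda>_. 0) z = 0" by simp
  have "((\<lambda>t. bers_lift s n w G (\<lambda>z. of_real t * \<mu> z) z / of_real t) \<longlongrightarrow> D \<mu> z) (at_right 0)"
    using differential_pointwise[OF D \<mu> z] by (simp add: F0)
  moreover have "((\<lambda>t. bers_lift s n w G (\<lambda>z. of_real t * \<mu> z) z / of_real t)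
      \<longlongrightarrow> lin_coeff s n * (deriv ^^ (n - 3)) (bers_kernel m) z) (at_right 0)"
  proof -
    obtain C where "\<forall>\<^sub>F t in at_right (0::real). \<forall>z'\<in>cball 0 (norm z). norm (bers_lift s n w G (\<lambda>z. of_real t * \<mu> z) z'
        - of_real t * (lin_coeff s n * (deriv ^^ (n - 3)) (bers_kernel m) z')) \<le> C * t\<^sup>2"
      using bers_lift_family[OF w \<mu> rep h n, of s] zc(2) unfolding bigO_disc_def by blast
    then have "\<forall>\<^sub>F t in at_right (0::real). norm (bers_lift s n w G (\<lambda>z. of_real t * \<mu> z) z
        - of_real t * (lin_coeff s n * (deriv ^^ (n - 3)) (bers_kernel m) z)) \<le> C * t\<^sup>2"
      by eventually_elim (use zc(1) in blast)
    then show ?thesis by (rule tendsto_of_norm_diff_le_square)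
  qed
  ultimately show ?thesis by (intro tendsto_unique[of "at_right (0::real)"]) auto
qed

lemma differentials_same_kernel:
  assumes fuchsian: "fuchsian_group G" and n: "n \<ge> 3"
    and card: "(\<forall>g\<in>G. g 0 = 0) \<longrightarrow> n \<le> card G + 1"
    and w: "\<forall>\<mu>\<in>belt G. normalized_solution \<mu> (w \<mu>)"
    and D3: "has_differential_at_0 G 2 (bers_lift s 3 w G) D3"
    and Dn: "has_differential_at_0 G q (bers_lift s n w G) Dn"
    and \<mu>: "\<mu> \<in> linf_space G"
  shows "D3 \<mu> = (\<lambda>_. 0) \<longleftrightarrow> Dn \<mu> = (\<lambda>_. 0)"
proof -
  obtain m where m: "m \<in> borel_measurable borel" "\<And>z. norm z \<le> 1 \<Longrightarrow> m z = 0"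
    "AE z in lborel. m z = (if z \<in> ext_disc then \<mu> z else 0)" "AE z in lborel. norm (m z) \<le> linf_norm \<mu>"
    using linf_borel_representative[OF \<mu>] by blast
  have rep: "borel_representative \<mu> (linf_norm \<mu>) m"
    using m linf_norm_nonneg[OF \<mu>] by (simp add: borel_representative_def)
  define \<Phi> where "\<Phi> = bers_kernel m"
  have D3\<Phi>: "D3 \<mu> z = \<Phi> z" if "z \<in> disc" for z
    unfolding \<Phi>_def by (rule differential_bers_lift_3[OF w \<mu> rep D3 that])
  have b3: "D3 \<mu> \<in> bers_space 2" and bn: "Dn \<mu> \<in> bers_space q"
    using D3 Dn \<mu> by (auto simp: has_differential_at_0_def)
  \<comment> \<open>Holomorphy of the integral needs no differentiation under the integral sign: on
    the disc it agrees with \<open>D3 \<mu>\<close>, an element of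
    \<open>bers_space 2\<close>.\<close>
  have h: "\<Phi> holomorphic_on disc"
    using b3 D3\<Phi> holomorphic_cong[OF refl, of disc "D3 \<mu>" \<Phi>] by (simp add: bers_space_def)
  have Dn\<Phi>: "Dn \<mu> z = lin_coeff s n * (deriv ^^ (n - 3)) \<Phi> z" if "z \<in> disc" for z
    unfolding \<Phi>_def by (rule differential_bers_lift[OF w \<mu> rep h[unfolded \<Phi>_def] n Dn that])
  have off: "D3 \<mu> z = 0" "Dn \<mu> z = 0" if "z \<notin> disc" for z
    using b3 bn that by (auto simp: bers_space_def)
  show ?thesis
  proof
    assume D0: "D3 \<mu> = (\<lambda>_. 0)"
    have "Dn \<mu> z = 0" for z
    proof (cases "z \<in> disc")
      case True
      have "(deriv ^^ (n - 3)) \<Phi> z = (deriv ^^ (n - 3)) (\<lambda>_. 0) z"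
        by (rule higher_deriv_cong_disc[OF _ True]) (use D3\<Phi> D0 in auto)
      then show ?thesis using Dn\<Phi>[OF True] by (simp add: higher_deriv_const)
    qed (rule off)
    then show "Dn \<mu> = (\<lambda>_. 0)" by auto
  next
    assume D0: "Dn \<mu> = (\<lambda>_. 0)"
    have lc: "lin_coeff s n \<noteq> 0" 
    proof -
      have "(of_nat (n - 2) :: complex) \<noteq> 0" unfolding of_nat_eq_0_iff using n by simp
      then show ?thesis by (cases s) (simp_all only: lin_coeff_def series.case one_neq_zero not_False_eq_True)
    qed
    have GB: "G \<subseteq> Bij disc"
      using fuchsian subgroup.subset unfolding fuchsian_group_def by (fastforce simp: BijGroup_def)
    have "\<Phi> z = 0" if "z \<in> disc" for z
    proof (rule automorphic_polynomial_zero[OF h _ _ _ _ _ that])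
      show "(deriv ^^ (n - 3)) \<Phi> z = 0" if "z \<in> disc" for z using Dn\<Phi>[OF that] D0 lc by simp
      show "G \<subseteq> extensional disc" using GB by (auto simp: Bij_def)
      show "g z \<in> disc" if "g \<in> G" "z \<in> disc" for g z
      proof -
        have "g ` disc = disc" using GB that(1) by (auto simp: Bij_def bij_betw_def)
        then show ?thesis using imageI[OF that(2), of g] by simp
      qed
      \<comment> \<open>With k = n - 3 the required number k + 2 of group elements is n - 1.\<close>
      show "(\<forall>g\<in>G. g 0 = 0) \<longrightarrow> n - 3 + 2 \<le> card G" using card n by auto
      show "\<exists>\<alpha> a. norm \<alpha> = 1 \<and> norm a < 1 \<and> (\<forall>z\<in>disc. g z = \<alpha> * ((z - a) / (1 - cnj a * z)) \<and>
          \<Phi> (g z) * (\<alpha> * (1 - a * cnj a) / (1 - cnj a * z)\<^sup>2)\<^sup>2 = \<Phi> z)" if g: "g \<in> G" for g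
      proof -
        obtain \<alpha> a where ga: "norm \<alpha> = 1" "norm a < 1" "\<And>z. z \<in> disc \<Longrightarrow> g z = \<alpha> * ((z - a) / (1 - cnj a * z))"
          using fuchsian_Moebius[OF fuchsian g] by blast
        have "\<Phi> (g z) * (\<alpha> * (1 - a * cnj a) / (1 - cnj a * z)\<^sup>2)\<^sup>2 = \<Phi> z" if z: "z \<in> disc" for z
        proof -
          have "(LINT \<zeta>|lborel. m \<zeta> / (\<zeta> - g z)^4) * (\<alpha> * (1 - a * cnj a) / (1 - cnj a * z)\<^sup>2)\<^sup>2
            = (LINT \<zeta>|lborel. m \<zeta> / (\<zeta> - z)^4)"
            by (rule kernel_automorphic[OF fuchsian g \<mu> z ga(1,2) _ m(1) _ m(3,4)]) (use ga(3) m(2) in auto)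
          then show ?thesis unfolding \<Phi>_def bers_kernel_def by (simp only: mult.assoc)
        qed
        then show ?thesis using ga by blast
      qed
    qed
    then have "D3 \<mu> z = 0" for z using D3\<Phi> off(1) by (cases "z \<in> disc") auto
    then show "D3 \<mu> = (\<lambda>_. 0)" by auto
  qed
qed

theorem corollary4p22:
  fixes G :: "(complex \<Rightarrow> complex) set"
    and n :: nat
    and s :: series
    and w :: "(complex \<Rightarrow> complex) \<Rightarrow> complex option \<Rightarrow> complex option"
    and D3 Dn :: "(complex \<Rightarrow> complex) \<Rightarrow> complex \<Rightarrow> complex"
  assumes fuchsian: "fuchsian_group G"
    and nontrivial: "G \<noteq> {one (BijGroup disc)}"
    and n: "n \<ge> 3"
    and not_small_rotation_group: "(\<forall>g\<in>G. g 0 = 0) \<longrightarrow> n \<le> card G + 1"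
    and w: "\<And>\<mu>. \<mu> \<in> belt G \<Longrightarrow> normalized_solution \<mu> (w \<mu>)"
    and D3: "has_differential_at_0 G 2 (bers_lift s 3 w G) D3"
    and Dn: "has_differential_at_0 G (n - 1) (bers_lift s n w G) Dn"
  shows "congruent (kernel_rel G D3) Dn \<and> inj_on (induced Dn) (tangent_space G D3)"
proof -
  \<comment> \<open>By linearity, equal kernels mean equal fibres of \<open>D3\<close> and
    \<open>Dn\<close>. One inclusion makes \<open>Dn\<close> constant on the classes, the other
    makes the induced map injective.\<close>
  have eq: "D3 \<mu> = D3 \<nu> \<longleftrightarrow> Dn \<mu> = Dn \<nu>" and R: "(\<mu>, \<nu>) \<in> kernel_rel G D3 \<longleftrightarrow> D3 \<mu> = D3 \<nu>"
    if h: "\<mu> \<in> linf_space G" "\<nu> \<in> linf_space G" for \<mu> \<nu>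
  proof -
    have "D3 (\<lambda>z. \<mu> z - \<nu> z) = (\<lambda>_. 0) \<longleftrightarrow> Dn (\<lambda>z. \<mu> z - \<nu> z) = (\<lambda>_. 0)"
      by (rule differentials_same_kernel[OF fuchsian n not_small_rotation_group _ D3 Dn linf_diff[OF h]]) (use w in auto)
    then show "D3 \<mu> = D3 \<nu> \<longleftrightarrow> Dn \<mu> = Dn \<nu>"
      unfolding differential_diff[OF D3 h] differential_diff[OF Dn h] by (simp add: fun_eq_iff)
    show "(\<mu>, \<nu>) \<in> kernel_rel G D3 \<longleftrightarrow> D3 \<mu> = D3 \<nu>"
      using h unfolding kernel_rel_def mem_Collect_eq prod.case differential_diff[OF D3 h] by (simp add: fun_eq_iff)
  qed
  have sub: "\<mu> \<in> linf_space G \<and> \<nu> \<in> linf_space G" if h: "(\<mu>, \<nu>) \<in> kernel_rel G D3" for \<mu> \<nu>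
    using h by (simp add: kernel_rel_def)
  have cls: "kernel_rel G D3 `` {\<mu>} = {\<nu> \<in> linf_space G. D3 \<mu> = D3 \<nu>}" if h: "\<mu> \<in> linf_space G" for \<mu>
    using R[OF h] sub by auto
  have ind: "induced Dn (kernel_rel G D3 `` {\<mu>}) = Dn \<mu>" if h: "\<mu> \<in> linf_space G" for \<mu>
  proof -
    have e: "Dn \<nu> = Dn \<mu>" if \<nu>: "\<nu> \<in> linf_space G" "D3 \<mu> = D3 \<nu>" for \<nu>
      using eq[OF h \<nu>(1)] \<nu>(2) by simp
    have "Dn ` (kernel_rel G D3 `` {\<mu>}) = {Dn \<mu>}" unfolding cls[OF h] using h e by blast
    then show ?thesis by (simp add: induced_def)
  qed
  have "congruent (kernel_rel G D3) Dn" using eq R sub by (metis congruentI)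
  moreover have "inj_on (induced Dn) (tangent_space G D3)"
  proof (rule inj_onI)
    fix X Y assume "X \<in> tangent_space G D3" "Y \<in> tangent_space G D3" and I: "induced Dn X = induced Dn Y"
    then obtain \<mu> \<nu> where \<mu>: "\<mu> \<in> linf_space G" "X = kernel_rel G D3 `` {\<mu>}"
      and \<nu>: "\<nu> \<in> linf_space G" "Y = kernel_rel G D3 `` {\<nu>}"
      unfolding tangent_space_def by (metis quotientE)
    then have "D3 \<mu> = D3 \<nu>" using I eq ind by simp
    then show "X = Y" using \<mu> \<nu> cls by simp
  qed
  ultimately show ?thesis ..
qed

end
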